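(* Let $G$ be a $\mathfrak{T}$-group of nilpotency class $2$ with derived group $G'$ of Hirsch length $2$. Then there are irreducible polynomials $f_1(t),\dots,f_m(t)\in\mathbb{Q}[t]$ and rational functions $W_I(X,Y)$, $I\subseteq\{1,\dots,m\}$, such that for almost all primes $p$ $$\zeta^{\triangleleft}_{G,p}(s)=\sum_{I\subseteq\{1,\dots,m\}}c_{p,I}\,W_I(p,p^{-s}),$$ where $$c_{p,I}=|\{x\in\mathbb{P}^1(\mathbb{F}_p)\mid f_i(x)\equiv 0 \bmod p \text{ if and only if } i\in I\}|.$$ In particular, $\zeta^{\triangleleft}_G(s)$ is finitely uniform. For almost all primes $p$, $\zeta^{\triangleleft}_{G,p}(s)$ satisfies the functional equation $$\zeta^{\triangleleft}_{G,p}(s)\big|_{p\to p^{-1}}=(-1)^{d+2}p^{\binom{d+2}{2}-(2d+2)s}\,\zeta^{\triangleleft}_{G,p}(s),$$ where $d$ is the Hirsch length of $G/G'$.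
   Context: A $\mathfrak{T}$-group is a finitely generated torsion-free nilpotent group. The Hirsch length is the number of infinite cyclic factors in a decomposition series. For a prime $p$, the local normal zeta function is $\zeta^{\triangleleft}_{G,p}(s)=\sum_{n\ge 0}a_{p^n}p^{-ns}$, where $a_k$ is the number of normal subgroups of $G$ of index $k$; $\zeta^{\triangleleft}_G(s)=\prod_p\zeta^{\triangleleft}_{G,p}(s)$. The function $\zeta^{\triangleleft}_G(s)$ is called finitely uniform if there are finitely many rational functions $V_1(X,Y),\dots,V_n(X,Y)$ such that for every prime $p$ there is $k\in\{1,\dots,n\}$ with $\zeta^{\triangleleft}_{G,p}(s)=V_k(p,p^{-s})$. For $x\in\mathbb{P}^1(\mathbb{F}_p)$, the condition $f_i(x)\equiv0\bmod p$ refers to the vanishing at $x$ of the reduction mod $p$ of the homogenization of $f_i$ (defined for almost all $p$). Since $\sum_I c_{p,I}=p+1$, one may write $\zeta^{\triangleleft}_{G,p}(s)=(p+1)W_\emptyset(p,p^{-s})+\sum_{I\ne\emptyset}c_{p,I}\,(W_I-W_\emptyset)(p,p^{-s})$; the operation $p\to p^{-1}$ inverts $p$ in the factor $p+1$ and in the arguments of the $W_I$ (so $p^{-s}$ becomes $p^{s}$) and leaves the numbers $c_{p,I}$, $I\ne\emptyset$, unchanged. "Almost all primes" means all but finitely many primes.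
   Formalization: The functional equation is asserted only when the centre of G has Hirsch length 2; otherwise the stated exponent is wrong, e.g. for the product of two discrete Heisenberg groups and Z (d=5) the factor is -p^(21-11s), not -p^(21-12s). *)

theory Defs
  imports
    "HOL-Analysis.Analysis"
    "HOL-Algebra.Elementary_Groups"
    "HOL-Algebra.Generated_Groups"
    "HOL-Computational_Algebra.Computational_Algebra"
    "HOL-Computational_Algebra.Field_as_Ring"
    "HOL-Number_Theory.Modular_Inverse"
begin

section \<open>Finitely generated torsion-free nilpotent groups\<close>

text \<open>\<open>lower_central G i\<close> is the term usually written \<open>\<gamma>\<^sub>i\<^sub>+\<^sub>1(G)\<close>.\<close>

primrec lower_central :: "('a, 'b) monoid_scheme \<Rightarrow> nat \<Rightarrow> 'a set" where
  "lower_central G 0 = carrier G"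
| "lower_central G (Suc i) =
     generate G (\<Union>x \<in> lower_central G i. \<Union>y \<in> carrier G.
       {x \<otimes>\<^bsub>G\<^esub> y \<otimes>\<^bsub>G\<^esub> inv\<^bsub>G\<^esub> x \<otimes>\<^bsub>G\<^esub> inv\<^bsub>G\<^esub> y})"

definition nilpotency_class :: "('a, 'b) monoid_scheme \<Rightarrow> nat \<Rightarrow> bool" where
  "nilpotency_class G c \<longleftrightarrow>
     lower_central G c = {\<one>\<^bsub>G\<^esub>} \<and> (\<forall>i<c. lower_central G i \<noteq> {\<one>\<^bsub>G\<^esub>})"

definition T_group :: "('a, 'b) monoid_scheme \<Rightarrow> bool" where
  "T_group G \<longleftrightarrow> group G
     \<and> (\<exists>A. finite A \<and> A \<subseteq> carrier G \<and> generate G A = carrier G)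
     \<and> (\<forall>x \<in> carrier G. \<forall>n::nat. 0 < n \<longrightarrow> x [^]\<^bsub>G\<^esub> n = \<one>\<^bsub>G\<^esub> \<longrightarrow> x = \<one>\<^bsub>G\<^esub>)
     \<and> (\<exists>c. nilpotency_class G c)"

text \<open>\<open>has_hirsch_length G h\<close>: some finite subnormal series of \<open>G\<close> with cyclic factors has exactly
  \<open>h\<close> infinite factors. The number \<open>h\<close> does not depend on the series.\<close>

definition has_hirsch_length :: "('a, 'b) monoid_scheme \<Rightarrow> nat \<Rightarrow> bool" where
  "has_hirsch_length G h \<longleftrightarrow>
     (\<exists>(H :: nat \<Rightarrow> 'a set) k.
        H 0 = {\<one>\<^bsub>G\<^esub>} \<and> H k = carrier G
      \<and> (\<forall>i<k. H i \<lhd> G\<lparr>carrier := H (Suc i)\<rparr>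
             \<and> cyclic_group (G\<lparr>carrier := H (Suc i)\<rparr> Mod H i))
      \<and> card {i. i < k \<and> infinite (carrier (G\<lparr>carrier := H (Suc i)\<rparr> Mod H i))} = h)"

definition center :: "('a, 'b) monoid_scheme \<Rightarrow> 'a set" where
  "center G = {z \<in> carrier G. \<forall>x \<in> carrier G. z \<otimes>\<^bsub>G\<^esub> x = x \<otimes>\<^bsub>G\<^esub> z}"


section \<open>Local normal zeta functions\<close>

text \<open>For \<open>k > 0\<close> the condition on \<open>card\<close> excludes subgroups of infinite index. A finitely generated
  group has only finitely many subgroups of a given finite index, so the outer \<open>card\<close> is a genuine
  count.\<close>

definition normal_count :: "('a, 'b) monoid_scheme \<Rightarrow> nat \<Rightarrow> nat" where
  "normal_count G k = card {N. N \<lhd> G \<and> card (rcosets\<^bsub>G\<^esub> N) = k}"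

definition local_normal_zeta_term ::
    "('a, 'b) monoid_scheme \<Rightarrow> nat \<Rightarrow> complex \<Rightarrow> nat \<Rightarrow> complex" where
  "local_normal_zeta_term G p s n =
     of_nat (normal_count G (p ^ n)) * of_nat p powr (- (of_nat n * s))"

definition local_normal_zeta :: "('a, 'b) monoid_scheme \<Rightarrow> nat \<Rightarrow> complex \<Rightarrow> complex" where
  "local_normal_zeta G p s = suminf (local_normal_zeta_term G p s)"


section \<open>Rational functions in two variables over the rationals\<close>

text \<open>In \<open>rat poly poly\<close> the inner variable is \<open>X\<close> and the outer variable is \<open>Y\<close>; evaluation of a
  rational function uses its numerator and denominator in lowest terms.\<close>

type_synonym rat_fun2 = "rat poly poly fract"

definition poly2_eval :: "rat poly poly \<Rightarrow> complex \<Rightarrow> complex \<Rightarrow> complex" where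
  "poly2_eval q x y = poly (map_poly (\<lambda>c. poly (map_poly of_rat c) x) q) y"

definition rf_regular :: "rat_fun2 \<Rightarrow> complex \<Rightarrow> complex \<Rightarrow> bool" where
  "rf_regular W x y \<longleftrightarrow> poly2_eval (snd (quot_of_fract W)) x y \<noteq> 0"

definition rf_eval :: "rat_fun2 \<Rightarrow> complex \<Rightarrow> complex \<Rightarrow> complex" where
  "rf_eval W x y =
     poly2_eval (fst (quot_of_fract W)) x y / poly2_eval (snd (quot_of_fract W)) x y"

text \<open>Identities between a local zeta function and rational functions in \<open>p\<^sup>-\<^sup>s\<close> are identities of
  analytic functions on a half-plane \<open>Re s > \<sigma>\<close> on which the Dirichlet series converges and the
  rational functions have no poles.\<close>

definition finitely_uniform :: "('a, 'b) monoid_scheme \<Rightarrow> bool" where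
  "finitely_uniform G \<longleftrightarrow>
     (\<exists>(n::nat) (V :: nat \<Rightarrow> rat_fun2) (\<sigma>::real). \<forall>p. prime p \<longrightarrow>
        (\<exists>k \<in> {1..n}. \<forall>s. Re s > \<sigma> \<longrightarrow>
            summable (local_normal_zeta_term G p s)
          \<and> rf_regular (V k) (of_nat p) (of_nat p powr (- s))
          \<and> local_normal_zeta G p s = rf_eval (V k) (of_nat p) (of_nat p powr (- s))))"


section \<open>Points of the projective line over a prime field\<close>

definition proj_reps :: "nat \<Rightarrow> (int \<times> int) set" where
  "proj_reps p = {0..<int p} \<times> {0..<int p} - {(0, 0)}"

definition proj_rel :: "nat \<Rightarrow> ((int \<times> int) \<times> (int \<times> int)) set" where
  "proj_rel p = {((x, y), (x', y')). (x, y) \<in> proj_reps p \<and> (x', y') \<in> proj_reps p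
      \<and> (\<exists>l \<in> {1..<int p}. x' = l * x mod int p \<and> y' = l * y mod int p)}"

definition proj_line :: "nat \<Rightarrow> (int \<times> int) set set" where
  "proj_line p = proj_reps p // proj_rel p"

text \<open>Meaningful only if \<open>p\<close> does not divide the denominator of \<open>q\<close>.\<close>

definition rat_mod :: "nat \<Rightarrow> rat \<Rightarrow> int" where
  "rat_mod p q = (fst (quotient_of q) * modular_inverse (int p) (snd (quotient_of q))) mod int p"

definition vanishes_mod :: "nat \<Rightarrow> rat poly \<Rightarrow> (int \<times> int) set \<Rightarrow> bool" where
  "vanishes_mod p f P \<longleftrightarrow>
     (\<forall>(x, y) \<in> P.
        (\<Sum>k \<le> degree f. rat_mod p (coeff f k) * x ^ k * y ^ (degree f - k)) mod int p = 0)"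

definition point_count :: "nat \<Rightarrow> nat \<Rightarrow> (nat \<Rightarrow> rat poly) \<Rightarrow> nat set \<Rightarrow> nat" where
  "point_count p m f I =
     card {P \<in> proj_line p. \<forall>i \<in> {1..m}. vanishes_mod p (f i) P \<longleftrightarrow> i \<in> I}"


section \<open>The sum over subsets and its inversion\<close>

definition uniform_sum ::
    "nat \<Rightarrow> (nat \<Rightarrow> rat poly) \<Rightarrow> (nat set \<Rightarrow> rat_fun2) \<Rightarrow> nat \<Rightarrow> complex \<Rightarrow> complex" where
  "uniform_sum m f W p s =
     (\<Sum>I \<in> Pow {1..m}. of_nat (point_count p m f I)
        * rf_eval (W I) (of_nat p) (of_nat p powr (- s)))"

text \<open>Since the point counts add up to \<open>p + 1\<close>, \<open>uniform_sum\<close> equals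
  \<open>(p + 1) W\<^sub>\<emptyset>(p, p\<^sup>-\<^sup>s) + \<Sum>\<^sub>I\<^sub>\<noteq>\<^sub>\<emptyset> c\<^sub>p\<^sub>,\<^sub>I (W\<^sub>I - W\<^sub>\<emptyset>)(p, p\<^sup>-\<^sup>s)\<close>. Inversion of \<open>p\<close> acts on this
  expression and leaves the numbers \<open>c\<^sub>p\<^sub>,\<^sub>I\<close> with \<open>I \<noteq> \<emptyset>\<close> unchanged.\<close>

definition uniform_sum_inverted ::
    "nat \<Rightarrow> (nat \<Rightarrow> rat poly) \<Rightarrow> (nat set \<Rightarrow> rat_fun2) \<Rightarrow> nat \<Rightarrow> complex \<Rightarrow> complex" where
  "uniform_sum_inverted m f W p s =
     (inverse (of_nat p) + 1) * rf_eval (W {}) (inverse (of_nat p)) (of_nat p powr s)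
   + (\<Sum>I \<in> Pow {1..m} - {{}}. of_nat (point_count p m f I)
        * rf_eval (W I - W {}) (inverse (of_nat p)) (of_nat p powr s))"

text \<open>The theorem asserts the functional equation, whose exponent is \<open>(d+2 choose 2) - (2d+2)s\<close> with
  \<open>d\<close> the Hirsch length of \<open>G/G'\<close>, for centres of Hirsch length 2, that is, with \<open>Z(G)/G'\<close> finite.
  With this exponent it fails otherwise: if \<open>G\<close> is the product of two discrete Heisenberg groups and
  an infinite cyclic group, so that \<open>d = 5\<close>, then with \<open>Y = p\<^sup>-\<^sup>s\<close> the local zeta function is
  \<open>(1 - p^5 Y^5) / ((1 - p^5 Y^3)^2 (1 - p^6 Y^5) (1 - Y) (1 - p Y) \<dots> (1 - p^4 Y))\<close>, and inverting
  \<open>p\<close> multiplies it by \<open>- p^21 Y^11\<close> rather than by \<open>- p^21 Y^12\<close>.\<close>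

end

theory Submission
  imports Defs "HOL-Library.Function_Algebras"
begin

text \<open>Let I be the preimage in G of the torsion subgroup of G/G'. If g^e lies in G', then the
  e-th power of every commutator of g is trivial, so torsion-freeness makes I central. It follows
  that I is free abelian of rank 2 and that G is a central extension of Z^d by Z^2
  (\<open>central_ext_exists\<close>), described by an antisymmetric bilinear commutator form
  \<open>ph\<close> from Z^d x Z^d to Z^2.

  A normal subgroup N of finite index is recorded by M, its intersection with Z^2, by its image K in
  Z^d, and by lifts of a basis of K, taken modulo M. Normality forces K into X(M), the set of x with
  ph(x,y) in M for all y, and conversely each such pair (M,K) comes from |Z^2:M|^d subgroups N
  (\<open>card_fibre\<close>). As X(M) is again isomorphic to Z^d, summing over K gives
  (\<open>normal_count_gf\<close>): the local zeta function is that of Z^d times the sum over all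
  sublattices M of p-power index of |Z^2:M|^(d-s) |Z^d:X(M)|^(-s).

  Such an M is p^a M0 with Z^2/M0 cyclic of order p^b, that is, M0 is a point t of the projective
  line over Z/p^b (\<open>M0_surj\<close>, \<open>M0_inj\<close>). The index of X(M0) counts
  solutions modulo p^b of a linear system whose coefficients are linear polynomials in t, so it is
  governed by the elementary divisors at p of a matrix over Z[t], evaluated at t. These are found
  for all t at once: Gaussian elimination with pivots of least valuation works over any filter along
  which valuations of polynomial values can be compared (\<open>elimination\<close>). There are
  three such filters. Away from the zeros modulo p of a fixed polynomial all elementary divisors are
  units (\<open>generic_elimination\<close>). Near a zero of an irreducible f, for large p, the
  valuation of A(t) is the multiplicity of f in A times v(f(t)) (\<open>root_elimination\<close>).
  Near a fixed p-adic integer it is affine in v(f(t)), where f has least degree among the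
  polynomials vanishing there (\<open>local_elimination\<close>).

  For almost all p the zeros of f modulo p are simple, and by Hensel's argument f(t) is distributed
  over a residue class like a coordinate. A residue class therefore contributes a generic series U,
  or U + K_f if it is a zero of f, where K_f depends only on a list of multiplicities
  (\<open>cls_root\<close>). Summation over the projective line over F_p gives 1 + (p+1) U + K_inf +
  sum over f of n_f K_f, with n_f the number of zeros of f (\<open>Xi_good\<close>). The polynomials
  f do not vanish at infinity, so this is a sum over point counts with W_I equal to a generic part
  plus the K_f with f in I, the term 1 + K_inf being spread evenly over the p + 1 points.

  U and K_f are sums over half-open cones. Inverting the variables moves the open side of each cone,
  the corrections telescope, and both K_f and 1 + (p+1) U are multiplied by -p
  (\<open>Kf_inverse\<close>, \<open>Uf_inverse\<close>). The remaining geometric factors give the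
  rest of the exponent provided that the lattice \<open>Lat\<close> has rank d, which holds when the
  centre has Hirsch length 2 (\<open>Ph_injective\<close>).

  For finite uniformity, large primes need only finitely many functions because n_f is at most the
  degree of f. For each of the other primes rationality is proved separately, by compactness of the
  p-adic integers together with \<open>local_elimination\<close> (\<open>ratl_cls\<close>).\<close>

section \<open>Additive subgroups and their index\<close>

definition addsub :: "'a::ab_group_add set => bool" where
 "addsub S \<longleftrightarrow> 0 : S & (ALL x:S. ALL y:S. x - y : S)"

lemma addsub_zero: "addsub S ==> 0 : S" by (simp add: addsub_def)

lemma addsub_diff: "addsub S ==> x : S ==> y : S ==> x - y : S" by (simp add: addsub_def)

lemma addsub_minus: "addsub S ==> x : S ==> - x : S" using addsub_diff[of S 0 x] addsub_zero[of S] by simp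

lemma addsub_add: "addsub S ==> x : S ==> y : S ==> x + y : S"
 using addsub_diff[of S x "- y"] addsub_minus[of S y] by simp

lemma addsub_Int: "addsub S ==> addsub T ==> addsub (S Int T)" by (auto simp: addsub_def)

lemma addsub_UNIV [simp]: "addsub UNIV" by (simp add: addsub_def)

lemma addsub_sum: "addsub S ==> (!!i. i : I ==> f i : S) ==> sum f I : S"
 by (induction I rule: infinite_finite_induct) (auto simp: addsub_zero addsub_add)

lemma addsub_int:
 fixes S :: "int set"
 assumes "addsub S"
 obtains m where "m >= 0" "S = {x. m dvd x}"
proof (cases "S = {0}")
 case True
 thus ?thesis by (intro that[of 0]) auto
next
 case False
 then obtain x where x: "x : S" "x ~= 0" using addsub_zero[OF assms] by auto
 have "\<bar>x\<bar> : S" using x addsub_minus[OF assms] by (auto simp: abs_if)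
 hence ex: "EX k>0. int k : S" using x by (intro exI[of _ "nat \<bar>x\<bar>"]) auto
 define m where "m = (LEAST k. k > 0 & int k : S)"
 have m: "m > 0" "int m : S" and least: "!!k. k > 0 ==> int k : S ==> m <= k"
  using LeastI_ex[OF ex] Least_le[of "%k. k > 0 & int k : S"] unfolding m_def by blast+
 have mulN: "int m * int k : S" for k
  by (induction k) (auto simp: addsub_zero[OF assms] algebra_simps intro: addsub_add[OF assms m(2)])
 have mul: "int m * k : S" for k
 proof (cases "k >= 0")
  case True thus ?thesis using mulN[of "nat k"] by simp
 next
  case False thus ?thesis using addsub_minus[OF assms mulN[of "nat (-k)"]] by simp
 qed
 show ?thesis
 proof (rule that[of "int m"])
  show "S = {x. int m dvd x}"
  proof (intro equalityI subsetI)
   fix y assume y: "y : S"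
   have "y mod int m = y - int m * (y div int m)" by (simp add: minus_mult_div_eq_mod)
   hence *: "y mod int m : S" using addsub_diff[OF assms y mul] by simp
   have "y mod int m = 0"
   proof (rule ccontr)
    assume "y mod int m ~= 0"
    moreover have ge: "y mod int m >= 0" using m(1) by simp
    ultimately have "nat (y mod int m) > 0" by linarith
    moreover have "int (nat (y mod int m)) : S" using * ge by simp
    ultimately have "m <= nat (y mod int m)" by (rule least)
    thus False using m(1) pos_mod_bound[of "int m" y] by linarith
   qed
   thus "y : {x. int m dvd x}" by auto
  next
   fix y assume "y : {x. int m dvd x}"
   then obtain k where "y = int m * k" by (auto simp: dvd_def)
   thus "y : S" using mul by simp
  qed
 qed simp
qed

definition transv :: "'a::ab_group_add set => 'a set => 'a set => bool" where
 "transv A B R \<longleftrightarrow> R <= A & (ALL a:A. EX! r. r : R & a - r : B)"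

definition cosrel :: "'a::ab_group_add set => 'a set => ('a \<times> 'a) set" where
 "cosrel A B = {(x, y). x : A & y : A & x - y : B}"

text \<open>For B not contained in A this is the index in A of the intersection. Infinite index has
  the value 0, because \<open>card\<close> of an infinite set is 0.\<close>

definition idx :: "'a::ab_group_add set => 'a set => nat" where
 "idx A B = card (A // cosrel A B)"

lemma cosrel_iff: "(x, y) : cosrel A B \<longleftrightarrow> x : A & y : A & x - y : B" by (simp add: cosrel_def)

lemma equiv_cosrel: "addsub A ==> addsub B ==> equiv A (cosrel A B)"
proof (rule equivI)
 assume AB: "addsub A" "addsub B"
 show "refl_on A (cosrel A B)" using addsub_zero[OF AB(2)] by (auto simp: refl_on_def cosrel_iff)
 show "sym (cosrel A B)" using addsub_minus[OF AB(2)] by (fastforce simp: sym_def cosrel_iff)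
 show "trans (cosrel A B)" using addsub_add[OF AB(2)] by (force simp: trans_def cosrel_iff)
qed (auto simp: cosrel_def)

lemma idx_transv:
 assumes "addsub A" "addsub B" "transv A B R"
 shows "idx A B = card R"
proof -
 let ?r = "cosrel A B"
 have eq: "equiv A ?r" using equiv_cosrel assms by blast
 have RA: "R <= A" and ex1: "!!a. a : A ==> EX! r. r : R & a - r : B" using assms(3) by (auto simp: transv_def)
 have "bij_betw (%r. ?r `` {r}) R (A // ?r)"
 proof (rule bij_betwI')
  fix x y assume xy: "x : R" "y : R"
  hence A: "x : A" "y : A" using RA by auto
  have "?r `` {x} = ?r `` {y} \<longleftrightarrow> x - y : B"
   using eq_equiv_class_iff[OF eq A] A by (simp add: cosrel_iff)
  moreover have "x - y : B \<longleftrightarrow> x = y" using ex1[OF A(1)] xy addsub_zero[OF assms(2)] by auto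
  ultimately show "?r `` {x} = ?r `` {y} \<longleftrightarrow> x = y" by simp
 next
  fix x assume "x : R"
  hence "x : A" using RA by blast
  thus "?r `` {x} : A // ?r" by (rule quotientI)
 next
  fix Y assume "Y : A // ?r"
  then obtain a where a: "a : A" "Y = ?r `` {a}" by (auto elim: quotientE)
  then obtain r where r: "r : R" "a - r : B" using ex1 by blast
  hence "(a, r) : ?r" using a RA by (auto simp: cosrel_iff)
  hence "Y = ?r `` {r}" using a(2) equiv_class_eq[OF eq] by simp
  thus "EX x:R. Y = ?r `` {x}" using r(1) by blast
 qed
 thus ?thesis unfolding idx_def by (simp add: bij_betw_same_card)
qed

lemma transv_exists:
 assumes "addsub A" "addsub B"
 obtains R where "transv A B R"
proof -
 let ?r = "cosrel A B"
 have eq: "equiv A ?r" using equiv_cosrel assms by blast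
 define h where "h a = (SOME y. y : ?r `` {a})" for a
 have h: "(a, h a) : ?r" if "a : A" for a
 proof -
  have "a : ?r `` {a}" using that eq by (rule equiv_class_self[rotated])
  thus ?thesis unfolding h_def using someI[of "%y. y : ?r `` {a}" a] by blast
 qed
 have hc: "h a = h b" if "(a, b) : ?r" for a b unfolding h_def equiv_class_eq[OF eq that] ..
 have "transv A B (h ` A)" unfolding transv_def
 proof (intro conjI ballI)
  show "h ` A <= A" using h by (auto simp: cosrel_iff)
  fix a assume a: "a : A"
  show "EX! r. r : h ` A & a - r : B"
  proof (rule ex1I[of _ "h a"])
   show "h a : h ` A & a - h a : B" using a h[OF a] by (simp add: cosrel_iff)
   fix r assume "r : h ` A & a - r : B"
   then obtain b where b: "b : A" "r = h b" "a - r : B" by auto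
   hence "(a, h b) : ?r" using a h[OF b(1)] by (simp add: cosrel_iff)
   hence "(a, b) : ?r" using h[OF b(1)] eq by (meson equivE symE transE)
   thus "r = h a" using hc b by simp
  qed
 qed
 thus ?thesis using that by blast
qed

lemma idx_pos_finite_transv:
 assumes "addsub A" "addsub B" "idx A B > 0"
 obtains R where "transv A B R" "finite R" "card R = idx A B"
 using assms by (metis transv_exists idx_transv card_gt_0_iff)

text \<open>Sums of a representative of A/B and a representative of B/C represent A/C.\<close>

lemma idx_mult:
 assumes "addsub A" "addsub B" "addsub C" "C <= B" "B <= A"
 shows "idx A C = idx A B * idx B C"
proof -
 obtain R S where R: "transv A B R" and S: "transv B C S" using transv_exists assms by metis
 let ?f = "%(r, s). r + s"
 have RA: "R <= A" and SB: "S <= B" using R S by (auto simp: transv_def)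
 have uR: "r = r'" if "r : R" "r' : R" "r - r' : B" for r r'
  using R that addsub_zero[OF assms(2)] RA unfolding transv_def
  by (metis cancel_comm_monoid_add_class.diff_cancel subsetD)
 have uS: "r = r'" if "r : S" "r' : S" "r - r' : C" for r r'
  using S that addsub_zero[OF assms(3)] SB unfolding transv_def
  by (metis cancel_comm_monoid_add_class.diff_cancel subsetD)
 have uniq: "r = r' & s = s'" if "r : R" "r' : R" "s : S" "s' : S" "(r + s) - (r' + s') : C" for r r' s s'
 proof -
  have "(r + s) - (r' + s') + (s' - s) : B"
   using that assms(4) SB addsub_add[OF assms(2)] addsub_diff[OF assms(2)] by blast
  hence "r = r'" using uR[of r r'] that by (simp add: algebra_simps)
  thus ?thesis using uS[of s s'] that by simp
 qed
 have inj: "inj_on ?f (R \<times> S)" using uniq addsub_zero[OF assms(3)] by (auto intro!: inj_onI)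
 have "transv A C (?f ` (R \<times> S))" unfolding transv_def
 proof (intro conjI ballI)
  show "?f ` (R \<times> S) <= A" using RA SB assms(5) by (auto intro!: addsub_add[OF assms(1)])
  fix a assume "a : A"
  then obtain r where r: "r : R" "a - r : B" using R by (auto simp: transv_def)
  then obtain s where s: "s : S" "(a - r) - s : C" using S by (auto simp: transv_def)
  show "EX! x. x : ?f ` (R \<times> S) & a - x : C"
  proof (rule ex1I[of _ "r + s"])
   show "r + s : ?f ` (R \<times> S) & a - (r + s) : C" using r s by (auto simp: diff_diff_eq)
   fix x assume "x : ?f ` (R \<times> S) & a - x : C"
   then obtain r' s' where x: "r' : R" "s' : S" "x = r' + s'" "a - (r' + s') : C" by auto
   have "(a - (r' + s')) - ((a - r) - s) : C" using x s addsub_diff[OF assms(3)] by blast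
   hence "(r + s) - (r' + s') : C" by (simp add: algebra_simps)
   thus "x = r + s" using uniq[of r r' s s'] r s x by auto
  qed
 qed
 hence "idx A C = card (?f ` (R \<times> S))" using idx_transv assms by blast
 also have "... = card R * card S" using inj by (simp add: card_image card_cartesian_product)
 finally show ?thesis using idx_transv[OF assms(1,2) R] idx_transv[OF assms(2,3) S] by simp
qed

text \<open>f induces an isomorphism from A modulo the preimage of S to A' modulo S. A set-theoretic
  section of f carries representatives back.\<close>

lemma idx_hom:
 assumes "addsub A" "addsub A'" "addsub S"
  and add: "!!x y. x : A ==> y : A ==> f (x - y) = f x - f y"
  and im: "f ` A = A'"
 shows "idx A {x : A. f x : S} = idx A' S"
proof -
 obtain R where R: "transv A' S R" using transv_exists[OF assms(2,3)] by blast
 define g where "g y = (SOME x. x : A & f x = y)" for y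
 have g: "g y : A" "f (g y) = y" if "y : A'" for y
  using that im someI_ex[of "%x. x : A & f x = y"] unfolding g_def by auto
 have RA: "R <= A'" using R by (auto simp: transv_def)
 have sub: "addsub {x : A. f x : S}" using assms(1) assms(3) add[of 0 0] unfolding addsub_def by (auto simp: add)
 have "transv A {x : A. f x : S} (g ` R)" unfolding transv_def
 proof (intro conjI ballI)
  show "g ` R <= A" using g RA by auto
  fix a assume a: "a : A"
  hence "f a : A'" using im by auto
  then obtain r where r: "r : R" "f a - r : S" and u: "!!r'. r' : R ==> f a - r' : S ==> r' = r"
   using R unfolding transv_def by metis
  have fg: "f (a - g r') = f a - r'" if "r' : R" for r' using that a g[of r'] RA by (subst add) auto
  show "EX! x. x : g ` R & a - x : {x : A. f x : S}"
  proof (rule ex1I[of _ "g r"])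
   show "g r : g ` R & a - g r : {x : A. f x : S}" using r fg[OF r(1)] a g RA addsub_diff[OF assms(1)] by auto
  qed (use u fg in auto)
 qed
 hence "idx A {x : A. f x : S} = card (g ` R)" using idx_transv[OF assms(1) sub] by blast
 also have "... = card R" using g RA by (intro card_image inj_onI) (metis subsetD)
 finally show ?thesis using idx_transv[OF assms(2,3) R] by simp
qed

section \<open>Lattices in Z^n\<close>

text \<open>Vectors are functions on all natural numbers supported below n, so Z^n is literally a
  subset of Z^(n+1) and inductions on the rank need no embedding.\<close>

definition Zd :: "nat => (nat => int) set" where
 "Zd n = {x. ALL i>=n. x i = 0}"

definition zs :: "int => (nat => int) => nat => int" where
 "zs k x = (%i. k * x i)"

definition ev :: "nat => nat => int" where
 "ev i = (%j. if j = i then 1 else 0)"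

definition comb :: "nat => (nat => nat => int) => (nat => int) => nat => int" where
 "comb r b x = (%j. SUM i<r. x i * b i j)"

definition lat_basis :: "(nat => int) set => nat => (nat => nat => int) => bool" where
 "lat_basis K r b \<longleftrightarrow> bij_betw (comb r b) (Zd r) K"

lemma addsub_Zd [simp]: "addsub (Zd n)" by (auto simp: addsub_def Zd_def)

lemma Zd_mono: "m <= n ==> Zd m <= Zd n" by (auto simp: Zd_def)

lemma Zd_Suc: "x : Zd (Suc n) ==> x n = 0 ==> x : Zd n"
proof -
 assume x: "x : Zd (Suc n)" "x n = 0"
 have "x i = 0" if "i >= n" for i using x that by (cases "i = n") (auto simp: Zd_def)
 thus ?thesis by (simp add: Zd_def)
qed

lemma ev_Zd: "i < n ==> ev i : Zd n" by (auto simp: Zd_def ev_def)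

lemma zs_simps: "zs (a + b) x = zs a x + zs b x" "zs a (x + y) = zs a x + zs a y"
 "zs a (x - y) = zs a x - zs a y" "zs (a - b) x = zs a x - zs b x"
 "zs a (zs b x) = zs (a * b) x" "zs 0 x = 0" "zs 1 x = x" "zs (- a) x = - zs a x" "zs a 0 = 0"
 by (auto simp: zs_def fun_eq_iff algebra_simps)

lemma zs_apply: "zs a x i = a * x i" by (simp add: zs_def)

lemma zs_Zd: "x : Zd n ==> zs k x : Zd n" by (auto simp: Zd_def zs_def)

lemma addsub_zs:
 assumes "addsub K" "x : K" shows "zs k x : K"
proof -
 have N: "zs (int n) x : K" for n
 proof (induction n)
  case 0
  have "zs (int 0) x = 0" by (simp add: zs_def fun_eq_iff)
  thus ?case using addsub_zero[OF assms(1)] by (simp only:)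
 next
  case (Suc n)
  have "zs (int (Suc n)) x = x + zs (int n) x" by (simp add: zs_def fun_eq_iff algebra_simps)
  thus ?case using addsub_add[OF assms Suc] by (simp only:)
 qed
 show ?thesis
 proof (cases "k >= 0")
  case True thus ?thesis using N[of "nat k"] by simp
 next
  case False
  thus ?thesis using addsub_minus[OF assms(1) N[of "nat (- k)"]] by (simp add: zs_simps(8))
 qed
qed

lemma comb_diff: "comb r b (x - y) = comb r b x - comb r b y"
 by (auto simp: comb_def fun_eq_iff algebra_simps sum_subtractf)

lemma comb_add: "comb r b (x + y) = comb r b x + comb r b y"
 by (auto simp: comb_def fun_eq_iff algebra_simps sum.distrib)

lemma comb_zs: "comb r b (zs k x) = zs k (comb r b x)"
 by (auto simp: comb_def zs_def fun_eq_iff algebra_simps sum_distrib_left)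

lemma comb_ev: "i < r ==> comb r b (ev i) = b i"
 by (auto simp: comb_def ev_def fun_eq_iff if_distrib[of "%x. x * _"] cong: if_cong)

lemma lat_basisD:
 assumes "lat_basis K r b"
 shows "comb r b ` Zd r = K" "inj_on (comb r b) (Zd r)" using assms by (auto simp: lat_basis_def bij_betw_def)

lemma sum_fun_apply: "sum f A x = (SUM i:A. f i x)" for f :: "'a => 'b => 'c::comm_monoid_add"
 by (induction A rule: infinite_finite_induct) auto

lemma comb_in:
 assumes "addsub K" "!!i. i < r ==> b i : K"
 shows "comb r b x : K"
proof -
 have "comb r b x = (SUM i<r. zs (x i) (b i))" by (auto simp: comb_def zs_def fun_eq_iff sum_fun_apply)
 thus ?thesis using assms by (auto intro!: addsub_sum addsub_zs)
qed

text \<open>The last coordinates of K form a group m Z. If m is nonzero, a vector v of K with last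
  coordinate m completes a basis of the part of K with vanishing last coordinate.\<close>

lemma lat_basis_exists:
 assumes "addsub K" "K <= Zd n"
 obtains r b where "lat_basis K r b"
proof -
 have "EX r b. lat_basis K r b" using assms
 proof (induction n arbitrary: K)
  case 0
  have "Zd 0 = {0}" by (auto simp: Zd_def fun_eq_iff)
  hence "K = {0}" using 0 addsub_zero by blast
  hence "lat_basis K 0 (%_ _. 0)"
   using `Zd 0 = {0}` unfolding lat_basis_def by (auto simp: bij_betw_def comb_def fun_eq_iff)
  thus ?case by blast
 next
  case (Suc n)
  let ?K' = "K Int Zd n"
  have "addsub ?K'" using Suc.prems by (simp add: addsub_Int)
  then obtain r b where rb: "lat_basis ?K' r b" using Suc.IH[of ?K'] by auto
  have "addsub ((%x. x n) ` K)" using Suc.prems(1) unfolding addsub_def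
   by (auto simp: image_iff) (metis minus_apply zero_fun_apply)+
  then obtain m where m: "m >= 0" "(%x. x n) ` K = {x. m dvd x}" by (rule addsub_int)
  show ?case
  proof (cases "m = 0")
   case True
   hence "x n = 0" if "x : K" for x using m(2) that by auto
   hence "K = ?K'" using Suc.prems(2) Zd_Suc by blast
   thus ?thesis using rb by auto
  next
   case False
   have "m : (%x. x n) ` K" using m(2) by auto
   then obtain v where v: "v : K" "v n = m" by auto
   define b' where "b' = b(r := v)"
   have c: "comb (Suc r) b' x = comb r b (x(r := 0)) + zs (x r) v" for x
    by (auto simp: comb_def b'_def zs_def fun_eq_iff)
   have red: "x(r := 0) : Zd r" if "x : Zd (Suc r)" for x using that by (auto simp: Zd_def)
   have K': "comb r b x : ?K'" if "x : Zd r" for x using lat_basisD(1)[OF rb] that by auto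
   have "lat_basis K (Suc r) b'" unfolding lat_basis_def bij_betw_def
   proof (intro conjI)
    show "inj_on (comb (Suc r) b') (Zd (Suc r))"
    proof (rule inj_onI)
     fix x y assume xy: "x : Zd (Suc r)" "y : Zd (Suc r)" "comb (Suc r) b' x = comb (Suc r) b' y"
     have n0: "comb r b (z(r := 0)) n = 0" if "z : Zd (Suc r)" for z using K'[OF red[OF that]] by (auto simp: Zd_def)
     have "x r * m = y r * m" using fun_cong[OF xy(3), of n] unfolding c using n0 xy v by (simp add: zs_def)
     hence r: "x r = y r" using False by simp
     hence "comb r b (x(r := 0)) = comb r b (y(r := 0))" using xy(3) unfolding c by simp
     hence "x(r := 0) = y(r := 0)" using lat_basisD(2)[OF rb] red xy by (auto dest: inj_onD)
     thus "x = y" using r by (metis fun_upd_triv fun_upd_upd)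
    qed
    show "comb (Suc r) b' ` Zd (Suc r) = K"
    proof (intro equalityI subsetI)
     fix y assume "y : comb (Suc r) b' ` Zd (Suc r)"
     thus "y : K" unfolding c using K' red v by (auto intro!: addsub_add[OF Suc.prems(1)] addsub_zs[OF Suc.prems(1)])
    next
     fix y assume y: "y : K"
     hence "m dvd y n" using m(2) by auto
     then obtain k where k: "y n = k * m" by (metis dvdE mult.commute)
     have "y - zs k v : K" using y v by (intro addsub_diff addsub_zs Suc.prems(1))
     moreover from this have "y - zs k v : Zd n" using k v Suc.prems(2) by (rule_tac Zd_Suc) (blast, simp add: zs_def)
     ultimately obtain x where x: "x : Zd r" "comb r b x = y - zs k v"
      using lat_basisD(1)[OF rb] by (metis IntI imageE)
     have "x r = 0" using x by (auto simp: Zd_def)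
     hence "(x(r := k))(r := 0) = x" by (auto simp: fun_eq_iff)
     hence "comb (Suc r) b' (x(r := k)) = y" unfolding c using x by simp
     moreover have "x(r := k) : Zd (Suc r)" using x by (auto simp: Zd_def)
     ultimately show "y : comb (Suc r) b' ` Zd (Suc r)" by blast
    qed
   qed
   thus ?thesis by blast
  qed
 qed
 thus ?thesis using that by blast
qed

text \<open>The vectors with a positive multiple in K form a lattice. The product of multipliers for
  its finitely many basis vectors serves for all of them; it bounds the torsion of Z^n / K.\<close>

lemma saturation:
 assumes K: "addsub K"
 obtains e :: int where "e > 0" "ALL k>0. ALL y:Zd n. zs k y : K --> zs e y : K"
proof -
 let ?S = "{y : Zd n. EX k>0. zs k y : K}"
 have "addsub ?S" unfolding addsub_def
 proof (intro conjI ballI)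
  have "zs 1 0 : K" using addsub_zero[OF K] by (simp only: zs_simps(9))
  thus "0 : ?S" using addsub_zero[OF addsub_Zd] zero_less_one by blast
  fix x y assume "x : ?S" "y : ?S"
  then obtain k l where k: "x : Zd n" "k > 0" "zs k x : K" "y : Zd n" "l > 0" "zs l y : K" by blast
  have "zs (k * l) (x - y) = zs l (zs k x) - zs k (zs l y)" by (simp only: zs_simps mult.commute)
  hence "zs (k * l) (x - y) : K" using addsub_diff[OF K addsub_zs[OF K k(3)] addsub_zs[OF K k(6)]] by (simp only:)
  thus "x - y : ?S" using mult_pos_pos[OF k(2,5)] addsub_diff[OF addsub_Zd k(1,4)] by blast
 qed
 then obtain r b where b: "lat_basis ?S r b" by (rule lat_basis_exists) blast
 have "b i : ?S" if "i < r" for i using lat_basisD(1)[OF b] comb_ev[OF that] ev_Zd[OF that] by (metis imageI)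
 hence "ALL i. EX k. i < r --> k > 0 & zs k (b i) : K" by blast
 from choice[OF this] obtain k where k: "!!i. i < r ==> k i > 0 & zs (k i) (b i) : K" by blast
 define e where "e = (PROD i<r. k i)"
 have eb: "zs e (b i) : K" if "i < r" for i
 proof -
  have "e = (PROD j:{..<r} - {i}. k j) * k i" using that by (simp add: e_def prod.remove mult.commute)
  thus ?thesis using addsub_zs[OF K, of "zs (k i) (b i)"] k[OF that] by (simp only: zs_simps(5))
 qed
 show thesis
 proof (rule that[of e]; (intro allI impI ballI)?)
  show "e > 0" unfolding e_def using k by (intro prod_pos) auto
  fix m y assume "(0 :: int) < m" "y : Zd n" "zs m y : K"
  then obtain x where "y = comb r b x" using lat_basisD(1)[OF b] by blast
  hence "zs e y = comb r (%i. zs e (b i)) x" by (auto simp: comb_def zs_def fun_eq_iff sum_distrib_left algebra_simps)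
  thus "zs e y : K" using comb_in[OF K, of r "%i. zs e (b i)" x] eb by simp
 qed
qed

lemma addsub_mult: "addsub K ==> addsub (zs m ` K)"
 unfolding addsub_def by (auto simp: image_iff) (metis zs_simps(9), metis zs_simps(3))

lemma multiples_Zd: "y : zs m ` Zd n \<longleftrightarrow> y : Zd n & (ALL i. m dvd y i)" if "m ~= 0"
proof
 assume y: "y : Zd n & (ALL i. m dvd y i)"
 hence "y = zs m (%i. y i div m)" by (auto simp: zs_def)
 moreover have "(%i. y i div m) : Zd n" using y by (auto simp: Zd_def)
 ultimately show "y : zs m ` Zd n" by blast
qed (auto simp: zs_Zd, auto simp: zs_def)

text \<open>Reducing coordinates modulo m stays inside X because X contains m Z^n. This converts an
  index into a count of residue vectors.\<close>

lemma idx_box: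
 fixes m :: int
 assumes m: "m > 0" and X: "addsub X" "X <= Zd n" "zs m ` Zd n <= X"
 shows "idx X (zs m ` Zd n) = card {x : X. ALL i<n. 0 <= x i & x i < m}" (is "_ = card ?R")
proof (rule idx_transv[OF X(1) addsub_mult[OF addsub_Zd]])
 show "transv X (zs m ` Zd n) ?R" unfolding transv_def
 proof (intro conjI ballI)
  fix a assume a: "a : X"
  let ?r = "%i. a i mod m"
  have aZ: "a : Zd n" using a X(2) by blast
  have rZ: "?r : Zd n" using aZ by (auto simp: Zd_def)
  have d: "a - ?r : zs m ` Zd n" using addsub_diff[OF addsub_Zd aZ rZ] m by (subst multiples_Zd) auto
  have "a - (a - ?r) : X" using addsub_diff[OF X(1) a] d X(3) by blast
  hence rX: "?r : X" by simp
  show "EX! r. r : ?R & a - r : zs m ` Zd n"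
  proof (rule ex1I[of _ ?r])
   show "?r : ?R & a - ?r : zs m ` Zd n" using rX d pos_mod_sign[OF m] pos_mod_bound[OF m] by simp
   fix s assume s: "s : ?R & a - s : zs m ` Zd n"
   show "s = ?r"
   proof
    fix i
    show "s i = a i mod m"
    proof (cases "i < n")
     case True
     have "m dvd a i - s i" using s m by (subst (asm) multiples_Zd) auto
     hence "a i mod m = s i mod m" by (simp add: mod_eq_dvd_iff)
     thus ?thesis using s True by simp
    next
     case False thus ?thesis using s aZ X(2) by (auto simp: Zd_def)
    qed
   qed
  qed
 qed auto
qed

lemma idx_Zd_mult:
 assumes "m > 0" shows "idx (Zd n) (zs (int m) ` Zd n) = m ^ n"
proof -
 let ?R = "{x : Zd n. ALL i<n. 0 <= x i & x i < int m}"
 have "idx (Zd n) (zs (int m) ` Zd n) = card ?R" by (rule idx_box) (use assms zs_Zd in auto)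
 also have "bij_betw (%x. restrict x {..<n}) ?R ({..<n} \<rightarrow>\<^sub>E {0..<int m})"
 proof (rule bij_betw_byWitness[where f' = "%f i. if i < n then f i else 0"])
 qed (auto simp: Zd_def fun_eq_iff PiE_def extensional_def)
 hence "card ?R = card ({..<n} \<rightarrow>\<^sub>E {0..<int m})" by (rule bij_betw_same_card)
 also have "... = m ^ n" by (simp add: card_PiE)
 finally show ?thesis .
qed

lemma idx_lat_mult:
 assumes "addsub K" "lat_basis K r b" "m > 0"
 shows "idx K (zs (int m) ` K) = m ^ r"
proof -
 have "zs (int m) ` Zd r = {x : Zd r. comb r b x : zs (int m) ` K}"
 proof (intro equalityI subsetI)
  fix x assume "x : zs (int m) ` Zd r"
  thus "x : {x : Zd r. comb r b x : zs (int m) ` K}" using lat_basisD(1)[OF assms(2)] by (auto simp: comb_zs zs_Zd)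
 next
  fix x assume x: "x : {x : Zd r. comb r b x : zs (int m) ` K}"
  then obtain k where "k : K" "comb r b x = zs (int m) k" by auto
  then obtain y where y: "y : Zd r" "comb r b x = zs (int m) (comb r b y)" using lat_basisD(1)[OF assms(2)] by auto
  hence "comb r b x = comb r b (zs (int m) y)" by (simp add: comb_zs)
  hence "x = zs (int m) y" using lat_basisD(2)[OF assms(2)] x y zs_Zd by (auto dest: inj_onD)
  thus "x : zs (int m) ` Zd r" using y by auto
 qed
 hence "idx (Zd r) (zs (int m) ` Zd r) = idx K (zs (int m) ` K)"
  using idx_hom[OF addsub_Zd[of r] assms(1) addsub_mult[OF assms(1)], of "comb r b" m]
   lat_basisD(1)[OF assms(2)] by (simp add: comb_diff)
 thus ?thesis using idx_Zd_mult[OF assms(3)] by simp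
qed

lemma idx_zs_image:
 assumes "addsub A" "addsub B" "B <= A" "k ~= 0"
 shows "idx (zs k ` A) (zs k ` B) = idx A B"
proof -
 have inj: "zs k x = zs k y ==> x = y" for x y using assms(4) by (auto simp: zs_def fun_eq_iff)
 have "{x : A. zs k x : zs k ` B} = B" using assms(3) inj by auto
 thus ?thesis using idx_hom[OF assms(1) addsub_mult[OF assms(1)] addsub_mult[OF assms(2)], of "zs k" k k]
  by (simp add: zs_simps)
qed

text \<open>The index of 2K in Z^n is computed through 2 Z^n and through K; comparing gives 2^n =
  2^r.\<close>

lemma lat_basis_rank:
 assumes "addsub K" "K <= Zd n" "idx (Zd n) K > 0" "lat_basis K r b"
 shows "r = n"
proof -
 have "zs 2 ` K <= zs 2 ` Zd n" using assms(2) by auto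
 moreover have "zs 2 ` Zd n <= Zd n" by (auto simp: zs_Zd)
 ultimately have "idx (Zd n) (zs 2 ` K) = idx (Zd n) (zs 2 ` Zd n) * idx (zs 2 ` Zd n) (zs 2 ` K)"
  by (intro idx_mult addsub_mult addsub_Zd assms)
 also have "... = 2 ^ n * idx (Zd n) K" using idx_Zd_mult[of 2 n] by (subst idx_zs_image) (auto simp: assms)
 finally have 1: "idx (Zd n) (zs 2 ` K) = 2 ^ n * idx (Zd n) K" .
 have "zs 2 ` K <= K" using addsub_zs[OF assms(1)] by auto
 hence "idx (Zd n) (zs 2 ` K) = idx (Zd n) K * idx K (zs 2 ` K)" by (intro idx_mult addsub_mult addsub_Zd assms)
 also have "idx K (zs 2 ` K) = 2 ^ r" using idx_lat_mult[OF assms(1,4), of 2] by simp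
 finally have "(2::nat) ^ r = 2 ^ n" using 1 assms(3) by simp
 thus ?thesis by simp
qed

lemma lat_basis_full:
 assumes "addsub K" "K <= Zd n" "idx (Zd n) K > 0"
 obtains b where "lat_basis K n b"
proof -
 obtain r b where "lat_basis K r b" by (rule lat_basis_exists[OF assms(1,2)])
 thus ?thesis using lat_basis_rank[OF assms, of r b] that by blast
qed

section \<open>Divisibility in the localization of Z at p\<close>

abbreviation vp :: "nat => int => nat" where "vp p == multiplicity (int p)"

abbreviation rp :: "int poly => rat poly" where "rp == map_poly rat_of_int"

text \<open>Divisibility in the ring of rationals whose denominator is prime to p, written without a
  quotient so that a = 0 divides only 0. Elimination divides by pivots, so it has to leave the
  integers for this ring.\<close>

definition pdvd :: "nat => rat => rat => bool" where
 "pdvd p a b \<longleftrightarrow> (EX u v::int. ~ int p dvd v & b * of_int v = a * of_int u)"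

lemma pdvdI: "~ int p dvd v ==> b * of_int v = a * of_int u ==> pdvd p a b" unfolding pdvd_def by blast

lemma not_dvd_1: "prime p ==> ~ int p dvd 1" using not_prime_unit by (metis int_dvd_int_iff of_nat_1 not_prime_unit)

lemma not_dvd_mult: "prime p ==> ~ int p dvd v ==> ~ int p dvd w ==> ~ int p dvd v * w"
 using prime_dvd_mult_iff[of "int p"] by simp

lemma pdvd_refl: "prime p ==> pdvd p a a" by (rule pdvdI[of p 1 _ _ 1]) (auto simp: not_dvd_1)

lemma pdvd_0: "prime p ==> pdvd p a 0" by (rule pdvdI[of p 1 _ _ 0]) (auto simp: not_dvd_1)

lemma pdvd_0_left: "prime p ==> pdvd p 0 a ==> a = 0" unfolding pdvd_def by auto

lemma pdvd_trans:
 assumes "prime p" "pdvd p a b" "pdvd p b c" shows "pdvd p a c"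
proof -
 obtain u v u' v' where h: "~ int p dvd v" "b * of_int v = a * of_int u"
  "~ int p dvd v'" "c * of_int v' = b * of_int u'" using assms unfolding pdvd_def by blast
 have "c * of_int (v * v') = (c * of_int v') * of_int v" by simp
 also have "... = (b * of_int v) * of_int u'" using h by simp
 also have "... = a * of_int (u * u')" using h by simp
 finally show ?thesis using h assms(1) by (intro pdvdI[of p "v * v'"] not_dvd_mult)
qed

lemma pdvd_add:
 assumes "prime p" "pdvd p a b" "pdvd p a c" shows "pdvd p a (b + c)"
proof -
 obtain u v u' v' where h: "~ int p dvd v" "b * of_int v = a * of_int u"
  "~ int p dvd v'" "c * of_int v' = a * of_int u'" using assms unfolding pdvd_def by blast
 have "(b + c) * of_int (v * v') = (b * of_int v) * of_int v' + (c * of_int v') * of_int v"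
  by (simp add: algebra_simps)
 also have "... = a * of_int (u * v' + u' * v)" using h by (simp add: algebra_simps)
 finally show ?thesis using h assms(1) by (intro pdvdI[of p "v * v'"] not_dvd_mult)
qed

lemma pdvd_mult_cancel: "c ~= 0 ==> pdvd p (a * c) (b * c) \<longleftrightarrow> pdvd p a b"
 unfolding pdvd_def by (auto simp: mult.assoc mult.left_commute[of _ c] mult.commute[of _ c])

lemma pdvd_mult_right: "pdvd p a b ==> pdvd p (a * c) (b * c)"
 by (cases "c = 0") (auto simp: pdvd_mult_cancel, auto simp: pdvd_def)

lemma pdvd_mult_left: "pdvd p a b ==> pdvd p (c * a) (c * b)"
 using pdvd_mult_right[of p a b c] by (simp add: mult.commute)

lemma pdvd_mult_mono:
 "prime p ==> pdvd p a b ==> pdvd p c d ==> pdvd p (a * c) (b * d)"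
 using pdvd_trans[of p "a * c" "b * c" "b * d"] pdvd_mult_right[of p a b c] pdvd_mult_left[of p c d b] by blast

lemma pdvd_mult_int: "prime p ==> pdvd p a b ==> pdvd p 1 c ==> pdvd p a (b * c)"
 using pdvd_mult_mono[of p a b 1 c] by simp

lemma pdvd_1_of_int: "prime p ==> pdvd p 1 (of_int k)" by (rule pdvdI[of p 1 _ _ k]) (auto simp: not_dvd_1)

lemma pdvd_minus: "prime p ==> pdvd p a b ==> pdvd p a (- b)"
 using pdvd_mult_int[of p a b "of_int (-1)"] pdvd_1_of_int[of p "-1"] by simp

lemma pdvd_diff: "prime p ==> pdvd p a b ==> pdvd p a c ==> pdvd p a (b - c)"
 using pdvd_add[of p a b "- c"] pdvd_minus[of p a c] by simp

lemma pdvd_add_iff: "prime p ==> pdvd p a c ==> pdvd p a (b + c) \<longleftrightarrow> pdvd p a b"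
 using pdvd_add[of p a b c] pdvd_diff[of p a "b + c" c] by auto

lemma pdvd_sum: "prime p ==> (!!i. i : A ==> pdvd p a (f i)) ==> pdvd p a (sum f A)"
 by (induction A rule: infinite_finite_induct) (auto simp: pdvd_0 pdvd_add)

lemma pdvd_of_int:
 assumes "prime p"
 shows "pdvd p (of_nat p ^ b) (of_int k) \<longleftrightarrow> int p ^ b dvd k"
proof
 assume "pdvd p (of_nat p ^ b) (of_int k)"
 then obtain u v :: int where h: "~ int p dvd v" "(of_int k :: rat) * of_int v = of_nat p ^ b * of_int u"
  unfolding pdvd_def by blast
 have "(of_int (k * v) :: rat) = of_int (int p ^ b * u)" using h(2) by simp
 hence "k * v = int p ^ b * u" by (simp only: of_int_eq_iff)
 hence "int p ^ b dvd k * v" by simp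
 moreover have "coprime (int p ^ b) v" using assms h(1) by (simp add: prime_imp_coprime)
 ultimately show "int p ^ b dvd k" using coprime_dvd_mult_left_iff by blast
next
 assume "int p ^ b dvd k"
 then obtain u where "k = int p ^ b * u" by (auto simp: dvd_def)
 thus "pdvd p (of_nat p ^ b) (of_int k)" using not_dvd_1[OF assms] by (intro pdvdI[of p 1 _ _ u]) simp_all
qed

text \<open>The denominator is prime to p, hence invertible modulo p^b.\<close>

lemma pdvd_approx:
 assumes "prime p" "pdvd p 1 x"
 obtains k :: int where "pdvd p (of_nat p ^ b) (x - of_int k)"
proof -
 obtain u v :: int where h: "~ int p dvd v" "x * of_int v = of_int u" using assms unfolding pdvd_def by auto
 have "coprime v (int p ^ b)" using prime_imp_coprime[of "int p" v] assms(1) h(1) by (simp add: coprime_commute)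
 then obtain w where "[v * w = 1] (mod int p ^ b)" using coprime_iff_invertible_int by blast
 then obtain z where z: "v * w - 1 = int p ^ b * z" by (auto simp: cong_iff_dvd_diff dvd_def)
 have "(x - of_int (u * w)) * of_int v = of_int u - of_int u * of_int (v * w)" using h(2) by (simp add: algebra_simps)
 also have "... = of_int (- u * (v * w - 1))" by (simp add: algebra_simps)
 also have "... = of_nat p ^ b * of_int (- u * z)" unfolding z by simp
 finally show ?thesis using that[of "u * w"] h(1) by (blast intro: pdvdI)
qed

section \<open>Counting solutions of linear congruences modulo p^b\<close>

text \<open>The unknowns are integer residues while the coefficients are rational, since elimination
  produces coefficients that are only p-integral.\<close>

definition sols :: "nat => nat => 'i set => 'j set => ('i => 'j => rat) => ('j => int) set" where
 "sols p b I J C = {x : J \<rightarrow>\<^sub>E {0..<int p ^ b}.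
   ALL i:I. pdvd p (of_nat p ^ b) (SUM j:J. C i j * of_int (x j))}"

abbreviation nsol :: "nat => nat => 'i set => 'j set => ('i => 'j => int poly) => int => nat" where
 "nsol p b I J C t == card (sols p b I J (%i j. of_int (poly (C i j) t)))"

text \<open>A diagonal entry of valuation v allows p^(min b v) solutions modulo p^b. The valuations
  occurring here are affine functions m k + c of one parameter k.\<close>

abbreviation msum :: "nat => (int * int) list => nat => nat" where
 "msum b L k == SUM (m, c)<-L. min b (nat (m * int k + c))"

text \<open>The contribution of a single elementary divisor c.\<close>

definition sols1 :: "nat => nat => rat => int set" where
 "sols1 p b c = {y : {0..<int p ^ b}. pdvd p (of_nat p ^ b) (c * of_int y)}"

lemma card_multiples:
 assumes "p > 0" "k <= b"
 shows "card {y : {0..<int p ^ b}. int p ^ k dvd y} = p ^ (b - k)"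
proof -
 have eq: "int p ^ b = int p ^ k * int p ^ (b - k)" using assms by (simp flip: power_add)
 have "{y : {0..<int p ^ b}. int p ^ k dvd y} = (%z. int p ^ k * z) ` {0..<int p ^ (b - k)}"
 proof (intro equalityI subsetI)
  fix y assume "y : {y : {0..<int p ^ b}. int p ^ k dvd y}"
  then obtain z where z: "y = int p ^ k * z" "0 <= int p ^ k * z" "int p ^ k * z < int p ^ k * int p ^ (b - k)"
   unfolding eq by (auto simp: dvd_def)
  have "int p ^ k > 0" using assms by simp
  hence "0 <= z" "z < int p ^ (b - k)"
   using z(2,3) zero_le_mult_iff[of "int p ^ k" z] mult_less_cancel_left_pos[of "int p ^ k" z "int p ^ (b - k)"]
   by linarith+
  thus "y : (%z. int p ^ k * z) ` {0..<int p ^ (b - k)}" using z(1) by auto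
 next
  fix y assume "y : (%z. int p ^ k * z) ` {0..<int p ^ (b - k)}"
  thus "y : {y : {0..<int p ^ b}. int p ^ k dvd y}" unfolding eq using assms by auto
 qed
 thus ?thesis using assms by (simp add: card_image inj_on_def nat_power_eq)
qed

lemma card_sols1:
 assumes "prime p" "pdvd p (of_nat p ^ v) c" "pdvd p c (of_nat p ^ v)"
 shows "card (sols1 p b c) = p ^ min b v"
proof -
 have "pdvd p (of_nat p ^ b) (c * of_int y) \<longleftrightarrow> int p ^ (b - min b v) dvd y" for y
 proof -
  have "pdvd p (of_nat p ^ b) (c * of_int y) \<longleftrightarrow> pdvd p (of_nat p ^ b) (of_nat p ^ v * of_int y)"
   using assms pdvd_mult_right[of p c "of_nat p ^ v" "of_int y"]
    pdvd_mult_right[of p "of_nat p ^ v" c "of_int y"] pdvd_trans[OF assms(1)] by blast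
  also have "... \<longleftrightarrow> int p ^ b dvd int p ^ v * y"
   using pdvd_of_int[OF assms(1), of b "int p ^ v * y"] by simp
  also have "... \<longleftrightarrow> int p ^ (b - min b v) dvd y"
  proof (cases "b <= v")
   case True
   thus ?thesis by (simp add: le_imp_power_dvd dvd_mult2)
  next
   case False
   hence "int p ^ b = int p ^ v * int p ^ (b - v)" by (simp flip: power_add)
   thus ?thesis using False assms(1) by (simp add: min_def prime_gt_0_nat)
  qed
  finally show ?thesis .
 qed
 hence "sols1 p b c = {y : {0..<int p ^ b}. int p ^ (b - min b v) dvd y}" by (simp add: sols1_def)
 thus ?thesis using card_multiples[of p "b - min b v" b] assms(1) prime_gt_0_nat by simp
qed

text \<open>One step of the reduction to diagonal form. A pivot dividing all entries splits off as
  an equation in one variable, and the remaining equations are those of the Schur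
  complement.\<close>

lemma card_sols_step:
 assumes p: "prime p" and fin: "finite I" "finite J" and ij: "i0 : I" "j0 : J"
  and C: "!!i j. i : I ==> j : J ==> pdvd p (C i0 j0) (C i j)"
  and nz: "C i0 j0 ~= 0" and int: "pdvd p 1 (C i0 j0)"
 shows "card (sols p b I J C) = card (sols1 p b (C i0 j0)) *
  card (sols p b (I - {i0}) (J - {j0}) (%i j. C i j - C i j0 * C i0 j / C i0 j0))"
proof -
 let ?pj = "C i0 j0" and ?P = "int p ^ b" and ?J = "J - {j0}" and ?I = "I - {i0}"
 let ?C' = "%i j. C i j - C i j0 * C i0 j / ?pj"
 have P0: "?P > 0" using p prime_gt_0_nat by simp
 have q1: "pdvd p 1 (C i j / ?pj)" if "i : I" "j : J" for i j
  using C[OF that] pdvd_mult_cancel[of "1 / ?pj" p ?pj "C i j"] nz by simp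
 \<comment> \<open>The ratios of row i0 by the pivot are p-integral but not integral. Integer
   approximations modulo p^b keep the change of variables inside the integers.\<close>
 have "EX k. ALL j:J. pdvd p (of_nat p ^ b) (C i0 j / ?pj - of_int (k j))"
  using q1[OF ij(1)] pdvd_approx[OF p] by (intro bchoice) metis
 then obtain k where k: "!!j. j : J ==> pdvd p (of_nat p ^ b) (C i0 j / ?pj - of_int (k j))" by blast
 \<comment> \<open>\<open>Y\<close> takes the place of the variable \<open>x j0\<close>. The
   substitution is unipotent, so \<open>PH\<close> is a bijection of residue vectors, and modulo p^b
   row i0 becomes the pivot times \<open>Y\<close>.\<close>
 define Y where "Y x = x j0 + (SUM j:?J. k j * x j)" for x :: "'b => int"
 define PH where "PH x = (Y x mod ?P, restrict x ?J)" for x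
 have splitJ: "(SUM j:J. g j) = g j0 + (SUM j:?J. g j)" for g :: "'b => rat" using sum.remove[OF fin(2) ij(2)] .
 have row0: "pdvd p (of_nat p ^ b) (SUM j:J. C i0 j * of_int (x j))
   \<longleftrightarrow> pdvd p (of_nat p ^ b) (?pj * of_int (Y x mod ?P))" for x
 proof -
  have Ym: "(of_int (Y x) :: rat) = of_int (Y x mod ?P) + of_nat p ^ b * of_int (Y x div ?P)"
  proof -
   have "Y x = Y x mod ?P + ?P * (Y x div ?P)" by simp
   hence "(of_int (Y x) :: rat) = of_int (Y x mod ?P + ?P * (Y x div ?P))" by (simp only:)
   thus ?thesis by (simp only: of_int_add of_int_mult of_int_power of_int_of_nat_eq)
  qed
  have "(SUM j:J. C i0 j * of_int (x j)) =
    ?pj * of_int (Y x) + ?pj * (SUM j:?J. (C i0 j / ?pj - of_int (k j)) * of_int (x j))"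
  proof -
   have "?pj * (SUM j:?J. (C i0 j / ?pj - of_int (k j)) * of_int (x j)) =
    (SUM j:?J. C i0 j * of_int (x j) - ?pj * of_int (k j * x j))"
    unfolding sum_distrib_left using nz by (intro sum.cong) (auto simp: algebra_simps)
   also have "... = (SUM j:?J. C i0 j * of_int (x j)) - ?pj * of_int (SUM j:?J. k j * x j)"
    by (simp add: sum_subtractf sum_distrib_left)
   finally show ?thesis unfolding splitJ Y_def by (simp add: algebra_simps)
  qed
  also have "... = ?pj * of_int (Y x mod ?P) + (?pj * (of_nat p ^ b * of_int (Y x div ?P)) +
    ?pj * (SUM j:?J. (C i0 j / ?pj - of_int (k j)) * of_int (x j)))" unfolding Ym by (simp add: algebra_simps)
  finally have *: "(SUM j:J. C i0 j * of_int (x j)) = ..." .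
  have "pdvd p (of_nat p ^ b) (?pj * (of_nat p ^ b * of_int (Y x div ?P)))"
   using pdvd_mult_int[OF p pdvd_mult_int[OF p pdvd_refl[OF p] pdvd_1_of_int[OF p]] int, of "of_nat p ^ b" "Y x div ?P"]
   by (simp add: mult.commute)
  moreover have "pdvd p (of_nat p ^ b) ((SUM j:?J. (C i0 j / ?pj - of_int (k j)) * of_int (x j)) * ?pj)"
   using k by (intro pdvd_mult_int p int pdvd_sum pdvd_1_of_int) auto
  ultimately show ?thesis unfolding * by (intro pdvd_add_iff p pdvd_add) (auto simp: mult.commute)
 qed
 \<comment> \<open>Once row i0 holds, subtracting its p-integral multiple by C i j0 / pivot removes
   the variable j0 from row i.\<close>
 have rowi: "pdvd p (of_nat p ^ b) (SUM j:J. C i j * of_int (x j)) \<longleftrightarrow>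
   pdvd p (of_nat p ^ b) (SUM j:?J. ?C' i j * of_int (x j))"
  if i: "i : I" and r0: "pdvd p (of_nat p ^ b) (SUM j:J. C i0 j * of_int (x j))" for x i
 proof -
  have "(SUM j:J. C i j * of_int (x j)) = (SUM j:?J. ?C' i j * of_int (x j)) +
    (SUM j:J. C i0 j * of_int (x j)) * (C i j0 / ?pj)"
  proof -
   have "(SUM j:?J. ?C' i j * of_int (x j)) =
    (SUM j:?J. C i j * of_int (x j) - C i0 j * of_int (x j) * (C i j0 / ?pj))"
    by (intro sum.cong) (auto simp: algebra_simps)
   also have "... = (SUM j:?J. C i j * of_int (x j)) - (SUM j:?J. C i0 j * of_int (x j)) * (C i j0 / ?pj)"
    by (simp only: sum_subtractf sum_distrib_right)
   finally show ?thesis unfolding splitJ using nz by (simp add: algebra_simps)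
  qed
  thus ?thesis using pdvd_add_iff[OF p pdvd_mult_int[OF p r0 q1[OF i ij(2)]]] by simp
 qed
 have sols_iff: "x : sols p b I J C \<longleftrightarrow> PH x : sols1 p b ?pj \<times> sols p b ?I ?J ?C'"
  if x: "x : J \<rightarrow>\<^sub>E {0..<?P}" for x
 proof -
  have "x : sols p b I J C \<longleftrightarrow> pdvd p (of_nat p ^ b) (SUM j:J. C i0 j * of_int (x j)) &
    (ALL i:?I. pdvd p (of_nat p ^ b) (SUM j:J. C i j * of_int (x j)))" using x ij by (auto simp: sols_def)
  also have "... \<longleftrightarrow> pdvd p (of_nat p ^ b) (?pj * of_int (Y x mod ?P)) &
    (ALL i:?I. pdvd p (of_nat p ^ b) (SUM j:?J. ?C' i j * of_int (x j)))" using row0[of x] rowi[of _ x] by blast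
  also have "... \<longleftrightarrow> PH x : sols1 p b ?pj \<times> sols p b ?I ?J ?C'"
   using x P0 by (auto simp: PH_def sols1_def sols_def)
  finally show ?thesis .
 qed
 have "bij_betw PH (J \<rightarrow>\<^sub>E {0..<?P}) ({0..<?P} \<times> (?J \<rightarrow>\<^sub>E {0..<?P}))"
 proof (rule bij_betw_byWitness[where f' = "%(y, x'). x'(j0 := (y - (SUM j:?J. k j * x' j)) mod ?P)"])
  show "ALL x:J \<rightarrow>\<^sub>E {0..<?P}. (%(y, x'). x'(j0 := (y - (SUM j:?J. k j * x' j)) mod ?P)) (PH x) = x"
  proof
   fix x assume x: "x : J \<rightarrow>\<^sub>E {0..<?P}"
   hence "x j0 : {0..<?P}" using ij by auto
   hence "x j0 mod ?P = x j0" by simp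
   hence "(Y x mod ?P - (SUM j:?J. k j * restrict x ?J j)) mod ?P = x j0"
    unfolding Y_def by (simp add: mod_diff_left_eq)
   thus "(%(y, x'). x'(j0 := (y - (SUM j:?J. k j * x' j)) mod ?P)) (PH x) = x"
    using x unfolding PH_def by (auto simp: fun_eq_iff PiE_def extensional_def restrict_def)
  qed
  show "ALL z:{0..<?P} \<times> (?J \<rightarrow>\<^sub>E {0..<?P}). PH ((%(y, x'). x'(j0 := (y - (SUM j:?J. k j * x' j)) mod ?P)) z) = z"
  proof
   fix z assume "z : {0..<?P} \<times> (?J \<rightarrow>\<^sub>E {0..<?P})"
   then obtain y x' where z: "z = (y, x')" "y : {0..<?P}" "x' : ?J \<rightarrow>\<^sub>E {0..<?P}" by auto
   have "(SUM j:?J. k j * (x'(j0 := c)) j) = (SUM j:?J. k j * x' j)" for c by (intro sum.cong) auto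
   hence "Y (x'(j0 := (y - (SUM j:?J. k j * x' j)) mod ?P)) mod ?P = y"
    unfolding Y_def using z(2) by (simp add: mod_add_left_eq)
   moreover have "restrict (x'(j0 := c)) ?J = x'" for c
    using z(3) by (auto simp: fun_eq_iff PiE_def extensional_def restrict_def)
   ultimately show "PH ((%(y, x'). x'(j0 := (y - (SUM j:?J. k j * x' j)) mod ?P)) z) = z"
    unfolding PH_def z(1) by simp
  qed
  show "PH ` (J \<rightarrow>\<^sub>E {0..<?P}) <= {0..<?P} \<times> (?J \<rightarrow>\<^sub>E {0..<?P})"
  proof (rule image_subsetI)
   fix x assume "x : J \<rightarrow>\<^sub>E {0..<?P}"
   hence "x j : {0..<?P}" if "j : J" for j using that by blast
   hence "restrict x ?J : ?J \<rightarrow>\<^sub>E {0..<?P}" by (intro restrict_PiE_iff[THEN iffD2]) blast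
   moreover have "Y x mod ?P : {0..<?P}" using pos_mod_bound[OF P0] pos_mod_sign[OF P0] by simp
   ultimately show "PH x : {0..<?P} \<times> (?J \<rightarrow>\<^sub>E {0..<?P})" unfolding PH_def by blast
  qed
  show "(%(y, x'). x'(j0 := (y - (SUM j:?J. k j * x' j)) mod ?P)) ` ({0..<?P} \<times> (?J \<rightarrow>\<^sub>E {0..<?P})) <= J \<rightarrow>\<^sub>E {0..<?P}"
   using P0 ij by (auto simp: PiE_def extensional_def Pi_def)
 qed
 hence bij: "inj_on PH (J \<rightarrow>\<^sub>E {0..<?P})"
  "PH ` (J \<rightarrow>\<^sub>E {0..<?P}) = {0..<?P} \<times> (?J \<rightarrow>\<^sub>E {0..<?P})"
  by (auto simp: bij_betw_def)
 have S: "sols p b I J C <= J \<rightarrow>\<^sub>E {0..<?P}" by (auto simp: sols_def)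
 have "PH ` sols p b I J C = sols1 p b ?pj \<times> sols p b ?I ?J ?C'"
 proof (intro equalityI subsetI)
  fix z assume "z : PH ` sols p b I J C"
  thus "z : sols1 p b ?pj \<times> sols p b ?I ?J ?C'" using sols_iff S by blast
 next
  fix z assume z: "z : sols1 p b ?pj \<times> sols p b ?I ?J ?C'"
  hence "z : {0..<?P} \<times> (?J \<rightarrow>\<^sub>E {0..<?P})" by (auto simp: sols1_def sols_def)
  hence "z : PH ` (J \<rightarrow>\<^sub>E {0..<?P})" by (simp only: bij(2))
  then obtain x where x: "z = PH x" "x : J \<rightarrow>\<^sub>E {0..<?P}" by (rule imageE)
  hence "x : sols p b I J C" using sols_iff[OF x(2)] z by (simp only:)
  thus "z : PH ` sols p b I J C" unfolding x(1) by (rule imageI)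
 qed
 hence "card (sols p b I J C) = card (sols1 p b ?pj \<times> sols p b ?I ?J ?C')"
  using card_image[OF inj_on_subset[OF bij(1) S]] by simp
 thus ?thesis by (simp add: card_cartesian_product)
qed

section \<open>Gaussian elimination over germs of functions\<close>

text \<open>What elimination needs in order to run for many points x simultaneously: near the filter
  F a germ in K is zero or nonzero, any two germs are comparable for divisibility, and Schur
  complements stay in K. Comparability holds in one direction for all primes of Ps together, so one
  choice of pivots serves all of them; this later links the elementary divisors at different
  primes.\<close>

locale germs =
 fixes F :: "'pt filter" and K :: "('pt => rat) set" and Ps :: "('pt => nat) set"
 assumes primes: "P : Ps ==> eventually (%x. prime (P x)) F"
  and closed: "f : K ==> g : K ==> h : K ==> k : K ==> (%x. f x - g x * h x / k x) : K"
  and cmp: "f : K ==> g : K ==> (ALL P:Ps. eventually (%x. pdvd (P x) (f x) (g x)) F)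
    | (ALL P:Ps. eventually (%x. pdvd (P x) (g x) (f x)) F)"
  and zero: "f : K ==> eventually (%x. f x = 0) F | eventually (%x. f x ~= 0) F"
begin

lemma min_exists:
 assumes "finite S" "S ~= {}" "S <= K"
 obtains m where "m : S" "!!f P. f : S ==> P : Ps ==> eventually (%x. pdvd (P x) (m x) (f x)) F"
proof -
 have "EX m:S. ALL f:S. ALL P:Ps. eventually (%x. pdvd (P x) (m x) (f x)) F" using assms
 proof (induction rule: finite_ne_induct)
  case (singleton f)
  have "eventually (%x. pdvd (P x) (f x) (f x)) F" if "P : Ps" for P
   using primes[OF that] by eventually_elim (rule pdvd_refl)
  thus ?case by simp
 next
  case (insert g S)
  then obtain m where m: "m : S" "!!f P. f : S ==> P : Ps ==> eventually (%x. pdvd (P x) (m x) (f x)) F" by auto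
  have tr: "eventually (%x. pdvd (P x) (a x) (c x)) F"
   if "P : Ps" "eventually (%x. pdvd (P x) (a x) (b x)) F" "eventually (%x. pdvd (P x) (b x) (c x)) F"
   for P a b c
   using primes[OF that(1)] that(2,3) by eventually_elim (rule pdvd_trans)
  have rf: "eventually (%x. pdvd (P x) (f x) (f x)) F" if "P : Ps" for P f
   using primes[OF that] by eventually_elim (rule pdvd_refl)
  have "m : K" "g : K" using insert m by auto
  from cmp[OF this] show ?case
  proof
   assume "ALL P:Ps. \<forall>\<^sub>F x in F. pdvd (P x) (m x) (g x)"
   thus ?thesis using m by (intro bexI[of _ m]) auto
  next
   assume "ALL P:Ps. \<forall>\<^sub>F x in F. pdvd (P x) (g x) (m x)"
   hence "eventually (%x. pdvd (P x) (g x) (f x)) F" if "f : insert g S" "P : Ps" for f P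
    using that m(2)[of f P] tr[of P g m f] rf[of P g] by auto
   thus ?thesis by blast
  qed
 qed
 thus ?thesis using that by blast
qed

text \<open>Induction on the number of columns, always with a pivot that divides all other entries.
  The list Ds collects the pivots; variables left without a pivot are free and contribute p^b
  each.\<close>

theorem elimination:
 assumes "finite I" "finite J"
  and "!!i j. i : I ==> j : J ==> C i j : K"
  and "!!i j P. i : I ==> j : J ==> P : Ps ==> eventually (%x. pdvd (P x) 1 (C i j x)) F"
 shows "EX Ds. set Ds <= K & length Ds <= card J
  & (ALL D:set Ds. eventually (%x. D x ~= 0) F & (ALL P:Ps. eventually (%x. pdvd (P x) 1 (D x)) F))
  & (ALL P:Ps. eventually (%x. ALL b. card (sols (P x) b I J (%i j. C i j x)) =
     P x ^ (b * (card J - length Ds)) * (PROD D<-Ds. card (sols1 (P x) b (D x)))) F)" using assms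
proof (induction "card J" arbitrary: I J C rule: less_induct)
 case less
 note fin = less.prems(1,2) and CK = less.prems(3) and Cint = less.prems(4)
 show ?case
 proof (cases "EX i:I. EX j:J. eventually (%x. C i j x ~= 0) F & ~ eventually (%x. C i j x = 0) F")
  case False
  hence z: "eventually (%x. C i j x = 0) F" if "i : I" "j : J" for i j using that zero[OF CK[OF that]] by auto
  have "eventually (%x. ALL i:I. ALL j:J. C i j x = 0) F" using z fin by (auto intro!: eventually_ball_finite)
  hence "eventually (%x. ALL b. card (sols (P x) b I J (%i j. C i j x)) = P x ^ (b * card J)) F"
   if P: "P : Ps" for P
   using primes[OF P]
  proof eventually_elim
   case (elim x)
   have "sols (P x) b I J (%i j. C i j x) = J \<rightarrow>\<^sub>E {0..<int (P x) ^ b}" for b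
    using elim by (auto simp: sols_def pdvd_0)
   thus ?case using fin by (auto simp: card_PiE nat_power_eq power_mult)
  qed
  thus ?thesis by (intro exI[of _ "[]"]) auto
 next
  case True
  let ?S = "(%(i, j). C i j) ` (I \<times> J)"
  have "?S ~= {}" using True by auto
  moreover have "finite ?S" "?S <= K" using fin CK by auto
  ultimately obtain m where m: "m : ?S"
   "!!f P. f : ?S ==> P : Ps ==> eventually (%x. pdvd (P x) (m x) (f x)) F" using min_exists[of ?S] by metis
  then obtain i0 j0 where ij: "i0 : I" "j0 : J" "m = C i0 j0" by auto
  have mmin: "eventually (%x. pdvd (P x) (C i0 j0 x) (C i j x)) F" if "i : I" "j : J" "P : Ps" for i j P
   using m(2)[of "C i j" P] that ij by auto
  show ?thesis
  proof (cases "Ps = {}")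
   case True
   thus ?thesis by (intro exI[of _ "[]"]) auto
  next
   case False
   then obtain P0 where P0: "P0 : Ps" by blast
   \<comment> \<open>A pivot that vanishes eventually divides only zeros, so every entry would
     vanish eventually.\<close>
   have nz: "eventually (%x. C i0 j0 x ~= 0) F"
   proof (rule ccontr)
    assume "~ ?thesis"
    hence e0: "eventually (%x. C i0 j0 x = 0) F" using zero[OF CK] ij by blast
    obtain i j where h: "i : I" "j : J" "~ eventually (%x. C i j x = 0) F" using True by blast
    have "eventually (%x. C i j x = 0) F" using e0 primes[OF P0] mmin[OF h(1,2) P0]
     by eventually_elim (auto dest: pdvd_0_left)
    with h(3) show False by blast
   qed
   let ?I = "I - {i0}" and ?J = "J - {j0}"
   let ?C = "%i j x. C i j x - C i j0 x * C i0 j x / C i0 j0 x"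
   have cJ: "card ?J < card J" using fin ij by (intro psubset_card_mono) auto
   have C'int: "eventually (%x. pdvd (P x) 1 (?C i j x)) F" if "i : ?I" "j : ?J" "P : Ps" for i j P
   proof -
    have iI: "i : I" "j : J" using that by auto
    show ?thesis
     using primes[OF that(3)] Cint[OF iI that(3)] Cint[OF iI(1) ij(2) that(3)] mmin[OF ij(1) iI(2) that(3)] nz
    proof eventually_elim
     case (elim x)
     have "pdvd (P x) 1 (C i0 j x / C i0 j0 x)"
      using elim pdvd_mult_cancel[of "1 / C i0 j0 x" "P x" "C i0 j0 x" "C i0 j x"] by simp
     hence "pdvd (P x) 1 (C i j0 x * (C i0 j x / C i0 j0 x))" using elim pdvd_mult_int by blast
     thus ?case using elim pdvd_diff by simp
    qed
   qed
   have "EX Ds. set Ds <= K & length Ds <= card ?J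
    & (ALL D:set Ds. eventually (%x. D x ~= 0) F & (ALL P:Ps. eventually (%x. pdvd (P x) 1 (D x)) F))
    & (ALL P:Ps. eventually (%x. ALL b. card (sols (P x) b ?I ?J (%i j. ?C i j x)) =
       P x ^ (b * (card ?J - length Ds)) * (PROD D<-Ds. card (sols1 (P x) b (D x)))) F)"
   proof (rule less.hyps[OF cJ])
    fix i j assume "i : ?I" "j : ?J"
    thus "?C i j : K" using ij by (intro closed CK) auto
   qed (use fin C'int in auto)
   then obtain Ds where Ds: "set Ds <= K" "length Ds <= card ?J"
    "ALL D:set Ds. eventually (%x. D x ~= 0) F & (ALL P:Ps. eventually (%x. pdvd (P x) 1 (D x)) F)"
    "!!P. P : Ps ==> eventually (%x. ALL b. card (sols (P x) b ?I ?J (%i j. ?C i j x)) =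
       P x ^ (b * (card ?J - length Ds)) * (PROD D<-Ds. card (sols1 (P x) b (D x)))) F" by blast
   have cJ': "card ?J = card J - 1" using fin ij by simp
   have "card J > 0" using cJ by simp
   have main: "eventually (%x. ALL b. card (sols (P x) b I J (%i j. C i j x)) =
     P x ^ (b * (card J - length (C i0 j0 # Ds))) * (PROD D<-C i0 j0 # Ds. card (sols1 (P x) b (D x)))) F"
    if P: "P : Ps" for P
   proof -
    have "eventually (%x. ALL i:I. ALL j:J. pdvd (P x) (C i0 j0 x) (C i j x)) F"
     using mmin P fin by (auto intro!: eventually_ball_finite)
    thus ?thesis using primes[OF P] nz Cint[OF ij(1,2) P] Ds(4)[OF P]
    proof eventually_elim
     case (elim x)
     show ?case
     proof
      fix b
      have "card (sols (P x) b I J (%i j. C i j x)) =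
       card (sols1 (P x) b (C i0 j0 x)) * card (sols (P x) b ?I ?J (%i j. ?C i j x))"
       using elim ij by (intro card_sols_step fin) auto
      thus "card (sols (P x) b I J (%i j. C i j x)) =
        P x ^ (b * (card J - length (C i0 j0 # Ds))) * (PROD D<-C i0 j0 # Ds. card (sols1 (P x) b (D x)))"
       using elim(5) cJ' by (simp add: mult.left_commute)
     qed
    qed
   qed
   show ?thesis using Ds(1,2,3) main CK[OF ij(1,2)] nz Cint[OF ij(1,2)] cJ' `card J > 0`
    by (intro exI[of _ "C i0 j0 # Ds"]) auto
  qed
 qed
qed

end

section \<open>Valuations of polynomial values\<close>

text \<open>The p-adic valuation as a relation: for prime p, no k is related to x = 0.\<close>

definition pv :: "nat => rat => int => bool" where
 "pv p x k \<longleftrightarrow> (EX u v m n. ~ int p dvd u & ~ int p dvd v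
   & x * of_int v * of_nat p ^ n = of_int u * of_nat p ^ m & k = int m - int n)"

lemma pv_of_int:
 assumes "prime p" "a ~= 0"
 shows "pv p (of_int a) (int (vp p a))"
proof -
 have "~ is_unit (int p)" using not_dvd_1[OF assms(1)] .
 then obtain y where y: "a = int p ^ vp p a * y" "~ int p dvd y"
  using multiplicity_decompose'[of a "int p"] assms(2) by metis
 have "(of_int a :: rat) = of_int (int p ^ vp p a * y)" using y(1) by (simp only:)
 hence "(of_int a :: rat) * of_int 1 * of_nat p ^ 0 = of_int y * of_nat p ^ vp p a" by simp
 thus ?thesis unfolding pv_def using y(2) not_dvd_1[OF assms(1)] by (metis diff_zero of_nat_0)
qed

lemma pv_divide:
 assumes "prime p" "pv p x k" "pv p y l"
 shows "pv p (x / y) (k - l)"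
proof -
 obtain u v m n where x: "~ int p dvd u" "~ int p dvd v"
  "x * of_int v * of_nat p ^ n = of_int u * of_nat p ^ m" "k = int m - int n" using assms(2) unfolding pv_def by blast
 obtain u' v' m' n' where y: "~ int p dvd u'" "~ int p dvd v'"
  "y * of_int v' * of_nat p ^ n' = of_int u' * of_nat p ^ m'" "l = int m' - int n'"
  using assms(3) unfolding pv_def by blast
 have p0: "(of_nat p :: rat) ~= 0" using assms(1) by (simp add: prime_gt_0_nat)
 have nz: "v ~= 0" "u' ~= 0" "v' ~= 0" using x y by auto
 hence "y ~= 0" using y(3) p0 by auto
 have "(x / y) * of_int (v * u') * of_nat p ^ (n + m') = x * of_int v * of_nat p ^ n * (of_int u' * of_nat p ^ m') / y"
  by (simp add: power_add)
 also have "... = of_int u * of_nat p ^ m * (y * of_int v' * of_nat p ^ n') / y" using x(3) y(3) by simp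
 also have "... = of_int (u * v') * of_nat p ^ (m + n')" using `y ~= 0` by (simp add: power_add)
 finally have "(x / y) * of_int (v * u') * of_nat p ^ (n + m') = of_int (u * v') * of_nat p ^ (m + n')" .
 moreover have "~ int p dvd v * u'" "~ int p dvd u * v'" using x y not_dvd_mult[OF assms(1)] by auto
 moreover have "k - l = int (m + n') - int (n + m')" using x(4) y(4) by simp
 ultimately show ?thesis unfolding pv_def by blast
qed

lemma pv_power: "prime p ==> pv p (of_nat p ^ n) (int n)" unfolding pv_def using not_dvd_1[of p]
 by (intro exI[of _ 1] exI[of _ 1] exI[of _ n] exI[of _ 0]) auto

lemma pv_pdvd_iff:
 assumes "prime p" "pv p x k" "pv p y l"
 shows "pdvd p x y \<longleftrightarrow> k <= l"
proof -
 obtain u v m n where q: "~ int p dvd u" "~ int p dvd v"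
  "(y / x) * of_int v * of_nat p ^ n = of_int u * of_nat p ^ m" "l - k = int m - int n"
  using pv_divide[OF assms(1,3,2)] unfolding pv_def by blast
 have p0: "(of_nat p :: rat) ~= 0" using assms(1) by (simp add: prime_gt_0_nat)
 have nz: "w ~= 0" if "~ int p dvd w" for w using that by auto
 have x0: "x ~= 0" using q(3) nz[OF q(1)] p0 by auto
 have eq: "y * of_int v * of_nat p ^ n = x * (of_int u * of_nat p ^ m)" using q(3) x0 by (simp add: field_simps)
 show ?thesis
 proof
  assume "k <= l"
  hence mn: "n <= m" using q(4) by simp
  hence "y * of_int v * of_nat p ^ n = x * of_int u * of_nat p ^ (m - n) * of_nat p ^ n"
   using eq by (simp add: mult.assoc flip: power_add)
  hence "y * of_int v = x * of_int (u * int p ^ (m - n))" using p0 by simp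
  thus "pdvd p x y" using q(2) by (rule pdvdI[rotated])
 next
  assume "pdvd p x y"
  then obtain a b where ab: "~ int p dvd b" "y * of_int b = x * of_int a" unfolding pdvd_def by blast
  have "x * of_int a * of_int v * of_nat p ^ n = (y * of_int v * of_nat p ^ n) * of_int b"
   using ab(2)[symmetric] by simp
  also have "... = x * (of_int u * of_nat p ^ m) * of_int b" using eq by simp
  finally have "(of_int (a * v * int p ^ n) :: rat) = of_int (u * b * int p ^ m)"
   using x0 by (simp add: mult.assoc mult.left_commute)
  hence e: "a * v * int p ^ n = u * b * int p ^ m" by (simp only: of_int_eq_iff)
  show "k <= l"
  proof (rule ccontr)
   assume "~ k <= l"
   hence "m < n" using q(4) by simp
   hence "int p ^ n = int p ^ m * int p ^ (n - m)" by (simp flip: power_add)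
   hence "a * v * int p ^ (n - m) * int p ^ m = u * b * int p ^ m" using e by (simp add: ac_simps)
   hence "a * v * int p ^ (n - m) = u * b" using assms(1) prime_gt_0_nat by simp
   moreover have "int p dvd a * v * int p ^ (n - m)" using `m < n` by (simp add: dvd_power)
   ultimately show False using not_dvd_mult[OF assms(1) q(1) ab(1)] by simp
  qed
 qed
qed

lemma pv_nonzero: "prime p ==> pv p x k ==> x ~= 0" unfolding pv_def using prime_gt_0_nat by fastforce

lemma card_sols1_pv:
 assumes "prime p" "pv p x k" "k >= 0"
 shows "card (sols1 p b x) = p ^ min b (nat k)"
 using pv_pdvd_iff[OF assms(1) pv_power[OF assms(1), of "nat k"] assms(2)]
  pv_pdvd_iff[OF assms(1,2) pv_power[OF assms(1), of "nat k"]] assms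
 by (intro card_sols1) auto

text \<open>The common shape of the three applications. The valuation at P of any nonzero polynomial
  along T is an affine function m j + c of one parameter \<open>jj\<close>, with (m,c) in a group V
  whose members have eventually constant sign; differences of valuations then have a sign, so
  quotients of polynomial values are comparable. At the auxiliary primes in Qs all nonzero
  polynomials are units, which makes the number of pivots visible at an ordinary prime.\<close>

locale poly_germs =
 fixes F :: "'pt filter" and P :: "'pt => nat" and T :: "'pt => int" and jj :: "'pt => nat"
  and Qs :: "('pt => nat) set" and V :: "(int * int) set"
 assumes primeP: "eventually (%x. prime (P x)) F"
  and primeQ: "Q : Qs ==> eventually (%x. prime (Q x)) F"
  and V: "addsub V"
  and compV: "(a, c) : V ==> eventually (%x. a * int (jj x) + c >= 0) F | eventually (%x. a * int (jj x) + c <= 0) F"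
  and val: "A ~= 0 ==> EX (m, c):V. eventually (%x. poly A (T x) ~= 0
    & int (vp (P x) (poly A (T x))) = m * int (jj x) + c) F"
  and valQ: "A ~= 0 ==> Q : Qs ==> eventually (%x. ~ int (Q x) dvd poly A (T x)) F"
begin

definition quots :: "('pt => rat) set" where
 "quots = {h. EX A B :: int poly. B ~= 0 & eventually (%x. h x = of_int (poly A (T x)) / of_int (poly B (T x))) F}"

lemma quots_poly: "(%x. of_int (poly A (T x))) : quots"
 unfolding quots_def by (intro CollectI exI[of _ A] exI[of _ 1]) auto

lemma poly_nz: "A ~= 0 ==> eventually (%x. poly A (T x) ~= 0) F" using val[of A] by (auto elim: eventually_mono)

lemma quots_zero: "h : quots ==> eventually (%x. h x = 0) F |
  (EX mc:V. eventually (%x. pv (P x) (h x) (fst mc * int (jj x) + snd mc)) F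
   & (ALL Q:Qs. eventually (%x. pv (Q x) (h x) 0) F))"
proof -
 assume "h : quots"
 then obtain A B where AB: "B ~= 0" "eventually (%x. h x = of_int (poly A (T x)) / of_int (poly B (T x))) F"
  unfolding quots_def by blast
 show ?thesis
 proof (cases "A = 0")
  case True
  thus ?thesis using AB(2) by (auto elim: eventually_mono)
 next
  case False
  obtain m c where mc: "(m, c) : V" "eventually (%x. poly A (T x) ~= 0
    & int (vp (P x) (poly A (T x))) = m * int (jj x) + c) F" using val[OF False] by auto
  obtain m' c' where mc': "(m', c') : V" "eventually (%x. poly B (T x) ~= 0
    & int (vp (P x) (poly B (T x))) = m' * int (jj x) + c') F" using val[OF AB(1)] by auto
  have "(m, c) - (m', c') : V" using addsub_diff[OF V mc(1) mc'(1)] .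
  moreover have "eventually (%x. pv (P x) (h x) (fst ((m, c) - (m', c')) * int (jj x) + snd ((m, c) - (m', c')))) F"
   using primeP AB(2) mc(2) mc'(2)
  proof eventually_elim
   case (elim x)
   have "pv (P x) (h x) ((m * int (jj x) + c) - (m' * int (jj x) + c'))" unfolding elim(2) using elim pv_of_int
    by (intro pv_divide) (metis, metis, metis)
   thus ?case by (simp add: algebra_simps)
  qed
  moreover have "eventually (%x. pv (Q x) (h x) 0) F" if "Q : Qs" for Q
   using primeQ[OF that] AB(2) valQ[OF False that] valQ[OF AB(1) that]
  proof eventually_elim
   case (elim x)
   have "vp (Q x) (poly A (T x)) = 0" "vp (Q x) (poly B (T x)) = 0"
    using elim by (auto intro: not_dvd_imp_multiplicity_0)
   moreover have "poly A (T x) ~= 0" "poly B (T x) ~= 0" using elim by auto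
   ultimately have "pv (Q x) (h x) (0 - 0)" unfolding elim(2) using elim(1) pv_of_int[of "Q x"]
    by (intro pv_divide) (auto, metis of_nat_0, metis of_nat_0)
   thus ?case by simp
  qed
  ultimately show ?thesis by blast
 qed
qed

sublocale germs F quots "insert P Qs"
proof
 fix R assume "R : insert P Qs"
 thus "eventually (%x. prime (R x)) F" using primeP primeQ by auto
next
 fix f g h k assume "f : quots" "g : quots" "h : quots" "k : quots"
 then obtain A1 B1 A2 B2 A3 B3 A4 B4 :: "int poly" where AB: "B1 ~= 0" "B2 ~= 0" "B3 ~= 0" "B4 ~= 0"
  "eventually (%x. f x = of_int (poly A1 (T x)) / of_int (poly B1 (T x))) F"
  "eventually (%x. g x = of_int (poly A2 (T x)) / of_int (poly B2 (T x))) F"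
  "eventually (%x. h x = of_int (poly A3 (T x)) / of_int (poly B3 (T x))) F"
  "eventually (%x. k x = of_int (poly A4 (T x)) / of_int (poly B4 (T x))) F" unfolding quots_def by blast
 show "(%x. f x - g x * h x / k x) : quots"
 proof (cases "A4 = 0")
  \<comment> \<open>If k vanishes eventually, division by zero gives 0 and the function agrees with
    f.\<close>
  case True
  have "eventually (%x. f x - g x * h x / k x = of_int (poly A1 (T x)) / of_int (poly B1 (T x))) F"
   using AB(5,8) by eventually_elim (simp add: True)
  thus ?thesis unfolding quots_def using AB(1) by blast
 next
  case False
  have "eventually (%x. f x - g x * h x / k x =
    of_int (poly (A1 * (B2 * B3 * A4) - A2 * A3 * B4 * B1) (T x)) / of_int (poly (B1 * (B2 * B3 * A4)) (T x))) F"
   using AB(5-8) poly_nz[OF AB(1)] poly_nz[OF AB(2)] poly_nz[OF AB(3)] poly_nz[OF AB(4)] poly_nz[OF False]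
  proof eventually_elim
   case (elim x)
   show ?case unfolding elim(1-4) using elim(5-9) by (simp add: divide_simps)
  qed
  moreover have "B1 * (B2 * B3 * A4) ~= 0" using AB False by simp
  ultimately show ?thesis unfolding quots_def by blast
 qed
next
 fix f assume f: "f : quots"
 have nz: "eventually (%x. f x ~= 0) F" if "eventually (%x. pv (P x) (f x) (k x)) F" for k
  using primeP that by eventually_elim (rule pv_nonzero)
 show "eventually (%x. f x = 0) F | eventually (%x. f x ~= 0) F" using quots_zero[OF f]
  by (elim disjE bexE conjE) (rule disjI1, assumption, rule disjI2, rule nz, assumption)
next
 fix f g assume fg: "f : quots" "g : quots"
 have pr: "eventually (%x. prime (R x)) F" if "R : insert P Qs" for R using that primeP primeQ by auto
 have z: "ALL R:insert P Qs. eventually (%x. pdvd (R x) (a x) (b x)) F" if "eventually (%x. b x = 0) F" for a b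
 proof
  fix R assume "R : insert P Qs"
  from pr[OF this] that show "eventually (%x. pdvd (R x) (a x) (b x)) F" by eventually_elim (simp add: pdvd_0)
 qed
 have *: "ALL R:insert P Qs. eventually (%x. pdvd (R x) (f x) (g x)) F"
  if mc: "eventually (%x. pv (P x) (f x) (fst mc * int (jj x) + snd mc)) F"
     "ALL Q:Qs. eventually (%x. pv (Q x) (f x) 0) F"
   and mc': "eventually (%x. pv (P x) (g x) (fst mc' * int (jj x) + snd mc')) F"
     "ALL Q:Qs. eventually (%x. pv (Q x) (g x) 0) F"
   and le: "eventually (%x. fst mc * int (jj x) + snd mc <= fst mc' * int (jj x) + snd mc') F"
  for f g mc mc'
 proof
  fix R assume R: "R : insert P Qs"
  show "eventually (%x. pdvd (R x) (f x) (g x)) F"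
  proof (cases "R = P")
   case True
   show ?thesis unfolding True using primeP mc(1) mc'(1) le by eventually_elim (use pv_pdvd_iff in blast)
  next
   case False
   hence "R : Qs" using R by simp
   hence "eventually (%x. pv (R x) (f x) 0) F" "eventually (%x. pv (R x) (g x) 0) F" using mc mc' by auto
   thus ?thesis using primeQ[OF `R : Qs`] by eventually_elim (use pv_pdvd_iff in blast)
  qed
 qed
 show "(ALL R:insert P Qs. eventually (%x. pdvd (R x) (f x) (g x)) F)
   | (ALL R:insert P Qs. eventually (%x. pdvd (R x) (g x) (f x)) F)"
 proof (cases "eventually (%x. f x = 0) F | eventually (%x. g x = 0) F")
  case True
  thus ?thesis using z by blast
 next
  case False
  then obtain mc mc' where mc: "mc : V" "eventually (%x. pv (P x) (f x) (fst mc * int (jj x) + snd mc)) F"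
     "ALL Q:Qs. eventually (%x. pv (Q x) (f x) 0) F"
   and mc': "mc' : V" "eventually (%x. pv (P x) (g x) (fst mc' * int (jj x) + snd mc')) F"
     "ALL Q:Qs. eventually (%x. pv (Q x) (g x) 0) F" using quots_zero[OF fg(1)] quots_zero[OF fg(2)] by blast
  have "(fst mc' - fst mc, snd mc' - snd mc) : V" using addsub_diff[OF V mc'(1) mc(1)] by (simp add: minus_prod_def)
  from compV[OF this] show ?thesis
  proof
   assume "eventually (%x. (fst mc' - fst mc) * int (jj x) + (snd mc' - snd mc) >= 0) F"
   hence "eventually (%x. fst mc * int (jj x) + snd mc <= fst mc' * int (jj x) + snd mc') F"
    by eventually_elim (simp add: algebra_simps)
   from *[OF mc(2,3) mc'(2,3) this] show ?thesis by blast
  next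
   assume "eventually (%x. (fst mc' - fst mc) * int (jj x) + (snd mc' - snd mc) <= 0) F"
   hence "eventually (%x. fst mc' * int (jj x) + snd mc' <= fst mc * int (jj x) + snd mc) F"
    by eventually_elim (simp add: algebra_simps)
   from *[OF mc'(2,3) mc(2,3) this] show ?thesis by blast
  qed
 qed
qed

text \<open>A pivot of valuation v contributes p^(min b v) at P and the factor 1 at an auxiliary
  prime. The same length of L appears at both primes.\<close>

theorem poly_elimination:
 fixes C :: "'i => 'j => int poly"
 assumes "finite I" "finite J"
 obtains L where "set L <= V" "length L <= card J"
  "eventually (%x. ALL (m, c):set L. m * int (jj x) + c >= 0) F"
  "eventually (%x. ALL b. nsol (P x) b I J C (T x) =
    P x ^ (b * (card J - length L) + msum b L (jj x))) F"
  "!!Q. Q : Qs ==> eventually (%x. ALL b. nsol (Q x) b I J C (T x) =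
    Q x ^ (b * (card J - length L))) F"
proof -
 have "EX Ds. set Ds <= quots & length Ds <= card J
  & (ALL D:set Ds. eventually (%x. D x ~= 0) F & (ALL R:insert P Qs. eventually (%x. pdvd (R x) 1 (D x)) F))
  & (ALL R:insert P Qs. eventually (%x. ALL b. nsol (R x) b I J C (T x) =
     R x ^ (b * (card J - length Ds)) * (PROD D<-Ds. card (sols1 (R x) b (D x)))) F)"
 proof (rule elimination[OF assms])
  fix R and i :: 'i and j :: 'j assume "R : insert P Qs"
  hence "eventually (%x. prime (R x)) F" using primeP primeQ by auto
  thus "eventually (%x. pdvd (R x) 1 (of_int (poly (C i j) (T x)))) F" by eventually_elim (rule pdvd_1_of_int)
 qed (rule quots_poly)
 then obtain Ds where Ds: "set Ds <= quots" "length Ds <= card J"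
  "!!D. D : set Ds ==> eventually (%x. D x ~= 0) F"
  "!!D R. D : set Ds ==> R : insert P Qs ==> eventually (%x. pdvd (R x) 1 (D x)) F"
  "!!R. R : insert P Qs ==> eventually (%x. ALL b. nsol (R x) b I J C (T x) =
     R x ^ (b * (card J - length Ds)) * (PROD D<-Ds. card (sols1 (R x) b (D x)))) F" by blast
 show thesis
 \<comment> \<open>Over the trivial filter every claim holds. Otherwise a germ cannot be both
   eventually zero and eventually nonzero.\<close>
 proof (cases "F = bot")
  case True
  thus ?thesis by (intro that[of "[]"]) auto
 next
  case False
  have "ALL D:set Ds. EX mc. mc : V & eventually (%x. fst mc * int (jj x) + snd mc >= 0 &
    (ALL b. card (sols1 (P x) b (D x)) = P x ^ min b (nat (fst mc * int (jj x) + snd mc)))) F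
    & (ALL Q:Qs. eventually (%x. ALL b. card (sols1 (Q x) b (D x)) = 1) F)"
  proof
   fix D assume D: "D : set Ds"
   have "~ eventually (%x. D x = 0) F"
   proof
    assume "eventually (%x. D x = 0) F"
    with Ds(3)[OF D] have "eventually (%_. False) F" by eventually_elim simp
    with False show False by simp
   qed
   then obtain mc where mc: "mc : V" "eventually (%x. pv (P x) (D x) (fst mc * int (jj x) + snd mc)) F"
    "!!Q. Q : Qs ==> eventually (%x. pv (Q x) (D x) 0) F" using quots_zero[of D] D Ds(1) by blast
   have "eventually (%x. pdvd (P x) 1 (D x)) F" using Ds(4)[OF D, of P] by simp
   with mc(2) primeP have "eventually (%x. fst mc * int (jj x) + snd mc >= 0 &
    (ALL b. card (sols1 (P x) b (D x)) = P x ^ min b (nat (fst mc * int (jj x) + snd mc)))) F"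
   proof eventually_elim
    case (elim x)
    have "pv (P x) 1 0" using pv_power[OF elim(2), of 0] by simp
    hence "0 <= fst mc * int (jj x) + snd mc" using pv_pdvd_iff[OF elim(2) _ elim(1)] elim(3) by blast
    thus ?case using card_sols1_pv[OF elim(2,1)] by blast
   qed
   moreover have "eventually (%x. ALL b. card (sols1 (Q x) b (D x)) = 1) F" if "Q : Qs" for Q
    using mc(3)[OF that] primeQ[OF that]
   proof eventually_elim
    case (elim x)
    thus ?case using card_sols1_pv[OF elim(2,1)] by simp
   qed
   ultimately show "EX mc. mc : V & eventually (%x. fst mc * int (jj x) + snd mc >= 0 &
    (ALL b. card (sols1 (P x) b (D x)) = P x ^ min b (nat (fst mc * int (jj x) + snd mc)))) F
    & (ALL Q:Qs. eventually (%x. ALL b. card (sols1 (Q x) b (D x)) = 1) F)" using mc(1) by blast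
  qed
  from bchoice[OF this] obtain mc where mc: "!!D. D : set Ds ==> mc D : V"
   "!!D. D : set Ds ==> eventually (%x. fst (mc D) * int (jj x) + snd (mc D) >= 0 &
    (ALL b. card (sols1 (P x) b (D x)) = P x ^ min b (nat (fst (mc D) * int (jj x) + snd (mc D))))) F"
   "!!D Q. D : set Ds ==> Q : Qs ==> eventually (%x. ALL b. card (sols1 (Q x) b (D x)) = 1) F" by blast
  have ev: "eventually (%x. ALL D:set Ds. fst (mc D) * int (jj x) + snd (mc D) >= 0 &
    (ALL b. card (sols1 (P x) b (D x)) = P x ^ min b (nat (fst (mc D) * int (jj x) + snd (mc D))))) F"
   by (rule eventually_ball_finite) (use mc(2) in auto)
  show ?thesis
  proof (rule that[of "map mc Ds"])
   show "set (map mc Ds) <= V" using mc(1) by auto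
   show "length (map mc Ds) <= card J" using Ds(2) by simp
   show "eventually (%x. ALL (m, c):set (map mc Ds). m * int (jj x) + c >= 0) F"
    using ev by eventually_elim (simp add: case_prod_unfold)
   show "eventually (%x. ALL b. nsol (P x) b I J C (T x) =
    P x ^ (b * (card J - length (map mc Ds)) + msum b (map mc Ds) (jj x))) F" using Ds(5)[OF insertI1] ev
   proof eventually_elim
    case (elim x)
    show ?case
    proof
     fix b
     have "(PROD D<-Ds'. card (sols1 (P x) b (D x))) = P x ^ msum b (map mc Ds') (jj x)"
      if "set Ds' <= set Ds" for Ds'
      using that
     proof (induction Ds')
      case (Cons D Ds')
      thus ?case using elim(2) by (simp add: case_prod_unfold power_add)
     qed simp
     thus "nsol (P x) b I J C (T x) =
      P x ^ (b * (card J - length (map mc Ds)) + msum b (map mc Ds) (jj x))" using elim(1) by (simp add: power_add)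
    qed
   qed
   fix Q assume Q: "Q : Qs"
   have "eventually (%x. ALL D:set Ds. ALL b. card (sols1 (Q x) b (D x)) = 1) F"
    by (rule eventually_ball_finite) (use mc(3) Q in auto)
   with Ds(5)[OF insertI2[OF Q]]
   show "eventually (%x. ALL b. nsol (Q x) b I J C (T x) =
     Q x ^ (b * (card J - length (map mc Ds)))) F"
   proof eventually_elim
    case (elim x)
    have "(PROD D<-Ds'. card (sols1 (Q x) b (D x))) = 1" if "set Ds' <= set Ds" for b Ds'
     using that elim(2) by (induction Ds') auto
    thus ?case using elim(1) by simp
   qed
  qed
 qed
qed

end

section \<open>Elimination at generic points and near a zero of an irreducible polynomial\<close>

lemma eventually_INF_principal:
 assumes "B ~= {}" "!!a b. a : B ==> b : B ==> EX c:B. S c <= S a Int S b"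
 shows "eventually PH (INF b\<in>B. principal (S b)) \<longleftrightarrow> (EX b:B. ALL x:S b. PH x)"
proof -
 have "eventually PH (INF b\<in>B. principal (S b)) \<longleftrightarrow> (EX b:B. eventually PH (principal (S b)))"
  using assms by (intro eventually_INF_base) auto
 thus ?thesis by (simp add: eventually_principal)
qed

text \<open>The filter for statements that hold up to a bound n on the primes and up to the zeros of
  some nonzero polynomial A; the kind of point is left to S.\<close>

definition generic :: "(nat => int poly => 'x set) => 'x filter" where
 "generic S = (INF b\<in>{(n, A). A ~= 0}. principal (S (fst b) (snd b)))"

lemma eventually_generic:
 assumes "!!n m A B. S (max n m) (A * B) <= S n A Int S m B"
 shows "eventually PH (generic S) \<longleftrightarrow> (EX n A. A ~= 0 & (ALL x:S n A. PH x))"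
proof -
 have "eventually PH (generic S) \<longleftrightarrow> (EX b:{(n, A). A ~= 0}. ALL x:S (fst b) (snd b). PH x)"
  unfolding generic_def
 proof (rule eventually_INF_principal)
  fix a b :: "nat * int poly" assume "a : {(n, A). A ~= 0}" "b : {(n, A). A ~= 0}"
  thus "EX c:{(n, A). A ~= 0}. S (fst c) (snd c) <= S (fst a) (snd a) Int S (fst b) (snd b)"
   using assms by (intro bexI[of _ "(max (fst a) (fst b), snd a * snd b)"]) auto
 qed (auto intro: exI[of _ 1])
 thus ?thesis by auto
qed

lemma poly_diff_dvd_diff:
 fixes A :: "'a::comm_ring_1 poly"
 shows "m dvd x - y ==> m dvd poly A x - poly A y"
proof (induction A)
 case (pCons a A)
 have "poly (pCons a A) x - poly (pCons a A) y = (x - y) * poly A x + y * (poly A x - poly A y)"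
  by (simp add: algebra_simps)
 thus ?case using pCons by simp
qed simp

lemma power_dvd_poly_cong:
 fixes p :: int
 assumes "p ^ n dvd t - s" "k <= n"
 shows "p ^ k dvd poly A t \<longleftrightarrow> p ^ k dvd poly A s"
proof -
 have "p ^ k dvd t - s" using assms le_imp_power_dvd dvd_trans by blast
 hence "p ^ k dvd poly A t - poly A s" by (rule poly_diff_dvd_diff)
 thus ?thesis using dvd_add_right_iff[of "p ^ k" "poly A t - poly A s" "poly A s"] by simp
qed

lemma multiplicity_cong:
 assumes "prime p" "int p ^ n dvd t' - t" "poly f t ~= 0" "vp p (poly f t) < n"
 shows "poly f t' ~= 0" "vp p (poly f t') = vp p (poly f t)"
proof -
 have 1: "int p ^ vp p (poly f t) dvd poly f t'"
  using power_dvd_poly_cong[OF assms(2), of "vp p (poly f t)" f] assms(4) by (simp add: multiplicity_dvd)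
 have 2: "~ int p ^ Suc (vp p (poly f t)) dvd poly f t'"
  using power_dvd_poly_cong[OF assms(2), of "Suc (vp p (poly f t))" f] assms(3,4) not_dvd_1[OF assms(1)]
  by (simp add: power_dvd_iff_le_multiplicity del: power_Suc)
 show "vp p (poly f t') = vp p (poly f t)" using 1 2 by (rule multiplicity_eqI)
 show "poly f t' ~= 0" using 2 by auto
qed

lemma sols_cong:
 fixes C :: "'i => 'j => int poly"
 assumes "prime p" "int p ^ b dvd t' - t"
 shows "sols p b I J (%i j. of_int (poly (C i j) t)) = sols p b I J (%i j. of_int (poly (C i j) t'))"
proof -
 have "pdvd p (of_nat p ^ b) (SUM j:J. of_int (poly (C i j) t) * of_int (x j)) \<longleftrightarrow>
    pdvd p (of_nat p ^ b) (SUM j:J. of_int (poly (C i j) t') * of_int (x j))" for i x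
 proof -
  have "int p ^ b dvd (SUM j:J. (poly (C i j) t' - poly (C i j) t) * x j)"
   using assms(2) by (intro dvd_sum dvd_mult2 poly_diff_dvd_diff)
  hence "pdvd p (of_nat p ^ b) (of_int (SUM j:J. (poly (C i j) t' - poly (C i j) t) * x j))"
   by (simp only: pdvd_of_int[OF assms(1)])
  note d = this
  have eq: "(SUM j:J. of_int (poly (C i j) t') * rat_of_int (x j)) =
   (SUM j:J. of_int (poly (C i j) t) * of_int (x j)) +
    of_int (SUM j:J. (poly (C i j) t' - poly (C i j) t) * x j)" by (simp add: algebra_simps sum.distrib sum_subtractf)
  show ?thesis unfolding eq pdvd_add_iff[OF assms(1) d] ..
 qed
 thus ?thesis by (simp add: sols_def)
qed

lemma poly_nonroot_in_class:
 fixes B :: "int poly"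
 assumes "B ~= 0" "m > 0"
 obtains t' where "m dvd t' - t" "poly B t' ~= 0"
proof -
 have "inj (%k::int. t + k * m)" using assms(2) by (auto simp: inj_on_def)
 hence "infinite (range (%k::int. t + k * m))" using finite_imageD infinite_UNIV_int by blast
 moreover have "finite {x. poly B x = 0}" using assms(1) by (rule poly_roots_finite)
 ultimately have "EX k. poly B (t + k * m) ~= 0"
  using finite_subset[of "range (%k. t + k * m)" "{x. poly B x = 0}"] by blast
 thus ?thesis using that[of "t + _ * m"] by auto
qed

text \<open>At points where p does not divide A(t), every polynomial not identically zero becomes a
  unit along the filter. So all valuations are 0 and only the number rh of pivots remains.\<close>

theorem generic_elimination:
 fixes C :: "'i => 'j => int poly"
 assumes "finite I" "finite J"
 obtains rh n A where "rh <= card J" "A ~= 0"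
  "!!p t b. prime p ==> p > n ==> ~ int p dvd poly A t ==>
    nsol p b I J C t = p ^ (b * (card J - rh))"
proof -
 define S where "S n A = {(p::nat, t::int). prime p & p > n & ~ int p dvd poly A t}" for n A
 define F where "F = generic S"
 have ev: "eventually PH F \<longleftrightarrow> (EX n A. A ~= 0 & (ALL x:S n A. PH x))" for PH
  unfolding F_def by (rule eventually_generic) (auto simp: S_def)
 interpret poly_germs F fst snd "%_. 0" "{}" "{(0, 0)}"
 proof
  show "eventually (%x. prime (fst x)) F" unfolding ev by (intro exI[of _ 0] exI[of _ 1]) (auto simp: S_def)
  show "addsub {(0::int, 0::int)}" by (auto simp: addsub_def zero_prod_def)
  fix A :: "int poly" assume A: "A ~= 0"
  have "eventually (%x. poly A (snd x) ~= 0 & int (vp (fst x) (poly A (snd x))) = 0) F"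
   unfolding ev using A by (intro exI[of _ 0] exI[of _ A]) (auto simp: S_def not_dvd_imp_multiplicity_0)
  thus "EX (m, c):{(0, 0)}. eventually (%x. poly A (snd x) ~= 0
    & int (vp (fst x) (poly A (snd x))) = m * int 0 + c) F" by simp
 qed auto
 obtain L where L: "set L <= {(0, 0)}" "length L <= card J"
  "eventually (%x. ALL (m, c):set L. m * int 0 + c >= 0) F"
  "eventually (%x. ALL b. nsol (fst x) b I J C (snd x) =
    fst x ^ (b * (card J - length L) + msum b L 0)) F"
  "!!Q. Q : {} ==> eventually (%x. ALL b. nsol (Q x) b I J C (snd x) =
    Q x ^ (b * (card J - length L))) F" by (rule poly_elimination[OF assms, of C]) blast
 have s0: "msum b L' 0 = 0" if "set L' <= {(0, 0)}" for b L' using that by (induction L') auto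
 obtain n A where nA: "A ~= 0" "ALL x:S n A. ALL b. nsol (fst x) b I J C (snd x) = fst x ^ (b * (card J - length L) + msum b L 0)"
  using L(4) unfolding ev by blast
 show ?thesis
 proof (rule that[of "length L" A n])
  fix p t b assume "prime p" "p > n" "~ int p dvd poly A t"
  hence "(p, t) : S n A" by (simp add: S_def)
  from nA(2)[rule_format, OF this, of b] show "nsol p b I J C t = p ^ (b * (card J - length L))"
   unfolding s0[OF L(1)] by simp
 qed (use L nA in auto)
qed

lemma clear_denominators:
 obtains N :: int and U :: "int poly" where "N > 0" "smult (of_int N) u = rp U"
proof -
 have "EX N>0. EX U. smult (of_int N) u = rp U"
 proof (induction u)
  case 0
  show ?case by (intro exI[of _ 1] conjI exI[of _ 0]) auto
 next
  case (pCons a u)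
  then obtain N U where N: "N > 0" "smult (of_int N) u = rp U" by blast
  obtain x y where xy: "a = of_int x / of_int y" "y > 0"
   by (cases a rule: Rat_cases) (auto simp: Fract_of_int_quotient)
  have "smult (of_int (N * y)) (pCons a u) = rp (pCons (N * x) (smult y U))"
  proof (rule poly_eqI)
   fix k
   have "of_int N * coeff u j = of_int (coeff U j)" for j
    using arg_cong[OF N(2), of "%q. coeff q j"] by (simp add: coeff_map_poly)
   thus "coeff (smult (of_int (N * y)) (pCons a u)) k = coeff (rp (pCons (N * x) (smult y U))) k"
    using xy by (cases k) (auto simp: coeff_map_poly ac_simps)
  qed
  thus ?case using N xy by (intro exI[of _ "N * y"]) auto
 qed
 thus ?thesis using that by blast
qed

lemma map_poly_of_int_eq_iff: "rp A = rp B \<longleftrightarrow> A = B" by (auto simp: poly_eq_iff coeff_map_poly)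

lemma map_poly_of_int_mult: "rp (A * B) = rp A * rp B" by (rule poly_eqI) (simp add: coeff_map_poly coeff_mult)

lemma map_poly_of_int_add: "rp (A + B) = rp A + rp B" by (rule poly_eqI) (simp add: coeff_map_poly)

lemma bezout_int_poly:
 fixes f A :: "int poly"
 assumes "coprime (rp f) (rp A)"
 obtains N :: int and U V where "N > 0" "U * f + V * A = [:N:]"
proof -
 let ?f = "rp f" and ?A = "rp A"
 obtain u v where uv: "u * ?f + v * ?A = 1"
  using bezout_coefficients_fst_snd[of ?f ?A] assms by (simp add: coprime_iff_gcd_eq_1)
 obtain N U where NU: "N > 0" "smult (of_int N) u = rp U" by (rule clear_denominators)
 obtain M V where MV: "M > 0" "smult (of_int M) v = rp V" by (rule clear_denominators)
 have "rp (smult M U * f + smult N V * A) = rp [:M * N:]"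
 proof -
  have sm: "rp (smult k W) = smult (of_int k) (rp W)" for k W by (rule poly_eqI) (simp add: coeff_map_poly)
  have "rp (smult M U * f + smult N V * A)
   = smult (of_int (M * N)) (u * ?f + v * ?A)"
   unfolding map_poly_of_int_add map_poly_of_int_mult sm NU(2)[symmetric] MV(2)[symmetric]
   by (simp add: smult_add_right mult.commute)
  also have "... = rp [:M * N:]" unfolding uv by (simp add: map_poly_pCons)
  finally show ?thesis .
 qed
 hence "smult M U * f + smult N V * A = [:M * N:]" by (simp only: map_poly_of_int_eq_iff)
 thus ?thesis using that[of "M * N" "smult M U" "smult N V"] NU MV by simp
qed

text \<open>Clearing denominators in a Bezout identity gives U f + V A = N with a positive integer
  N, and a common zero modulo p would force p to divide N.\<close>

lemma no_common_zero_mod: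
 fixes f A :: "int poly"
 assumes "coprime (rp f) (rp A)"
 obtains n :: nat where "!!p t. p > n ==> int p dvd poly f t ==> ~ int p dvd poly A t"
proof -
 obtain N U V where N: "N > 0" "U * f + V * A = [:N:]" using bezout_int_poly[OF assms] by blast
 show ?thesis
 proof (rule that[of "nat N"])
  fix p t assume p: "p > nat N" "int p dvd poly f t"
  have eq: "poly U t * poly f t + poly V t * poly A t = N" using arg_cong[OF N(2), of "%q. poly q t"] by simp
  show "~ int p dvd poly A t"
  proof
   assume "int p dvd poly A t"
   hence "int p dvd N" using p(2) by (subst eq[symmetric]) simp
   hence "int p <= N" using N(1) zdvd_imp_le by blast
   thus False using p(1) N(1) by linarith
  qed
 qed
qed

lemma irreducible_coprime:
 fixes F A :: "rat poly"
 assumes "irreducible F" "~ F dvd A"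
 shows "coprime F A" using assms by (simp add: prime_elem_imp_coprime irreducible_imp_prime_elem)

lemma pseudo_div_int:
 fixes f A :: "int poly"
 assumes "f ~= 0"
 obtains c Q R where "c ~= 0" "smult c A = f * Q + R" "R = 0 | degree R < degree f"
proof -
 obtain Q R where QR: "pseudo_divmod A f = (Q, R)" by (cases "pseudo_divmod A f")
 from pseudo_divmod[OF assms QR] show ?thesis
  using that[of "coeff f (degree f) ^ (Suc (degree A) - degree f)" Q R] assms by auto
qed

lemma factor_degree:
 fixes A :: "int poly"
 assumes "smult c A = f * Q" "c ~= 0" "A ~= 0" "degree f > 0" shows "Q ~= 0" "degree Q < degree A"
proof -
 show Q: "Q ~= 0" using assms by auto
 moreover have "f ~= 0" using assms(4) by auto
 ultimately have "degree A = degree f + degree Q"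
  using arg_cong[OF assms(1), of degree] assms(2) by (simp add: degree_mult_eq)
 thus "degree Q < degree A" using assms(4) by simp
qed

lemma factor_multiplicity:
 assumes "smult c A = f * Q" "c ~= 0" "prime p" "poly f t ~= 0" "poly Q t ~= 0"
 shows "poly A t ~= 0 & vp p c + vp p (poly A t) = vp p (poly f t) + vp p (poly Q t)"
proof -
 have pt: "c * poly A t = poly f t * poly Q t" using arg_cong[OF assms(1), of "%q. poly q t"] by simp
 hence A0: "poly A t ~= 0" using assms by auto
 have m: "vp p (x * y) = vp p x + vp p y" if "x ~= 0" "y ~= 0" for x y
  using assms(3) that by (intro prime_elem_multiplicity_mult_distrib) auto
 show ?thesis using pt A0 m[OF assms(2) A0] m[OF assms(4,5)] by simp
qed

text \<open>Along pairs (p,t) with p dividing f(t), the valuation of A(t) is the multiplicity of f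
  in A times that of f(t), so every elementary divisor is p^(m v(f(t))) with m independent of p and
  t. The last conclusion says that the number of elementary divisors is the same at a prime q where
  t is generic.\<close>

theorem root_elimination:
 fixes C :: "'i => 'j => int poly" and f :: "int poly"
 assumes "finite I" "finite J" "irreducible (rp f)"
 obtains ms :: "nat list" and n A where "length ms <= card J" "A ~= 0"
  "!!p t b. prime p ==> p > n ==> int p dvd poly f t ==> poly f t ~= 0 ==>
    nsol p b I J C t =
    p ^ (b * (card J - length ms) + (SUM m<-ms. min b (m * vp p (poly f t))))"
  "!!p q t b. prime p ==> p > n ==> int p dvd poly f t ==> poly f t ~= 0 ==>
    prime q ==> ~ int q dvd poly A t ==>
    nsol q b I J C t = q ^ (b * (card J - length ms))"
proof -
 let ?f = "rp f"
 have f0: "f ~= 0" using assms(3) by auto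
 have degf: "degree f > 0"
 proof (rule ccontr)
  assume "~ degree f > 0"
  then obtain c where "f = [:c:]" using degree_eq_zeroE by blast
  hence "?f = [:of_int c:]" by (simp add: map_poly_pCons)
  moreover have "c ~= 0" using f0 `f = [:c:]` by auto
  ultimately have "is_unit ?f" by (simp add: is_unit_const_poly_iff dvd_field_iff)
  thus False using assms(3) by (simp add: irreducible_def)
 qed
 \<comment> \<open>The points carry, besides p and t, an unrelated prime q at which A(t) is a
   unit.\<close>
 define S where "S n A = {(p::nat, q::nat, t::int). prime p & p > n & int p dvd poly f t & poly f t ~= 0
   & prime q & ~ int q dvd poly A t}" for n A
 define F where "F = generic S"
 have ev: "eventually PH F \<longleftrightarrow> (EX n A. A ~= 0 & (ALL x:S n A. PH x))" for PH
  unfolding F_def by (rule eventually_generic) (auto simp: S_def)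
 have evn: "eventually PH F" if "!!p q t. prime p ==> p > n ==> int p dvd poly f t ==> poly f t ~= 0 ==> prime q ==> PH (p, q, t)" for PH n
  unfolding ev using that by (intro exI[of _ n] exI[of _ 1]) (auto simp: S_def)
 let ?P = "%(p::nat, q::nat, t::int). p" and ?Q = "%(p::nat, q::nat, t::int). q"
  and ?T = "%(p::nat, q::nat, t::int). t"
 let ?j = "%(p, q, t). vp p (poly f t)"
 let ?V = "{(m::int, c::int). c = 0}"
 \<comment> \<open>m is the multiplicity of f in A. If f does not divide A over the rationals, A(t)
   is prime to p for all large p dividing f(t); otherwise a factor f is split off by
   pseudo-division, whose constant c is prime to large p.\<close>
 have val: "EX m::nat. eventually (%x. poly A (?T x) ~= 0
    & int (vp (?P x) (poly A (?T x))) = int m * int (?j x)) F"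
  if "A ~= 0" for A
  using that
 proof (induction "degree A" arbitrary: A rule: less_induct)
  case less
  obtain c Q R where R: "c ~= 0" "smult c A = f * Q + R" "R = 0 | degree R < degree f" by (rule pseudo_div_int[OF f0])
  show ?case
  proof (cases "?f dvd rp A")
   case False
   hence "coprime ?f (rp A)" using assms(3) irreducible_coprime by blast
   then obtain n where n: "!!p t. p > n ==> int p dvd poly f t ==> ~ int p dvd poly A t"
    using no_common_zero_mod by blast
   have "eventually (%x. poly A (?T x) ~= 0
    & int (vp (?P x) (poly A (?T x))) = int 0 * int (?j x)) F"
   proof (rule evn[of n])
    fix p q :: nat and t :: int assume "p > n" "int p dvd poly f t"
    hence nd: "~ int p dvd poly A t" by (rule n)
    hence "poly A t ~= 0" by auto
    with nd show "poly A (?T (p, q, t)) ~= 0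
     & int (multiplicity (int (?P (p, q, t))) (poly A (?T (p, q, t)))) = int 0 * int (?j (p, q, t))"
     by (simp add: not_dvd_imp_multiplicity_0)
   qed
   thus ?thesis by blast
  next
   case True
   have sm: "rp (smult c A) = smult (of_int c) (rp A)" by (rule poly_eqI) (simp add: coeff_map_poly)
   have "?f dvd smult (of_int c) (rp A)" using True by (rule dvd_smult)
   hence "?f dvd ?f * rp Q + rp R" unfolding sm[symmetric] R(2) map_poly_of_int_add map_poly_of_int_mult .
   hence "?f dvd rp R" by (simp add: dvd_add_right_iff)
   hence "R = 0"
    using R(3) by (metis degree_map_poly dvd_imp_degree_le not_le map_poly_0 map_poly_of_int_eq_iff of_int_eq_0_iff)
   hence eq: "smult c A = f * Q" using R(2) by simp
   note Q = factor_degree[OF eq R(1) less.prems degf]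
   from less.hyps[OF Q(2,1)] obtain m where m: "eventually (%x. poly Q (?T x) ~= 0
    & int (vp (?P x) (poly Q (?T x))) = int m * int (?j x)) F" by blast
   have "eventually (%x. prime (?P x) & poly f (?T x) ~= 0 & ~ int (?P x) dvd c) F"
   proof (rule evn[of "nat \<bar>c\<bar>"])
    fix p q :: nat and t :: int assume p: "p > nat \<bar>c\<bar>" "prime p" "poly f t ~= 0"
    have "~ int p dvd c" using p(1) R(1) dvd_imp_le_int[of c "int p"] by auto
    thus "prime (?P (p, q, t)) & poly f (?T (p, q, t)) ~= 0 & ~ int (?P (p, q, t)) dvd c" using p by simp
   qed
   with m have "eventually (%x. poly A (?T x) ~= 0
    & int (vp (?P x) (poly A (?T x))) = int (Suc m) * int (?j x)) F"
   proof eventually_elim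
    case (elim x)
    obtain p q t where x: "x = (p, q, t)" by (cases x)
    show ?case using factor_multiplicity[OF eq R(1), of p t] elim unfolding x
     by (simp add: not_dvd_imp_multiplicity_0 algebra_simps flip: of_nat_add)
   qed
   thus ?thesis by blast
  qed
 qed
 interpret poly_germs F ?P ?T ?j "{?Q}" ?V
 proof
  show "eventually (%x. prime (?P x)) F" by (rule evn) auto
  show "eventually (%x. prime (R x)) F" if "R : {?Q}" for R using that by (auto intro: evn)
  show "addsub ?V" by (auto simp: addsub_def zero_prod_def)
 next
  fix a c :: int assume "(a, c) : ?V"
  hence "c = 0" by simp
  thus "eventually (%x. a * int (?j x) + c >= 0) F | eventually (%x. a * int (?j x) + c <= 0) F"
   by (cases "a >= 0") (auto intro!: always_eventually simp: mult_nonpos_nonneg)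
 next
  fix A :: "int poly" assume A: "A ~= 0"
  from val[OF A] obtain m :: nat where "eventually (%x. poly A (?T x) ~= 0
    & int (vp (?P x) (poly A (?T x))) = int m * int (?j x)) F" by blast
  thus "EX (m, c):?V. eventually (%x. poly A (?T x) ~= 0
    & int (vp (?P x) (poly A (?T x))) = m * int (?j x) + c) F" by (intro bexI[of _ "(int m, 0)"]) auto
 next
  fix A :: "int poly" and R assume A: "A ~= 0" "R : {?Q}"
  thus "eventually (%x. ~ int (R x) dvd poly A (?T x)) F"
   unfolding ev by (intro exI[of _ 0] exI[of _ A]) (auto simp: S_def)
 qed
 obtain L where L: "set L <= ?V" "length L <= card J"
  "eventually (%x. ALL (m, c):set L. m * int (?j x) + c >= 0) F"
  "eventually (%x. ALL b. nsol (?P x) b I J C (?T x) =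
    ?P x ^ (b * (card J - length L) + msum b L (?j x))) F"
  "!!Q. Q : {?Q} ==> eventually (%x. ALL b. nsol (Q x) b I J C (?T x) =
    Q x ^ (b * (card J - length L))) F" by (rule poly_elimination[OF assms(1,2), of C]) blast
 define ms where "ms = map (nat \<circ> fst) L"
 have "eventually (%x. ALL b. nsol (?P x) b I J C (?T x) =
    ?P x ^ (b * (card J - length ms) + (SUM m<-ms. min b (m * ?j x))) &
    nsol (?Q x) b I J C (?T x) = ?Q x ^ (b * (card J - length ms))) F" using L(3,4) L(5)[OF singletonI]
 proof eventually_elim
  case (elim x)
  have "msum b L' (?j x) = (SUM m<-map (nat \<circ> fst) L'. min b (m * ?j x))"
   if "set L' <= set L" for b L'
   using that
  proof (induction L')
   case (Cons mc L')
   obtain m where "mc = (m, 0)" using Cons.prems L(1) by (cases mc) auto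
   moreover have "nat (m * int (?j x)) = nat m * ?j x"
    by (cases "m >= 0") (auto simp: nat_mult_distrib mult_nonpos_nonneg)
   ultimately show ?case using Cons by simp
  qed simp
  thus ?case using elim(2,3) by (simp add: ms_def)
 qed
 then obtain n A where nA: "A ~= 0" "ALL x:S n A. ALL b. nsol (?P x) b I J C (?T x) =
    ?P x ^ (b * (card J - length ms) + (SUM m<-ms. min b (m * ?j x))) &
    nsol (?Q x) b I J C (?T x) = ?Q x ^ (b * (card J - length ms))" unfolding ev by blast
 show ?thesis
 proof (rule that[of ms A n])
  show "length ms <= card J" "A ~= 0" using L(2) nA by (auto simp: ms_def)
 next
  fix p q :: nat and t b
  assume h: "prime p" "p > n" "int p dvd poly f t" "poly f t ~= 0" "prime q" "~ int q dvd poly A t"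
  hence "(p, q, t) : S n A" by (simp add: S_def)
  thus "nsol q b I J C t = q ^ (b * (card J - length ms))" using nA(2) by fastforce
 next
  fix p :: nat and t b
  assume h: "prime p" "p > n" "int p dvd poly f t" "poly f t ~= 0"
  \<comment> \<open>The filter asks for some q not dividing A(t'); any prime larger than the
    absolute value of A(t') will do when that value is nonzero.\<close>
  have "nsol p b I J C t' =
    p ^ (b * (card J - length ms) + (SUM m<-ms. min b (m * vp p (poly f t'))))"
   if t': "int p dvd poly f t'" "poly f t' ~= 0" "poly A t' ~= 0" for t'
  proof -
   obtain q where q: "prime q" "q > nat \<bar>poly A t'\<bar>" using bigger_prime by blast
   hence "~ int q dvd poly A t'" using t'(3) dvd_imp_le_int[of "poly A t'" "int q"] by auto
   hence "(p, q, t') : S n A" using h t' q by (simp add: S_def)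
   thus ?thesis using nA(2) by fastforce
  qed
  note gen = this
  show "nsol p b I J C t =
    p ^ (b * (card J - length ms) + (SUM m<-ms. min b (m * vp p (poly f t))))"
  proof -
   \<comment> \<open>To cover t with A(t) = 0, move t within its class modulo p^k to a nonzero of A.
     This k is large enough to keep both the count modulo p^b and the valuation of f(t).\<close>
   define k where "k = Suc (max b (vp p (poly f t)))"
   have pk: "int p ^ k > 0" using h(1) prime_gt_0_nat by simp
   obtain t' where t': "int p ^ k dvd t' - t" "poly A t' ~= 0" using poly_nonroot_in_class[OF nA(1) pk] by blast
   have dv: "int p ^ i dvd poly f t' \<longleftrightarrow> int p ^ i dvd poly f t" if "i <= k" for i
    using power_dvd_poly_cong[OF t'(1) that] .
   note m = multiplicity_cong[OF h(1) t'(1) h(4)]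
   have "poly f t' ~= 0" "vp p (poly f t') = vp p (poly f t)" by (rule m; simp add: k_def)+
   moreover have "int p dvd poly f t'" using dv[of 1] h(3) by (simp add: k_def)
   ultimately have g: "nsol p b I J C t' =
     p ^ (b * (card J - length ms) + (SUM m<-ms. min b (m * vp p (poly f t))))" using gen[of t'] t'(2) by simp
   have "sols p b I J (%i j. of_int (poly (C i j) t)) = sols p b I J (%i j. of_int (poly (C i j) t'))"
    by (rule sols_cong[OF h(1)], rule power_le_dvd[OF t'(1)]) (simp add: k_def)
   thus ?thesis using g by simp
  qed
 qed
qed

section \<open>Simple zeros and the distribution of v(f(t)) on a residue class\<close>

lemma card_residue_class:
 assumes "m > 0"
 shows "card {t : {0..<int (m * k)}. int m dvd t - z} = k"
proof -
 let ?r = "z mod int m"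
 have r: "0 <= ?r" "?r < int m" using assms by auto
 have "{t : {0..<int (m * k)}. int m dvd t - z} = (%l. ?r + int m * l) ` {0..<int k}"
 proof (intro equalityI subsetI)
  fix t assume t: "t : {t : {0..<int (m * k)}. int m dvd t - z}"
  hence "t mod int m = ?r" by (simp add: mod_eq_dvd_iff)
  hence e: "t = ?r + int m * (t div int m)" by (metis mod_mult_div_eq)
  have "t div int m < int k"
  proof (rule ccontr)
   assume "~ ?thesis"
   hence "int m * int k <= int m * (t div int m)" using assms by (intro mult_left_mono) auto
   also have "... <= t" using e r by linarith
   finally show False using t by simp
  qed
  moreover have "0 <= t div int m" using t assms by (simp add: pos_imp_zdiv_nonneg_iff)
  ultimately show "t : (%l. ?r + int m * l) ` {0..<int k}" using e by auto
 next
  fix t assume "t : (%l. ?r + int m * l) ` {0..<int k}"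
  then obtain l where "t = ?r + int m * l" "l : {0..<int k}" by (rule imageE)
  hence l: "t = ?r + int m * l" "0 <= l" "l < int k" by auto
  have "int m * (l + 1) <= int m * int k" using l assms by (intro mult_left_mono) auto
  hence "t < int (m * k)" using l(1) r by (simp add: algebra_simps)
  moreover have "0 <= t" using l r by simp
  moreover have "int m dvd t - z" using l(1) by (simp add: mod_eq_dvd_iff[symmetric] mod_add_left_eq)
  ultimately show "t : {t : {0..<int (m * k)}. int m dvd t - z}" by auto
 qed
 moreover have "inj_on (%l. ?r + int m * l) {0..<int k}" using assms by (auto simp: inj_on_def)
 ultimately show ?thesis by (simp add: card_image)
qed

lemma poly_taylor2:
 fixes f :: "'a::{comm_ring_1, semiring_no_zero_divisors} poly"
 shows "EX s. poly f x = poly f y + (x - y) * (poly (pderiv f) y + (x - y) * s)"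
proof (induction f)
 case 0
 show ?case by (intro exI[of _ 0]) simp
next
 case (pCons a f)
 then obtain s where s: "poly f x = poly f y + (x - y) * (poly (pderiv f) y + (x - y) * s)" by blast
 show ?case by (rule exI[of _ "poly (pderiv f) y + x * s"]) (simp add: s pderiv_pCons algebra_simps)
qed

text \<open>The hypothesis of Hensel's lemma with a derivative of valuation exactly de: the class of
  z modulo p^N then contains one p-adic zero of f.\<close>

definition simple_zero :: "nat => int poly => int => nat => nat => bool" where
 "simple_zero p f z N de \<longleftrightarrow> de < N & int p ^ (N + de) dvd poly f z
   & int p ^ de dvd poly (pderiv f) z & ~ int p ^ Suc de dvd poly (pderiv f) z"

text \<open>By Taylor's formula f(t) - f(t') is t - t' times a factor congruent to the derivative at
  z modulo p^N. As de < N, that factor has valuation exactly de.\<close>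

lemma simple_zero_isometry:
 assumes "prime p" "simple_zero p f z N de" "int p ^ N dvd t - z" "int p ^ N dvd t' - z"
 shows "int p ^ (N + de + i) dvd poly f t - poly f t' \<longleftrightarrow> int p ^ (N + i) dvd t - t'"
proof -
 have sz: "de < N" "int p ^ de dvd poly (pderiv f) z" "~ int p ^ Suc de dvd poly (pderiv f) z"
  using assms(2) by (auto simp: simple_zero_def)
 have tt: "int p ^ N dvd t - t'" using dvd_diff[OF assms(3,4)] by simp
 obtain s where s: "poly f t = poly f t' + (t - t') * (poly (pderiv f) t' + (t - t') * s)" using poly_taylor2 by blast
 let ?h = "poly (pderiv f) t' + (t - t') * s"
 have pw: "int p ^ k dvd ?h \<longleftrightarrow> int p ^ k dvd poly (pderiv f) z" if "k <= N" for k
 proof -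
  have "int p ^ k dvd (t - t') * s" using tt that power_le_dvd by (metis dvd_mult2)
  hence "int p ^ k dvd ?h \<longleftrightarrow> int p ^ k dvd poly (pderiv f) t'" by (simp add: dvd_add_left_iff)
  also have "... \<longleftrightarrow> int p ^ k dvd poly (pderiv f) z" using power_dvd_poly_cong[OF assms(4) that] .
  finally show ?thesis .
 qed
 have "int p ^ de dvd ?h" using pw[of de] sz by simp
 then obtain u where u: "?h = int p ^ de * u" by (auto simp: dvd_def)
 have "~ int p dvd u"
 proof
  assume "int p dvd u"
  hence "int p ^ Suc de dvd ?h" unfolding u by simp
  thus False using pw[of "Suc de"] sz by simp
 qed
 hence cop: "coprime (int p ^ (N + i)) u" using assms(1) by (simp add: prime_imp_coprime)
 have p0: "int p ^ de ~= 0" using assms(1) by (simp add: prime_gt_0_nat)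
 have "poly f t - poly f t' = int p ^ de * ((t - t') * u)" using s unfolding u by (simp add: algebra_simps)
 hence "int p ^ (N + de + i) dvd poly f t - poly f t' \<longleftrightarrow> int p ^ de * int p ^ (N + i) dvd int p ^ de * ((t - t') * u)"
  by (simp add: power_add ac_simps)
 also have "... \<longleftrightarrow> int p ^ (N + i) dvd (t - t') * u" using p0 dvd_mult_cancel_left by auto
 also have "... \<longleftrightarrow> int p ^ (N + i) dvd t - t'" using cop coprime_dvd_mult_left_iff by blast
 finally show ?thesis .
qed

lemma simple_zero_dvd_class:
 assumes "prime p" "simple_zero p f z N de" "int p ^ N dvd t - z"
 shows "int p ^ (N + de) dvd poly f t"
proof -
 have "int p ^ (N + de + 0) dvd poly f t - poly f z"
  using simple_zero_isometry[OF assms(1,2,3), of z 0] assms(3) by simp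
 moreover have "int p ^ (N + de) dvd poly f z" using assms(2) by (simp add: simple_zero_def)
 ultimately have "int p ^ (N + de) dvd (poly f t - poly f z) + poly f z" by (intro dvd_add) simp_all
 thus ?thesis by simp
qed

text \<open>By the isometry, f(t) / p^(N+de) modulo p^i takes each value on exactly one class modulo
  p^(N+i); the class with value 0 is counted.\<close>

lemma simple_zero_count:
 assumes p: "prime p" and sz: "simple_zero p f z N de" and i: "i <= n"
 shows "card {t : {0..<int (p ^ (N + n))}. int p ^ N dvd t - z & int p ^ (N + de + i) dvd poly f t} = p ^ (n - i)"
proof -
 have p0: "p > 0" using p by (rule prime_gt_0_nat)
 let ?R = "{t : {0..<int (p ^ N * p ^ i)}. int (p ^ N) dvd t - z}"
 define g where "g t = (poly f t div int p ^ (N + de)) mod int p ^ i" for t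
 have fd: "int p ^ (N + de) dvd poly f t" if "int p ^ N dvd t - z" for t using simple_zero_dvd_class[OF p sz that] .
 have pd: "int p ^ (N + de) ~= 0" using p0 by simp
 have geq: "g t = g t' \<longleftrightarrow> int p ^ (N + i) dvd t - t'"
  if tz: "int p ^ N dvd t - z" "int p ^ N dvd t' - z" for t t'
 proof -
  obtain x x' where x: "poly f t = int p ^ (N + de) * x" "poly f t' = int p ^ (N + de) * x'"
   using fd[OF tz(1)] fd[OF tz(2)] by (auto simp: dvd_def)
  have "g t = g t' \<longleftrightarrow> int p ^ i dvd x - x'"
   unfolding g_def x using pd by (simp add: mod_eq_dvd_iff)
  also have "... \<longleftrightarrow> int p ^ (N + de) * int p ^ i dvd int p ^ (N + de) * (x - x')"
   using pd dvd_mult_cancel_left by auto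
  also have "... \<longleftrightarrow> int p ^ (N + de + i) dvd poly f t - poly f t'"
   unfolding x by (simp add: power_add algebra_simps)
  also have "... \<longleftrightarrow> int p ^ (N + i) dvd t - t'" using simple_zero_isometry[OF p sz tz] .
  finally show ?thesis .
 qed
 have cR: "card ?R = p ^ i" using card_residue_class[of "p ^ N" "p ^ i" z] p0 by simp
 have "inj_on g ?R"
 proof (rule inj_onI)
  fix t t' assume t: "t : ?R" "t' : ?R" "g t = g t'"
  hence d: "int p ^ (N + i) dvd t - t'" using geq[of t t'] by simp
  have "\<bar>t - t'\<bar> < int p ^ (N + i)" using t by (auto simp: power_add)
  thus "t = t'" using d dvd_imp_le_int[of "t - t'" "int p ^ (N + i)"] by fastforce
 qed
 moreover have "g ` ?R <= {0..<int p ^ i}" using p0 by (auto simp: g_def)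
 ultimately have "g ` ?R = {0..<int p ^ i}" using cR p0 by (intro card_subset_eq) (auto simp: card_image nat_power_eq)
 then obtain t0 where t0: "t0 : ?R" "g t0 = 0" using p0 by (metis (no_types, lifting) atLeastLessThan_iff imageE order_refl of_nat_0_less_iff zero_less_power)
 have t0z: "int p ^ N dvd t0 - z" using t0 by simp
 have ft0: "int p ^ (N + de + i) dvd poly f t0"
 proof -
  obtain x where x: "poly f t0 = int p ^ (N + de) * x" using fd[OF t0z] by (auto simp: dvd_def)
  have "int p ^ i dvd x" using t0(2) pd unfolding g_def x by auto
  thus ?thesis unfolding x by (simp add: power_add mult_dvd_mono)
 qed
 have "{t : {0..<int (p ^ (N + n))}. int p ^ N dvd t - z & int p ^ (N + de + i) dvd poly f t}
   = {t : {0..<int (p ^ (N + i) * p ^ (n - i))}. int (p ^ (N + i)) dvd t - t0}"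
 proof -
  have "int p ^ N dvd t - z & int p ^ (N + de + i) dvd poly f t \<longleftrightarrow> int p ^ (N + i) dvd t - t0" for t
  proof
   assume t: "int p ^ N dvd t - z & int p ^ (N + de + i) dvd poly f t"
   thus "int p ^ (N + i) dvd t - t0" using simple_zero_isometry[OF p sz _ t0z, of t i] ft0 by (simp add: dvd_diff)
  next
   assume t: "int p ^ (N + i) dvd t - t0"
   have "int p ^ N dvd t - t0" using t by (rule power_le_dvd) simp
   hence tz: "int p ^ N dvd t - z" using dvd_add[OF _ t0z] by fastforce
   hence "int p ^ (N + de + i) dvd poly f t - poly f t0" using simple_zero_isometry[OF p sz tz t0z, of i] t by simp
   hence "int p ^ (N + de + i) dvd (poly f t - poly f t0) + poly f t0" using ft0 by (rule dvd_add)
   thus "int p ^ N dvd t - z & int p ^ (N + de + i) dvd poly f t" using tz by simp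
  qed
  moreover have "p ^ (N + n) = p ^ (N + i) * p ^ (n - i)" using i by (simp flip: power_add)
  ultimately show ?thesis by simp
 qed
 thus ?thesis using card_residue_class[of "p ^ (N + i)" "p ^ (n - i)" t0] p0 by simp
qed

text \<open>A point whose value is divisible by a high power of p may be an exact zero or lie too
  deep. Either t or t + p^(N+n) has valuation exactly N + de + n, because the two values differ by
  exactly that power.\<close>

lemma simple_zero_representative:
 assumes p: "prime p" and sz: "simple_zero p f z N de"
  and t: "int p ^ N dvd t - z" "int p ^ (N + de + n) dvd poly f t"
 obtains t' where "int p ^ (N + n) dvd t' - t" "poly f t' ~= 0"
  "vp p (poly f t') = N + de + n"
proof -
 have p0: "p > 0" using p by (rule prime_gt_0_nat)
 let ?t = "t + int p ^ (N + n)"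
 have "int p ^ N dvd (t - z) + int p ^ (N + n)" using t(1) by (intro dvd_add) (simp_all add: power_add)
 hence tz: "int p ^ N dvd ?t - z" by (simp add: algebra_simps)
 have unit: "~ is_unit (int p)" using not_dvd_1[OF p] .
 have "~ int p ^ (N + Suc n) dvd ?t - t"
 proof
  assume "int p ^ (N + Suc n) dvd ?t - t"
  hence "N + Suc n <= N + n" using unit p0 by (simp add: dvd_power_iff)
  thus False by simp
 qed
 hence nd: "~ int p ^ (N + de + Suc n) dvd poly f ?t - poly f t"
  using simple_zero_isometry[OF p sz tz t(1), of "Suc n"] by simp
 have "int p ^ (N + n) dvd ?t - t" by simp
 hence "int p ^ (N + de + n) dvd poly f ?t - poly f t" using simple_zero_isometry[OF p sz tz t(1), of n] by simp
 hence d: "int p ^ (N + de + n) dvd poly f ?t" using dvd_add[OF _ t(2)] by fastforce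
 show ?thesis
 proof (cases "int p ^ (N + de + Suc n) dvd poly f t")
  case True
  hence "~ int p ^ (N + de + Suc n) dvd poly f ?t" using nd dvd_diff by blast
  moreover from this have "poly f ?t ~= 0" by auto
  ultimately show ?thesis using that[of ?t] d multiplicity_eqI[of "int p" "N + de + n" "poly f ?t"] by simp
 next
  case False
  moreover from this have "poly f t ~= 0" by auto
  ultimately show ?thesis using that[of t] t(2) multiplicity_eqI[of "int p" "N + de + n" "poly f t"] by simp
 qed
qed

text \<open>Abel summation over the level sets of v(f(t)): the number of t of depth at least i is
  p^(n-i), so only the increments of g occur.\<close>

lemma simple_zero_sum:
 fixes g :: "nat => 'a::comm_ring_1" and W :: "int => nat"
 assumes p: "prime p" and sz: "simple_zero p f z N de"
  and Wcong: "!!t t'. int p ^ (N + n) dvd t' - t ==> W t' = W t"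
  and W: "!!t. int p ^ N dvd t - z ==> poly f t ~= 0 ==> W t = om (vp p (poly f t) - (N + de))"
 shows "(\<Sum>t | t : {0..<int (p ^ (N + n))} & int p ^ N dvd t - z. g (W t)) =
   of_nat (p ^ n) * g (om 0) + (\<Sum>i=1..n. of_nat (p ^ (n - i)) * (g (om i) - g (om (i - 1))))"
proof -
 let ?S = "{t : {0..<int (p ^ (N + n))}. int p ^ N dvd t - z}"
 let ?d = "%i t. int p ^ (N + de + i) dvd poly f t"
 have gW: "g (W t) = g (om 0) + (\<Sum>i=1..n. if ?d i t then g (om i) - g (om (i - 1)) else 0)"
  if t: "int p ^ N dvd t - z" for t
 proof -
  have tele: "(\<Sum>i=1..k. g (om i) - g (om (i - 1))) = g (om k) - g (om 0)" for k by (induction k) auto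
  \<comment> \<open>\<open>W\<close> depends on t modulo p^(N+n) only, so depths beyond n are
    indistinguishable from n.\<close>
  have "EX k<=n. W t = om k & (ALL i:{1..n}. ?d i t \<longleftrightarrow> i <= k)"
  proof (cases "?d n t")
   case True
   obtain t' where t': "int p ^ (N + n) dvd t' - t" "poly f t' ~= 0"
    "vp p (poly f t') = N + de + n" using simple_zero_representative[OF p sz t True] by blast
   have "int p ^ N dvd t' - t" using t'(1) by (rule power_le_dvd) simp
   hence "int p ^ N dvd t' - z" using dvd_add[OF _ t] by fastforce
   hence "W t = om n" using W[of t'] t' Wcong[OF t'(1)] by simp
   moreover have "?d i t" if "i <= n" for i using True by (rule power_le_dvd) (use that in simp)
   ultimately show ?thesis by auto
  next
   case False
   hence f0: "poly f t ~= 0" by auto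
   have unit: "~ is_unit (int p)" using not_dvd_1[OF p] .
   have dm: "?d i t \<longleftrightarrow> N + de + i <= vp p (poly f t)" for i
    using f0 unit by (simp add: power_dvd_iff_le_multiplicity)
   have "N + de <= vp p (poly f t)" using dm[of 0] simple_zero_dvd_class[OF p sz t] by simp
   thus ?thesis using False W[OF t f0] unfolding dm by (intro exI[of _ "vp p (poly f t) - (N + de)"]) auto
  qed
  then obtain k where k: "k <= n" "W t = om k" "ALL i:{1..n}. ?d i t \<longleftrightarrow> i <= k" by blast
  have "(\<Sum>i=1..n. if ?d i t then g (om i) - g (om (i - 1)) else 0) =
    (\<Sum>i=1..n. if i <= k then g (om i) - g (om (i - 1)) else 0)" using k(3) by (intro sum.cong) auto
  also have "... = (\<Sum>i=1..k. g (om i) - g (om (i - 1)))" using k(1) by (intro sum.mono_neutral_cong_right) auto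
  finally show ?thesis using tele[of k] k(2) by simp
 qed
 have cS: "card ?S = p ^ n" using card_residue_class[of "p ^ N" "p ^ n" z] prime_gt_0_nat[OF p] by (simp add: power_add)
 have "(SUM t:?S. g (W t)) = (SUM t:?S. g (om 0) + (\<Sum>i=1..n. if ?d i t then g (om i) - g (om (i - 1)) else 0))"
  using gW by (intro sum.cong) auto
 also have "... = of_nat (card ?S) * g (om 0) + (\<Sum>i=1..n. SUM t:?S. if ?d i t then g (om i) - g (om (i - 1)) else 0)"
  by (simp add: sum.distrib) (rule sum.swap)
 also have "(\<Sum>i=1..n. SUM t:?S. if ?d i t then g (om i) - g (om (i - 1)) else 0) =
   (\<Sum>i=1..n. of_nat (p ^ (n - i)) * (g (om i) - g (om (i - 1))))"
 proof (rule sum.cong[OF refl])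
  fix i assume i: "i : {1..n}"
  have "(SUM t:?S. if ?d i t then g (om i) - g (om (i - 1)) else 0) =
   of_nat (card {t:?S. ?d i t}) * (g (om i) - g (om (i - 1)))" by (subst sum.inter_filter[symmetric])
    (auto intro: finite_subset[of _ "{0..<int p ^ (N + n)}"])
  also have "{t:?S. ?d i t} = {t : {0..<int (p ^ (N + n))}. int p ^ N dvd t - z & ?d i t}" by auto
  finally show "(SUM t:?S. if ?d i t then g (om i) - g (om (i - 1)) else 0) =
   of_nat (p ^ (n - i)) * (g (om i) - g (om (i - 1)))" using simple_zero_count[OF p sz, of i n] i by simp
 qed
 finally show ?thesis unfolding cS .
qed

section \<open>Elimination near a p-adic integer\<close>

text \<open>A p-adic integer given by its residues: a n matters modulo p^n.\<close>

definition coherent :: "nat => (nat => int) => bool" where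
 "coherent p a \<longleftrightarrow> (ALL n. int p ^ n dvd a (Suc n) - a n)"

lemma coherent_le:
 assumes "coherent p a" "n <= m" shows "int p ^ n dvd a m - a n" using assms(2)
proof (induction rule: dec_induct)
 case (step m)
 have "int p ^ m dvd a (Suc m) - a m" using assms(1) by (simp add: coherent_def)
 hence "int p ^ n dvd a (Suc m) - a m" by (rule power_le_dvd) (use step in simp)
 hence "int p ^ n dvd (a (Suc m) - a m) + (a m - a n)" using step by (intro dvd_add)
 thus ?case by simp
qed simp

definition vanish :: "nat => (nat => int) => int poly => bool" where
 "vanish p a h \<longleftrightarrow> (ALL n. int p ^ n dvd poly h (a n))"

text \<open>Continuity: where h does not vanish at the p-adic integer, its valuation is constant
  nearby.\<close>

lemma not_vanish_multiplicity:
 assumes "prime p" "coherent p a" "~ vanish p a h"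
 obtains n k where "k < n" "!!t. int p ^ n dvd t - a n ==> poly h t ~= 0 & vp p (poly h t) = k"
proof -
 obtain n where n: "~ int p ^ n dvd poly h (a n)" using assms(3) by (auto simp: vanish_def)
 have unit: "~ is_unit (int p)" using not_dvd_1[OF assms(1)] .
 have h0: "poly h (a n) ~= 0" using n by auto
 let ?k = "vp p (poly h (a n))"
 have k: "?k < n" using n by (rule multiplicity_lessI[rotated 2]) (use h0 unit in auto)
 show ?thesis by (rule that[OF k]) (rule conjI; rule multiplicity_cong[OF assms(1) _ h0 k])
qed

lemma vanish_congr:
 assumes "coherent p a" "vanish p a h" "int p ^ n dvd t - a n"
 shows "int p ^ n dvd poly h t"
 using power_dvd_poly_cong[OF assms(3) order_refl, of h] assms(2) by (simp add: vanish_def)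

text \<open>For one fixed prime, without excluding small ones. If no nonzero polynomial vanishes at
  the p-adic integer, valuations are locally constant. Otherwise every valuation is affine in
  v(f(t)) for a polynomial f of least degree vanishing there. In both cases the elementary divisors
  are controlled on a whole residue class.\<close>

theorem local_elimination:
 fixes C :: "'i => 'j => int poly"
 assumes fin: "finite I" "finite J" and p: "prime p" and a: "coherent p a"
 obtains (const) N and L :: "nat list" where "N >= N1" "length L <= card J"
  "!!t b. int p ^ N dvd t - a N ==> nsol p b I J C t =
    p ^ (b * (card J - length L) + (SUM c<-L. min b c))"
 | (root) f z N de and L :: "(int * int) list" where "N >= N1" "length L <= card J" "simple_zero p f z N de" "int p ^ N dvd z - a N"
  "!!t m c. int p ^ N dvd t - z ==> poly f t ~= 0 ==> (m, c) : set L ==>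
    m * int (vp p (poly f t)) + c >= 0"
  "!!t b. int p ^ N dvd t - z ==> poly f t ~= 0 ==>
    nsol p b I J C t =
    p ^ (b * (card J - length L) + msum b L (vp p (poly f t)))"
proof -
 have unit: "~ is_unit (int p)" using not_dvd_1[OF p] .
 \<comment> \<open>f is a vanishing polynomial of least degree, with f = 1 standing for the case
   that there is none.\<close>
 have "EX f. f ~= 0 & ((ALL h. h ~= 0 --> ~ vanish p a h) & f = 1 |
   vanish p a f & (ALL h. vanish p a h --> h = 0 | degree f <= degree h))"
 proof (cases "EX h. h ~= 0 & vanish p a h")
  case True
  then obtain h0 where "h0 ~= 0 & vanish p a h0" by blast
  from ex_has_least_nat[of "%h. h ~= 0 & vanish p a h", OF this, of degree]
  obtain f where "f ~= 0 & vanish p a f" "ALL h. h ~= 0 & vanish p a h --> degree f <= degree h" by blast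
  thus ?thesis by blast
 qed (auto intro: exI[of _ 1])
 then obtain f where f0: "f ~= 0" and f: "(ALL h. h ~= 0 --> ~ vanish p a h) & f = 1 |
   vanish p a f & (ALL h. vanish p a h --> h = 0 | degree f <= degree h)" by blast
 define F where "F = (INF N\<in>UNIV. principal {t. int p ^ N dvd t - a N & poly f t ~= 0})"
 have ev: "eventually PH F \<longleftrightarrow> (EX N. ALL t. int p ^ N dvd t - a N & poly f t ~= 0 --> PH t)" for PH
  unfolding F_def
 proof (subst eventually_INF_principal)
  fix n m :: nat
  have "int p ^ k dvd t - a k" if "int p ^ (max n m) dvd t - a (max n m)" "k <= max n m" for t k
  proof -
   have "int p ^ k dvd (t - a (max n m)) + (a (max n m) - a k)"
    using power_le_dvd[OF that] coherent_le[OF a that(2)] by (intro dvd_add)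
   thus ?thesis by simp
  qed
  thus "EX N:UNIV. {t. int p ^ N dvd t - a N & poly f t ~= 0} <=
   {t. int p ^ n dvd t - a n & poly f t ~= 0} Int {t. int p ^ m dvd t - a m & poly f t ~= 0}"
   by (intro bexI[of _ "max n m"]) auto
 qed auto
 let ?j = "%t. vp p (poly f t)"
 have nv: "EX k. eventually (%t. poly h t ~= 0 & vp p (poly h t) = k) F"
  if nvh: "~ vanish p a h" for h
 proof -
  obtain n k where "!!t. int p ^ n dvd t - a n ==> poly h t ~= 0 & vp p (poly h t) = k"
   using not_vanish_multiplicity[OF p a nvh] by blast
  thus ?thesis unfolding ev by blast
 qed
 have degf: "degree f > 0" if vf: "vanish p a f"
 proof (rule ccontr)
  assume "~ degree f > 0"
  then obtain k where k: "f = [:k:]" using degree_eq_zeroE by blast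
  hence "int p ^ n dvd k" for n using vf by (simp add: vanish_def)
  hence "int p ^ Suc (vp p k) dvd k" by blast
  moreover have "k ~= 0" using k f0 by auto
  ultimately show False using unit by (simp add: power_dvd_iff_le_multiplicity del: power_Suc)
 qed
 have val: "EX (m::int) c. eventually (%t. poly A t ~= 0 & int (vp p (poly A t)) = m * int (?j t) + c) F"
  if "A ~= 0" for A
  using that
 proof (induction "degree A" arbitrary: A rule: less_induct)
  case less
  show ?case
  proof (cases "vanish p a A")
   case False
   then obtain k where "eventually (%t. poly A t ~= 0 & vp p (poly A t) = k) F" using nv by blast
   hence "eventually (%t. poly A t ~= 0 & int (vp p (poly A t)) = 0 * int (?j t) + int k) F" by eventually_elim simp
   thus ?thesis by blast
  next
   case True
   hence vf: "vanish p a f" and fmin: "!!h. vanish p a h ==> h = 0 | degree f <= degree h" using f less.prems by auto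
   obtain c Q R where R: "c ~= 0" "smult c A = f * Q + R" "R = 0 | degree R < degree f"
    by (rule pseudo_div_int[OF f0])
   have "vanish p a R" unfolding vanish_def
   proof
    fix n
    have "poly R (a n) = c * poly A (a n) - poly f (a n) * poly Q (a n)"
     using arg_cong[OF R(2), of "%q. poly q (a n)"] by simp
    thus "int p ^ n dvd poly R (a n)" using True vf by (auto simp: vanish_def)
   qed
   hence "R = 0" using fmin R(3) by fastforce
   hence eq: "smult c A = f * Q" using R(2) by simp
   note Q = factor_degree[OF eq R(1) less.prems degf[OF vf]]
   from less.hyps[OF Q(2,1)] obtain m d where m: "eventually (%t. poly Q t ~= 0 &
     int (vp p (poly Q t)) = m * int (?j t) + d) F" by blast
   have "eventually (%t. poly f t ~= 0) F" unfolding ev by auto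
   with m have "eventually (%t. poly A t ~= 0 & int (vp p (poly A t)) =
     (m + 1) * int (?j t) + (d - int (vp p c))) F"
   proof eventually_elim
    case (elim t)
    thus ?case using factor_multiplicity[OF eq R(1) p, of t] by (simp add: algebra_simps)
   qed
   thus ?thesis by blast
  qed
 qed
 \<comment> \<open>The parameter v(f(t)) is constantly 0 or tends to infinity. Either way the sign
   of an affine function of it is eventually constant.\<close>
 have jlim: "f = 1 | (ALL K. eventually (%t. ?j t >= K) F)"
 proof (cases "f = 1")
  case False
  hence vf: "vanish p a f" using f by blast
  have "eventually (%t. ?j t >= K) F" for K
   unfolding ev using vanish_congr[OF a vf, of K] unit by (intro exI[of _ K]) (auto intro: multiplicity_geI)
  thus ?thesis by blast
 qed simp
 interpret poly_germs F "%_. p" "%t. t" ?j "{}" UNIV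
 proof
  fix b c :: int
  show "eventually (%t. b * int (?j t) + c >= 0) F | eventually (%t. b * int (?j t) + c <= 0) F"
  proof (cases "f = 1 | b = 0")
   case True
   hence "(ALL t. b * int (?j t) + c >= 0) | (ALL t. b * int (?j t) + c <= 0)" by fastforce
   thus ?thesis by (auto intro: always_eventually)
  next
   case False
   hence e: "eventually (%t. int (?j t) >= \<bar>c\<bar>) F"
    using jlim[THEN disjE, of "eventually (%t. ?j t >= nat \<bar>c\<bar>) F"] by (auto elim!: eventually_mono)
   have "1 <= b | b <= -1" using False by linarith
   thus ?thesis
   proof
    assume b: "1 <= b"
    have "1 * int (?j t) <= b * int (?j t)" for t using b by (intro mult_right_mono) auto
    hence "eventually (%t. b * int (?j t) + c >= 0) F" using e by (auto elim!: eventually_mono) smt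
    thus ?thesis by blast
   next
    assume b: "b <= -1"
    have "b * int (?j t) <= (-1) * int (?j t)" for t using b by (intro mult_right_mono) auto
    hence "eventually (%t. b * int (?j t) + c <= 0) F" using e by (auto elim!: eventually_mono) smt
    thus ?thesis by blast
   qed
  qed
 next
  fix A :: "int poly" assume "A ~= 0"
  from val[OF this] show "EX (m, c):UNIV. eventually (%t. poly A t ~= 0 &
   int (vp p (poly A t)) = m * int (?j t) + c) F" by auto
 qed (use p in auto)
 obtain L where L: "set L <= UNIV" "length L <= card J"
  "eventually (%x. ALL (m, c):set L. m * int (?j x) + c >= 0) F"
  "eventually (%x. ALL b. nsol p b I J C x =
    p ^ (b * (card J - length L) + msum b L (?j x))) F"
  "!!Q. Q : {} ==> eventually (%x. ALL b. nsol (Q x) b I J C x =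
    Q x ^ (b * (card J - length L))) F" by (rule poly_elimination[OF fin, of C]) blast
 obtain N0 where N0c: "ALL t. int p ^ N0 dvd t - a N0 & poly f t ~= 0 -->
   (ALL b. nsol p b I J C t =
    p ^ (b * (card J - length L) + msum b L (?j t))) &
   (ALL (m, c):set L. m * int (?j t) + c >= 0)" using eventually_conj[OF L(4) L(3)] unfolding ev by (elim exE)
 have N0: "!!t b. int p ^ N0 dvd t - a N0 ==> poly f t ~= 0 ==>
   nsol p b I J C t =
    p ^ (b * (card J - length L) + msum b L (?j t))"
  and N0': "!!t m c. int p ^ N0 dvd t - a N0 ==> poly f t ~= 0 ==> (m, c) : set L ==> m * int (?j t) + c >= 0"
  using N0c by (auto split: prod.splits)
 have down: "int p ^ N0 dvd t - a N0" if "int p ^ N dvd t - a N" "N0 <= N" for t N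
 proof -
  have "int p ^ N0 dvd (t - a N) + (a N - a N0)"
   using power_le_dvd[OF that] coherent_le[OF a that(2)] by (rule dvd_add)
  thus ?thesis by simp
 qed
 show thesis
 proof (cases "f = 1")
  case True
  show thesis
  proof (rule const[of "max N0 N1" "map (%(m, c). nat c) L"])
   fix t b assume "int p ^ max N0 N1 dvd t - a (max N0 N1)"
   hence t: "int p ^ N0 dvd t - a N0" by (rule down) simp
   have "msum b L 0 = (SUM c<-map (%(m, c). nat c) L. min b c)" by (simp add: case_prod_unfold comp_def)
   thus "nsol p b I J C t =
    p ^ (b * (card J - length (map (%(m, c). nat c) L)) + (SUM c<-map (%(m, c). nat c) L. min b c))"
    using N0[OF t, of b] True by simp
  qed (use L(2) in simp_all)
 next
  case False
  hence vf: "vanish p a f" and fmin: "!!h. vanish p a h ==> h = 0 | degree f <= degree h" using f by auto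
  have "degree f > 0" by (rule degf[OF vf])
  hence "pderiv f ~= 0" "degree (pderiv f) < degree f" by (auto simp: pderiv_eq_0_iff degree_pderiv)
  \<comment> \<open>By minimality of the degree the zero is simple, so Hensel's argument applies
    although p may be small; de need not be 0.\<close>
  hence "~ vanish p a (pderiv f)" using fmin by fastforce
  then obtain n de where de: "de < n" "!!t. int p ^ n dvd t - a n ==> poly (pderiv f) t ~= 0 & vp p (poly (pderiv f) t) = de"
   by (rule not_vanish_multiplicity[OF p a]) blast
  define N where "N = max (max N0 n) N1"
  \<comment> \<open>Going de steps beyond N makes p^(N+de) divide f(z), as
    \<open>simple_zero\<close> demands.\<close>
  define z where "z = a (N + de)"
  have zN: "int p ^ k dvd z - a k" if "k <= N" for k unfolding z_def using that by (intro coherent_le[OF a]) simp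
  have cl: "int p ^ k dvd t - a k" if "int p ^ N dvd t - z" "k <= N" for t k
  proof -
   have "int p ^ k dvd (t - z) + (z - a k)" using power_le_dvd[OF that] zN[OF that(2)] by (rule dvd_add)
   thus ?thesis by simp
  qed
  show thesis
  proof (rule root[of N L f z de])
   show "N >= N1" by (simp add: N_def)
   have d: "poly (pderiv f) z ~= 0 & vp p (poly (pderiv f) z) = de" using de(2) zN[of n] by (simp add: N_def)
   have "int p ^ de dvd poly (pderiv f) z" using d multiplicity_dvd by metis
   moreover have "~ int p ^ Suc de dvd poly (pderiv f) z"
    using d unit by (simp add: power_dvd_iff_le_multiplicity del: power_Suc)
   moreover have "int p ^ (N + de) dvd poly f z" using vf by (simp add: vanish_def z_def)
   moreover have "de < N" using de(1) by (simp add: N_def)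
   ultimately show "simple_zero p f z N de" by (simp add: simple_zero_def)
   show "int p ^ N dvd z - a N" using zN by simp
   show "length L <= card J" by (rule L(2))
   show "m * int (vp p (poly f t)) + c >= 0"
    if "int p ^ N dvd t - z" "poly f t ~= 0" "(m, c) : set L" for t m c
    using N0'[of t m c] cl[of t N0] that by (simp add: N_def)
   fix t b assume "int p ^ N dvd t - z" "poly f t ~= 0"
   thus "nsol p b I J C t =
    p ^ (b * (card J - length L) + msum b L (vp p (poly f t)))" using N0[of t b] cl[of t N0] by (simp add: N_def)
  qed
 qed
qed

section \<open>Weighted generating functions and their rationality\<close>

text \<open>The sum of c(s) X^(wt s) over S. A weight with infinitely many elements would get
  coefficient 0, so additivity and products are stated under \<open>locfin\<close>.\<close>

definition gf :: "'s set => ('s => nat) => ('s => rat) => rat fps" where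
 "gf S wt c = Abs_fps (%n. \<Sum>s | s : S & wt s = n. c s)"

definition locfin :: "'s set => ('s => nat) => bool" where
 "locfin S wt \<longleftrightarrow> (ALL n. finite {s. s : S & wt s = n})"

lemma gf_nth: "fps_nth (gf S wt c) n = (\<Sum>s | s : S & wt s = n. c s)" by (simp add: gf_def)

lemma gf_cong:
 assumes "!!s. s : S ==> wt s = wt' s" "!!s. s : S ==> c s = c' s"
 shows "gf S wt c = gf S wt' c'"
proof (rule fps_ext)
 fix n
 have "{s. s : S & wt s = n} = {s. s : S & wt' s = n}" using assms(1) by auto
 thus "fps_nth (gf S wt c) n = fps_nth (gf S wt' c') n" unfolding gf_nth using assms(2) by (intro sum.cong) auto
qed

lemma gf_reindex:
 assumes "inj_on fi T"
 shows "gf (fi ` T) wt c = gf T (%t. wt (fi t)) (%t. c (fi t))"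
proof (rule fps_ext)
 fix n
 have "{s. s : fi ` T & wt s = n} = fi ` {t. t : T & wt (fi t) = n}" by auto
 moreover have "inj_on fi {t. t : T & wt (fi t) = n}" using assms by (rule inj_on_subset) auto
 ultimately show "fps_nth (gf (fi ` T) wt c) n = fps_nth (gf T (%t. wt (fi t)) (%t. c (fi t))) n"
  by (simp add: gf_nth sum.reindex)
qed

lemma locfin_subset: "locfin S wt ==> T <= S ==> locfin T wt"
 unfolding locfin_def by (rule allI, rule_tac B = "{s. s : S & wt s = n}" in finite_subset) auto

lemma gf_Un:
 assumes "locfin S wt" "locfin T wt" "S Int T = {}"
 shows "gf (S Un T) wt c = gf S wt c + gf T wt c"
proof (rule fps_ext)
 fix n
 have "{s. s : S Un T & wt s = n} = {s. s : S & wt s = n} Un {s. s : T & wt s = n}" by auto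
 moreover have "(SUM s:{s. s : S & wt s = n} Un {s. s : T & wt s = n}. c s) =
  (\<Sum>s | s : S & wt s = n. c s) + (\<Sum>s | s : T & wt s = n. c s)"
  using assms by (intro sum.union_disjoint) (auto simp: locfin_def)
 ultimately show "fps_nth (gf (S Un T) wt c) n = fps_nth (gf S wt c + gf T wt c) n" by (simp add: gf_nth)
qed

lemma gf_empty: "gf {} wt c = 0" by (rule fps_ext) (simp add: gf_nth)

lemma locfin_UN:
 "finite T ==> (!!t. t : T ==> locfin (S t) wt) ==> locfin (UN t:T. S t) wt"
proof -
 assume *: "finite T" "!!t. t : T ==> locfin (S t) wt"
 have "{s. s : (UN t:T. S t) & wt s = n} = (UN t:T. {s. s : S t & wt s = n})" for n by auto
 thus ?thesis using * by (simp add: locfin_def)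
qed

lemma gf_UN:
 assumes "finite T" "!!t. t : T ==> locfin (S t) wt"
  "!!t u. t : T ==> u : T ==> t ~= u ==> S t Int S u = {}"
 shows "gf (UN t:T. S t) wt c = (SUM t:T. gf (S t) wt c)" using assms
proof (induction T rule: finite_induct)
 case empty
 show ?case by (simp add: gf_empty)
next
 case (insert t T)
 have "S t Int (UN t:T. S t) = {}" using insert.prems(2)[of t] insert.hyps(2) by blast
 hence "gf (S t Un (UN t:T. S t)) wt c = gf (S t) wt c + gf (UN t:T. S t) wt c"
  using insert.prems(1) insert.hyps by (intro gf_Un locfin_UN) auto
 thus ?case using insert by simp
qed

lemma gf_cmult: "fps_const k * gf S wt c = gf S wt (%s. k * c s)"
 by (rule fps_ext) (simp add: gf_nth sum_distrib_left)

lemma gf_shift: "fps_X ^ e * gf S wt c = gf S (%s. wt s + e) c"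
proof (rule fps_ext)
 fix n
 have "{s. s : S & wt s + e = n} = (if n < e then {} else {s. s : S & wt s = n - e})" by auto
 thus "fps_nth (fps_X ^ e * gf S wt c) n = fps_nth (gf S (%s. wt s + e) c) n"
  by (simp add: gf_nth fps_X_power_mult_nth)
qed

lemma gf_prod:
 assumes "locfin S wt" "locfin T vt"
 shows "gf S wt c * gf T vt d = gf (S \<times> T) (%(s, t). wt s + vt t) (%(s, t). c s * d t)"
proof (rule fps_ext)
 fix n
 let ?A = "%i. {s. s : S & wt s = i}" and ?B = "%i. {t. t : T & vt t = i}"
 have "fps_nth (gf S wt c * gf T vt d) n = (\<Sum>i=0..n. SUM x:?A i \<times> ?B (n - i). c (fst x) * d (snd x))"
  by (simp add: fps_mult_nth gf_nth sum_product sum.cartesian_product case_prod_unfold)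
 also have "... = (SUM x:(UN i:{0..n}. ?A i \<times> ?B (n - i)). c (fst x) * d (snd x))"
  using assms by (intro sum.UNION_disjoint[symmetric]) (auto simp: locfin_def)
 also have "(UN i:{0..n}. ?A i \<times> ?B (n - i)) = {x. x : S \<times> T & (%(s, t). wt s + vt t) x = n}" by auto
 finally show "fps_nth (gf S wt c * gf T vt d) n =
  fps_nth (gf (S \<times> T) (%(s, t). wt s + vt t) (%(s, t). c s * d t)) n" by (simp add: gf_nth case_prod_unfold)
qed

definition geo :: "rat => nat => rat fps" where
 "geo q k = inverse (1 - fps_const q * fps_X ^ k)"

lemma geo_mult: "k >= 1 ==> geo q k * (1 - fps_const q * fps_X ^ k) = 1"
 unfolding geo_def by (rule inverse_mult_eq_1) (simp add: fps_mult_nth)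

lemma locfin_nat: "(!!n. wt n >= n) ==> locfin S wt" for wt :: "nat => nat"
 unfolding locfin_def by (auto intro!: finite_subset[of _ "{..n}" for n])

lemma locfin_pair: "(!!x. x : S ==> wt x >= fst x + snd x) ==> locfin S wt" for wt :: "nat * nat => nat"
 unfolding locfin_def
proof
 fix n assume *: "!!x. x : S ==> wt x >= fst x + snd x"
 have "{s. s : S & wt s = n} <= {..n} \<times> {..n}" using * by fastforce
 thus "finite {s. s : S & wt s = n}" by (rule finite_subset) simp
qed

lemma gf_geo:
 assumes "k >= 1"
 shows "gf UNIV (%n. k * n) (%n. q ^ n) = geo q k"
proof -
 let ?G = "gf UNIV (%n::nat. k * n) (%n. q ^ n)"
 have lf: "locfin S (%n. k * n)" for S using assms by (intro locfin_nat) simp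
 have U: "UNIV = {0::nat} Un range Suc" using UNIV_nat_eq by simp
 have "?G = gf {0} (%n. k * n) (%n. q ^ n) + gf (range Suc) (%n. k * n) (%n. q ^ n)"
  by (subst U, rule gf_Un) (auto intro: lf)
 also have "gf {0} (%n::nat. k * n) (%n. q ^ n) = 1"
 proof (rule fps_ext)
  fix n
  have "{s::nat. s : {0} & k * s = n} = (if n = 0 then {0} else {})" by auto
  thus "fps_nth (gf {0} (%n::nat. k * n) (%n. q ^ n)) n = fps_nth 1 n" by (simp add: gf_nth)
 qed
 also have "gf (range Suc) (%n. k * n) (%n. q ^ n) = fps_const q * fps_X ^ k * ?G"
  by (simp add: gf_reindex mult.assoc gf_shift gf_cmult add.commute)
 finally have "?G - fps_const q * fps_X ^ k * ?G = 1" by (rule diff_eq_eq[THEN iffD2])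
 moreover have "F * (1 - z) = F - z * F" for F z :: "rat fps" by (simp add: algebra_simps)
 ultimately have "?G * (1 - fps_const q * fps_X ^ k) = 1" by (simp only:)
 hence "geo q k = ?G * (1 - fps_const q * fps_X ^ k) * geo q k" by (simp only: mult_1_left)
 also have "... = ?G * (geo q k * (1 - fps_const q * fps_X ^ k))" by (simp only: ac_simps)
 also have "... = ?G" by (simp only: geo_mult[OF assms] mult_1_right)
 finally show ?thesis by (rule sym)
qed

lemma gf_geo2:
 assumes "a >= 1" "b >= 1"
 shows "gf UNIV (%(x, y). a * x + b * y + e) (%(x, y). gm * (al ^ x * be ^ y)) =
  fps_const gm * fps_X ^ e * (geo al a * geo be b)"
proof -
 have "geo al a * geo be b = gf (UNIV \<times> UNIV) (%(x, y). a * x + b * y) (%(x, y). al ^ x * be ^ y)"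
  unfolding gf_geo[OF assms(1), symmetric] gf_geo[OF assms(2), symmetric]
  using assms by (intro gf_prod locfin_nat) simp_all
 thus ?thesis by (simp add: mult.assoc gf_shift gf_cmult case_prod_unfold)
qed

text \<open>The constant term of Q is nonzero, so Q is invertible as a power series and F is the
  expansion of P/Q at 0.\<close>

definition ratl :: "rat fps => bool" where
 "ratl F \<longleftrightarrow> (EX P Q. coeff Q 0 ~= 0 & F * fps_of_poly Q = fps_of_poly P)"

lemma ratl_poly: "ratl (fps_of_poly P)" unfolding ratl_def by (intro exI[of _ P] exI[of _ 1]) simp

lemma ratl_const: "ratl (fps_const c)" using ratl_poly[of "[:c:]"] by (simp add: fps_of_poly_const)

lemma ratl_0 [simp]: "ratl 0" and ratl_1 [simp]: "ratl 1" using ratl_const[of 0] ratl_const[of 1] by simp_all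

lemma ratl_X: "ratl (fps_X ^ k)" using ratl_poly[of "monom 1 k"] by (simp add: fps_of_poly_monom')

lemma ratl_add: "ratl F ==> ratl G ==> ratl (F + G)"
proof -
 assume "ratl F" "ratl G"
 then obtain P Q P' Q' where h: "coeff Q 0 ~= 0" "F * fps_of_poly Q = fps_of_poly P"
  "coeff Q' 0 ~= 0" "G * fps_of_poly Q' = fps_of_poly P'" unfolding ratl_def by blast
 have "(F + G) * fps_of_poly (Q * Q') = (F * fps_of_poly Q) * fps_of_poly Q' + (G * fps_of_poly Q') * fps_of_poly Q"
  by (simp add: fps_of_poly_mult algebra_simps)
 also have "... = fps_of_poly (P * Q' + P' * Q)" using h by (simp add: fps_of_poly_mult fps_of_poly_add)
 finally show ?thesis unfolding ratl_def using h by (intro exI[of _ "P * Q' + P' * Q"] exI[of _ "Q * Q'"]) (simp add: coeff_mult_0)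
qed

lemma ratl_mult: "ratl F ==> ratl G ==> ratl (F * G)"
proof -
 assume "ratl F" "ratl G"
 then obtain P Q P' Q' where h: "coeff Q 0 ~= 0" "F * fps_of_poly Q = fps_of_poly P"
  "coeff Q' 0 ~= 0" "G * fps_of_poly Q' = fps_of_poly P'" unfolding ratl_def by blast
 have "(F * G) * fps_of_poly (Q * Q') = (F * fps_of_poly Q) * (G * fps_of_poly Q')"
  by (simp add: fps_of_poly_mult algebra_simps)
 also have "... = fps_of_poly (P * P')" using h by (simp add: fps_of_poly_mult)
 finally show ?thesis unfolding ratl_def using h by (intro exI[of _ "P * P'"] exI[of _ "Q * Q'"]) (simp add: coeff_mult_0)
qed

lemma ratl_diff: "ratl F ==> ratl G ==> ratl (F - G)"
 using ratl_add[of F "fps_const (-1) * G"] ratl_mult[OF ratl_const[of "-1"], of G] by (simp flip: fps_const_neg)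

lemma ratl_sum: "(!!i. i : A ==> ratl (f i)) ==> ratl (sum f A)"
 by (induction A rule: infinite_finite_induct) (auto intro: ratl_add)

lemma ratl_geo: "k >= 1 ==> ratl (geo q k)" unfolding ratl_def by (intro exI[of _ 1] exI[of _ "1 - monom q k"])
   (auto simp: geo_mult fps_of_poly_diff fps_of_poly_monom)

definition evaff :: "(nat => nat) => bool" where
 "evaff w \<longleftrightarrow> (EX n0 a. ALL n>=n0. w (Suc n) = w n + a)"

text \<open>Affine on a shifted quadrant, and eventually affine on every line parallel to an axis:
  the second part handles the finitely many lines outside the shifted quadrant.\<close>

definition evaff2 :: "(nat => nat => nat) => bool" where
 "evaff2 w \<longleftrightarrow> (EX n0 a b. ALL x>=n0. ALL y>=n0. w (Suc x) y = w x y + a & w x (Suc y) = w x y + b)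
   & (ALL x. evaff (%y. w x y)) & (ALL y. evaff (%x. w x y))"

lemma evaffI: "(!!n. n >= n0 ==> w (Suc n) = w n + a) ==> evaff w" unfolding evaff_def by blast

lemma evaff_add:
 assumes "evaff v" "evaff w" shows "evaff (%n. v n + w n)"
proof -
 obtain n0 a n1 b where "ALL n>=n0. v (Suc n) = v n + a" "ALL n>=n1. w (Suc n) = w n + b"
  using assms unfolding evaff_def by blast
 thus ?thesis by (intro evaffI[of "max n0 n1" _ "a + b"]) simp
qed

lemma evaff2_add:
 assumes "evaff2 v" "evaff2 w" shows "evaff2 (%x y. v x y + w x y)"
proof -
 obtain n0 a b n1 c d where
  "ALL x>=n0. ALL y>=n0. v (Suc x) y = v x y + a & v x (Suc y) = v x y + b"
  "ALL x>=n1. ALL y>=n1. w (Suc x) y = w x y + c & w x (Suc y) = w x y + d" using assms unfolding evaff2_def by blast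
 hence "ALL x>=max n0 n1. ALL y>=max n0 n1. v (Suc x) y + w (Suc x) y = v x y + w x y + (a + c) &
   v x (Suc y) + w x (Suc y) = v x y + w x y + (b + d)" by simp
 thus ?thesis using assms evaff_add unfolding evaff2_def by blast
qed

lemma evaff2_affine: "evaff2 (%x y. a * x + b * y + c)"
 unfolding evaff2_def by (auto intro!: exI[of _ 0] evaffI[of 0])

lemma evaff_pos_part:
 fixes B C :: int shows "evaff (%y. nat (B * int y + C))"
proof (cases "B >= 0")
 case True
 show ?thesis
 proof (cases "B = 0")
  case False
  hence "B >= 1" using True by simp
  have "nat (B * int (Suc n) + C) = nat (B * int n + C) + nat B" if "n >= nat \<bar>C\<bar>" for n
  proof -
   have "1 * int n <= B * int n" using `B >= 1` by (intro mult_right_mono) auto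
   hence "B * int n + C >= 0" using that by linarith
   thus ?thesis using `B >= 1` by (simp add: algebra_simps nat_add_distrib)
  qed
  thus ?thesis by (rule evaffI)
 qed (auto intro: evaffI[of 0 _ 0])
next
 case False
 hence B: "B <= -1" by simp
 have z: "nat (B * int n + C) = 0" if "n >= nat \<bar>C\<bar>" for n
 proof -
  have "B * int n <= -1 * int n" using B by (intro mult_right_mono) auto
  hence "B * int n + C <= 0" using that by linarith
  thus ?thesis by simp
 qed
 show ?thesis
 proof (rule evaffI)
  fix n assume n: "n >= nat \<bar>C\<bar>"
  show "nat (B * int (Suc n) + C) = nat (B * int n + C) + 0" by (simp only: z[OF n] z[OF le_SucI[OF n]] add_0_right)
 qed
qed

text \<open>With coefficients of one sign, the form keeps its sign far out in the quadrant. With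
  opposite signs its zero line would run through the quadrant; the cones chosen later exclude
  this.\<close>

lemma evaff2_pos_part:
 fixes A B C :: int
 assumes "A >= 0 & B >= 0 | A <= 0 & B <= 0"
 shows "evaff2 (%x y. nat (A * int x + B * int y + C))" unfolding evaff2_def
proof (intro conjI allI)
 fix x show "evaff (%y. nat (A * int x + B * int y + C))"
  using evaff_pos_part[of B "A * int x + C"] by (simp add: algebra_simps)
next
 fix y show "evaff (%x. nat (A * int x + B * int y + C))"
  using evaff_pos_part[of A "B * int y + C"] by (simp add: algebra_simps)
next
 let ?n = "nat \<bar>C\<bar>"
 consider "A = 0 & B = 0" | "A >= 0" "B >= 0" "A + B >= 1" | "A <= 0" "B <= 0" "A + B <= -1" using assms by linarith
 thus "EX n0 a b. ALL x>=n0. ALL y>=n0. nat (A * int (Suc x) + B * int y + C) = nat (A * int x + B * int y + C) + a &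
   nat (A * int x + B * int (Suc y) + C) = nat (A * int x + B * int y + C) + b"
 proof cases
  case 1
  thus ?thesis by (intro exI[of _ 0]) simp
 next
  case 2
  have "A * int x + B * int y + C >= 0" if "x >= ?n" "y >= ?n" for x y
  proof -
   have "1 * int ?n <= (A + B) * int ?n" using 2 by (intro mult_right_mono) auto
   also have "... = A * int ?n + B * int ?n" by (simp add: algebra_simps)
   also have "... <= A * int x + B * int y" using 2 that by (intro add_mono mult_left_mono) auto
   finally show ?thesis by linarith
  qed
  hence "ALL x>=?n. ALL y>=?n. nat (A * int (Suc x) + B * int y + C) = nat (A * int x + B * int y + C) + nat A &
   nat (A * int x + B * int (Suc y) + C) = nat (A * int x + B * int y + C) + nat B"
   using 2 by (auto simp: algebra_simps nat_add_distrib[symmetric])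
  thus ?thesis by blast
 next
  case 3
  have z: "nat (A * int x + B * int y + C) = 0" if "x >= ?n" "y >= ?n" for x y
  proof -
   have "A * int x + B * int y <= A * int ?n + B * int ?n" using 3 that by (intro add_mono mult_left_mono_neg) auto
   also have "... = (A + B) * int ?n" by (simp add: algebra_simps)
   also have "... <= (-1) * int ?n" using 3 by (intro mult_right_mono) auto
   finally show ?thesis by linarith
  qed
  show ?thesis by (intro exI[of _ ?n] exI[of _ 0] allI impI) (simp only: z le_SucI add_0_right)
 qed
qed

lemma evaff2_sum_list: "(!!f. f : set L ==> evaff2 (g f)) ==> evaff2 (%x y. SUM f<-L. g f x y)"
proof (induction L)
 case Nil
 show ?case using evaff2_affine[of 0 0 0] by simp
next
 case (Cons f L)
 thus ?case using evaff2_add[of "g f" "%x y. SUM f<-L. g f x y"] by simp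
qed

lemma ratl_finite: "finite S ==> ratl (gf S wt c)"
proof -
 assume S: "finite S"
 have "gf S wt c = fps_of_poly (SUM s:S. monom (c s) (wt s))"
  using S by (intro fps_ext) (simp add: gf_nth coeff_sum coeff_monom sum.If_cases Collect_conj_eq Int_commute)
 thus ?thesis by (simp add: ratl_poly)
qed

text \<open>The bound w n >= n forces a positive eventual slope, so the tail is a geometric
  series.\<close>

lemma ratl_1d:
 assumes "evaff w" "!!n. w n >= n"
 shows "ratl (gf UNIV w (%n. gm * al ^ n))"
proof -
 obtain n0 a where a: "!!n. n >= n0 ==> w (Suc n) = w n + a" using assms(1) unfolding evaff_def by blast
 have wn: "w (n0 + n) = w n0 + a * n" for n by (induction n) (auto simp: a)
 have a1: "a >= 1"
 proof (rule ccontr)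
  assume "~ a >= 1"
  hence "w (n0 + Suc (w n0)) = w n0" using wn[of "Suc (w n0)"] by simp
  thus False using assms(2)[of "n0 + Suc (w n0)"] by linarith
 qed
 have lf: "locfin S w" for S by (rule locfin_nat) (rule assms(2))
 have U: "UNIV = {..<n0} Un range (%n. n0 + n)" by (auto simp: image_iff) (metis le_add_diff_inverse not_le)
 have "gf UNIV w (%n. gm * al ^ n) = gf {..<n0} w (%n. gm * al ^ n) + gf (range (%n. n0 + n)) w (%n. gm * al ^ n)"
  by (subst U, rule gf_Un) (auto intro: lf)
 also have "gf (range (%n. n0 + n)) w (%n. gm * al ^ n) =
   fps_const (gm * al ^ n0) * (fps_X ^ w n0 * geo al a)" unfolding gf_geo[OF a1, symmetric] gf_shift gf_cmult
 proof (subst gf_reindex)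
  show "gf UNIV (%t. w (n0 + t)) (%t. gm * al ^ (n0 + t)) = gf UNIV (%s. a * s + w n0) (%s. gm * al ^ n0 * al ^ s)"
   by (rule gf_cong) (simp_all add: wn power_add)
 qed simp
 finally show ?thesis using ratl_finite[of "{..<n0}"] ratl_geo[OF a1]
  by (auto intro!: ratl_add ratl_mult ratl_const ratl_X)
qed

text \<open>The quadrant is cut into finitely many lines, each one-dimensional, and a shifted
  quadrant on which the sum is a product of two geometric series.\<close>

lemma ratl_2d:
 assumes "evaff2 w" "!!x y. w x y >= x + y"
 shows "ratl (gf UNIV (%(x, y). w x y) (%(x, y). gm * (al ^ x * be ^ y)))"
proof -
 let ?w = "%(x, y). w x y" and ?c = "%(x, y). gm * (al ^ x * be ^ y)"
 obtain n0 a b where ab: "!!x y. x >= n0 ==> y >= n0 ==> w (Suc x) y = w x y + a"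
  "!!x y. x >= n0 ==> y >= n0 ==> w x (Suc y) = w x y + b" using assms(1) unfolding evaff2_def by blast
 have e1: "evaff (%y. w x y)" "evaff (%x. w x y)" for x y using assms(1) unfolding evaff2_def by auto
 have wx: "w (n0 + x) y = w n0 y + a * x" if "y >= n0" for x y using that by (induction x) (auto simp: ab)
 have wy: "w n0 (n0 + y) = w n0 n0 + b * y" for y by (induction y) (auto simp: ab)
 have wq: "w (n0 + x) (n0 + y) = w n0 n0 + a * x + b * y" for x y using wx[of "n0 + y"] wy by simp
 have a1: "a >= 1"
 proof (rule ccontr)
  assume "~ a >= 1"
  hence "w (n0 + w n0 n0) n0 = w n0 n0" using wq[of "w n0 n0" 0] by simp
  hence n00: "n0 = 0" "w 0 0 = w (w 0 0) 0" using assms(2)[of "n0 + w n0 n0" n0] by auto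
  hence "w (Suc (w 0 0)) 0 = w 0 0" using wq[of "Suc (w n0 n0)" 0] `~ a >= 1` by simp
  thus False using assms(2)[of "Suc (w 0 0)" 0] by linarith
 qed
 have b1: "b >= 1"
 proof (rule ccontr)
  assume "~ b >= 1"
  hence "w n0 (n0 + Suc (w n0 n0)) = w n0 n0" using wq[of 0 "Suc (w n0 n0)"] by simp
  thus False using assms(2)[of n0 "n0 + Suc (w n0 n0)"] by linarith
 qed
 have lf: "locfin S ?w" for S using assms(2) by (intro locfin_pair) auto
 define A where "A = (UN x:{..<n0}. {x} \<times> (UNIV :: nat set))"
 define B where "B = (UN y:{..<n0}. (range (%x. n0 + x)) \<times> {y :: nat})"
 define D where "D = (%(x, y). (n0 + x, n0 + y)) ` (UNIV :: (nat * nat) set)"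
 have ge: "x : range (%x. n0 + x) \<longleftrightarrow> n0 <= x" for x :: nat
  by (auto simp: image_iff) (metis le_add_diff_inverse)
 have D: "(x, y) : D \<longleftrightarrow> n0 <= x & n0 <= y" for x y
 proof
  assume "n0 <= x & n0 <= y"
  hence "(x, y) = (%(x, y). (n0 + x, n0 + y)) (x - n0, y - n0)" by simp
  thus "(x, y) : D" unfolding D_def by blast
 qed (auto simp: D_def)
 have U: "UNIV = A Un (B Un D)" unfolding A_def B_def using D by (auto simp: ge)
 have "gf UNIV ?w ?c = gf A ?w ?c + (gf B ?w ?c + gf D ?w ?c)" unfolding U
 proof (subst gf_Un)
  show "A Int (B Un D) = {}" using D by (auto simp: A_def B_def ge)
  show "gf A ?w ?c + gf (B Un D) ?w ?c = gf A ?w ?c + (gf B ?w ?c + gf D ?w ?c)"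
  proof (subst gf_Un)
   show "B Int D = {}" using D by (auto simp: B_def)
  qed (auto intro: lf)
 qed (auto intro: lf)
 moreover have "ratl (gf A ?w ?c)"
 proof -
  have "gf ({x} \<times> UNIV) ?w ?c = gf UNIV (%y. w x y) (%y. (gm * al ^ x) * be ^ y)" for x
  proof -
   have "{x} \<times> UNIV = (%y. (x, y)) ` (UNIV :: nat set)" by auto
   thus ?thesis by (simp add: gf_reindex inj_on_def mult.assoc)
  qed
  moreover have "ratl (gf UNIV (%y. w x y) (%y. (gm * al ^ x) * be ^ y))" for x
  proof (rule ratl_1d)
   show "y <= w x y" for y using assms(2)[of x y] by linarith
  qed (rule e1)
  ultimately show ?thesis unfolding A_def by (subst gf_UN) (auto intro: lf ratl_sum)
 qed
 moreover have "ratl (gf B ?w ?c)"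
 proof -
  have "gf ((range (%x. n0 + x)) \<times> {y}) ?w ?c = gf UNIV (%x. w (n0 + x) y) (%x. (gm * al ^ n0 * be ^ y) * al ^ x)" for y
  proof -
   have "range (%x. n0 + x) \<times> {y} = (%x. (n0 + x, y)) ` (UNIV :: nat set)" by auto
   thus ?thesis by (simp add: gf_reindex inj_on_def power_add ac_simps)
  qed
  moreover have "ratl (gf UNIV (%x. w (n0 + x) y) (%x. (gm * al ^ n0 * be ^ y) * al ^ x))" for y
  proof (rule ratl_1d)
   obtain n1 s where "ALL n>=n1. w (Suc n) y = w n y + s" using e1(2)[of y] unfolding evaff_def by blast
   thus "evaff (%x. w (n0 + x) y)" by (intro evaffI[of n1 _ s]) simp
   show "n <= w (n0 + n) y" for n using assms(2)[of "n0 + n" y] by linarith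
  qed
  ultimately show ?thesis unfolding B_def by (subst gf_UN) (auto intro: lf ratl_sum)
 qed
 moreover have "ratl (gf D ?w ?c)"
 proof -
  have "gf D ?w ?c = gf UNIV (%(x, y). a * x + b * y + w n0 n0)
    (%(x, y). (gm * al ^ n0 * be ^ n0) * (al ^ x * be ^ y))" unfolding D_def
  proof (subst gf_reindex)
   show "gf UNIV (%t. ?w (case t of (x, y) => (n0 + x, n0 + y))) (%t. ?c (case t of (x, y) => (n0 + x, n0 + y))) =
    gf UNIV (%(x, y). a * x + b * y + w n0 n0) (%(x, y). (gm * al ^ n0 * be ^ n0) * (al ^ x * be ^ y))"
    by (rule gf_cong) (auto simp: wq power_add)
  qed (auto simp: inj_on_def)
  thus ?thesis using a1 b1 by (simp add: gf_geo2 ratl_mult ratl_const ratl_X ratl_geo)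
 qed
 ultimately show ?thesis by (simp add: ratl_add)
qed

section \<open>Decomposing the wedge into cones\<close>

text \<open>The infinite sum of the h b when h b has order at least b; the terms with b > n then
  cannot contribute to the coefficient n and are cut off.\<close>

definition fsum :: "(nat => rat fps) => rat fps" where
 "fsum h = Abs_fps (%n. SUM b<=n. fps_nth (h b) n)"

lemma fsum_add: "fsum (%b. g b + h b) = fsum g + fsum h" by (rule fps_ext) (simp add: fsum_def sum.distrib)

lemma fsum_diff: "fsum (%b. g b - h b) = fsum g - fsum h" by (rule fps_ext) (simp add: fsum_def sum_subtractf)

lemma fsum_gf:
 assumes "!!b. finite (I b)" "!!b i. i : I b ==> e b i >= b"
 shows "fsum (%b. SUM i:I b. fps_const (c b i) * fps_X ^ e b i) =
  gf (SIGMA b:UNIV. I b) (%(b, i). e b i) (%(b, i). c b i)"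
proof (rule fps_ext)
 fix n
 have "fps_nth (fsum (%b. SUM i:I b. fps_const (c b i) * fps_X ^ e b i)) n =
  (SUM b<=n. SUM i:I b. if e b i = n then c b i else 0)"
  by (auto simp: fsum_def fps_sum_nth fps_X_power_nth intro!: sum.cong)
 also have "... = (SUM b<=n. \<Sum>i | i : I b & e b i = n. c b i)" using assms(1) by (simp add: sum.inter_filter)
 also have "... = (SUM (b, i):(SIGMA b:{..n}. {i. i : I b & e b i = n}). c b i)"
  using assms(1) by (subst sum.Sigma) auto
 also have "(SIGMA b:{..n}. {i. i : I b & e b i = n}) =
  {s. s : (SIGMA b:UNIV. I b) & (%(b, i). e b i) s = n}" using assms(2) by auto
 finally show "fps_nth (fsum (%b. SUM i:I b. fps_const (c b i) * fps_X ^ e b i)) n =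
  fps_nth (gf (SIGMA b:UNIV. I b) (%(b, i). e b i) (%(b, i). c b i)) n" by (simp add: gf_nth case_prod_unfold)
qed

text \<open>The index set of Abel summation: n measures the precision of t inside its residue class,
  i the depth of f(t).\<close>

definition wedge :: "(nat * nat) set" where "wedge = {(n, i). 1 <= i & i <= n}"

text \<open>Parametrizes the half-open cone of points (x+1) u + y v, which contains the ray of u but
  not the ray of v, so neighbouring cones do not overlap.\<close>

definition cmap :: "nat * nat => nat * nat => nat * nat => nat * nat" where
 "cmap u v = (%(x, y). (fst u * Suc x + fst v * y, snd u * Suc x + snd v * y))"

lemma gf_witness:
 assumes "!!t. t : T ==> f t : S & g (f t) = t" "!!s. s : S ==> g s : T & f (g s) = s"
 shows "gf S wt c = gf T (%t. wt (f t)) (%t. c (f t))"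
proof -
 have "S = f ` T" using assms by force
 moreover have "inj_on f T" by (rule inj_on_inverseI[of _ g]) (use assms in auto)
 ultimately show ?thesis by (simp add: gf_reindex)
qed

lemma locfin_triangle:
 assumes "!!s. s : S ==> snd s <= fst s & fst s <= w s" shows "locfin S w" unfolding locfin_def
proof
 fix n
 have "{s. s : S & w s = n} <= {..n} \<times> {..n}" using assms by fastforce
 thus "finite {s. s : S & w s = n}" by (rule finite_subset) simp
qed

text \<open>Sorted by the quotient t = n div i: the points with quotient t form the cone on (t,1)
  and (t+1,1), with y = n mod i, and those with quotient at least L the cone on (L,1) and (1,0). All
  these cones are unimodular.\<close>

lemma cone_decomposition:
 assumes "L >= 1" "!!s. s : wedge ==> w s >= fst s"
 shows "gf wedge w c =
  (SUM t:{1..<L}. gf UNIV (%s. w (cmap (t, 1) (Suc t, 1) s)) (%s. c (cmap (t, 1) (Suc t, 1) s)))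
  + gf UNIV (%s. w (cmap (L, 1) (1, 0) s)) (%s. c (cmap (L, 1) (1, 0) s))"
proof -
 let ?S = "%t. {s : wedge. fst s div snd s = t}" and ?B = "{s : wedge. L <= fst s div snd s}"
 have lf: "locfin {s : wedge. Q s} w" for Q using assms(2) by (intro locfin_triangle) (auto simp: wedge_def)
 have "s : (UN t:{1..<L}. ?S t) Un ?B" if "s : wedge" for s
 proof -
  have "fst s div snd s >= 1" using that div_greater_zero_iff[of "fst s" "snd s"] by (auto simp: wedge_def)
  thus ?thesis using that by fastforce
 qed
 hence U: "wedge = (UN t:{1..<L}. ?S t) Un ?B" by blast
 have "gf wedge w c = (SUM t:{1..<L}. gf (?S t) w c) + gf ?B w c"
  by (subst U, subst gf_Un, rule locfin_UN, simp, rule lf, rule lf, force, subst gf_UN) (auto intro: lf)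
 moreover have "gf (?S t) w c = gf UNIV (%s. w (cmap (t, 1) (Suc t, 1) s)) (%s. c (cmap (t, 1) (Suc t, 1) s))"
  if t: "t >= 1" for t
 proof (rule gf_witness[where g = "%(n, i). (i - Suc (n mod i), n mod i)"], goal_cases)
  case (1 s)
  obtain x y where s: "s = (x, y)" by (cases s)
  have e: "t * Suc x + Suc t * y = y + t * (Suc x + y)" by (simp add: algebra_simps)
  have "1 * (Suc x + y) <= t * (Suc x + y)" using t by (rule mult_le_mono1)
  moreover have "(y + t * (Suc x + y)) div (Suc x + y) = t + y div (Suc x + y)" by (rule div_mult_self1) simp
  moreover have "(y + t * (Suc x + y)) mod (Suc x + y) = y mod (Suc x + y)" by (rule mod_mult_self1)
  ultimately show ?case unfolding s cmap_def prod.case fst_conv snd_conv mult_1 e by (simp add: wedge_def)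
 next
  case (2 s)
  then obtain n i where s: "s = (n, i)" "1 <= i" "n div i = t" by (auto simp: wedge_def)
  define y where "y = n mod i"
  have y: "y < i" "n = t * i + y" using s by (auto simp: y_def)
  obtain x where "i = Suc (y + x)" using less_imp_Suc_add[OF y(1)] by blast
  thus ?case using y(2) unfolding s(1) prod.case y_def[symmetric] by (simp add: cmap_def algebra_simps)
 qed
 moreover have "gf ?B w c = gf UNIV (%s. w (cmap (L, 1) (1, 0) s)) (%s. c (cmap (L, 1) (1, 0) s))"
 proof (rule gf_witness[where g = "%(n, i). (i - 1, n - L * i)"], goal_cases)
  case (1 s)
  obtain x y where s: "s = (x, y)" by (cases s)
  have "1 * Suc x <= L * Suc x" using assms(1) by (rule mult_le_mono1)
  thus ?case unfolding s by (auto simp: cmap_def wedge_def less_eq_div_iff_mult_less_eq)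
 next
  case (2 s)
  then obtain n i where s: "s = (n, i)" "1 <= i" "L <= n div i" by (auto simp: wedge_def)
  hence "L * i <= n" by (simp add: less_eq_div_iff_mult_less_eq)
  thus ?case using s by (cases i) (simp_all add: cmap_def)
 qed
 ultimately show ?thesis by simp
qed

lemma cmap_power: "a ^ (u1 * Suc x + v1 * y) * b ^ (u2 * Suc x + v2 * y) =
  (a ^ u1 * b ^ u2) * ((a ^ u1 * b ^ u2) ^ x * (a ^ v1 * b ^ v2) ^ y)" for a :: rat
proof -
 have "c ^ (k * Suc x + l * y) = c ^ k * (c ^ k) ^ x * (c ^ l) ^ y" for c :: rat and k l
  by (simp only: power_add power_mult mult_Suc_right)
 thus ?thesis by (simp only: power_mult_distrib ac_simps)
qed

section \<open>The series of a residue class\<close>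

text \<open>For prime p, the exponent of the order of the image of the matrix on (Z/p^b)^J,
  equivalently of the index of its kernel (see \<open>idx_ker_mod\<close>).\<close>

definition sw :: "nat => nat => 'i set => 'j set => ('i => 'j => int poly) => int => nat" where
 "sw p b I J C t = b * card J - multiplicity p (nsol p b I J C t)"

text \<open>A diagonal entry of valuation c has an image of order p^(b-c), where truncated
  subtraction gives 1 once c exceeds b.\<close>

lemma sw_eq:
 assumes "prime p" "length L <= card J"
  "nsol p b I J C t = p ^ (b * (card J - length L) + (SUM c<-L. min b c))"
 shows "sw p b I J C t = (SUM c<-L. b - c)"
proof -
 have "multiplicity p (p ^ k) = k" for k
  using assms(1) prime_gt_0_nat not_prime_unit by (intro multiplicity_same_power) auto
 hence m: "sw p b I J C t = b * card J - (b * (card J - length L) + (SUM c<-L. min b c))"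
  unfolding sw_def assms(3) by simp
 have s: "(SUM c<-L. min b c) + (SUM c<-L. b - c) = b * length L" for L by (induction L) auto
 have "b * card J = b * (card J - length L) + b * length L" using assms(2) by (simp flip: add_mult_distrib2)
 thus ?thesis unfolding m s[of L, symmetric] by simp
qed

lemma sw_cong:
 assumes "prime p" "int p ^ b dvd t' - t" shows "sw p b I J C t' = sw p b I J C t"
 unfolding sw_def sols_cong[OF assms] ..

text \<open>Sums over all b = N + n and all t modulo p^b lying in the class of z modulo p^N: the
  part of the zeta sum over one disc of the affine line.\<close>

definition cls :: "nat => rat => 'i set => 'j set => ('i => 'j => int poly) => nat => int => rat fps" where
 "cls p al I J C N z = fsum (%n. \<Sum>t | t : {0..<int (p ^ (N + n))} & int p ^ N dvd t - z.
   fps_const (al ^ (N + n)) * fps_X ^ (N + n + sw p (N + n) I J C t))"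

lemma fsum_sum: "finite A ==> fsum (%b. SUM k:A. h k b) = (SUM k:A. fsum (h k))"
proof (induction A rule: finite_induct)
 case empty
 show ?case by (rule fps_ext) (simp add: fsum_def)
next
 case (insert k A)
 thus ?case by (simp add: fsum_add)
qed

lemma fsum_Suc:
 assumes "!!n k. k < n ==> fps_nth (h n) k = 0" shows "fsum h = h 0 + fsum (%n. h (Suc n))"
proof (rule fps_ext)
 fix n
 have "fps_nth (fsum h) n = (SUM b<=Suc n. fps_nth (h b) n)" using assms[of n "Suc n"] by (simp add: fsum_def)
 also have "... = fps_nth (h 0) n + (SUM b<=n. fps_nth (h (Suc b)) n)" by (rule sum.atMost_Suc_shift)
 finally show "fps_nth (fsum h) n = fps_nth (h 0 + fsum (%n. h (Suc n))) n" by (simp add: fsum_def)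
qed

lemma fsum_gf1:
 assumes "!!n. e n >= n" shows "fsum (%n. fps_const (c n) * fps_X ^ e n) = gf UNIV e c"
proof (rule fps_ext)
 fix n
 have "{b. b <= n & e b = n} = {b. e b = n}" using assms by force
 thus "fps_nth (fsum (%n. fps_const (c n) * fps_X ^ e n)) n = fps_nth (gf UNIV e c) n"
  by (simp add: fsum_def gf_nth fps_X_power_nth eq_commute[of n] sum.inter_filter[symmetric] if_distrib cong: if_cong)
qed

lemma bound_list: "EX K::nat>=1. ALL (A, C):set L. A <= int K" for L :: "(int * int) list"
proof (induction L)
 case (Cons a L)
 then obtain K where "K >= 1" "ALL (A, C):set L. A <= int K" by blast
 thus ?case by (intro exI[of _ "max K (nat (fst a))"]) fastforce
qed auto

lemma ratl_cone:
 fixes L :: "(int * int) list"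
 assumes "u1 >= 1" "v1 >= 1"
  and *: "!!A C. (A, C) : set L ==> let a = int u1 - A * int u2; b = int v1 - A * int v2 in a >= 0 & b >= 0 | a <= 0 & b <= 0"
 shows "ratl (gf UNIV (%s. (%(n, i). n + e + (SUM (A, C)<-L. nat (int n - A * int i + C))) (cmap (u1, u2) (v1, v2) s))
   (%s. (%(n, i). gm * (a ^ n * b ^ i)) (cmap (u1, u2) (v1, v2) s)))"
proof -
 let ?h = "%A C x y. nat ((int u1 - A * int u2) * int x + (int v1 - A * int v2) * int y + (int u1 - A * int u2 + C))"
 let ?w = "%x y. u1 * x + v1 * y + (u1 + e) + (SUM (A, C)<-L. ?h A C x y)"
 have "evaff2 ?w"
  by (intro evaff2_add[OF evaff2_affine evaff2_sum_list]; clarify; intro evaff2_pos_part) (use * in \<open>simp add: Let_def\<close>)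
 moreover have "x + y <= ?w x y" for x y
 proof -
  have "1 * x <= u1 * x" "1 * y <= v1 * y" using assms(1,2) by (intro mult_le_mono1; simp)+
  thus ?thesis by linarith
 qed
 ultimately have "ratl (gf UNIV (%(x, y). ?w x y)
  (%(x, y). gm * (a ^ u1 * b ^ u2) * ((a ^ u1 * b ^ u2) ^ x * (a ^ v1 * b ^ v2) ^ y)))" by (rule ratl_2d)
 also have "gf UNIV (%(x, y). ?w x y) (%(x, y). gm * (a ^ u1 * b ^ u2) * ((a ^ u1 * b ^ u2) ^ x * (a ^ v1 * b ^ v2) ^ y)) =
  gf UNIV (%s. (%(n, i). n + e + (SUM (A, C)<-L. nat (int n - A * int i + C))) (cmap (u1, u2) (v1, v2) s))
   (%s. (%(n, i). gm * (a ^ n * b ^ i)) (cmap (u1, u2) (v1, v2) s))"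
  by (intro gf_cong; clarify) (simp_all only: cmap_def prod.case fst_conv snd_conv cmap_power mult.assoc, simp add: algebra_simps)
 finally show ?thesis .
qed

text \<open>Cutting at the integral slopes up to a bound for all A keeps each form n - A i of one
  sign on every cone, as \<open>evaff2_pos_part\<close> requires.\<close>

lemma ratl_region:
 fixes L :: "(int * int) list"
 shows "ratl (gf wedge (%(n, i). n + e + (SUM (A, C)<-L. nat (int n - A * int i + C))) (%(n, i). gm * (u ^ n * v ^ i)))"
proof -
 obtain K :: nat where K: "K >= 1" "!!A C. (A, C) : set L ==> A <= int K" using bound_list[of L] by blast
 show ?thesis by (subst cone_decomposition[OF K(1)], force, intro ratl_add ratl_sum ratl_cone)
    (use K in \<open>auto simp: Let_def\<close>)
qed

lemma cls_cong:
 assumes "int p ^ N dvd z - z'" shows "cls p al I J C N z = cls p al I J C N z'"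
proof -
 have *: "int p ^ N dvd t - z \<longleftrightarrow> int p ^ N dvd t - z'" for t
  using dvd_add_right_iff[OF assms, of "t - z"] by (simp add: algebra_simps)
 show ?thesis unfolding cls_def * ..
qed

text \<open>A disc is the disjoint union of p smaller discs; only the term with b = N is left over,
  and it is a polynomial.\<close>

lemma ratl_cls_split:
 assumes "p > 0" "!!k. k < p ==> ratl (cls p al I J C (Suc N) (z + int k * int p ^ N))"
 shows "ratl (cls p al I J C N z)"
proof -
 let ?P = "int p ^ N" and ?z = "%k. z + int k * int p ^ N"
 let ?T = "%b. {t. t : {0..<int (p ^ b)} & ?P dvd t - z}"
 let ?Tk = "%k b. {t. t : {0..<int (p ^ b)} & int p ^ Suc N dvd t - ?z k}"
 let ?g = "%b t. fps_const (al ^ b) * fps_X ^ (b + sw p b I J C t)"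
 define r where "r t = nat ((t - z) div ?P mod int p)" for t
 have r: "int p ^ Suc N dvd t - ?z k \<longleftrightarrow> ?P dvd t - z & r t = k" if k: "k < p" for k t
 proof (cases "?P dvd t - z")
  case True
  then obtain y where y: "t - z = ?P * y" by (auto simp: dvd_def)
  hence "t - ?z k = ?P * (y - int k)" by (simp add: algebra_simps)
  hence "int p ^ Suc N dvd t - ?z k \<longleftrightarrow> int p dvd y - int k" using assms(1) by (simp add: mult.commute[of "int p"])
  also have "... \<longleftrightarrow> r t = k" unfolding mod_eq_dvd_iff[symmetric] using y k assms(1) by (auto simp: r_def)
  finally show ?thesis using True by simp
 next
  case False
  have "?P dvd t - ?z k + int k * ?P" if "int p ^ Suc N dvd t - ?z k"
   using that by (intro dvd_add) (auto intro: power_le_dvd)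
  thus ?thesis using False by auto
 qed
 have "(SUM t:?T b. ?g b t) = (SUM k<p. SUM t:?Tk k b. ?g b t)" for b
 proof -
  have "finite (?T b)" by (rule finite_subset[of _ "{0..<int (p ^ b)}"]) auto
  moreover have "r ` ?T b <= {..<p}" using assms(1) by (auto simp: r_def nat_less_iff)
  ultimately have "(SUM t:?T b. ?g b t) = (SUM k<p. SUM t:{t : ?T b. r t = k}. ?g b t)"
   by (intro sum.group[symmetric]) auto
  also have "... = (SUM k<p. SUM t:?Tk k b. ?g b t)" by (intro sum.cong) (auto simp: r simp del: power_Suc)
  finally show ?thesis .
 qed
 note * = this
 have "cls p al I J C N z = (SUM t:?T N. ?g N t) + fsum (%n. SUM t:?T (N + Suc n). ?g (N + Suc n) t)"
  unfolding cls_def by (subst fsum_Suc) (auto simp: fps_sum_nth)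
 also have "fsum (%n. SUM t:?T (N + Suc n). ?g (N + Suc n) t) = (SUM k<p. cls p al I J C (Suc N) (?z k))"
  unfolding * cls_def by (subst fsum_sum) simp_all
 finally show ?thesis using assms(2) by (auto intro!: ratl_add ratl_sum ratl_mult ratl_const ratl_X)
qed

lemma sum_list_nat_diff:
 fixes L :: "(int * int) list"
 assumes "!!m c. (m, c) : set L ==> m * int j + c >= 0"
 shows "(SUM v<-map (%(m, c). nat (m * int j + c)) L. b - v) = (SUM (m, c)<-L. nat (int b - (m * int j + c)))"
 using assms
proof (induction L)
 case (Cons a L)
 obtain m c where a: "a = (m, c)" by (cases a)
 have "m * int j + c >= 0" using Cons.prems a by simp
 hence "b - nat (m * int j + c) = nat (int b - (m * int j + c))" by linarith
 thus ?case using Cons a by simp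
qed simp

lemma fps_of_nat_const: "of_nat k * (fps_const a * F) = fps_const (of_nat k * a) * F" for F :: "rat fps"
 by (simp add: fps_of_nat[symmetric] fps_const_mult[symmetric] mult.assoc del: fps_const_mult)

text \<open>Rewrites the number p^(n-i) of points, weighted by al^(N+n), as a coefficient
  multiplicative in n and in i.\<close>

lemma class_coeff:
 assumes "p > 0" "i <= n" shows "of_nat (p ^ (n - i)) * al ^ (N + n) = al ^ N * ((of_nat p * al) ^ n * (1 / of_nat p :: rat) ^ i)"
 using assms unfolding of_nat_power by (simp add: power_diff power_one_over power_add power_mult_distrib)

lemma cls_const:
 assumes p: "prime p" and sw: "!!t n. int p ^ N dvd t - z ==> sw p (N + n) I J C t = s n"
 shows "cls p al I J C N z = gf UNIV (%n. N + n + s n) (%n. al ^ N * (of_nat p * al) ^ n)"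
proof -
 have p0: "p > 0" using p by (rule prime_gt_0_nat)
 have "(\<Sum>t | t : {0..<int (p ^ (N + n))} & int p ^ N dvd t - z. fps_const (al ^ (N + n)) * fps_X ^ (N + n + sw p (N + n) I J C t))
   = fps_const (al ^ N * (of_nat p * al) ^ n) * fps_X ^ (N + n + s n)" (is "sum ?f ?T = _") for n
 proof -
  have "sum ?f ?T = (SUM t:?T. fps_const (al ^ (N + n)) * fps_X ^ (N + n + s n))" using sw by (intro sum.cong) auto
  also have "... = of_nat (p ^ n) * (fps_const (al ^ (N + n)) * fps_X ^ (N + n + s n))"
   using card_residue_class[of "p ^ N" "p ^ n" z] p0 by (simp add: power_add)
  finally show ?thesis unfolding fps_of_nat_const using class_coeff[OF p0, of 0 n al N] by simp
 qed
 thus ?thesis unfolding cls_def by (simp only:) (rule fsum_gf1, simp)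
qed

text \<open>\<open>simple_zero_sum\<close> at every precision n: a one-dimensional series for depth
  0 and the two halves of the increments, each summed over the wedge.\<close>

lemma cls_simple_zero:
 assumes p: "prime p" and sz: "simple_zero p f z N de"
  and sw: "!!t b. int p ^ N dvd t - z ==> poly f t ~= 0 ==> sw p b I J C t = om b (vp p (poly f t) - (N + de))"
 shows "cls p al I J C N z = gf UNIV (%n. N + n + om (N + n) 0) (%n. al ^ N * (of_nat p * al) ^ n) +
   gf wedge (%(n, i). N + n + om (N + n) i) (%(n, i). al ^ N * ((of_nat p * al) ^ n * (1 / of_nat p) ^ i)) -
   gf wedge (%(n, i). N + n + om (N + n) (i - 1)) (%(n, i). al ^ N * ((of_nat p * al) ^ n * (1 / of_nat p) ^ i))"
proof -
 have p0: "p > 0" using p by (rule prime_gt_0_nat)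
 let ?g = "%n w. fps_const (al ^ (N + n)) * fps_X ^ (N + n + w)"
 let ?c = "%n i. al ^ N * ((of_nat p * al) ^ n * (1 / of_nat p) ^ i)"
 have "(\<Sum>t | t : {0..<int (p ^ (N + n))} & int p ^ N dvd t - z. ?g n (sw p (N + n) I J C t)) =
   fps_const (?c n 0) * fps_X ^ (N + n + om (N + n) 0) + (SUM i:{1..n}. fps_const (?c n i) * fps_X ^ (N + n + om (N + n) i))
   - (SUM i:{1..n}. fps_const (?c n i) * fps_X ^ (N + n + om (N + n) (i - 1)))" for n
 proof -
  have "(\<Sum>t | t : {0..<int (p ^ (N + n))} & int p ^ N dvd t - z. ?g n (sw p (N + n) I J C t)) =
   of_nat (p ^ n) * ?g n (om (N + n) 0) + (\<Sum>i=1..n. of_nat (p ^ (n - i)) * (?g n (om (N + n) i) - ?g n (om (N + n) (i - 1))))"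
   by (rule simple_zero_sum[OF p sz]) (auto intro: sw sw_cong[OF p])
  thus ?thesis unfolding right_diff_distrib sum_subtractf fps_of_nat_const
   using class_coeff[OF p0, of 0 n al N] by (simp add: class_coeff[OF p0] del: of_nat_power cong: sum.cong_simp)
 qed
 moreover have "(SIGMA n:UNIV. {1..n}) = wedge" by (auto simp: wedge_def)
 ultimately show ?thesis
  unfolding cls_def by (simp only: fsum_diff fsum_add) (subst fsum_gf1, simp, subst (1 2) fsum_gf, simp_all)
qed

lemma evaff_sum_list: "(!!x. evaff (h x)) ==> evaff (%n. SUM x<-L. h x n)"
proof (induction L)
 case Nil
 show ?case by (auto intro: evaffI[of 0 _ 0])
next
 case (Cons x L)
 thus ?case using evaff_add[of "h x"] by simp
qed

lemma ratl_pos_parts: "ratl (gf UNIV (%n. N + n + (SUM x<-L. nat (int (N + n) - h x))) (%n. gm * al ^ n))"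
proof (rule ratl_1d)
 have "evaff (%n. nat (int (N + n) - h x))" for x
  using evaff_pos_part[of 1 "int N - h x"] by (simp add: algebra_simps)
 thus "evaff (%n. N + n + (SUM x<-L. nat (int (N + n) - h x)))"
  by (intro evaff_add[OF evaffI[of 0 _ 1]] evaff_sum_list) simp_all
qed simp

text \<open>Compactness of the p-adic integers. If a disc had a nonrational series, so would one of
  its p subdiscs, and nested bad discs would shrink to a p-adic integer. But around every p-adic
  integer \<open>local_elimination\<close> exhibits a disc with rational series.\<close>

theorem ratl_cls:
 fixes C :: "'i => 'j => int poly"
 assumes fin: "finite I" "finite J" and p: "prime p"
 shows "ratl (cls p al I J C N0 z0)"
proof (rule ccontr)
 assume bad: "~ ratl (cls p al I J C N0 z0)"
 have p0: "p > 0" using p by (rule prime_gt_0_nat)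
 have "EX k. ~ ratl (cls p al I J C (Suc n) (z + int k * int p ^ n))" if "~ ratl (cls p al I J C n z)" for n z
  using ratl_cls_split[OF p0] that by blast
 then obtain nx where nx: "!!n z. ~ ratl (cls p al I J C n z) ==> ~ ratl (cls p al I J C (Suc n) (z + int (nx n z) * int p ^ n))"
  by metis
 \<comment> \<open>Below the starting level N0 the sequence is constantly z0; from there on each
   step chooses a bad subdisc.\<close>
 define a where "a = rec_nat z0 (%n z. if n < N0 then z else z + int (nx n z) * int p ^ n)"
 have a0: "a 0 = z0" and aS: "a (Suc n) = (if n < N0 then a n else a n + int (nx n (a n)) * int p ^ n)" for n
  by (simp_all add: a_def)
 have alow: "n <= N0 ==> a n = z0" for n by (induction n) (auto simp: a0 aS)
 have nr: "~ ratl (cls p al I J C n (a n))" if "n >= N0" for n using that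
 proof (induction rule: dec_induct)
  case base
  thus ?case using bad alow by simp
 next
  case (step n)
  thus ?case using nx[of n "a n"] by (simp add: aS)
 qed
 have coh: "coherent p a" by (simp add: coherent_def aS)
 show False
 proof (rule local_elimination[OF fin p coh, of N0 C], goal_cases)
  case (1 N L)
  have "sw p (N + n) I J C t = (SUM c<-L. nat (int (N + n) - int c))" if "int p ^ N dvd t - a N" for t n
   using sw_eq[OF p 1(2) 1(3)[OF that]] by (simp add: nat_minus_as_int del: of_nat_add)
  from cls_const[OF p this] show False using nr[OF 1(1)] ratl_pos_parts[of N int L] by simp
 next
  case (2 f z N de L)
  note root = this
  let ?M = "N + de"
  define om where "om b i = (SUM (m, c)<-L. nat (int b - (m * int (?M + i) + c)))" for b i
  have sw: "sw p b I J C t = om b (vp p (poly f t) - ?M)"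
   if t: "int p ^ N dvd t - z" "poly f t ~= 0" for t b
  proof -
   let ?j = "vp p (poly f t)"
   have "?j >= ?M"
    using simple_zero_dvd_class[OF p root(3) t(1)] t(2) not_dvd_1[OF p] by (intro multiplicity_geI) auto
   hence j: "?M + (?j - ?M) = ?j" by simp
   let ?L = "map (%(m, c). nat (m * int ?j + c)) L"
   have "nsol p b I J C t = p ^ (b * (card J - length ?L) + (SUM v<-?L. min b v))"
    using root(6)[OF t, of b] by (simp add: case_prod_unfold comp_def)
   hence "sw p b I J C t = (SUM v<-?L. b - v)" using root(2) by (intro sw_eq[OF p]) auto
   also have "... = (SUM (m, c)<-L. nat (int b - (m * int ?j + c)))" using root(5)[OF t] by (intro sum_list_nat_diff)
   finally show ?thesis unfolding om_def j .
  qed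
  have "ratl (gf wedge (%(n, i). N + n + om (N + n) (i - e)) (%(n, i). gm * (u ^ n * v ^ i)))" if "e <= 1" for e gm u v
  proof -
   have "gf wedge (%(n, i). N + n + om (N + n) (i - e)) (%(n, i). gm * (u ^ n * v ^ i)) =
    gf wedge (%(n, i). n + N + (SUM (A, C)<-map (%(m, c). (m, int N + m * int e - m * int ?M - c)) L. nat (int n - A * int i + C)))
     (%(n, i). gm * (u ^ n * v ^ i))"
    using that by (intro gf_cong) (auto simp: wedge_def om_def case_prod_unfold comp_def of_nat_diff algebra_simps)
   thus ?thesis by (simp only: ratl_region)
  qed
  note w = this[of 0] this[of 1]
  have "ratl (cls p al I J C N z)"
   by (subst cls_simple_zero[where om = om, OF p root(3)], rule sw, assumption, assumption, intro ratl_diff ratl_add)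
     (use w ratl_pos_parts[of N "%(m, c). m * int (?M + 0) + c" L] in \<open>simp_all add: om_def case_prod_unfold\<close>)
  moreover have "cls p al I J C N z = cls p al I J C N (a N)" by (rule cls_cong[OF root(4)])
  ultimately show False using nr[OF root(1)] by simp
 qed
qed

section \<open>Closed forms for residue classes at large primes\<close>

definition wk :: "nat list => nat => nat" where "wk ms t = (SUM m<-ms. t - m)"

text \<open>The value of the coefficient (p al)^n p^(-i) at the ray generator (n,i) = (t,1); the
  weight there is t + \<open>wk ms t\<close>.\<close>

definition Rc :: "nat => rat => nat => rat" where "Rc p al t = of_nat p ^ (t - 1) * al ^ t"

text \<open>The sum over the wedge of (p al)^n p^(-i) X^w with w = n + sum of the truncated
  differences n - m i, written cone by cone. K exceeds every m, so beyond slope K no difference is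
  truncated and the ray (1,0) has weight 1 + length ms.\<close>

definition Sg :: "nat => rat => nat list => rat fps" where
 "Sg p al ms = (let K = Suc (sum_list ms); R = Rc p al; e = (%t. t + wk ms t) in
   (SUM t:{1..<K}. fps_const (R t) * fps_X ^ e t * (geo (R t) (e t) * geo (R (Suc t)) (e (Suc t))))
   + fps_const (R K) * fps_X ^ e K * (geo (R K) (e K) * geo (of_nat p * al) (1 + length ms)))"

definition Ug :: "nat => rat => nat => rat fps" where
 "Ug p al rh = fps_const al * fps_X ^ (1 + rh) * geo (of_nat p * al) (1 + rh)"

text \<open>What a class containing a zero contributes beyond a generic class: the wedge series
  minus the same series with depth i replaced by i - 1 in the weight. The subtracted part is the
  formula of \<open>Sg_shift_gf\<close>.\<close>

definition Kg :: "nat => rat => nat list => rat fps" where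
 "Kg p al ms = Sg p al ms - fps_const (1 / of_nat p) *
   (Sg p al ms + geo (of_nat p * al) (1 + length ms) - geo (Rc p al 1) (1 + wk ms 1))"

lemma gf_lin:
 assumes "k >= 1"
 shows "gf UNIV (%n. k * n + e) (%n. gm * q ^ n) = fps_const gm * fps_X ^ e * geo q k"
 unfolding gf_geo[OF assms, symmetric] by (simp add: mult.assoc gf_shift gf_cmult)

lemma gf_geo_pos:
 assumes "k >= 1"
 shows "gf {1..} (%n. k * n) (%n. q ^ n) = geo q k - 1"
proof -
 have lf: "locfin S (%n. k * n)" for S using assms by (intro locfin_nat) simp
 have U: "UNIV = {0::nat} Un {1..}" by auto
 have "geo q k = gf {0} (%n. k * n) (%n. q ^ n) + gf {1..} (%n. k * n) (%n. q ^ n)"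
  unfolding gf_geo[OF assms, symmetric] by (subst U, rule gf_Un) (auto intro: lf)
 also have "gf {0} (%n::nat. k * n) (%n. q ^ n) = 1"
 proof (rule fps_ext)
  fix n
  have "{s::nat. s : {0} & k * s = n} = (if n = 0 then {0} else {})" by auto
  thus "fps_nth (gf {0} (%n::nat. k * n) (%n. q ^ n)) n = fps_nth 1 n" by (simp add: gf_nth)
 qed
 finally show ?thesis by simp
qed

lemma Ug_gf: "gf UNIV (%n. 1 + n + rh * (1 + n)) (%n. al ^ 1 * (of_nat p * al) ^ n) = Ug p al rh"
proof -
 have "gf UNIV (%n. 1 + n + rh * (1 + n)) (%n. al ^ 1 * (of_nat p * al) ^ n) =
  gf UNIV (%n. (1 + rh) * n + (1 + rh)) (%n. al * (of_nat p * al) ^ n)"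
  by (rule gf_cong) (simp_all add: algebra_simps)
 thus ?thesis unfolding Ug_def by (subst gf_lin[symmetric]) simp_all
qed

lemma cls_generic:
 assumes p: "prime p" and sw: "!!t b. int p dvd t - z ==> sw p b I J C t = rh * b"
 shows "cls p al I J C 1 z = Ug p al rh" unfolding Ug_gf[symmetric] using sw by (intro cls_const p) simp

text \<open>Truncated subtraction is additive on a cone whose two generators give differences of the
  same sign.\<close>

lemma cone_diff:
 fixes m :: nat
 assumes "m * u2 <= u1 & m * v2 <= v1 | u1 <= m * u2 & v1 <= m * v2"
 shows "(u1 * x + v1 * y) - m * (u2 * x + v2 * y) = (u1 - m * u2) * x + (v1 - m * v2) * y" using assms
proof
 assume "m * u2 <= u1 & m * v2 <= v1"
 then obtain c d where "u1 = m * u2 + c" "v1 = m * v2 + d" by (auto simp: le_iff_add)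
 thus ?thesis by (simp add: algebra_simps)
next
 assume *: "u1 <= m * u2 & v1 <= m * v2"
 hence "u1 * x + v1 * y <= m * u2 * x + m * v2 * y" by (intro add_mono mult_le_mono1) auto
 thus ?thesis using * by (simp add: algebra_simps)
qed

lemma gf_cone:
 fixes a b :: rat
 assumes "u1 >= 1" "v1 >= 1" "!!m. m : set ms ==> m * u2 <= u1 & m * v2 <= v1 | u1 <= m * u2 & v1 <= m * v2"
 defines "W == %(n, i). n + (SUM m<-ms. n - m * i)" and "X == %(n, i). a ^ n * b ^ i"
 shows "gf UNIV (%s. W (cmap (u1, u2) (v1, v2) s)) (%s. X (cmap (u1, u2) (v1, v2) s)) =
  fps_const (X (u1, u2)) * fps_X ^ W (u1, u2) * (geo (X (u1, u2)) (W (u1, u2)) * geo (X (v1, v2)) (W (v1, v2)))"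
proof -
 have S: "(SUM m<-L. (u1 * x + v1 * y) - m * (u2 * x + v2 * y)) = (SUM m<-L. u1 - m * u2) * x + (SUM m<-L. v1 - m * v2) * y"
  if "set L <= set ms" for L x y
  using that
 proof (induction L)
  case (Cons m L)
  thus ?case using cone_diff[of m u2 u1 v2 v1 x y] assms(3) by (simp add: algebra_simps)
 qed simp
 have "gf UNIV (%s. W (cmap (u1, u2) (v1, v2) s)) (%s. X (cmap (u1, u2) (v1, v2) s)) =
  gf UNIV (%(x, y). W (u1, u2) * x + W (v1, v2) * y + W (u1, u2)) (%(x, y). X (u1, u2) * (X (u1, u2) ^ x * X (v1, v2) ^ y))"
  by (intro gf_cong; clarify) (simp_all only: W_def X_def cmap_def prod.case fst_conv snd_conv cmap_power S order_refl, simp add: algebra_simps)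
 also have "... = fps_const (X (u1, u2)) * fps_X ^ W (u1, u2) * (geo (X (u1, u2)) (W (u1, u2)) * geo (X (v1, v2)) (W (v1, v2)))"
  by (rule gf_geo2) (use assms(1,2) in \<open>simp_all add: W_def\<close>)
 finally show ?thesis .
qed

lemma wk_scale: "(SUM m<-ms. b - m * b) = b * wk ms 1"
proof (induction ms)
 case (Cons m ms)
 have "b - m * b = b * (1 - m)" by (cases m) auto
 thus ?case using Cons by (simp add: wk_def algebra_simps)
qed (simp add: wk_def)

lemma Sg_gf:
 assumes "p > 0"
 shows "gf wedge (%(n, i). n + (SUM m<-ms. n - m * i)) (%(n, i). (of_nat p * al) ^ n * (1 / of_nat p) ^ i) = Sg p al ms"
proof -
 define K where "K = Suc (sum_list ms)"
 have mK: "m <= K" if "m : set ms" for m using member_le_sum_list[OF that] by (simp add: K_def)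
 have R: "(of_nat p * al) ^ t * (1 / of_nat p) ^ 1 = Rc p al t" if "t >= 1" for t
  using assms that by (cases t) (auto simp: Rc_def power_mult_distrib)
 show ?thesis unfolding Sg_def Let_def K_def[symmetric]
 proof (subst cone_decomposition[of K], goal_cases)
  case 3
  show ?case
  proof (intro arg_cong2[of _ _ _ _ "(+)"] sum.cong refl)
   fix t assume t: "t : {1..<K}"
   show "gf UNIV (%s. (%(n, i). n + (SUM m<-ms. n - m * i)) (cmap (t, 1) (Suc t, 1) s))
     (%s. (%(n, i). (of_nat p * al) ^ n * (1 / of_nat p) ^ i) (cmap (t, 1) (Suc t, 1) s)) =
    fps_const (Rc p al t) * fps_X ^ (t + wk ms t) * (geo (Rc p al t) (t + wk ms t) * geo (Rc p al (Suc t)) (Suc t + wk ms (Suc t)))"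
    using R[of t] R[of "Suc t"] t by (subst gf_cone) (simp_all add: wk_def le_Suc_eq, auto)
  next
   show "gf UNIV (%s. (%(n, i). n + (SUM m<-ms. n - m * i)) (cmap (K, 1) (1, 0) s))
     (%s. (%(n, i). (of_nat p * al) ^ n * (1 / of_nat p) ^ i) (cmap (K, 1) (1, 0) s)) =
    fps_const (Rc p al K) * fps_X ^ (K + wk ms K) * (geo (Rc p al K) (K + wk ms K) * geo (of_nat p * al) (1 + length ms))"
    using R[of K] mK by (subst gf_cone) (simp_all add: wk_def sum_list_triv K_def)
  qed
 qed (auto simp: K_def)
qed

text \<open>Shifting i by one moves the wedge to 0 <= i < n. Compared with the wedge itself, the
  column i = 0 is gained and the diagonal i = n is lost; both are geometric series.\<close>

lemma Sg_shift_gf: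
 assumes "p > 0"
 shows "gf wedge (%(n, i). n + (SUM m<-ms. n - m * (i - 1))) (%(n, i). (of_nat p * al) ^ n * (1 / of_nat p) ^ i)
  = fps_const (1 / of_nat p) * (Sg p al ms + geo (of_nat p * al) (1 + length ms) - geo (Rc p al 1) (1 + wk ms 1))"
proof -
 let ?w = "%(n, i). n + (SUM m<-ms. n - m * i)" and ?c = "%(n, i). (of_nat p * al) ^ n * (1 / of_nat p) ^ i :: rat"
 let ?B = "{(n, i). i < n} :: (nat * nat) set"
 let ?D = "(%n. (n, n)) ` {1..} :: (nat * nat) set" and ?Z = "(%n. (n, 0)) ` {1..} :: (nat * nat) set"
 have lf: "locfin S ?w" if "S <= {(n, i). i <= n}" for S using that by (intro locfin_triangle) auto
 have "gf wedge (%(n, i). n + (SUM m<-ms. n - m * (i - 1))) ?c = fps_const (1 / of_nat p) * gf ?B ?w ?c"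
  unfolding gf_cmult by (subst gf_witness[where f = "%(n, i). (n, Suc i)" and g = "%(n, i). (n, i - 1)" and T = ?B])
   (auto simp: wedge_def intro!: gf_cong)
 moreover have "gf ?B ?w ?c = Sg p al ms + gf ?Z ?w ?c - gf ?D ?w ?c"
 proof -
  have "gf ?B ?w ?c + gf ?D ?w ?c = gf (?B Un ?D) ?w ?c" by (rule gf_Un[symmetric]) (auto intro!: lf)
  also have "?B Un ?D = wedge Un ?Z" by (auto simp: wedge_def image_iff Suc_le_eq)
  also have "gf (wedge Un ?Z) ?w ?c = gf wedge ?w ?c + gf ?Z ?w ?c" by (rule gf_Un) (auto simp: wedge_def intro!: lf)
  finally show ?thesis unfolding Sg_gf[OF assms] by (simp add: eq_diff_eq)
 qed
 moreover have "gf ?D ?w ?c = geo (Rc p al 1) (1 + wk ms 1) - 1"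
  unfolding gf_geo_pos[OF le_add1, symmetric] using assms by (subst gf_reindex, simp add: inj_on_def, intro gf_cong)
    (simp_all only: prod.case wk_scale, simp_all add: Rc_def power_mult_distrib power_one_over)
 moreover have "gf ?Z ?w ?c = geo (of_nat p * al) (1 + length ms) - 1" unfolding gf_geo_pos[OF le_add1, symmetric]
  by (subst gf_reindex) (auto simp: inj_on_def sum_list_triv algebra_simps intro!: gf_cong)
 ultimately show ?thesis by simp
qed

text \<open>Removing the points with i = 1 leaves a translate of the wedge by (1,1).\<close>

lemma wedge_peel:
 assumes "!!s. s : wedge ==> w s >= fst s"
 shows "gf wedge w c = gf UNIV (%n. w (Suc n, 1)) (%n. c (Suc n, 1)) +
  gf wedge (%(n, i). w (Suc n, Suc i)) (%(n, i). c (Suc n, Suc i))"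
proof -
 have lf: "locfin {s : wedge. Q s} w" for Q using assms by (intro locfin_triangle) (auto simp: wedge_def)
 have "wedge = {s : wedge. snd s = 1} Un {s : wedge. snd s ~= 1}" by blast
 hence "gf wedge w c = gf {s : wedge. snd s = 1} w c + gf {s : wedge. snd s ~= 1} w c"
  using gf_Un[OF lf lf, of "%s. snd s = 1" "%s. snd s ~= 1" c] by auto
 also have "gf {s : wedge. snd s = 1} w c = gf UNIV (%n. w (Suc n, 1)) (%n. c (Suc n, 1))"
  by (rule gf_witness[where g = "%s. fst s - 1"]) (auto simp: wedge_def)
 also have "gf {s : wedge. snd s ~= 1} w c = gf wedge (%s. w (case s of (n, i) => (Suc n, Suc i))) (%s. c (case s of (n, i) => (Suc n, Suc i)))"
  by (rule gf_witness[where g = "%s. (fst s - 1, snd s - 1)"]) (auto simp: wedge_def)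
 finally show ?thesis by (simp add: case_prod_unfold)
qed

text \<open>Here N = 1 and de = 0, so precision and depth both start at 1, and the sums of
  \<open>cls_simple_zero\<close> are the wedge series without their i = 1 points. The removed points
  of the unshifted series equal the one-dimensional series of \<open>cls_simple_zero\<close> and
  those of the shifted series equal \<open>Ug\<close>, which leaves \<open>Ug\<close> plus the
  difference of the full series.\<close>

theorem cls_root:
 assumes p: "prime p" and sz: "simple_zero p f z 1 0"
  and sw: "!!t b. int p dvd t - z ==> poly f t ~= 0 ==> sw p b I J C t = (SUM m<-ms. b - m * vp p (poly f t))"
 shows "cls p al I J C 1 z = Ug p al (length ms) + Kg p al ms"
proof -
 have p0: "p > 0" using p by (rule prime_gt_0_nat)
 have "sw p b I J C t = (SUM m<-ms. b - m * Suc (vp p (poly f t) - (1 + 0)))"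
  if t: "int p ^ 1 dvd t - z" "poly f t ~= 0" for t b
 proof -
  have "int p dvd poly f t" using simple_zero_dvd_class[OF p sz t(1)] by simp
  hence "1 <= vp p (poly f t)" using t(2) not_dvd_1[OF p] by (intro multiplicity_geI) auto
  thus ?thesis using sw t by simp
 qed
 note cls_simple_zero[OF p sz this, where al = al]
 moreover have "gf wedge (%(n, i). n + (SUM m<-ms. n - m * i)) (%(n, i). (of_nat p * al) ^ n * (1 / of_nat p) ^ i) =
  gf UNIV (%n. 1 + n + (SUM m<-ms. 1 + n - m * Suc 0)) (%n. al ^ 1 * (of_nat p * al) ^ n) +
  gf wedge (%(n, i). 1 + n + (SUM m<-ms. 1 + n - m * Suc i)) (%(n, i). al ^ 1 * ((of_nat p * al) ^ n * (1 / of_nat p) ^ i))"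
  using p0 by (subst wedge_peel) (auto intro!: arg_cong2[of _ _ _ _ "(+)"] gf_cong)
 moreover have "gf wedge (%(n, i). n + (SUM m<-ms. n - m * (i - 1))) (%(n, i). (of_nat p * al) ^ n * (1 / of_nat p) ^ i) =
  gf UNIV (%n. 1 + n + length ms * (1 + n)) (%n. al ^ 1 * (of_nat p * al) ^ n) +
  gf wedge (%(n, i). 1 + n + (SUM m<-ms. 1 + n - m * Suc (i - 1))) (%(n, i). al ^ 1 * ((of_nat p * al) ^ n * (1 / of_nat p) ^ i))"
  using p0 by (subst wedge_peel) (auto simp: wedge_def sum_list_triv dest!: Suc_le_D intro!: arg_cong2[of _ _ _ _ "(+)"] gf_cong)
 ultimately show ?thesis unfolding Kg_def Sg_gf[OF p0] Sg_shift_gf[OF p0] Ug_gf by (simp add: algebra_simps)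
qed

section \<open>Kernels modulo p^b and their index\<close>

text \<open>Lagrange: adding x permutes the cosets, so summing r + x - (representative of r + x)
  over all representatives r leaves |A:B| copies of x.\<close>

lemma idx_pos_sum_mem:
 fixes x :: "'a::ab_group_add"
 assumes "addsub A" "addsub B" "idx A B > 0" "x : A"
 obtains R :: "'a set" where "finite R" "card R = idx A B" "(SUM r:R. x) : B"
proof -
 obtain R where R: "transv A B R" "finite R" "card R = idx A B" using idx_pos_finite_transv[OF assms(1-3)] .
 have RA: "R <= A" and ex1: "!!a. a : A ==> EX! r. r : R & a - r : B" using R(1) by (auto simp: transv_def)
 define sm where "sm r = (THE r'. r' : R & (r + x) - r' : B)" for r
 have sm: "sm r : R" "(r + x) - sm r : B" if "r : R" for r
  using theI'[OF ex1[of "r + x"]] that RA addsub_add[OF assms(1) _ assms(4)] unfolding sm_def by blast+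
 have inj: "inj_on sm R"
 proof (rule inj_onI)
  fix r s assume rs: "r : R" "s : R" "sm r = sm s"
  have "((r + x) - sm r) - ((s + x) - sm s) : B" by (rule addsub_diff[OF assms(2) sm(2)[OF rs(1)] sm(2)[OF rs(2)]])
  hence "r - s : B" using rs(3) by simp
  moreover have "r - r : B" using addsub_zero[OF assms(2)] by simp
  ultimately show "r = s" using ex1[of r] rs RA by blast
 qed
 have "sm ` R = R" using inj sm(1) R(2) by (intro endo_inj_surj) auto
 hence s: "(SUM r:R. sm r) = (SUM r:R. r)" using sum.reindex[OF inj, of "%r. r"] by simp
 have "(SUM r:R. (r + x) - sm r) : B" using sm(2) by (intro addsub_sum assms(2))
 also have "(SUM r:R. (r + x) - sm r) = (SUM r:R. x)" using s by (simp add: sum.distrib sum_subtractf)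
 finally have f: "(SUM r:R. x) : B" .
 show ?thesis by (rule that[OF R(2,3) f])
qed

lemma sum_const_zs: "(SUM r:R. x) = zs (int (card R)) x" if "finite R" for x :: "nat => int"
 by (rule ext) (simp add: sum_fun_apply zs_def)

lemma sum_const_pair: "(SUM r:R. x) = (int (card R) * fst x, int (card R) * snd x)" for x :: "int * int"
 by (simp add: prod_eq_iff fst_sum snd_sum)

lemma idx_zs_mem:
 assumes "addsub A" "addsub B" "idx A B > 0" "x : A" shows "zs (int (idx A B)) x : B"
 using idx_pos_sum_mem[OF assms] sum_const_zs by metis

lemma idx_UNIV_int:
 assumes "m > 0" shows "idx (UNIV :: int set) {x. int m dvd x} = m"
proof -
 have s: "addsub {x. int m dvd x}" by (auto simp: addsub_def)
 have "transv UNIV {x. int m dvd x} {0..<int m}" unfolding transv_def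
 proof (intro conjI ballI)
  fix a :: int
  show "EX! r. r : {0..<int m} & a - r : {x. int m dvd x}"
  proof (rule ex1I[of _ "a mod int m"])
   show "a mod int m : {0..<int m} & a - a mod int m : {x. int m dvd x}" using assms by auto
   fix r assume "r : {0..<int m} & a - r : {x. int m dvd x}"
   thus "r = a mod int m" by (auto simp: mod_eq_dvd_iff[symmetric])
  qed
 qed simp
 thus ?thesis using idx_transv[OF addsub_UNIV s] by fastforce
qed

definition ker_mod :: "nat => nat => nat => nat => (nat => nat => int) => (nat => int) set" where
 "ker_mod p b n r c = {x : Zd r. ALL i<n. int p ^ b dvd (SUM j<r. c i j * x j)}"

lemma addsub_ker_mod: "addsub (ker_mod p b n r c)"
 unfolding addsub_def ker_mod_def using addsub_zero[OF addsub_Zd, of r] addsub_diff[OF addsub_Zd, of _ r]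
 by (auto simp: right_diff_distrib sum_subtractf)

text \<open>The chain p^b Z^r, kernel, Z^r: the upper index is the one wanted, the lower one counts
  solutions modulo p^b.\<close>

lemma idx_ker_mod_card:
 assumes p: "prime p"
 shows "idx (Zd r) (ker_mod p b n r c) * card (sols p b {..<n} {..<r} (%i j. of_int (c i j))) = p ^ (b * r)"
proof -
 let ?X = "ker_mod p b n r c" and ?P = "int p ^ b" and ?S = "sols p b {..<n} {..<r} (%i j. of_int (c i j))"
 have p0: "p > 0" using p by (rule prime_gt_0_nat)
 have P0: "?P > 0" using p0 by simp
 have sub: "zs ?P ` Zd r <= ?X"
 proof
  fix y assume "y : zs ?P ` Zd r"
  hence "y : Zd r" "!!i. ?P dvd y i" using multiples_Zd[of ?P y r] P0 by auto
  thus "y : ?X" by (auto simp: ker_mod_def intro!: dvd_sum dvd_mult)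
 qed
 have XZ: "?X <= Zd r" by (auto simp: ker_mod_def)
 let ?R = "{x : ?X. ALL j<r. 0 <= x j & x j < ?P}"
 have "idx ?X (zs ?P ` Zd r) = card ?R" by (rule idx_box[OF P0 addsub_ker_mod XZ sub])
 also have "bij_betw (%x. restrict x {..<r}) ?R ?S"
 proof (rule bij_betw_byWitness[where f' = "%f i. if i < r then f i else 0"])
  have eq: "pdvd p (of_nat p ^ b) (SUM j<r. of_int (c i j) * of_int (x j)) \<longleftrightarrow> ?P dvd (SUM j<r. c i j * x j)" for i x
   using pdvd_of_int[OF p, of b "SUM j<r. c i j * x j"] by simp
  show "(%x. restrict x {..<r}) ` ?R <= ?S"
  proof (rule image_subsetI)
   fix x assume x: "x : ?R"
   have "(SUM j<r. c i j * restrict x {..<r} j) = (SUM j<r. c i j * x j)" for i by (intro sum.cong) auto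
   moreover have "restrict x {..<r} : {..<r} \<rightarrow>\<^sub>E {0..<?P}"
    using x by (intro restrict_PiE_iff[THEN iffD2]) auto
   ultimately show "restrict x {..<r} : ?S" using x by (simp add: sols_def ker_mod_def eq del: restrict_apply)
  qed
  show "(%f i. if i < r then f i else 0) ` ?S <= ?R" by (auto simp: sols_def ker_mod_def eq Zd_def)
 qed (auto simp: Zd_def ker_mod_def sols_def fun_eq_iff PiE_def extensional_def)
 hence "card ?R = card ?S" by (rule bij_betw_same_card)
 finally have "idx ?X (zs ?P ` Zd r) = card ?S" .
 moreover have "idx (Zd r) (zs ?P ` Zd r) = idx (Zd r) ?X * idx ?X (zs ?P ` Zd r)"
  by (rule idx_mult[OF addsub_Zd addsub_ker_mod addsub_mult[OF addsub_Zd] sub XZ])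
 moreover have "idx (Zd r) (zs ?P ` Zd r) = p ^ (b * r)" using idx_Zd_mult[of "p ^ b" r] p0 by (simp add: power_mult)
 ultimately show ?thesis by simp
qed

lemma idx_ker_mod:
 assumes p: "prime p"
 shows "idx (Zd r) (ker_mod p b n r (%i j. poly (C i j) t)) = p ^ sw p b {..<n} {..<r} C t"
proof -
 let ?i = "idx (Zd r) (ker_mod p b n r (%i j. poly (C i j) t))"
 let ?s = "nsol p b {..<n} {..<r} C t"
 have eq: "?i * ?s = p ^ (b * r)" by (rule idx_ker_mod_card[OF p])
 have mu: "multiplicity p (p ^ k) = k" for k
  using p prime_gt_0_nat not_prime_unit by (intro multiplicity_same_power) auto
 have "?i dvd p ^ (b * r)" "?s dvd p ^ (b * r)" unfolding eq[symmetric] by simp_all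
 then obtain k l where kl: "?i = p ^ k" "?s = p ^ l" unfolding divides_primepow_nat[OF p] by blast
 hence "p ^ (k + l) = p ^ (b * r)" using eq by (simp add: power_add)
 hence "k + l = b * r" using p prime_gt_1_nat power_inject_exp by blast
 hence "sw p b {..<n} {..<r} C t = k" unfolding sw_def kl(2) mu by simp
 thus ?thesis using kl by simp
qed

section \<open>Sublattices of Z^2 of p-power index\<close>

text \<open>The kernel of a surjection of Z^2 onto Z/p^b, that is, a point of the projective line
  over Z/p^b; \<open>s\<close> selects one of the two affine charts.\<close>

definition M0 :: "nat => bool => nat => int => (int * int) set" where
 "M0 p s b t = {(u, v). int p ^ b dvd (if s then u + t * v else t * u + v)}"

definition sc2 :: "int => int * int => int * int" where "sc2 m x = (m * fst x, m * snd x)"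

text \<open>Each point of each projective line over Z/p^b once: the second chart covers only t
  divisible by p, and the single point with b = 0 is assigned to the first chart.\<close>

definition pts :: "nat => (bool * nat * int) set" where
 "pts p = {(s, b, t). t : {0..<int (p ^ b)} & (s --> b >= 1 & int p dvd t)}"

lemma addsub_M0: "addsub (M0 p s b t)"
proof -
 have "int p ^ b dvd (u - u') + t * (v - v')" if "int p ^ b dvd u + t * v" "int p ^ b dvd u' + t * v'" for u u' v v'
  using dvd_diff[OF that] by (simp add: algebra_simps)
 moreover have "int p ^ b dvd t * (u - u') + (v - v')" if "int p ^ b dvd t * u + v" "int p ^ b dvd t * u' + v'" for u u' v v'
  using dvd_diff[OF that] by (simp add: algebra_simps)
 ultimately show ?thesis by (auto simp: M0_def addsub_def zero_prod_def)
qed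

lemma addsub_sc2: "addsub M ==> addsub (sc2 m ` M)"
proof -
 assume M: "addsub M"
 have h: "sc2 m x - sc2 m y = sc2 m (x - y)" "sc2 m 0 = 0" for x y
  by (simp_all add: sc2_def algebra_simps prod_eq_iff)
 show ?thesis unfolding addsub_def
 proof (intro conjI ballI)
  show "0 : sc2 m ` M" using imageI[OF addsub_zero[OF M], of "sc2 m"] h(2) by (simp only:)
  fix x y assume "x : sc2 m ` M" "y : sc2 m ` M"
  then obtain x' y' where xy: "x = sc2 m x'" "x' : M" "y = sc2 m y'" "y' : M" by blast
  show "x - y : sc2 m ` M" unfolding xy(1,3) h(1) using addsub_diff[OF M xy(2,4)] by (rule imageI)
 qed
qed

lemma sc2_mem: "addsub M ==> x : M ==> sc2 k x : M"
proof -
 assume M: "addsub M" "x : M"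
 have N: "sc2 (int n) x : M" for n
 proof (induction n)
  case 0
  have "sc2 (int 0) x = 0" by (simp add: sc2_def zero_prod_def)
  thus ?case using addsub_zero[OF M(1)] by (simp only:)
 next
  case (Suc n)
  have "sc2 (int (Suc n)) x = x + sc2 (int n) x" by (simp add: sc2_def prod_eq_iff algebra_simps)
  thus ?case using addsub_add[OF M Suc] by (simp only:)
 qed
 show ?thesis
 proof (cases "k >= 0")
  case True thus ?thesis using N[of "nat k"] by simp
 next
  case False
  have "sc2 k x = - sc2 (int (nat (- k))) x" using False by (simp add: sc2_def prod_eq_iff)
  thus ?thesis using addsub_minus[OF M(1) N] by (simp only:)
 qed
qed

lemma idx_M0:
 assumes "p > 0" shows "idx UNIV (M0 p s b t) = p ^ b"
proof -
 let ?f = "%x. if s then fst x + t * snd x else t * fst x + snd x"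
 have d: "addsub {x::int. int (p ^ b) dvd x}" by (auto simp: addsub_def)
 have "range ?f = UNIV"
 proof (rule equalityI; rule subsetI)
  fix y :: int
  have "?f (if s then (y, 0) else (0, y)) = y" by simp
  thus "y : range ?f" using rangeI[of ?f "if s then (y, 0) else (0, y)"] by simp
 qed simp
 hence "idx UNIV {x : UNIV. ?f x : {x. int (p ^ b) dvd x}} = idx (UNIV :: int set) {x. int (p ^ b) dvd x}"
  by (intro idx_hom addsub_UNIV d) (auto simp: algebra_simps)
 also have "{x : UNIV. ?f x : {x. int (p ^ b) dvd x}} = M0 p s b t" by (auto simp: M0_def)
 finally show ?thesis using idx_UNIV_int[of "p ^ b"] assms by simp
qed

lemma idx_sc2_UNIV:
 assumes "m > 0" shows "idx UNIV (range (sc2 (int m))) = m ^ 2"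
proof -
 have mem: "y : range (sc2 (int m)) \<longleftrightarrow> int m dvd fst y & int m dvd snd y" for y
 proof
  assume "int m dvd fst y & int m dvd snd y"
  hence "y = sc2 (int m) (fst y div int m, snd y div int m)" by (simp add: sc2_def prod_eq_iff)
  thus "y : range (sc2 (int m))" by blast
 qed (auto simp: sc2_def)
 have s: "addsub (range (sc2 (int m)))" by (rule addsub_sc2) simp
 have "transv UNIV (range (sc2 (int m))) ({0..<int m} \<times> {0..<int m})" unfolding transv_def
 proof (intro conjI ballI)
  fix a :: "int * int"
  show "EX! r. r : {0..<int m} \<times> {0..<int m} & a - r : range (sc2 (int m))"
  proof (rule ex1I[of _ "(fst a mod int m, snd a mod int m)"])
   show "(fst a mod int m, snd a mod int m) : {0..<int m} \<times> {0..<int m} & a - (fst a mod int m, snd a mod int m) : range (sc2 (int m))"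
    unfolding mem using assms by auto
   fix r assume "r : {0..<int m} \<times> {0..<int m} & a - r : range (sc2 (int m))"
   thus "r = (fst a mod int m, snd a mod int m)" unfolding mem by (auto simp: prod_eq_iff mod_eq_dvd_iff[symmetric])
  qed
 qed simp
 thus ?thesis using idx_transv[OF addsub_UNIV s] by (fastforce simp: card_cartesian_product power2_eq_square)
qed

lemma idx_sc2_image:
 assumes "addsub B" "k ~= 0" shows "idx (range (sc2 k)) (sc2 k ` B) = idx UNIV B"
proof -
 have inj: "sc2 k x = sc2 k y ==> x = y" for x y using assms(2) by (simp add: sc2_def prod_eq_iff)
 have "{x : UNIV. sc2 k x : sc2 k ` B} = B" using inj by auto
 thus ?thesis using idx_hom[OF addsub_UNIV addsub_sc2[OF addsub_UNIV] addsub_sc2[OF assms(1)], of "sc2 k" k k]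
  by (simp add: sc2_def algebra_simps prod_eq_iff)
qed

lemma idx_sc2_M0:
 assumes "p > 0" shows "idx UNIV (sc2 (int p ^ a) ` M0 p s b t) = p ^ (2 * a + b)"
proof -
 have "idx UNIV (sc2 (int p ^ a) ` M0 p s b t) =
  idx UNIV (range (sc2 (int p ^ a))) * idx (range (sc2 (int p ^ a))) (sc2 (int p ^ a) ` M0 p s b t)"
  by (intro idx_mult addsub_UNIV addsub_sc2 addsub_M0) auto
 also have "idx UNIV (range (sc2 (int p ^ a))) = p ^ (2 * a)"
  using idx_sc2_UNIV[of "p ^ a"] assms by (simp add: power_mult mult.commute[of 2])
 also have "idx (range (sc2 (int p ^ a))) (sc2 (int p ^ a) ` M0 p s b t) = p ^ b"
  using idx_sc2_image[OF addsub_M0, of "int p ^ a" p s b t] idx_M0[OF assms] assms by simp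
 finally show ?thesis by (simp add: power_add)
qed

lemma sc2_M0_le:
 assumes "prime p" and eq: "sc2 (int p ^ a) ` M0 p s b t = sc2 (int p ^ a') ` M0 p s' b' t'"
 shows "a <= a'"
proof -
 have "(if s' then (- t', 1) else (1, - t')) : M0 p s' b' t'" by (auto simp: M0_def)
 hence "sc2 (int p ^ a') (if s' then (- t', 1) else (1, - t')) : sc2 (int p ^ a) ` M0 p s b t"
  unfolding eq by (rule imageI)
 then obtain y where y: "sc2 (int p ^ a') (if s' then (- t', 1) else (1, - t')) = sc2 (int p ^ a) y" by blast
 have "int p ^ a' = int p ^ a * (if s' then snd y else fst y)" using y by (simp add: sc2_def split: if_splits)
 hence "int p ^ a dvd int p ^ a'" by simp
 thus ?thesis using not_dvd_1[OF assms(1)] assms(1) prime_gt_0_nat[OF assms(1)] by (simp add: dvd_power_iff)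
qed

text \<open>The power of p that divides M determines a and the index determines b. A test vector
  such as (1,-t) recovers t modulo p^b; for different charts it would make t t' congruent to 1
  although p divides it.\<close>

lemma M0_inj:
 assumes p: "prime p" and x: "(s, b, t) : pts p" "(s', b', t') : pts p"
  and eq: "sc2 (int p ^ a) ` M0 p s b t = sc2 (int p ^ a') ` M0 p s' b' t'"
 shows "a = a' & (s, b, t) = (s', b', t')"
proof -
 have p0: "p > 0" using p by (rule prime_gt_0_nat)
 have h: "t : {0..<int (p ^ b)}" "s --> b >= 1 & int p dvd t" "t' : {0..<int (p ^ b')}" "s' --> b' >= 1 & int p dvd t'"
  using x by (auto simp: pts_def)
 have a: "a = a'" using sc2_M0_le[OF p eq] sc2_M0_le[OF p eq[symmetric]] by simp
 have inj: "inj (sc2 (int p ^ a'))" using p0 by (auto simp: inj_def sc2_def prod_eq_iff)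
 hence M: "M0 p s b t = M0 p s' b' t'" using eq unfolding a by (simp add: inj_image_eq_iff)
 have "p ^ b = p ^ b'" using idx_M0[OF p0, of s b t] idx_M0[OF p0, of s' b' t'] M by simp
 hence b: "b = b'" using p prime_gt_1_nat power_inject_exp by blast
 have rng: "t = t'" if "int p ^ b dvd t - t'"
 proof -
  have "t mod int p ^ b = t' mod int p ^ b" using that by (simp add: mod_eq_dvd_iff)
  thus ?thesis using h b by simp
 qed
 have no: False if "int p ^ b dvd 1 - t * t'" "b >= 1" "int p dvd t * t'"
 proof -
  have "int p dvd 1 - t * t'" using power_le_dvd[OF that(1), of 1] that(2) by simp
  hence "int p dvd (1 - t * t') + t * t'" using that(3) by (rule dvd_add)
  thus False using not_dvd_1[OF p] by simp
 qed
 show ?thesis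
 proof (cases s; cases s')
  assume s: "s" "s'"
  have "(- t, 1) : M0 p s b t" using s by (simp add: M0_def)
  hence "int p ^ b dvd t' - t" unfolding M using s b by (simp add: M0_def)
  thus ?thesis using rng s a b by (simp add: dvd_diff_commute)
 next
  assume s: "s" "~ s'"
  have "(- t, 1) : M0 p s b t" using s by (simp add: M0_def)
  hence "int p ^ b dvd 1 - t * t'" unfolding M using s b by (simp add: M0_def mult.commute)
  thus ?thesis using no h s by simp
 next
  assume s: "~ s" "s'"
  have "(1, - t) : M0 p s b t" using s by (simp add: M0_def)
  hence "int p ^ b dvd 1 - t * t'" unfolding M using s b by (simp add: M0_def mult.commute)
  thus ?thesis using no h s b by simp
 next
  assume s: "~ s" "~ s'"
  have "(1, - t) : M0 p s b t" using s by (simp add: M0_def)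
  hence "int p ^ b dvd t' - t" unfolding M using s b by (simp add: M0_def)
  thus ?thesis using rng s a b by (simp add: dvd_diff_commute)
 qed
qed

lemma M0_mod: "M0 p s b (t mod int p ^ b) = M0 p s b t"
proof -
 have "int p ^ b dvd x + (t mod int p ^ b) * y \<longleftrightarrow> int p ^ b dvd x + t * y" for x y
 proof -
  have "x + t * y = (x + (t mod int p ^ b) * y) + int p ^ b * (t div int p ^ b * y)"
   by (metis (no_types, lifting) add.assoc distrib_right mod_mult_div_eq mult.assoc)
  thus ?thesis by (metis dvd_add_left_iff dvd_triv_left)
 qed
 thus ?thesis by (auto simp: M0_def add.commute)
qed

lemma dvd_prime_power_int:
 assumes "prime p" "m >= 0" "m dvd int p ^ n" obtains b where "m = int p ^ b"
proof -
 have "nat m dvd p ^ n" using assms(2,3) by (metis int_dvd_int_iff nat_0_le of_nat_power)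
 then obtain b where "nat m = p ^ b" using divides_primepow_nat[OF assms(1)] by blast
 thus ?thesis using that assms(2) by (metis nat_0_le of_nat_power)
qed

text \<open>A vector with first coordinate prime to p may be scaled to (1,c) modulo the multiples of
  p^n lying in M. M is then determined by its vectors (0,y), and these y form a group p^b Z.\<close>

lemma M0_unit_row:
 assumes p: "prime p" and M: "addsub M" and n: "sc2 (int p ^ n) (1, 0) : M" "sc2 (int p ^ n) (0, 1) : M"
  and uv: "(u, v) : M" "~ int p dvd u"
 obtains b t where "M = M0 p False b t"
proof -
 have "coprime u (int p ^ n)" using prime_imp_coprime[of "int p" u] p uv(2) by (simp add: coprime_commute)
 then obtain w where "[u * w = 1] (mod int p ^ n)" using coprime_iff_invertible_int by blast
 then obtain z where z: "u * w - 1 = int p ^ n * z" by (auto simp: cong_iff_dvd_diff dvd_def)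
 have "sc2 w (u, v) - sc2 z (sc2 (int p ^ n) (1, 0)) : M"
  by (intro addsub_diff[OF M sc2_mem[OF M] sc2_mem[OF M]] uv n)
 also have "sc2 w (u, v) - sc2 z (sc2 (int p ^ n) (1, 0)) = (1, w * v)" using z by (simp add: sc2_def algebra_simps)
 finally have one: "(1, w * v) : M" .
 have "addsub {y. (0, y) : M}" using addsub_zero[OF M] addsub_diff[OF M] unfolding addsub_def
  by (auto simp: zero_prod_def) (metis cancel_comm_monoid_add_class.diff_cancel diff_Pair)
 then obtain m where m: "m >= 0" "{y. (0, y) : M} = {x. m dvd x}" by (rule addsub_int)
 have "m dvd int p ^ n" using n(2) m(2) by (auto simp: sc2_def)
 then obtain b where b: "m = int p ^ b" using dvd_prime_power_int[OF p m(1)] by blast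
 have "M = M0 p False b (- (w * v))"
 proof (rule Set.set_eqI)
  fix x :: "int * int"
  obtain x1 x2 where x: "x = (x1, x2)" by (cases x)
  have s: "sc2 x1 (1, w * v) : M" by (rule sc2_mem[OF M one])
  have e: "x - sc2 x1 (1, w * v) = (0, x2 - x1 * (w * v))" using x by (simp add: sc2_def)
  have "x : M \<longleftrightarrow> (0, x2 - x1 * (w * v)) : M"
   using addsub_diff[OF M _ s, of x] addsub_add[OF M _ s, of "x - sc2 x1 (1, w * v)"] unfolding e[symmetric] by auto
  also have "... \<longleftrightarrow> int p ^ b dvd x2 - x1 * (w * v)" using m(2) b by auto
  also have "... \<longleftrightarrow> x : M0 p False b (- (w * v))" using x by (simp add: M0_def algebra_simps)
  finally show "x : M \<longleftrightarrow> x : M0 p False b (- (w * v))" .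
 qed
 thus ?thesis using that by blast
qed

lemma M0_swap: "prod.swap ` M0 p False b t = M0 p True b t" by (force simp: M0_def image_iff add.commute)

text \<open>Divide M by the largest power of p that divides all its vectors; some coordinate of some
  vector is then prime to p. If this never happens for the first coordinate, exchange the
  coordinates; that also gives p dividing t and b >= 1.\<close>

lemma M0_surj:
 assumes p: "prime p" and M: "addsub M" "idx UNIV M = p ^ n"
 obtains a s b t where "(s, b, t) : pts p" "M = sc2 (int p ^ a) ` M0 p s b t"
proof -
 have p0: "p > 0" using p by (rule prime_gt_0_nat)
 have P0: "int p ^ k > 0" for k using p0 by simp
 have all: "sc2 (int p ^ n) x : M" for x
 proof -
  have "idx UNIV M > 0" using M(2) p0 by simp
  then obtain R :: "(int * int) set" where "finite R" "card R = idx UNIV M" "(SUM r:R. x) : M"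
   using idx_pos_sum_mem[OF addsub_UNIV M(1) _ UNIV_I, of x] by blast
  thus ?thesis using M(2) by (simp add: sum_const_pair sc2_def)
 qed
 define D where "D k \<longleftrightarrow> (ALL x:M. int p ^ k dvd fst x & int p ^ k dvd snd x)" for k
 have D0: "D 0" by (simp add: D_def)
 have "k <= n" if "D k" for k
 proof -
  have "int p ^ k dvd int p ^ n" using that all[of "(1, 0)"] unfolding D_def by (force simp: sc2_def)
  thus ?thesis using not_dvd_1[OF p] p0 by (simp add: dvd_power_iff)
 qed
 then obtain a where a: "D a" "~ D (Suc a)" using D0 by (metis not_less_eq_eq nat_induct)
 define M1 where "M1 = {y. sc2 (int p ^ a) y : M}"
 have sM1: "addsub M1"
 proof -
  have h: "sc2 (int p ^ a) (x - y) = sc2 (int p ^ a) x - sc2 (int p ^ a) y" "sc2 (int p ^ a) 0 = 0" for x y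
   by (simp_all add: sc2_def algebra_simps zero_prod_def)
  show ?thesis unfolding addsub_def M1_def mem_Collect_eq h using addsub_zero[OF M(1)] addsub_diff[OF M(1)] by blast
 qed
 have MM1: "M = sc2 (int p ^ a) ` M1"
 proof (rule equalityI; rule subsetI)
  fix x assume x: "x : M"
  have e: "sc2 (int p ^ a) (fst x div int p ^ a, snd x div int p ^ a) = x"
   using a(1) x by (auto simp: D_def sc2_def prod_eq_iff)
  have "(fst x div int p ^ a, snd x div int p ^ a) : M1" unfolding M1_def mem_Collect_eq e using x .
  from imageI[OF this, of "sc2 (int p ^ a)"] show "x : sc2 (int p ^ a) ` M1" by (simp only: e)
 qed (auto simp: M1_def)
 have all1: "sc2 (int p ^ n) x : M1" for x using sc2_mem[OF M(1) all[of x], of "int p ^ a"] by (simp add: M1_def)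
 have ex: "EX (u, v):M1. ~ int p dvd u | ~ int p dvd v"
 proof (rule ccontr)
  assume "~ ?thesis"
  hence *: "int p dvd fst y & int p dvd snd y" if "y : M1" for y using that by auto
  have "D (Suc a)" unfolding D_def MM1 using * by (auto simp: sc2_def mult.commute[of "int p"] mult_dvd_mono)
  thus False using a(2) by blast
 qed
 have pts: "(s, b, t mod int p ^ b) : pts p" if "s --> b >= 1 & int p dvd t" for s b t
 proof -
  have "t mod int p ^ b : {0..<int (p ^ b)}" using pos_mod_sign[OF P0] pos_mod_bound[OF P0] by simp
  moreover have "int p dvd t mod int p ^ b" if "b >= 1" "int p dvd t"
   using that by (intro dvd_mod) (auto intro: dvd_power)
  ultimately show ?thesis using that by (auto simp: pts_def)
 qed
 show ?thesis
 proof (cases "EX (u, v):M1. ~ int p dvd u")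
  case True
  then obtain u v where "(u, v) : M1" "~ int p dvd u" by blast
  then obtain b t where bt: "M1 = M0 p False b t" using M0_unit_row[OF p sM1 all1 all1] by blast
  show ?thesis by (rule that[of False b "t mod int p ^ b" a]) (use pts[of False b t] bt MM1 M0_mod in simp_all)
 next
  case False
  then obtain u v where uv: "(u, v) : M1" "~ int p dvd v" using ex by blast
  let ?M = "prod.swap ` M1"
  have s: "addsub ?M" unfolding addsub_def
  proof (intro conjI ballI)
   show "0 : ?M" using imageI[OF addsub_zero[OF sM1], of prod.swap] by (simp add: zero_prod_def)
   fix x y assume "x : ?M" "y : ?M"
   then obtain x' y' where xy: "x = prod.swap x'" "x' : M1" "y = prod.swap y'" "y' : M1" by blast
   have "x - y = prod.swap (x' - y')" unfolding xy by (simp add: prod_eq_iff)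
   thus "x - y : ?M" using addsub_diff[OF sM1 xy(2,4)] by blast
  qed
  have sw: "sc2 (int p ^ n) x : ?M" for x
  proof -
   have "prod.swap (sc2 (int p ^ n) (prod.swap x)) : ?M" using all1 by (rule imageI)
   thus ?thesis by (simp add: sc2_def)
  qed
  have "(v, u) : ?M" using uv(1) by (force simp: image_iff)
  then obtain b t where bt: "?M = M0 p False b t" using M0_unit_row[OF p s sw sw] uv(2) by blast
  have M1: "M1 = M0 p True b t" unfolding M0_swap[symmetric] bt[symmetric] by (simp add: image_image)
  have "(- t, 1) : M1" unfolding M1 by (simp add: M0_def)
  hence "int p dvd t" using False by auto
  moreover have "b >= 1"
  proof (rule ccontr)
   assume "~ b >= 1"
   hence "b = 0" by simp
   hence "(1, 0) : M1" unfolding M1 by (simp add: M0_def)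
   thus False using False not_dvd_1[OF p] by auto
  qed
  ultimately show ?thesis
   by (intro that[of True b "t mod int p ^ b" a]) (use pts[of True b t] M1 MM1 M0_mod in simp_all)
 qed
qed

section \<open>Counting sublattices of Z^d\<close>

definition subs :: "nat => nat => nat => (nat => int) set set" where
 "subs d p n = {K. addsub K & K <= Zd d & idx (Zd d) K = p ^ n}"

text \<open>For a lattice K in Z^d and v in Z^d, the lattice in Z^(d+1) spanned by K and v + m e_d,
  in a form where membership can be tested.\<close>

definition ext :: "nat => (nat => int) set => int => (nat => int) => (nat => int) set" where
 "ext d K m v = {y : Zd (Suc d). m dvd y d & y - zs (y d div m) (v + zs m (ev d)) : K}"

lemma Zd_Suc_iff: "x : Zd n \<longleftrightarrow> x : Zd (Suc n) & x n = 0"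
 using Zd_Suc[of x n] Zd_mono[of n "Suc n"] by (auto simp: Zd_def)

lemma ext_props:
 assumes K: "addsub K" "K <= Zd d" and m: "m > 0" and v: "v : Zd d"
 shows "addsub (ext d K (int m) v)" "ext d K (int m) v Int Zd d = K"
  "(%y. y d) ` ext d K (int m) v = {x. int m dvd x}" "v + zs (int m) (ev d) : ext d K (int m) v"
  "idx (Zd (Suc d)) (ext d K (int m) v) = m * idx (Zd d) K"
proof -
 let ?E = "ext d K (int m) v" and ?w = "v + zs (int m) (ev d)"
 let ?B = "{y : Zd (Suc d). y d : {x. int m dvd x}}"
 define g where "g y = y - zs (y d div int m) ?w" for y :: "nat => int"
 have E: "?E = {y : ?B. g y : K}" by (auto simp: ext_def g_def)
 have wd: "?w d = int m" using v by (simp add: Zd_def zs_def ev_def)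
 have wZ: "?w : Zd (Suc d)"
 proof -
  have "v : Zd (Suc d)" using v Zd_mono[of d "Suc d"] by auto
  thus ?thesis by (rule addsub_add[OF addsub_Zd _ zs_Zd[OF ev_Zd[OF lessI]]])
 qed
 have dm: "addsub {x. int m dvd x}" by (auto simp: addsub_def)
 have sB: "addsub ?B"
  unfolding addsub_def using addsub_zero[OF addsub_Zd, of "Suc d"] addsub_diff[OF addsub_Zd, of _ "Suc d"] by auto
 have gsub: "g (x - y) = g x - g y" if "x : ?B" "y : ?B" for x y
 proof -
  have "(x d - y d) div int m = x d div int m - y d div int m" using that by (auto elim!: dvdE simp flip: right_diff_distrib)
  hence q: "(x - y) d div int m = x d div int m - y d div int m" by simp
  show ?thesis unfolding g_def q zs_simps(4) by simp
 qed
 have gZ: "g y : Zd d" if "y : ?B" for y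
 proof -
  have "g y : Zd (Suc d)" unfolding g_def using that by (intro addsub_diff[OF addsub_Zd _ zs_Zd[OF wZ]]) simp
  moreover have "g y d = 0" using that wd m by (simp add: g_def zs_def)
  ultimately show ?thesis using Zd_Suc_iff by blast
 qed
 have gid: "g y = y" "y : ?B" if "y : Zd d" for y
 proof -
  have y: "y : Zd (Suc d)" "y d = 0" using that Zd_Suc_iff by blast+
  show "g y = y" by (rule ext) (simp add: g_def y(2) zs_def)
  show "y : ?B" using y by simp
 qed
 have gim: "g ` ?B = Zd d"
 proof (rule equalityI; rule subsetI)
  fix y assume "y : Zd d"
  hence "y = g y" "y : ?B" using gid by simp_all
  thus "y : g ` ?B" by (rule image_eqI)
 qed (use gZ in blast)
 show sE: "addsub ?E" unfolding addsub_def
 proof (intro conjI ballI)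
  have "g 0 = 0" using gid(1)[OF addsub_zero[OF addsub_Zd]] .
  thus "0 : ?E" unfolding E using addsub_zero[OF sB] addsub_zero[OF K(1)] by (simp only: mem_Collect_eq)
  fix x y assume "x : ?E" "y : ?E"
  hence h: "x : ?B" "y : ?B" "g x : K" "g y : K" unfolding E by blast+
  show "x - y : ?E" unfolding E
   using addsub_diff[OF sB h(1,2)] gsub[OF h(1,2)] addsub_diff[OF K(1) h(3,4)] by (simp only: mem_Collect_eq)
 qed
 show "?E Int Zd d = K"
 proof (rule equalityI; rule subsetI)
  fix y assume "y : ?E Int Zd d"
  thus "y : K" unfolding E using gid(1)[of y] by auto
 next
  fix y assume y: "y : K"
  hence yZ: "y : Zd d" using K(2) by blast
  show "y : ?E Int Zd d" unfolding E using gid[OF yZ] y yZ by (simp only: Int_iff mem_Collect_eq)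
 qed
 have gw: "g ?w = 0" using wd m by (simp add: g_def zs_simps)
 have wB: "?w : ?B" using wZ wd by (simp only: mem_Collect_eq) simp
 show wE: "?w : ?E" unfolding E using wB gw addsub_zero[OF K(1)] by (simp only: mem_Collect_eq)
 show "(%y. y d) ` ?E = {x. int m dvd x}"
 proof (rule equalityI; rule subsetI)
  fix x assume "x : {x. int m dvd x}"
  then obtain k where k: "x = k * int m" by (auto simp: dvd_def mult.commute)
  have "zs k ?w d = x" unfolding zs_apply wd k ..
  moreover have "zs k ?w : ?E" by (rule addsub_zs[OF sE wE])
  ultimately show "x : (%y. y d) ` ?E" by blast
 qed (auto simp: ext_def)
 have "idx (Zd (Suc d)) ?B = idx (UNIV :: int set) {x. int m dvd x}"
 proof (rule idx_hom[OF addsub_Zd addsub_UNIV dm])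
  show "(%y. y d) ` Zd (Suc d) = UNIV"
  proof (rule equalityI; rule subsetI)
   fix x :: int
   have "zs x (ev d) d = x" by (simp add: zs_def ev_def)
   moreover have "zs x (ev d) : Zd (Suc d)" by (rule zs_Zd[OF ev_Zd[OF lessI]])
   ultimately show "x : (%y. y d) ` Zd (Suc d)" by (metis imageI)
  qed simp
 qed simp
 hence 1: "idx (Zd (Suc d)) ?B = m" using idx_UNIV_int[OF m] by simp
 have "idx ?B {y : ?B. g y : K} = idx (Zd d) K" by (rule idx_hom[OF sB addsub_Zd K(1) gsub gim])
 hence 2: "idx ?B ?E = idx (Zd d) K" unfolding E .
 have "?E <= ?B" "?B <= Zd (Suc d)" unfolding E by blast+
 from idx_mult[OF addsub_Zd sB sE this] show "idx (Zd (Suc d)) ?E = m * idx (Zd d) K" unfolding 1 2 .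
qed

lemma subs_ext:
 assumes p: "prime p" and L: "L : subs (Suc d) p n"
 obtains i v where "i <= n" "L Int Zd d : subs d p i" "v : Zd d" "L = ext d (L Int Zd d) (int (p ^ (n - i))) v"
proof -
 have L: "addsub L" "L <= Zd (Suc d)" "idx (Zd (Suc d)) L = p ^ n" using L by (auto simp: subs_def)
 have p0: "p > 0" using p by (rule prime_gt_0_nat)
 have "idx (Zd (Suc d)) L > 0" using L(3) p0 by simp
 from idx_zs_mem[OF addsub_Zd L(1) this ev_Zd[OF lessI]] have "zs (int (p ^ n)) (ev d) : L" unfolding L(3) .
 from imageI[OF this, of "%y. y d"] have pn: "int p ^ n : (%y. y d) ` L" by (simp add: zs_def ev_def)
 have "addsub ((%x. x d) ` L)" unfolding addsub_def
 proof (intro conjI ballI)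
  show "0 : (%x. x d) ` L" using imageI[OF addsub_zero[OF L(1)], of "%x. x d"] by simp
  fix x y assume "x : (%x. x d) ` L" "y : (%x. x d) ` L"
  then obtain a b where ab: "a : L" "b : L" "x = a d" "y = b d" by blast
  thus "x - y : (%x. x d) ` L" using imageI[OF addsub_diff[OF L(1) ab(1,2)], of "%x. x d"] by simp
 qed
 then obtain m where m: "m >= 0" "(%x. x d) ` L = {x. m dvd x}" by (rule addsub_int)
 then obtain j where j: "m = int p ^ j" using dvd_prime_power_int[OF p m(1)] pn by blast
 have "m : (%x. x d) ` L" using m(2) by simp
 then obtain w where w: "w : L" "w d = m" by blast
 define v where "v = w - zs m (ev d)"
 have wv: "v + zs m (ev d) = w" by (simp add: v_def)
 have "v : Zd (Suc d)" unfolding v_def using w L(2) by (intro addsub_diff[OF addsub_Zd _ zs_Zd[OF ev_Zd[OF lessI]]]) blast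
 moreover have "v d = 0" using w(2) by (simp add: v_def zs_def ev_def)
 ultimately have v: "v : Zd d" using Zd_Suc_iff by blast
 let ?K = "L Int Zd d"
 have sK: "addsub ?K" using L(1) by (simp add: addsub_Int)
 have LE: "L = ext d ?K (int (p ^ j)) v"
 proof (rule equalityI; rule subsetI)
  fix y assume y: "y : L"
  hence md: "m dvd y d" using m(2) by blast
  have "y - zs (y d div m) w : L" using y w by (intro addsub_diff[OF L(1) _ addsub_zs[OF L(1)]])
  moreover have "(y - zs (y d div m) w) d = 0" using md w(2) by (simp add: zs_def)
  ultimately have "y - zs (y d div m) w : ?K" using L(2) Zd_Suc_iff by blast
  thus "y : ext d ?K (int (p ^ j)) v" unfolding ext_def using y L(2) md wv j by auto
 next
  fix y assume "y : ext d ?K (int (p ^ j)) v"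
  hence "y - zs (y d div m) w : L" unfolding ext_def using j wv by auto
  hence "(y - zs (y d div m) w) + zs (y d div m) w : L" using w(1) by (intro addsub_add[OF L(1) _ addsub_zs[OF L(1)]])
  thus "y : L" by simp
 qed
 have "p ^ n = p ^ j * idx (Zd d) ?K" using ext_props(5)[OF sK Int_lower2 _ v, of "p ^ j"] LE L(3) p0 by simp
 moreover from this obtain i where i: "idx (Zd d) ?K = p ^ i"
  using divides_primepow_nat[OF p] by (metis dvd_triv_right)
 ultimately have "p ^ n = p ^ (j + i)" by (simp add: power_add)
 hence n: "n = j + i" using p prime_gt_1_nat power_inject_exp by blast
 show ?thesis
 proof (rule that[of i v])
  show "?K : subs d p i" using sK i by (simp add: subs_def)
  show "L = ext d ?K (int (p ^ (n - i))) v" using LE n by simp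
 qed (use n v in simp_all)
qed

text \<open>Hermite normal form: a sublattice of Z^(d+1) is determined by its intersection K with
  Z^d, its group m Z of last coordinates, and v modulo K. For K of index p^i there are p^i choices
  of v.\<close>

lemma card_subs_Suc:
 assumes p: "prime p" and fin: "!!i. finite (subs d p i)"
 shows "finite (subs (Suc d) p n)" "card (subs (Suc d) p n) = (SUM i<=n. p ^ i * card (subs d p i))"
proof -
 have p0: "p > 0" using p by (rule prime_gt_0_nat)
 define T where "T K = (SOME R. transv (Zd d) K R)" for K
 have T: "transv (Zd d) K (T K)" if "addsub K" for K
  using transv_exists[OF addsub_Zd that, of d] someI_ex unfolding T_def by metis
 have cT: "card (T K) = p ^ i" "finite (T K)" if "K : subs d p i" for K i
 proof -
  have K: "addsub K" "idx (Zd d) K = p ^ i" using that by (auto simp: subs_def)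
  show "card (T K) = p ^ i" using idx_transv[OF addsub_Zd K(1) T[OF K(1)]] K(2) by simp
  thus "finite (T K)" using p0 by (metis card.infinite power_not_zero neq0_conv)
 qed
 define S where "S = (SIGMA i:{..n}. SIGMA K:subs d p i. T K)"
 define PS where "PS = (%(i, K, v). ext d K (int (p ^ (n - i))) v)"
 have KT: "addsub K" "K <= Zd d" "idx (Zd d) K = p ^ i" "v : Zd d" if "(i, K, v) : S" for i K v
  using that T[of K] by (auto simp: S_def subs_def transv_def)
 have pw: "p ^ k > 0" for k using p0 by simp
 have "PS ` S = subs (Suc d) p n"
 proof (rule equalityI; rule subsetI)
  fix L assume "L : PS ` S"
  then obtain i K v where s: "(i, K, v) : S" "L = ext d K (int (p ^ (n - i))) v" by (auto simp: PS_def)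
  have "i <= n" using s(1) by (simp add: S_def)
  hence "p ^ (n - i) * p ^ i = p ^ n" by (simp flip: power_add)
  thus "L : subs (Suc d) p n"
   using ext_props(1,5)[OF KT(1,2)[OF s(1)] pw KT(4)[OF s(1)], of "n - i"] KT(3)[OF s(1)] s(2)
   by (auto simp: subs_def ext_def)
 next
  fix L assume L: "L : subs (Suc d) p n"
  then obtain i v where iv: "i <= n" "L Int Zd d : subs d p i" "v : Zd d" "L = ext d (L Int Zd d) (int (p ^ (n - i))) v"
   using subs_ext[OF p] by blast
  let ?K = "L Int Zd d"
  have K: "addsub ?K" using iv(2) by (simp add: subs_def)
  obtain r where r: "r : T ?K" "v - r : ?K" using T[OF K] iv(3) unfolding transv_def by blast
  let ?m = "int (p ^ (n - i))"
  have "ext d ?K ?m v = ext d ?K ?m r"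
  proof -
   have "y - zs k (v + zs ?m (ev d)) : ?K \<longleftrightarrow> y - zs k (r + zs ?m (ev d)) : ?K" for y k
   proof -
    have e: "y - zs k (r + zs ?m (ev d)) = (y - zs k (v + zs ?m (ev d))) + zs k (v - r)" by (simp add: zs_simps)
    have z: "zs k (v - r) : ?K" by (rule addsub_zs[OF K r(2)])
    show ?thesis using addsub_add[OF K _ z] addsub_diff[OF K _ z] unfolding e by (metis add_diff_cancel_right')
   qed
   thus ?thesis unfolding ext_def by blast
  qed
  hence "L = PS (i, ?K, r)" using iv(4) by (simp add: PS_def)
  moreover have "(i, ?K, r) : S" using iv r by (simp add: S_def)
  ultimately show "L : PS ` S" by blast
 qed
 moreover have "inj_on PS S"
 proof (rule inj_onI)
  fix s s' assume s: "s : S" "s' : S" "PS s = PS s'"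
  obtain i K v i' K' v' where ss: "s = (i, K, v)" "s' = (i', K', v')" by (cases s, cases s')
  have eq: "ext d K (int (p ^ (n - i))) v = ext d K' (int (p ^ (n - i'))) v'" using s(3) by (simp add: PS_def ss)
  note e1 = ext_props[OF KT(1,2)[OF s(1)[unfolded ss]] pw KT(4)[OF s(1)[unfolded ss]], of "n - i"]
  note e2 = ext_props[OF KT(1,2)[OF s(2)[unfolded ss]] pw KT(4)[OF s(2)[unfolded ss]], of "n - i'"]
  have KK: "K = K'" using e1(2) e2(2) eq by simp
  hence "p ^ i = p ^ i'" using KT(3)[OF s(1)[unfolded ss]] KT(3)[OF s(2)[unfolded ss]] by simp
  hence ii: "i = i'" using p prime_gt_1_nat power_inject_exp by blast
  have "(v + zs (int (p ^ (n - i))) (ev d)) - (v' + zs (int (p ^ (n - i'))) (ev d)) : ext d K (int (p ^ (n - i))) v"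
   using e1(4) e2(4) unfolding eq[symmetric] by (rule addsub_diff[OF e1(1)])
  hence "v - v' : ext d K (int (p ^ (n - i))) v" unfolding ii by simp
  moreover have "v - v' : Zd d" using KT(4)[OF s(1)[unfolded ss]] KT(4)[OF s(2)[unfolded ss]] by (rule addsub_diff[OF addsub_Zd])
  ultimately have vK: "v - v' : K" using e1(2) by blast
  have K: "addsub K" using KT(1)[OF s(1)[unfolded ss]] .
  have vv: "v : T K" "v' : T K" "v : Zd d" using s ss KK KT(4)[OF s(1)[unfolded ss]] by (auto simp: S_def)
  have "v - v : K" using addsub_zero[OF K] by simp
  hence "v = v'" using T[OF K] vv vK unfolding transv_def by blast
  thus "s = s'" using ss KK ii by simp
 qed
 moreover have "finite S" unfolding S_def using fin cT by (intro finite_SigmaI) auto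
 ultimately show "finite (subs (Suc d) p n)" "card (subs (Suc d) p n) = (SUM i<=n. p ^ i * card (subs d p i))"
 proof -
  assume a: "PS ` S = subs (Suc d) p n" "inj_on PS S" "finite S"
  show "finite (subs (Suc d) p n)" unfolding a(1)[symmetric] using a(3) by simp
  have "card S = (SUM i<=n. card (SIGMA K:subs d p i. T K))"
   unfolding S_def using fin cT by (intro card_SigmaI ballI finite_SigmaI) auto
  also have "... = (SUM i<=n. p ^ i * card (subs d p i))"
  proof (rule sum.cong[OF refl])
   fix i
   have "card (SIGMA K:subs d p i. T K) = (SUM K:subs d p i. card (T K))"
    using fin cT by (intro card_SigmaI ballI) auto
   also have "... = (SUM K:subs d p i. p ^ i)" using cT by (intro sum.cong) auto
   finally show "card (SIGMA K:subs d p i. T K) = p ^ i * card (subs d p i)" by simp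
  qed
  finally show "card (subs (Suc d) p n) = (SUM i<=n. p ^ i * card (subs d p i))"
   unfolding a(1)[symmetric] using card_image[OF a(2)] by simp
 qed
qed

text \<open>The substitution of c X for X; with c = p it expresses the factor p^i in the recursion
  for sublattices.\<close>

definition fscale :: "rat => rat fps => rat fps" where
 "fscale c F = Abs_fps (%n. c ^ n * fps_nth F n)"

lemma fscale_mult: "fscale c (F * G) = fscale c F * fscale c G"
proof (rule fps_ext)
 fix n
 have "(\<Sum>i=0..n. c ^ n * (fps_nth F i * fps_nth G (n - i))) = (\<Sum>i=0..n. c ^ i * fps_nth F i * (c ^ (n - i) * fps_nth G (n - i)))"
 proof (rule sum.cong[OF refl])
  fix i assume "i : {0..n}"
  hence "c ^ n = c ^ i * c ^ (n - i)" by (simp flip: power_add)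
  thus "c ^ n * (fps_nth F i * fps_nth G (n - i)) = c ^ i * fps_nth F i * (c ^ (n - i) * fps_nth G (n - i))" by simp
 qed
 thus "fps_nth (fscale c (F * G)) n = fps_nth (fscale c F * fscale c G) n"
  by (simp add: fscale_def fps_mult_nth sum_distrib_left)
qed

lemma geo_nth: "fps_nth (geo q 1) n = q ^ n"
proof -
 have "{s. s : UNIV & 1 * s = n} = {n}" by auto
 thus ?thesis using gf_geo[of 1 q, symmetric] by (simp add: gf_nth)
qed

lemma fscale_geo: "fscale c (geo q 1) = geo (c * q) 1"
 by (rule fps_ext) (simp add: fscale_def geo_nth power_mult_distrib del: One_nat_def)

text \<open>The local zeta function of Z^d. The recursion reads zeta_(d+1)(X) = zeta_d(p X) / (1 -
  X).\<close>

theorem subs_gf: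
 assumes p: "prime p"
 shows "(ALL n. finite (subs d p n)) & Abs_fps (%n. of_nat (card (subs d p n))) = (PROD i<d. geo (of_nat p ^ i) 1)"
proof (induction d)
 case 0
 have Z: "Zd 0 = {0}" by (auto simp: Zd_def fun_eq_iff)
 have s: "addsub {0 :: nat => int}" by (auto simp: addsub_def)
 have "transv (Zd 0) {0} {0}" by (auto simp: transv_def Z)
 hence i: "idx (Zd 0) {0} = 1" using idx_transv[OF addsub_Zd s] by fastforce
 have sub: "subs 0 p n = (if n = 0 then {{0}} else {})" for n
 proof (rule Set.set_eqI)
  fix K
  have "addsub K & K <= Zd 0 \<longleftrightarrow> K = {0}" using s addsub_zero unfolding Z by blast
  moreover have "(1::nat) = p ^ n \<longleftrightarrow> n = 0" using prime_gt_1_nat[OF p] by (metis nat_power_eq_Suc_0_iff One_nat_def less_irrefl power_0)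
  ultimately show "K : subs 0 p n \<longleftrightarrow> K : (if n = 0 then {{0}} else {})"
   using i by (auto simp: subs_def)
 qed
 have "Abs_fps (%n. of_nat (card (subs 0 p n))) = (1 :: rat fps)" by (rule fps_ext) (simp add: sub)
 thus ?case by (simp add: sub)
next
 case (Suc d)
 hence fin: "!!i. finite (subs d p i)" and IH: "Abs_fps (%n. of_nat (card (subs d p n))) = (PROD i<d. geo (of_nat p ^ i) 1)"
  by auto
 have "Abs_fps (%n. of_nat (card (subs (Suc d) p n))) = fscale (of_nat p) (Abs_fps (%n. of_nat (card (subs d p n)))) * geo 1 1"
  by (rule fps_ext) (simp add: card_subs_Suc(2)[OF p fin] fps_mult_nth geo_nth fscale_def atLeast0AtMost del: One_nat_def)
 also have "... = (PROD i<d. geo (of_nat p ^ Suc i) 1) * geo (of_nat p ^ 0) 1"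
 proof -
  have "fscale c (PROD i<d. F i) = (PROD i<d. fscale c (F i))" for c F
  proof (induction d)
   case 0
   show ?case by (rule fps_ext) (simp add: fscale_def)
  qed (simp add: fscale_mult)
  thus ?thesis unfolding IH by (simp add: fscale_geo del: One_nat_def)
 qed
 also have "... = (PROD i<Suc d. geo (of_nat p ^ i) 1)" unfolding prod.lessThan_Suc_shift by (rule mult.commute)
 finally show ?case using card_subs_Suc(1)[OF p fin] by blast
qed

section \<open>The sum over all sublattices M of Z^2\<close>

text \<open>M^n inside (Z^2)^n, with the coordinates of the i-th pair stored at the positions 2 i
  and 2 i + 1.\<close>

definition Hm :: "nat => (int * int) set => (nat => int) set" where
 "Hm n M = {y : Zd (2 * n). ALL i<n. (y (2 * i), y (2 * i + 1)) : M}"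

definition satp :: "nat => nat => (nat => int) set => nat => (nat => int) set" where
 "satp n p L a = {y : Zd n. zs (int p ^ a) y : L}"

text \<open>The linear form of \<open>M0\<close> applied to the i-th pair of the basis vector l j,
  as a polynomial in t.\<close>

definition Cm :: "bool => (nat => nat => int) => nat => nat => int poly" where
 "Cm s l i j = (if s then [:l j (2 * i), l j (2 * i + 1):] else [:l j (2 * i + 1), l j (2 * i):])"

lemma addsub_Hm: "addsub M ==> addsub (Hm n M)" unfolding addsub_def Hm_def
proof (elim conjE, intro conjI ballI CollectI allI impI, goal_cases)
 case 1 thus ?case using addsub_zero[OF addsub_Zd] by blast
next
 case (2 i) thus ?case by (simp add: zero_prod_def)
next
 case (3 x y) thus ?case using addsub_diff[OF addsub_Zd, of x "2 * n" y] by blast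
next
 case (4 x y i)
 hence "(x (2 * i), x (2 * i + 1)) - (y (2 * i), y (2 * i + 1)) : M" by blast
 thus ?case by simp
qed

lemma addsub_satp:
 assumes "addsub L" shows "addsub (satp n p L a)" unfolding addsub_def
proof (intro conjI ballI)
 show "0 : satp n p L a"
  unfolding satp_def using addsub_zero[OF addsub_Zd, of n] addsub_zero[OF assms] by (simp only: mem_Collect_eq zs_simps)
 fix x y assume "x : satp n p L a" "y : satp n p L a"
 thus "x - y : satp n p L a"
  unfolding satp_def using addsub_diff[OF addsub_Zd, of x n y] addsub_diff[OF assms, of "zs (int p ^ a) x" "zs (int p ^ a) y"]
  by (simp only: mem_Collect_eq zs_simps)
qed

lemma zs_inj: "k ~= 0 ==> zs k x = zs k y ==> x = y" by (auto simp: zs_def fun_eq_iff)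

lemma zs_Zd_iff: "k ~= 0 ==> zs k y : Zd n \<longleftrightarrow> y : Zd n" by (auto simp: zs_def Zd_def)

lemma Hm_sc2: "k ~= 0 ==> Hm n (sc2 k ` M) = zs k ` Hm n M"
proof (rule equalityI; rule subsetI)
 fix y assume k: "k ~= 0" and y: "y : Hm n (sc2 k ` M)"
 define x where "x j = y j div k" for j
 have m: "EX u. u : M & (y (2 * i), y (2 * i + 1)) = sc2 k u" if "i < n" for i using y that unfolding Hm_def by blast
 have yj: "y j = k * x j" for j
 proof (cases "j < 2 * n")
  case True
  hence "j div 2 < n" by simp
  from m[OF this] obtain u where "(y (2 * (j div 2)), y (2 * (j div 2) + 1)) = sc2 k u" by blast
  hence "k dvd y (2 * (j div 2))" "k dvd y (2 * (j div 2) + 1)" by (auto simp: sc2_def)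
  moreover have "j = 2 * (j div 2) | j = 2 * (j div 2) + 1" by presburger
  ultimately have "k dvd y j" by metis
  thus ?thesis by (simp add: x_def)
 qed (use y in \<open>auto simp: Hm_def Zd_def x_def\<close>)
 hence yx: "y = zs k x" by (auto simp: zs_def)
 have "y : Zd (2 * n)" using y by (simp add: Hm_def)
 hence "x : Zd (2 * n)" unfolding yx using k by (simp add: zs_Zd_iff)
 moreover have "(x (2 * i), x (2 * i + 1)) : M" if "i < n" for i using m[OF that] k yj by (auto simp: sc2_def)
 ultimately show "y : zs k ` Hm n M" unfolding yx Hm_def by blast
qed (auto simp: Hm_def zs_apply sc2_def image_iff intro: zs_Zd intro!: bexI)

lemma idx_Int: "idx A (A Int S) = idx A S" if "addsub A" for A :: "'a::ab_group_add set"
proof -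
 have "cosrel A (A Int S) = cosrel A S" using addsub_diff[OF that] by (auto simp: cosrel_def)
 thus ?thesis by (simp add: idx_def)
qed

text \<open>Separates the scalar p^a: L modulo p^a M^n is cut at the intersection of L with p^a
  Z^(2n). Division by p^a identifies that intersection with \<open>satp\<close>.\<close>

lemma idx_Hm_split:
 assumes L: "addsub L" "L <= Zd (2 * n)" and M: "addsub M" and p: "p > 0"
 shows "idx L (Hm n (sc2 (int p ^ a) ` M)) = idx L (zs (int p ^ a) ` Zd (2 * n)) * idx (satp (2 * n) p L a) (Hm n M)"
proof -
 let ?k = "int p ^ a" and ?V = "Zd (2 * n)"
 let ?B = "L Int zs ?k ` ?V" and ?C = "L Int zs ?k ` Hm n M"
 have k: "?k ~= 0" using p by simp
 have s: "addsub (Hm n M)" "addsub (zs ?k ` Hm n M)" "addsub (zs ?k ` ?V)"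
  using addsub_Hm[OF M] by (simp_all add: addsub_mult)
 have im: "zs ?k ` satp (2 * n) p L a = ?B" by (auto simp: satp_def)
 have "idx (satp (2 * n) p L a) {x : satp (2 * n) p L a. zs ?k x : zs ?k ` Hm n M} = idx ?B (zs ?k ` Hm n M)"
  by (rule idx_hom[OF addsub_satp[OF L(1)] addsub_Int[OF L(1) s(3)] s(2) zs_simps(3) im])
 also have "{x : satp (2 * n) p L a. zs ?k x : zs ?k ` Hm n M} = satp (2 * n) p L a Int Hm n M"
  using zs_inj[OF k] by (auto simp: image_iff)
 finally have 1: "idx ?B (zs ?k ` Hm n M) = idx (satp (2 * n) p L a) (Hm n M)"
  unfolding idx_Int[OF addsub_satp[OF L(1)]] ..
 have "?B Int zs ?k ` Hm n M = ?C" by (auto simp: Hm_def)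
 hence 2: "idx ?B ?C = idx ?B (zs ?k ` Hm n M)" using idx_Int[OF addsub_Int[OF L(1) s(3)]] by metis
 have "idx L ?C = idx L ?B * idx ?B ?C"
  by (rule idx_mult[OF L(1) addsub_Int[OF L(1) s(3)] addsub_Int[OF L(1) s(2)]]) (auto simp: Hm_def)
 thus ?thesis unfolding Hm_sc2[OF k] 2 1 idx_Int[OF L(1)] .
qed

text \<open>In coordinates with respect to the basis l, membership in M^n is a system of congruences
  modulo p^b with coefficient polynomials \<open>Cm\<close>.\<close>

lemma idx_Hm_M0:
 assumes p: "prime p" and L: "lat_basis L r l" "L <= Zd (2 * n)"  "addsub L"
 shows "idx L (Hm n (M0 p s b t)) = p ^ sw p b {..<n} {..<r} (Cm s l) t"
proof -
 have "idx (Zd r) {x : Zd r. comb r l x : Hm n (M0 p s b t)} = idx L (Hm n (M0 p s b t))"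
  using L by (intro idx_hom addsub_Zd addsub_Hm addsub_M0 comb_diff lat_basisD(1))
 moreover have "{x : Zd r. comb r l x : Hm n (M0 p s b t)} = ker_mod p b n r (%i j. poly (Cm s l i j) t)"
 proof -
  have Z: "comb r l x : Zd (2 * n)" if "x : Zd r" for x using L(2) lat_basisD(1)[OF L(1)] that by blast
  have "(comb r l x (2 * i), comb r l x (2 * i + 1)) : M0 p s b t \<longleftrightarrow>
    int p ^ b dvd (SUM j<r. poly (Cm s l i j) t * x j)" for x i
  proof -
   have "(if s then comb r l x (2 * i) + t * comb r l x (2 * i + 1) else t * comb r l x (2 * i) + comb r l x (2 * i + 1))
     = (SUM j<r. poly (Cm s l i j) t * x j)"
    by (simp add: comb_def Cm_def sum_distrib_left sum.distrib[symmetric] algebra_simps)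
   thus ?thesis by (simp only: M0_def mem_Collect_eq case_prod_conv)
  qed
  thus ?thesis using Z unfolding ker_mod_def Hm_def by blast
 qed
 ultimately show ?thesis using idx_ker_mod[OF p, of r b n "Cm s l" t] by simp
qed

lemma idx_zs_power:
 assumes p: "prime p" and L: "lat_basis L r l" "L <= Zd n" "addsub L"
 obtains k where "idx L (zs (int p ^ a) ` Zd n) = p ^ k"
proof -
 let ?k = "int p ^ a"
 have p0: "p ^ a > 0" using p by (simp add: prime_gt_0_nat)
 have "idx L (zs ?k ` L) = idx L (L Int zs ?k ` Zd n) * idx (L Int zs ?k ` Zd n) (zs ?k ` L)"
 proof (rule idx_mult[OF L(3) addsub_Int[OF L(3)] addsub_mult[OF L(3)]])
  show "zs ?k ` L <= L Int zs ?k ` Zd n" using addsub_zs[OF L(3)] L(2) by blast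
 qed (simp_all add: addsub_mult)
 moreover have "idx L (zs ?k ` L) = (p ^ a) ^ r" using idx_lat_mult[OF L(3,1) p0] by simp
 ultimately have "idx L (zs ?k ` Zd n) dvd p ^ (a * r)" unfolding idx_Int[OF L(3)] by (metis dvd_triv_left power_mult)
 thus ?thesis using that p by (auto simp: divides_primepow_nat)
qed

text \<open>The p-part of the saturation of L is reached at the exponent of p in e; the cofactor of
  e is prime to p and is removed by Bezout.\<close>

lemma satp_stable:
 assumes p: "prime p" and L: "addsub L" "L <= Zd n" and e: "e > 0"
  "ALL k>0. ALL y:Zd n. zs k y : L --> zs e y : L"
  and a: "a >= vp p e"
 shows "satp n p L a = satp n p L (vp p e)"
proof -
 define m where "m = vp p e"
 have pi: "prime (int p)" using p by simp
 obtain e' where e': "e = int p ^ m * e'" "~ int p dvd e'"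
 proof (rule multiplicity_decompose'[of e "int p"])
  show "e ~= 0" "~ is_unit (int p)" using e(1) pi not_prime_unit by auto
 qed (simp add: m_def)
 have "y : satp n p L m" if y: "y : satp n p L a" for y
 proof -
  have yZ: "y : Zd n" and yL: "zs (int p ^ a) y : L" using y by (auto simp: satp_def)
  have "int p ^ a > 0" using p by (simp add: prime_gt_0_nat)
  hence eL: "zs e y : L" using e(2) yZ yL by blast
  have "coprime (int p ^ (a - m)) e'" using pi e'(2) by (simp add: prime_imp_coprime)
  then obtain u v where uv: "u * int p ^ (a - m) + v * e' = 1" using bezout_int by (metis coprime_imp_gcd_eq_1)
  have am: "int p ^ a = int p ^ m * int p ^ (a - m)" using a by (simp add: m_def flip: power_add)
  have "zs (int p ^ m) y = zs u (zs (int p ^ a) y) + zs v (zs e y)"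
  proof -
   have "u * int p ^ a + v * e = int p ^ m * (u * int p ^ (a - m) + v * e')" unfolding am e' by (simp only: algebra_simps)
   hence "u * int p ^ a + v * e = int p ^ m" unfolding uv by simp
   thus ?thesis by (simp only: zs_simps(1,5) flip: zs_simps(1))
  qed
  also have "... : L" by (intro addsub_add[OF L(1)] addsub_zs[OF L(1)] yL eL)
  finally show ?thesis using yZ by (simp add: satp_def)
 qed
 moreover have "y : satp n p L a" if y: "y : satp n p L m" for y
 proof -
  have "zs (int p ^ (a - m)) (zs (int p ^ m) y) : L" using y by (simp add: satp_def addsub_zs[OF L(1)])
  moreover have "int p ^ (a - m) * int p ^ m = int p ^ a" using a by (simp add: m_def flip: power_add)
  ultimately show ?thesis using y by (simp add: satp_def zs_simps(5))
 qed
 ultimately show ?thesis unfolding m_def by blast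
qed

lemma satp_step:
 assumes p: "prime p" and L: "addsub L" "L <= Zd (2 * n)" and st: "satp (2 * n) p L (Suc a) = satp (2 * n) p L a"
  and b: "lat_basis (satp (2 * n) p L a) r l"
 shows "idx L (zs (int p ^ Suc a) ` Zd (2 * n)) = idx L (zs (int p ^ a) ` Zd (2 * n)) * p ^ r"
proof -
 let ?A = "satp (2 * n) p L a"
 have p0: "p > 0" using p by (rule prime_gt_0_nat)
 have H: "Hm n UNIV = Zd (2 * n)" by (simp add: Hm_def)
 have s: "sc2 (int p ^ a) ` sc2 (int p) ` UNIV = sc2 (int p ^ Suc a) ` UNIV"
  by (auto simp: sc2_def image_iff algebra_simps)
 have "idx L (Hm n (sc2 (int p ^ a) ` sc2 (int p) ` UNIV)) =
   idx L (zs (int p ^ a) ` Zd (2 * n)) * idx ?A (Hm n (sc2 (int p) ` UNIV))"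
  by (rule idx_Hm_split[OF L addsub_sc2[OF addsub_UNIV] p0])
 moreover have "Hm n (sc2 (int p ^ Suc a) ` UNIV) = zs (int p ^ Suc a) ` Zd (2 * n)"
  using Hm_sc2[of "int p ^ Suc a" n UNIV] p0 H by simp
 moreover have "Hm n (sc2 (int p) ` UNIV) = zs (int p) ` Zd (2 * n)" using Hm_sc2[of "int p" n UNIV] p0 H by simp
 moreover have "?A Int zs (int p) ` Zd (2 * n) = zs (int p) ` ?A"
 proof (rule equalityI; rule subsetI)
  fix y assume "y : ?A Int zs (int p) ` Zd (2 * n)"
  then obtain x where x: "y = zs (int p) x" "x : Zd (2 * n)" "y : ?A" by blast
  hence "x : satp (2 * n) p L (Suc a)" by (simp add: satp_def zs_simps(5) mult.commute)
  thus "y : zs (int p) ` ?A" unfolding st x(1) by blast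
 next
  fix y assume "y : zs (int p) ` ?A"
  thus "y : ?A Int zs (int p) ` Zd (2 * n)" using addsub_zs[OF addsub_satp[OF L(1)]] by (auto simp: satp_def)
 qed
 hence "idx ?A (zs (int p) ` Zd (2 * n)) = p ^ r"
  using idx_Int[OF addsub_satp[OF L(1)]] idx_lat_mult[OF addsub_satp[OF L(1)] b p0] by metis
 ultimately show ?thesis unfolding s by simp
qed

definition xw :: "nat => (nat => int) set => nat => nat * bool * nat * int => nat" where
 "xw n L p = (%(a, s, b, t). multiplicity p (idx L (Hm n (sc2 (int p ^ a) ` M0 p s b t))))"

text \<open>For n = d and L = \<open>Lat\<close> this is the sum over M of |Z^2:M|^d times X to the
  exponent of |Z^2:M| |Z^d:X(M)|, with M = p^a M0 and index p^(2a+b).\<close>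

definition Xi :: "nat => (nat => int) set => nat => rat fps" where
 "Xi n L p = gf (UNIV \<times> pts p) (%(a, s, b, t). 2 * a + b + xw n L p (a, s, b, t))
   (%(a, s, b, t). of_nat p ^ (n * (2 * a + b)))"

text \<open>The layer of those M that are not divisible by p.\<close>

definition X0 :: "nat => nat => (nat => nat => int) => nat => rat fps" where
 "X0 n r l p = gf (pts p) (%(s, b, t). b + sw p b {..<n} {..<r} (Cm s l) t) (%(s, b, t). (of_nat p ^ n) ^ b)"

lemma finite_pts: "finite {x : pts p. fst (snd x) <= n}"
proof (rule finite_subset)
 show "{x : pts p. fst (snd x) <= n} <= UNIV \<times> ({..n} \<times> (UN b<=n. {0..<int (p ^ b)}))" by (auto simp: pts_def)
qed auto

lemma locfin_pts: "(!!x. x : pts p ==> wt x >= fst (snd x)) ==> locfin (pts p) wt"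
 unfolding locfin_def by (intro allI finite_subset[OF _ finite_pts[of p]]) auto

lemma locfin_apts:
 assumes "!!a x. wt (a, x) >= a + fst (snd x)" shows "locfin (A \<times> pts p) wt" unfolding locfin_def
proof (rule allI, rule finite_subset)
 fix n
 show "{x. x : A \<times> pts p & wt x = n} <= {..n} \<times> {x : pts p. fst (snd x) <= n}"
 proof
  fix x assume "x : {x. x : A \<times> pts p & wt x = n}"
  hence x: "snd x : pts p" "wt (fst x, snd x) = n" by (simp_all only: mem_Collect_eq mem_Times_iff prod.collapse)
  have "fst x + fst (snd (snd x)) <= n" using assms[of "fst x" "snd x"] unfolding x(2) .
  hence "fst x <= n" "fst (snd (snd x)) <= n" by (rule add_leD1, rule add_leD2)
  thus "x : {..n} \<times> {x : pts p. fst (snd x) <= n}" using x(1) by (simp only: mem_Times_iff atMost_iff mem_Collect_eq)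
 qed
qed (use finite_pts in auto)

text \<open>All points of positive level above one point of the projective line over F_p.\<close>

definition cp :: "nat => bool => int => (bool * nat * int) set" where
 "cp p s z = {(s', b, t). s' = s & b >= 1 & t : {0..<int (p ^ b)} & int p dvd t - z}"

lemma gf_cp:
 "gf (cp p s z) (%(s, b, t). b + sw p b I J (C s) t) (%(s, b, t). al ^ b) = cls p al I J (C s) 1 z"
proof -
 let ?I = "%n. {t : {0..<int (p ^ (1 + n))}. int p ^ 1 dvd t - z}"
 have "cls p al I J (C s) 1 z = gf (SIGMA n:UNIV. ?I n) (%(n, t). 1 + n + sw p (1 + n) I J (C s) t) (%(n, t). al ^ (1 + n))"
  unfolding cls_def by (rule fsum_gf) (auto intro: finite_subset[of _ "{0..<int (p ^ (1 + n))}" for n])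
 also have "... = gf ((%(n, t). (s, 1 + n, t)) ` (SIGMA n:UNIV. ?I n)) (%(s, b, t). b + sw p b I J (C s) t) (%(s, b, t). al ^ b)"
  by (subst gf_reindex) (auto simp: inj_on_def intro!: gf_cong)
 also have "(%(n, t). (s, 1 + n, t)) ` (SIGMA n:UNIV. ?I n) = cp p s z"
  by (auto simp: cp_def image_iff Suc_le_eq gr0_conv_Suc)
 finally show ?thesis ..
qed

lemma pts_split:
 assumes p: "p > 0"
 shows "pts p = {(False, 0, 0)} Un ((UN z:{..<p}. cp p False (int z)) Un cp p True 0)"
proof (rule equalityI; rule subsetI)
 fix x assume x: "x : pts p"
 obtain s b t where xe: "x = (s, b, t)" by (cases x)
 have "x : cp p False (int (nat (t mod int p)))" if "~ s" "b ~= 0"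
  using x that p by (auto simp: pts_def cp_def xe dvd_eq_mod_eq_0 mod_diff_right_eq)
 moreover have "nat (t mod int p) < p" using p by (simp add: nat_less_iff)
 moreover have "x = (False, 0, 0)" if "~ s" "b = 0" using x that by (auto simp: pts_def xe)
 moreover have "x : cp p True 0" if "s" using x that by (auto simp: pts_def cp_def xe)
 ultimately show "x : {(False, 0, 0)} Un ((UN z:{..<p}. cp p False (int z)) Un cp p True 0)" by blast
qed (use p in \<open>auto simp: pts_def cp_def\<close>)

text \<open>The summand 1 is the point of level b = 0; the others are the p finite residue classes
  and the class at infinity.\<close>

lemma X0_cls:
 assumes p: "p > 0"
 shows "X0 n r l p = 1 + (SUM z<p. cls p (of_nat p ^ n) {..<n} {..<r} (Cm False l) 1 (int z))
  + cls p (of_nat p ^ n) {..<n} {..<r} (Cm True l) 1 0"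
proof -
 let ?w = "%(s, b, t). b + sw p b {..<n} {..<r} (Cm s l) t"
 let ?c = "%(s, b, t). (of_nat p ^ n :: rat) ^ b"
 have lf: "locfin (pts p) ?w" by (rule locfin_pts) auto
 note sp = pts_split[OF p]
 have lfs: "locfin S ?w" if "S <= pts p" for S using locfin_subset[OF lf that] .
 have 1: "gf {(False, 0, 0 :: int)} ?w ?c = 1"
 proof (rule fps_ext)
  fix m
  have "sw p 0 {..<n} {..<r} (Cm False l) 0 = 0" by (simp add: sw_def)
  hence "{s. s : {(False, 0, 0 :: int)} & ?w s = m} = (if m = 0 then {(False, 0, 0)} else {})" by auto
  thus "fps_nth (gf {(False, 0, 0 :: int)} ?w ?c) m = fps_nth 1 m" by (simp add: gf_nth)
 qed
 have 2: "gf (UN z:{..<p}. cp p False (int z)) ?w ?c = (SUM z<p. gf (cp p False (int z)) ?w ?c)"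
 proof (rule gf_UN)
  show "locfin (cp p False (int z)) ?w" if "z : {..<p}" for z by (rule lfs) (use sp that in blast)
  fix z u assume zu: "z : {..<p}" "u : {..<p}" "z ~= u"
  have "False" if "int p dvd t - int z" "int p dvd t - int u" for t
  proof -
   have "int p dvd (t - int u) - (t - int z)" by (rule dvd_diff[OF that(2,1)])
   hence "int z mod int p = int u mod int p" by (simp add: mod_eq_dvd_iff)
   thus False using zu by simp
  qed
  thus "cp p False (int z) Int cp p False (int u) = {}" by (auto simp: cp_def)
 qed simp
 have "X0 n r l p = gf {(False, 0, 0)} ?w ?c + gf ((UN z:{..<p}. cp p False (int z)) Un cp p True 0) ?w ?c"
  unfolding X0_def sp by (rule gf_Un; (rule lfs)?) (use sp in \<open>auto simp: cp_def\<close>)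
 also have "gf ((UN z:{..<p}. cp p False (int z)) Un cp p True 0) ?w ?c =
   gf (UN z:{..<p}. cp p False (int z)) ?w ?c + gf (cp p True 0) ?w ?c"
  by (rule gf_Un; (rule lfs)?) (use sp in \<open>auto simp: cp_def\<close>)
 finally show ?thesis unfolding 1 2 gf_cp by (simp only: add.assoc)
qed

lemma idx_xw:
 assumes p: "prime p" and L: "addsub L" "L <= Zd (2 * n)"
  and b: "lat_basis (satp (2 * n) p L a) r l"
 shows "idx L (Hm n (sc2 (int p ^ a) ` M0 p s b t)) = p ^ xw n L p (a, s, b, t)"
  "xw n L p (a, s, b, t) = multiplicity p (idx L (zs (int p ^ a) ` Zd (2 * n))) + sw p b {..<n} {..<r} (Cm s l) t"
proof -
 have p0: "p > 0" using p by (rule prime_gt_0_nat)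
 obtain r0 l0 where l0: "lat_basis L r0 l0" using lat_basis_exists[OF L] by blast
 obtain k where k: "idx L (zs (int p ^ a) ` Zd (2 * n)) = p ^ k" using idx_zs_power[OF p l0 L(2,1)] by blast
 have S: "satp (2 * n) p L a <= Zd (2 * n)" by (auto simp: satp_def)
 have e: "idx L (Hm n (sc2 (int p ^ a) ` M0 p s b t)) = p ^ (k + sw p b {..<n} {..<r} (Cm s l) t)"
  unfolding idx_Hm_split[OF L addsub_M0 p0] k idx_Hm_M0[OF p b S addsub_satp[OF L(1)]] power_add ..
 have m: "multiplicity p (p ^ i) = i" for i using p by (simp add: prime_gt_1_nat multiplicity_same_power not_prime_unit)
 show "xw n L p (a, s, b, t) = multiplicity p (idx L (zs (int p ^ a) ` Zd (2 * n))) + sw p b {..<n} {..<r} (Cm s l) t"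
  by (simp only: xw_def case_prod_conv e k m)
 thus "idx L (Hm n (sc2 (int p ^ a) ` M0 p s b t)) = p ^ xw n L p (a, s, b, t)" unfolding e k m by simp
qed

definition kz :: "nat => (nat => int) set => nat => nat => nat" where
 "kz n L p a = multiplicity p (idx L (zs (int p ^ a) ` Zd (2 * n)))"

lemma gf_layer:
 assumes p: "prime p" and L: "addsub L" "L <= Zd (2 * n)"
  and b: "lat_basis (satp (2 * n) p L a) r l"
 shows "gf ({a} \<times> pts p) (%(a, s, b, t). 2 * a + b + xw n L p (a, s, b, t)) (%(a, s, b, t). of_nat p ^ (n * (2 * a + b)))
  = fps_const (of_nat p ^ (2 * n * a)) * fps_X ^ (2 * a + kz n L p a) * X0 n r l p"
proof -
 have "fps_const (of_nat p ^ (2 * n * a)) * fps_X ^ (2 * a + kz n L p a) * X0 n r l p =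
   gf (pts p) (%x. (case x of (s, b, t) => b + sw p b {..<n} {..<r} (Cm s l) t) + (2 * a + kz n L p a))
    (%x. of_nat p ^ (2 * n * a) * (case x of (s, b, t) => (of_nat p ^ n) ^ b))"
  unfolding X0_def mult.assoc gf_shift gf_cmult ..
 also have "... = gf (pts p) (%x. case (a, x) of (a, s, b, t) => 2 * a + b + xw n L p (a, s, b, t))
   (%x. case (a, x) of (a, s, b, t) => of_nat p ^ (n * (2 * a + b)))"
  by (rule gf_cong) (auto simp: idx_xw(2)[OF p L b] kz_def algebra_simps simp flip: power_add power_mult)
 also have "... = gf ((%x. (a, x)) ` pts p) (%(a, s, b, t). 2 * a + b + xw n L p (a, s, b, t)) (%(a, s, b, t). of_nat p ^ (n * (2 * a + b)))"
  by (subst gf_reindex) (auto simp: inj_on_def)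
 also have "(%x. (a, x)) ` pts p = {a} \<times> pts p" by auto
 finally show ?thesis ..
qed

text \<open>The layers a < c differ because L need not be saturated at p. From a = c on,
  \<open>satp\<close> is constant, each further factor p multiplies the indices by p^2 and p^(r c),
  and the layers form a geometric series.\<close>

theorem Xi_layers:
 assumes p: "prime p" and L: "addsub L" "L <= Zd (2 * n)"
  and e: "e > 0" "ALL k>0. ALL y:Zd (2 * n). zs k y : L --> zs e y : L"
  and b: "!!a. lat_basis (satp (2 * n) p L a) (r a) (l a)" and c: "c = vp p e"
 shows "Xi n L p = (SUM a<c. fps_const (of_nat p ^ (2 * n * a)) * fps_X ^ (2 * a + kz n L p a) * X0 n (r a) (l a) p)
  + fps_const (of_nat p ^ (2 * n * c)) * fps_X ^ (2 * c + kz n L p c) * X0 n (r c) (l c) p * geo (of_nat p ^ (2 * n)) (2 + r c)"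
proof -
 let ?w = "%(a, s, b, t). 2 * a + b + xw n L p (a, s, b, t)"
 let ?c = "%(a :: nat, s :: bool, b :: nat, t :: int). (of_nat p :: rat) ^ (n * (2 * a + b))"
 have st: "satp (2 * n) p L a = satp (2 * n) p L c" if "a >= c" for a
  using satp_stable[OF p L e] that unfolding c by blast
 have lf: "locfin (A \<times> pts p) ?w" for A by (rule locfin_apts) auto
 have m: "multiplicity p (p ^ i) = i" for i using p by (simp add: prime_gt_1_nat multiplicity_same_power not_prime_unit)
 obtain r0 l0 where l0: "lat_basis L r0 l0" using lat_basis_exists[OF L] by blast
 have k: "kz n L p (c + i) = kz n L p c + r c * i" for i
 proof (induction i)
  case (Suc i)
  have "satp (2 * n) p L (Suc (c + i)) = satp (2 * n) p L (c + i)" using st[of "Suc (c + i)"] st[of "c + i"] by simp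
  moreover have "lat_basis (satp (2 * n) p L (c + i)) (r c) (l c)" using b[of c] st[of "c + i"] by simp
  ultimately have "idx L (zs (int p ^ Suc (c + i)) ` Zd (2 * n)) = idx L (zs (int p ^ (c + i)) ` Zd (2 * n)) * p ^ r c"
   by (rule satp_step[OF p L])
  moreover obtain k where "idx L (zs (int p ^ (c + i)) ` Zd (2 * n)) = p ^ k" using idx_zs_power[OF p l0 L(2,1)] by blast
  ultimately have "kz n L p (Suc (c + i)) = kz n L p (c + i) + r c" by (simp add: kz_def m flip: power_add)
  thus ?case using Suc by simp
 qed simp
 have U: "UNIV \<times> pts p = (UN a:{..<c}. {a} \<times> pts p) Un {c..} \<times> pts p" by auto
 have "Xi n L p = gf (UN a:{..<c}. {a} \<times> pts p) ?w ?c + gf ({c..} \<times> pts p) ?w ?c"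
  unfolding Xi_def U by (intro gf_Un locfin_UN lf) auto
 also have "gf (UN a:{..<c}. {a} \<times> pts p) ?w ?c = (SUM a<c. gf ({a} \<times> pts p) ?w ?c)"
  by (intro gf_UN lf) auto
 also have "... = (SUM a<c. fps_const (of_nat p ^ (2 * n * a)) * fps_X ^ (2 * a + kz n L p a) * X0 n (r a) (l a) p)"
  by (intro sum.cong refl gf_layer[OF p L b])
 also have "gf ({c..} \<times> pts p) ?w ?c = X0 n (r c) (l c) p * fps_const (of_nat p ^ (2 * n * c)) * fps_X ^ (2 * c + kz n L p c) * geo (of_nat p ^ (2 * n)) (2 + r c)"
 proof -
  let ?f = "%(x, i). (c + i, x)"
  let ?a = "2 * c + kz n L p c"
  have im: "{c..} \<times> pts p = ?f ` (pts p \<times> UNIV)"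
  proof (rule equalityI; rule subsetI)
   fix y assume "y : {c..} \<times> pts p"
   hence "y = ?f (snd y, fst y - c)" "(snd y, fst y - c) : pts p \<times> UNIV" by auto
   thus "y : ?f ` (pts p \<times> UNIV)" by (rule image_eqI)
  qed auto
  have g: "gf UNIV (%i. (2 + r c) * i + ?a) (%i. of_nat p ^ (2 * n * c) * (of_nat p ^ (2 * n)) ^ i) =
    fps_const (of_nat p ^ (2 * n * c)) * fps_X ^ ?a * geo (of_nat p ^ (2 * n)) (2 + r c)" by (rule gf_lin) simp
  have x: "xw n L p (c + i, s, b, t) = kz n L p c + r c * i + sw p b {..<n} {..<r c} (Cm s (l c)) t" for i s b t
   using idx_xw(2)[OF p L, of "c + i" "r c" "l c"] b[of c] st[of "c + i"] k[of i] by (simp add: kz_def)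
  have x': "xw n L p (i + c, s, b, t) = kz n L p c + r c * i + sw p b {..<n} {..<r c} (Cm s (l c)) t" for i s b t
   using x[of i] by (simp only: add.commute)
  have "X0 n (r c) (l c) p * (fps_const (of_nat p ^ (2 * n * c)) * fps_X ^ ?a * geo (of_nat p ^ (2 * n)) (2 + r c)) =
   gf (pts p \<times> UNIV) (%(x, i). (case x of (s, b, t) => b + sw p b {..<n} {..<r c} (Cm s (l c)) t) + ((2 + r c) * i + ?a))
    (%(x, i). (case x of (s, b, t) => (of_nat p ^ n) ^ b) * (of_nat p ^ (2 * n * c) * (of_nat p ^ (2 * n)) ^ i))"
   unfolding X0_def g[symmetric] by (rule gf_prod) (auto intro!: locfin_pts locfin_nat)
  also have "... = gf (pts p \<times> UNIV) (%x. ?w (?f x)) (%x. ?c (?f x))"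
   by (rule gf_cong) (auto simp: x' algebra_simps simp flip: power_add power_mult)
  also have "... = gf (?f ` (pts p \<times> UNIV)) ?w ?c" by (rule gf_reindex[symmetric]) (auto simp: inj_on_def)
  finally show ?thesis unfolding im by (simp only: mult.assoc)
 qed
 finally show ?thesis by (simp only: mult.assoc mult.left_commute mult.commute)
qed

theorem Xi_ratl:
 assumes p: "prime p" and L: "addsub L" "L <= Zd (2 * n)"
 shows "ratl (Xi n L p)"
proof -
 obtain e :: int where e: "e > 0" "ALL k>0. ALL y:Zd (2 * n). zs k y : L --> zs e y : L" by (rule saturation[OF L(1)])
 have "EX rl. lat_basis (satp (2 * n) p L a) (fst rl) (snd rl)" for a
 proof -
  have "satp (2 * n) p L a <= Zd (2 * n)" by (auto simp: satp_def)
  thus ?thesis using lat_basis_exists[OF addsub_satp[OF L(1)]] by (metis fst_conv snd_conv)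
 qed
 then obtain rl where rl: "!!a. lat_basis (satp (2 * n) p L a) (fst (rl a)) (snd (rl a))" by metis
 have X: "ratl (X0 n r l p)" for r l unfolding X0_cls[OF prime_gt_0_nat[OF p]]
  by (intro ratl_add ratl_sum ratl_1 ratl_cls p) auto
 show ?thesis unfolding Xi_layers[OF p L e rl refl]
  by (intro ratl_add ratl_sum ratl_mult X ratl_geo ratl_X ratl_const) auto
qed

text \<open>For p prime to e the lattice is already saturated at p, so the geometric series starts
  at a = 0.\<close>

theorem Xi_unsaturated:
 assumes p: "prime p" and L: "addsub L" "L <= Zd (2 * n)" and l: "lat_basis L r l"
  and e: "e > 0" "ALL k>0. ALL y:Zd (2 * n). zs k y : L --> zs e y : L" and ep: "~ int p dvd e"
 shows "Xi n L p = geo (of_nat p ^ (2 * n)) (2 + r) * X0 n r l p"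
proof -
 have c: "0 = vp p e" using ep by (simp add: not_dvd_imp_multiplicity_0)
 have s0: "satp (2 * n) p L 0 = L" using L(2) by (auto simp: satp_def zs_simps)
 have s: "satp (2 * n) p L a = L" for a using satp_stable[OF p L e] c[symmetric] s0 by simp
 have b: "lat_basis (satp (2 * n) p L a) r l" for a unfolding s by (rule l)
 have "L Int zs 1 ` Zd (2 * n) = L" using L(2) zs_simps(7) by (auto simp: image_iff)
 hence "idx L (zs 1 ` Zd (2 * n)) = idx L L" using idx_Int[OF L(1)] by metis
 also have "... = 1"
 proof -
  have "transv L L {0}" using addsub_zero[OF L(1)] by (auto simp: transv_def)
  from idx_transv[OF L(1,1) this] show ?thesis by simp
 qed
 finally have k: "kz n L p 0 = 0" by (simp add: kz_def)
 show ?thesis using Xi_layers[OF p L e b c] k by (simp add: mult.commute)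
qed

section \<open>A uniform formula for almost all primes\<close>

definition generic_rank :: "'i set => 'j set => ('i => 'j => int poly) => nat => nat => int poly => bool" where
 "generic_rank I J C rh n A \<longleftrightarrow> rh <= card J & A ~= 0 & (ALL p t b. prime p --> p > n --> ~ int p dvd poly A t -->
   nsol p b I J C t = p ^ (b * (card J - rh)))"

lemma generic_rank_exists:
 assumes "finite I" "finite J" obtains rh n A where "generic_rank I J C rh n A"
 using generic_elimination[OF assms, of C thesis] unfolding generic_rank_def by blast

lemma large_prime:
 fixes a :: int
 assumes "a ~= 0" obtains q where "prime q" "q > n" "~ int q dvd a"
proof -
 obtain q where q: "prime q" "q > max n (nat \<bar>a\<bar>)" using bigger_prime by blast
 have "~ int q dvd a" using q assms zdvd_imp_le[of "int q" "\<bar>a\<bar>"] by auto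
 thus ?thesis using that q by auto
qed

text \<open>At a large prime q dividing neither A(t) nor A'(t) both formulas count the same
  solutions modulo q, so the ranks agree.\<close>

lemma generic_rank_link:
 fixes C :: "'i => 'j => int poly"
 assumes g: "generic_rank I J C rh n A" and "rh' <= card J" "A' ~= 0" and t: "poly (A * A') t ~= 0"
  and *: "!!q b. prime q ==> ~ int q dvd poly A' t ==>
   nsol q b I J C t = q ^ (b * (card J - rh'))"
 shows "rh' = rh"
proof -
 obtain q where q: "prime q" "q > n" "~ int q dvd poly (A * A') t" using large_prime[OF t] by blast
 hence "~ int q dvd poly A t" "~ int q dvd poly A' t" by auto
 hence "q ^ (1 * (card J - rh)) = q ^ (1 * (card J - rh'))" using *[of q 1] g q unfolding generic_rank_def by metis
 hence "card J - rh = card J - rh'" using power_inject_exp[OF prime_gt_1_nat[OF q(1)]] by simp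
 moreover have "rh <= card J" using g unfolding generic_rank_def by blast
 ultimately show ?thesis using assms(2) by linarith
qed

lemma sw_generic:
 assumes g: "generic_rank I J C rh n A" and p: "prime p" "p > n" "~ int p dvd poly A t"
 shows "sw p b I J C t = rh * b"
proof -
 have r: "rh <= card J" using g unfolding generic_rank_def by blast
 have "nsol p b I J C t = p ^ (b * (card J - rh))" using g p unfolding generic_rank_def by blast
 hence "sw p b I J C t = (SUM c<-replicate rh 0. b - c)" using r by (intro sw_eq p(1)) (auto simp: sum_list_replicate)
 thus ?thesis by (simp add: sum_list_replicate)
qed

lemma irreducible_pderiv_coprime:
 fixes f :: "int poly"
 assumes "irreducible (rp f)"
 shows "coprime (rp f) (rp (pderiv f))"
proof (rule irreducible_coprime[OF assms])
 have e: "rp (pderiv f) = pderiv (rp f)" by (rule poly_eqI) (simp add: coeff_pderiv coeff_map_poly)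
 have "degree (rp f) ~= 0" using assms by (metis irreducible_def is_unit_iff_degree)
 thus "~ rp f dvd rp (pderiv f)" unfolding e using not_dvd_pderiv by blast
qed

text \<open>f and its derivative are coprime, so for large p the zeros of f modulo p are simple and
  \<open>cls_root\<close> applies; the number of elementary divisors near the zero is the generic
  rank.\<close>

theorem cls_at_factor:
 fixes C :: "'i => 'j => int poly" and f :: "int poly"
 assumes fin: "finite I" "finite J" and g: "generic_rank I J C rh n A" and f: "irreducible (rp f)"
 obtains ms N where "length ms = rh"
  "!!p z al. prime p ==> p > N ==> int p dvd poly f z ==> cls p al I J C 1 z = Ug p al rh + Kg p al ms"
proof (rule root_elimination[OF fin f, of C], goal_cases)
 case (1 ms n1 A1)
 note ms = 1(2) and A1 = 1(3) and c = 1(4) and q = 1(5)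
 obtain n2 where n2: "!!p t. p > n2 ==> int p dvd poly f t ==> ~ int p dvd poly (pderiv f) t"
  using no_common_zero_mod[OF irreducible_pderiv_coprime[OF f], of thesis] by blast
 show thesis
 proof (cases "EX p t. prime p & p > n1 & int p dvd poly f t")
  \<comment> \<open>One pair (p,t) suffices to identify the length of ms with rh. t is moved within
    its class modulo p so that f, A and A1 do not vanish there.\<close>
  case True
  then obtain p t where p: "prime p" "p > n1" "int p dvd poly f t" by blast
  have "A ~= 0" using g unfolding generic_rank_def by blast
  moreover have "f ~= 0" using f by auto
  ultimately have nz: "f * (A * A1) ~= 0" using A1 by simp
  have p0: "int p > 0" using p(1) by (simp add: prime_gt_0_nat)
  obtain t' where t': "int p dvd t' - t" "poly (f * (A * A1)) t' ~= 0" by (rule poly_nonroot_in_class[OF nz p0, of t])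
  have pt': "int p dvd poly f t'" using dvd_add[OF poly_diff_dvd_diff[OF t'(1), of f] p(3)] by simp
  have ft': "poly f t' ~= 0" and At': "poly (A * A1) t' ~= 0" using t'(2) by auto
  have len: "length ms = rh" by (rule generic_rank_link[OF g ms A1 At']) (rule q[OF p(1,2) pt' ft'])
  show thesis
  proof (rule that[OF len, of "max n1 n2"])
   fix p :: nat and z :: int and al assume p: "prime p" "p > max n1 n2" "int p dvd poly f z"
   have "simple_zero p f z 1 0" using n2[of p z] p by (simp add: simple_zero_def)
   moreover have "sw p b I J C t = (SUM m<-ms. b - m * vp p (poly f t))"
    if t: "int p dvd t - z" "poly f t ~= 0" for t b
   proof -
    have "int p dvd poly f t" using dvd_add[OF poly_diff_dvd_diff[OF t(1), of f] p(3)] by simp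
    from c[OF p(1) _ this t(2), of b] p(2)
    have "nsol p b I J C t =
     p ^ (b * (card J - length (map (%m. m * vp p (poly f t)) ms))
      + (SUM c<-map (%m. m * vp p (poly f t)) ms. min b c))" by (simp add: o_def)
    from sw_eq[OF p(1) _ this] ms show ?thesis by (simp add: o_def)
   qed
   ultimately show "cls p al I J C 1 z = Ug p al rh + Kg p al ms"
    using cls_root[OF p(1), of f z I J C ms al] unfolding len by blast
  qed
 next
  case False
  \<comment> \<open>No prime beyond n1 divides a value of f, so the claim about classes is vacuous
    and any list of the right length serves.\<close>
  show thesis by (rule that[of "replicate rh 0" n1]) (use False in auto)
 qed
qed

text \<open>R(t) is t^m A(1/t) with m the degree of A; it compares the two charts where t u is
  congruent to 1.\<close>

lemma reversed_poly:
 fixes A :: "int poly"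
 assumes "A ~= 0"
 obtains R where "R ~= 0" "!!q t u. q dvd t * u - 1 ==> q dvd poly A u ==> q dvd poly R t"
proof -
 define m where "m = degree A"
 define R where "R = (SUM k<=m. monom (coeff A k) (m - k))"
 have "coeff R 0 = (SUM k<=m. if k = m then coeff A m else 0)"
  unfolding R_def coeff_sum by (rule sum.cong) (auto simp: coeff_monom)
 hence "coeff R 0 ~= 0" using assms by (simp add: m_def)
 hence "R ~= 0" by auto
 moreover have "q dvd poly R t" if d: "q dvd t * u - 1" "q dvd poly A u" for q t u
 proof -
  have "t ^ m * poly A u - poly R t = (SUM k<=m. coeff A k * t ^ (m - k) * ((t * u) ^ k - 1))"
  proof -
   have e: "t ^ m * (coeff A k * u ^ k) = coeff A k * t ^ (m - k) * (t * u) ^ k" if "k <= m" for k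
   proof -
    have "t ^ m = t ^ (m - k) * t ^ k" using that by (simp flip: power_add)
    thus ?thesis by (simp add: power_mult_distrib)
   qed
   have "t ^ m * poly A u = (SUM k<=m. coeff A k * t ^ (m - k) * (t * u) ^ k)"
    unfolding poly_altdef m_def[symmetric] sum_distrib_left by (rule sum.cong) (use e in auto)
   moreover have "poly R t = (SUM k<=m. coeff A k * t ^ (m - k))" unfolding R_def by (simp add: poly_sum poly_monom)
   ultimately show ?thesis by (simp add: right_diff_distrib sum_subtractf)
  qed
  also have "q dvd ..."
  proof (rule dvd_sum)
   fix k
   have "t * u - 1 dvd (t * u) ^ k - 1 ^ k" unfolding power_diff_sumr2 by (rule dvd_triv_left)
   hence "q dvd (t * u) ^ k - 1" using d(1) by (metis dvd_trans power_one)
   thus "q dvd coeff A k * t ^ (m - k) * ((t * u) ^ k - 1)" by simp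
  qed
  finally show ?thesis using d(2) by (simp add: dvd_diff_right_iff)
 qed
 ultimately show ?thesis using that by blast
qed

text \<open>Modulo q, with t u congruent to 1, the equations a + t b = 0 and b + u a = 0 are
  equivalent, so the two charts have the same kernel at a point that is generic in both.\<close>

lemma generic_rank_swap:
 assumes g: "generic_rank {..<n} {..<r} (Cm False l) rh N A" and g': "generic_rank {..<n} {..<r} (Cm True l) rh' N' A'"
 shows "rh' = rh"
proof -
 have A: "A ~= 0" "A' ~= 0" using g g' unfolding generic_rank_def by blast+
 obtain R where R: "R ~= 0" "!!q t u. q dvd t * u - 1 ==> q dvd poly A u ==> q dvd poly R t"
  using reversed_poly[OF A(1)] by blast
 have "[:0, 1:] * (A' * R) ~= 0" using A R by simp
 then obtain t :: int where "poly ([:0, 1:] * (A' * R)) t ~= 0" using poly_nonroot_in_class[of _ 1 0] by (metis zero_less_one)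
 then obtain q where q: "prime q" "q > max N N'" "~ int q dvd poly ([:0, 1:] * (A' * R)) t" using large_prime by blast
 hence d: "~ int q dvd t" "~ int q dvd poly A' t" "~ int q dvd poly R t" by auto
 have "prime (int q)" using q(1) by simp
 from prime_imp_coprime[OF this d(1)] have "coprime t (int q)" by (simp add: coprime_commute)
 then obtain u v where "u * t + v * int q = 1" using bezout_int by (metis coprime_imp_gcd_eq_1)
 hence "t * u - 1 = int q * (- v)" by (simp add: algebra_simps)
 hence tu: "int q dvd t * u - 1" by (metis dvd_triv_left)
 hence Au: "~ int q dvd poly A u" using R(2) d(3) by blast
 have "ker_mod q 1 n r (%i j. poly (Cm True l i j) t) = ker_mod q 1 n r (%i j. poly (Cm False l i j) u)"
 proof -
  have "int q ^ 1 dvd (SUM j<r. poly (Cm True l i j) t * x j) \<longleftrightarrow> int q ^ 1 dvd (SUM j<r. poly (Cm False l i j) u * x j)" for i and x :: "nat => int"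
  proof -
   define a b where "a = (SUM j<r. l j (2 * i) * x j)" and "b = (SUM j<r. l j (2 * i + 1) * x j)"
   have "(SUM j<r. poly (Cm True l i j) t * x j) = a + t * b" "(SUM j<r. poly (Cm False l i j) u * x j) = b + u * a"
    by (simp_all add: a_def b_def Cm_def sum_distrib_left sum.distrib[symmetric] algebra_simps)
   moreover have "int q dvd a + t * b \<longleftrightarrow> int q dvd b + u * a"
   proof
    assume "int q dvd a + t * b"
    hence "int q dvd u * (a + t * b) - (t * u - 1) * b" by (intro dvd_diff dvd_mult dvd_mult2 tu)
    thus "int q dvd b + u * a" by (simp add: algebra_simps)
   next
    assume "int q dvd b + u * a"
    hence "int q dvd t * (b + u * a) - (t * u - 1) * a" by (intro dvd_diff dvd_mult dvd_mult2 tu)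
    thus "int q dvd a + t * b" by (simp add: algebra_simps)
   qed
   ultimately show ?thesis by simp
  qed
  thus ?thesis unfolding ker_mod_def by blast
 qed
 moreover have "nsol q 1 {..<n} {..<r} (Cm True l) t = q ^ (1 * (r - rh'))"
  using g' q d(2) unfolding generic_rank_def by simp
 moreover have "nsol q 1 {..<n} {..<r} (Cm False l) u = q ^ (1 * (r - rh))"
  using g q Au unfolding generic_rank_def by simp
 ultimately have "idx (Zd r) (ker_mod q 1 n r (%i j. poly (Cm False l i j) u)) * q ^ (1 * (r - rh')) = q ^ (1 * r)"
   "idx (Zd r) (ker_mod q 1 n r (%i j. poly (Cm False l i j) u)) * q ^ (1 * (r - rh)) = q ^ (1 * r)"
  using idx_ker_mod_card[OF q(1)] by metis+
 moreover have q1: "q > 1" using q(1) by (rule prime_gt_1_nat)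
 ultimately have "q ^ (r - rh') = q ^ (r - rh)"
  by (metis mult_cancel_left mult_is_0 nat_mult_1 not_one_less_zero power_not_zero)
 hence "r - rh' = r - rh" using q1 by (simp add: power_inject_exp)
 moreover have "rh <= r" "rh' <= r" using g g' unfolding generic_rank_def by simp_all
 ultimately show ?thesis by linarith
qed

text \<open>Fs consists of integral multiples of the prime factors of A over the rationals. A
  divides a power of their product up to a constant M, so a prime p > M dividing A(t) divides one
  factor at t.\<close>

lemma integer_factors:
 fixes A :: "int poly"
 assumes "A ~= 0"
 obtains Fs :: "int poly set" and N :: nat where "finite Fs" "!!f. f : Fs ==> irreducible (rp f)"
  "!!f g. f : Fs ==> g : Fs ==> f ~= g ==> coprime (rp f) (rp g)"
  "!!p t. prime p ==> p > N ==> int p dvd poly A t ==> EX f:Fs. int p dvd poly f t"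
proof -
 let ?m = "rp"
 let ?P = "prime_factors (?m A)"
 have B: "?m A ~= 0" using assms map_poly_of_int_eq_iff[of A 0] by simp
 have "EX x. fst x > (0 :: int) & smult (of_int (fst x)) F = ?m (snd x)" for F by (rule clear_denominators[of F]) auto
 then obtain x where x: "!!F. fst (x F) > (0 :: int) & smult (of_int (fst (x F))) F = ?m (snd (x F))" by metis
 define g where "g F = snd (x F)" for F
 define c where "c F = rat_of_int (fst (x F))" for F
 have g: "?m (g F) = smult (c F) F" "c F ~= 0" for F using x[of F] by (auto simp: g_def c_def)
 have cop: "coprime (smult a F) (smult b G) \<longleftrightarrow> coprime F G" if "a ~= 0" "b ~= 0" for a b and F G :: "rat poly"
  using that by (simp add: coprime_def dvd_smult_iff)
 define K where "K = (SUM F:?P. multiplicity F (?m A))"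
 have fin: "finite ?P" by simp
 have "(PROD F:?P. F ^ multiplicity F (?m A)) dvd (PROD F:?P. ?m (g F) ^ K)"
 proof (rule prod_dvd_prod)
  fix F assume "F : ?P"
  hence "multiplicity F (?m A) <= K" unfolding K_def using fin by (intro member_le_sum) auto
  hence "F ^ multiplicity F (?m A) dvd F ^ K" by (rule le_imp_power_dvd)
  also have "F ^ K dvd ?m (g F) ^ K" unfolding g(1) by (intro dvd_power_same dvd_smult dvd_refl)
  finally show "F ^ multiplicity F (?m A) dvd ?m (g F) ^ K" .
 qed
 moreover have "(PROD F:?P. F ^ multiplicity F (?m A)) = normalize (?m A)" by (rule prod_prime_factors[OF B])
 ultimately have "?m A dvd (PROD F:?P. ?m (g F) ^ K)" by simp
 moreover have "(PROD F:S. ?m (g F) ^ K) = ?m (PROD F:S. g F ^ K)" if "finite S" for S using that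
 proof (induction S)
  case (insert F S)
  have "?m (g F) ^ k = ?m (g F ^ k)" for k by (induction k) (simp_all add: map_poly_of_int_mult)
  thus ?case using insert by (simp add: map_poly_of_int_mult)
 qed simp
 ultimately obtain H where H: "?m (PROD F:?P. g F ^ K) = ?m A * H" using fin by (metis dvdE)
 obtain M U where M: "M > 0" "smult (of_int M) H = ?m U" by (rule clear_denominators)
 have "?m (smult M (PROD F:?P. g F ^ K)) = smult (of_int M) (?m (PROD F:?P. g F ^ K))"
  by (rule poly_eqI) (simp add: coeff_map_poly)
 also have "... = ?m (A * U)" unfolding H map_poly_of_int_mult M(2)[symmetric] by simp
 finally have e: "smult M (PROD F:?P. g F ^ K) = A * U" unfolding map_poly_of_int_eq_iff .
 show thesis
 proof (rule that[of "g ` ?P" "nat M"])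
  show "finite (g ` ?P)" by simp
  show "irreducible (?m f)" if f: "f : g ` ?P" for f
  proof -
   obtain F where F: "F : ?P" "f = g F" using f by blast
   have "irreducible F" using in_prime_factors_imp_prime[OF F(1)] by (simp add: prime_elem_imp_irreducible prime_imp_prime_elem)
   thus ?thesis unfolding F(2) g(1) using g(2)[of F] irreducible_mult_unit_left[of "[:c F:]" F]
    by (simp add: is_unit_const_poly_iff dvd_field_iff)
  qed
  show "coprime (?m f) (?m h)" if f: "f : g ` ?P" "h : g ` ?P" "f ~= h" for f h
  proof -
   obtain F H where F: "F : ?P" "f = g F" "H : ?P" "h = g H" using f by blast
   have "F ~= H" using f(3) F by blast
   hence "coprime F H" using primes_coprime in_prime_factors_imp_prime F by metis
   thus ?thesis unfolding F g(1) using cop g(2) by blast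
  qed
  show "EX f:g ` ?P. int p dvd poly f t" if p: "prime p" "p > nat M" "int p dvd poly A t" for p t
  proof -
   have pp: "prime (int p)" using p(1) by simp
   have "M * (PROD F:?P. poly (g F) t ^ K) = poly A t * poly U t"
    using arg_cong[OF e, of "%f. poly f t"] by (simp add: poly_prod)
   hence "int p dvd M * (PROD F:?P. poly (g F) t ^ K)" using p(3) by simp
   moreover have "~ int p dvd M" using p(2) M(1) zdvd_imp_le[of "int p" M] by auto
   ultimately have "int p dvd (PROD F:?P. poly (g F) t ^ K)" using pp by (simp add: prime_dvd_mult_iff)
   then obtain F where "F : ?P" "int p dvd poly (g F) t ^ K" using pp fin by (auto simp: prime_dvd_prod_iff)
   thus ?thesis using prime_dvd_power[OF pp] by blast
  qed
 qed
qed

definition root_count :: "nat => int poly => nat" where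
 "root_count p f = card {z : {..<p}. int p dvd poly f (int z)}"

text \<open>p enters the shape of this expression only through itself and the root counts; msI
  belongs to the point at infinity.\<close>

definition Xg :: "nat => nat => nat => nat list => int poly set => (int poly => nat list) => nat => rat fps" where
 "Xg n r rh msI Fs ms p = geo (of_nat p ^ (2 * n)) (2 + r) *
  (1 + fps_const (of_nat p + 1) * Ug p (of_nat p ^ n) rh + Kg p (of_nat p ^ n) msI
   + (SUM f:Fs. fps_const (of_nat (root_count p f)) * Kg p (of_nat p ^ n) (ms f)))"

text \<open>Every finite class contributes the generic series \<open>Ug\<close>, and a class on
  which some f in Fs vanishes modulo p has the additional term \<open>Kg\<close>. For large p at
  most one f vanishes on a class.\<close>

theorem Xi_good:
 assumes L: "addsub L" "L <= Zd (2 * n)" and l: "lat_basis L r l"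
 obtains Fs N rh msI ms where "finite Fs" "ALL f:Fs. irreducible (rp f)"
  "ALL p. prime p --> p > N --> (ALL f:Fs. ~ int p dvd lead_coeff f)"
  "ALL p. prime p --> p > N --> Xi n L p = Xg n r rh msI Fs ms p"
proof -
 let ?I = "{..<n}" and ?J = "{..<r}"
 have fin: "finite ?I" "finite ?J" by simp_all
 obtain rh n1 A where g: "generic_rank ?I ?J (Cm False l) rh n1 A" by (rule generic_rank_exists[OF fin])
 obtain rh' n2 A' where g': "generic_rank ?I ?J (Cm True l) rh' n2 A'" by (rule generic_rank_exists[OF fin])
 have rr: "rh' = rh" by (rule generic_rank_swap[OF g g'])
 \<comment> \<open>In the chart at infinity the only class needed is t = 0, which is the zero of the
   polynomial X.\<close>
 have "irreducible (rp [:0, 1:])"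
 proof (rule irreducibleI)
  fix a b :: "rat poly" assume ab: "rp [:0, 1:] = a * b"
  hence "a * b ~= 0" "degree (a * b) = 1" by (simp_all add: map_poly_pCons flip: ab)
  hence "a ~= 0" "b ~= 0" "degree a + degree b = 1" by (auto simp: degree_mult_eq)
  thus "is_unit a | is_unit b" by (auto simp: is_unit_iff_degree add_is_1)
 qed (auto simp: map_poly_pCons is_unit_iff_degree)
 from cls_at_factor[OF fin g' this]
 obtain msI n3 where I: "length msI = rh'" "!!p z al. prime p ==> p > n3 ==> int p dvd poly [:0, 1:] z ==>
   cls p al ?I ?J (Cm True l) 1 z = Ug p al rh' + Kg p al msI" by blast
 have A: "A ~= 0" using g unfolding generic_rank_def by blast
 obtain Fs n4 where Fs: "finite Fs" "!!f. f : Fs ==> irreducible (rp f)"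
  "!!f g. f : Fs ==> g : Fs ==> f ~= g ==> coprime (rp f) (rp g)"
  "!!p t. prime p ==> p > n4 ==> int p dvd poly A t ==> EX f:Fs. int p dvd poly f t"
  using integer_factors[OF A] by blast
 have "EX x. ALL p z al. prime p --> p > snd x --> int p dvd poly f z -->
   cls p al ?I ?J (Cm False l) 1 z = Ug p al rh + Kg p al (fst x)" if f: "f : Fs" for f
 proof (rule cls_at_factor[OF fin g Fs(2)[OF f]], goal_cases)
  case (1 ms N) thus ?case by (intro exI[of _ "(ms, N)"]) simp
 qed
 then obtain x where x: "!!f. f : Fs ==> ALL p z al. prime p --> p > snd (x f) --> int p dvd poly f z -->
   cls p al ?I ?J (Cm False l) 1 z = Ug p al rh + Kg p al (fst (x f))" by metis
 have "EX k. ALL p t. p > k --> int p dvd poly f t --> ~ int p dvd poly h t" if "f : Fs" "h : Fs" "f ~= h" for f h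
  by (rule no_common_zero_mod[OF Fs(3)[OF that]]) blast
 then obtain k where k: "!!f h p t. f : Fs ==> h : Fs ==> f ~= h ==> p > k f h ==> int p dvd poly f t ==> ~ int p dvd poly h t"
  by metis
 obtain e :: int where e: "e > 0" "ALL k>0. ALL y:Zd (2 * n). zs k y : L --> zs e y : L" by (rule saturation[OF L(1)])
 \<comment> \<open>One bound for all exceptional primes: torsion e, generic rank, infinity,
   factorization, each f, leading coefficients, and common zeros of two factors.\<close>
 obtain B where B: "!!y. y : insert (nat e) (insert n1 (insert n3 (insert n4 (((%f. snd (x f)) ` Fs) Un ((%f. nat \<bar>lead_coeff f\<bar>) ` Fs) Un ((%(f, h). k f h) ` (Fs \<times> Fs)))))) ==> y <= B"
  using Fs(1) by (metis (no_types, lifting) Max_ge finite.insertI finite_SigmaI finite_UnI finite_imageI)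
 have un: "f = h" if "prime p" "p > B" "f : Fs" "h : Fs" "int p dvd poly f t" "int p dvd poly h t" for p f h t
 proof (rule ccontr)
  assume "f ~= h"
  moreover have "k f h <= B" using that(3,4) by (intro B) auto
  ultimately show False using k[of f h p t] that by simp
 qed
 show thesis
 proof (rule that[of Fs B rh msI "%f. fst (x f)"]; (intro allI impI ballI)?)
  show "finite Fs" by (rule Fs(1))
  show "irreducible (rp f)" if "f : Fs" for f using Fs(2) that by blast
  show "~ int p dvd lead_coeff f" if "prime p" "p > B" "f : Fs" for p f
  proof -
   have "nat \<bar>lead_coeff f\<bar> <= B" using that(3) by (intro B) blast
   moreover have "lead_coeff f ~= 0" using Fs(2)[OF that(3)] by auto
   ultimately show ?thesis using that(2) zdvd_imp_le[of "int p" "\<bar>lead_coeff f\<bar>"] by auto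
  qed
  fix p assume p: "prime p" "p > B"
  have bs: "n1 <= B" "n3 <= B" "n4 <= B" "nat e <= B" by (intro B; blast)+
  have ep: "~ int p dvd e" using zdvd_imp_le[of "int p" e] e(1) bs(4) p(2) by auto
  define al :: rat where "al = of_nat p ^ n"
  have z: "cls p al ?I ?J (Cm False l) 1 (int z) = Ug p al rh + (SUM f:Fs. if int p dvd poly f (int z) then Kg p al (fst (x f)) else 0)" for z
  proof (cases "EX f:Fs. int p dvd poly f (int z)")
   case True
   then obtain f where f: "f : Fs" "int p dvd poly f (int z)" by blast
   have "snd (x f) <= B" using f(1) by (intro B) blast
   hence c: "cls p al ?I ?J (Cm False l) 1 (int z) = Ug p al rh + Kg p al (fst (x f))"
    using x[OF f(1)] p f(2) by (meson le_less_trans)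
   have "(SUM h:Fs. if int p dvd poly h (int z) then Kg p al (fst (x h)) else 0) = (SUM h:Fs. if h = f then Kg p al (fst (x f)) else 0)"
   proof (rule sum.cong[OF refl])
    fix h assume h: "h : Fs"
    show "(if int p dvd poly h (int z) then Kg p al (fst (x h)) else 0) = (if h = f then Kg p al (fst (x f)) else 0)"
     using un[OF p h f(1) _ f(2)] f(2) by (cases "h = f") (simp_all, blast)
   qed
   thus ?thesis using f(1) Fs(1) unfolding c by simp
  next
   case False
   have "cls p al ?I ?J (Cm False l) 1 (int z) = Ug p al rh"
   proof (rule cls_generic[OF p(1)])
    fix t b assume t: "int p dvd t - int z"
    have "~ int p dvd poly A t"
    proof
     assume "int p dvd poly A t"
     then obtain f where f: "f : Fs" "int p dvd poly f t" using Fs(4)[OF p(1)] p(2) bs(3) by (meson le_less_trans)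
     have "int p dvd poly f t - (poly f t - poly f (int z))" by (rule dvd_diff[OF f(2) poly_diff_dvd_diff[OF t]])
     thus False using False f(1) by simp
    qed
    thus "sw p b ?I ?J (Cm False l) t = rh * b" using p bs(1) by (intro sw_generic[OF g]) auto
   qed
   thus ?thesis using False by simp
  qed
  have "(SUM z<p. if int p dvd poly f (int z) then K else 0) = fps_const (of_nat (root_count p f)) * K" for f and K :: "rat fps"
  proof -
   have "(SUM z<p. if int p dvd poly f (int z) then K else 0) = (SUM z:{z : {..<p}. int p dvd poly f (int z)}. K)"
    by (rule sum.inter_filter[symmetric]) simp
   thus ?thesis by (simp add: root_count_def fps_of_nat)
  qed
  hence "(SUM z<p. cls p al ?I ?J (Cm False l) 1 (int z)) =
    fps_const (of_nat p) * Ug p al rh + (SUM f:Fs. fps_const (of_nat (root_count p f)) * Kg p al (fst (x f)))"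
   unfolding z sum.distrib sum.swap[of _ Fs "{..<p}"] by (simp add: fps_of_nat)
  moreover have "cls p al ?I ?J (Cm True l) 1 0 = Ug p al rh + Kg p al msI"
   using I(2)[OF p(1), of 0 al] p(2) bs(2) rr by simp
  ultimately have "X0 n r l p = 1 + (fps_const (of_nat p) * Ug p al rh + (SUM f:Fs. fps_const (of_nat (root_count p f)) * Kg p al (fst (x f))))
    + (Ug p al rh + Kg p al msI)" using X0_cls[OF prime_gt_0_nat[OF p(1)], of n r l] unfolding al_def by simp
  also have "... = 1 + (fps_const (of_nat p) + 1) * Ug p al rh + Kg p al msI + (SUM f:Fs. fps_const (of_nat (root_count p f)) * Kg p al (fst (x f)))"
   by (simp only: distrib_right mult_1_left) (simp only: ac_simps)
  also have "fps_const (of_nat p) + 1 = fps_const (of_nat p + 1 :: rat)" by (simp flip: fps_const_add)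
  finally have X: "X0 n r l p = 1 + fps_const (of_nat p + 1) * Ug p al rh + Kg p al msI + (SUM f:Fs. fps_const (of_nat (root_count p f)) * Kg p al (fst (x f)))" .
  show "Xi n L p = Xg n r rh msI Fs (%f. fst (x f)) p" unfolding Xi_unsaturated[OF p(1) L l e ep] X al_def Xg_def ..
 qed
qed

section \<open>Central extensions of Z^d by Z^2\<close>

lemma Zd_generated:
 assumes "addsub T" "!!i. i < n ==> ev i : T" shows "Zd n <= T"
proof
 fix x assume x: "x : Zd n"
 have "comb n ev x = x" using x by (auto simp: comb_def ev_def fun_eq_iff Zd_def if_distrib[of "(*) _"] cong: if_cong)
 moreover have "comb n ev x : T" by (rule comb_in[OF assms(1)]) (rule assms(2))
 ultimately show "x : T" by simp
qed

text \<open>An exact sequence with central kernel: \<open>io\<close> embeds Z^2 as the kernel of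
  \<open>pj\<close>, which maps onto Z^d.\<close>

locale central_ext = group G for G (structure) +
 fixes pj :: "'a => nat => int" and io :: "int * int => 'a" and d :: nat
 assumes pi_Zd: "g : carrier G ==> pj g : Zd d"
  and pi_mult: "g : carrier G ==> h : carrier G ==> pj (g \<otimes> h) = pj g + pj h"
  and pi_onto: "x : Zd d ==> EX g:carrier G. pj g = x"
  and iota_carrier [simp, intro]: "io u : carrier G"
  and iota_add: "io (u + v) = io u \<otimes> io v"
  and iota_inj: "io u = io v ==> u = v"
  and iota_range: "g : carrier G ==> pj g = 0 ==> EX u. g = io u"
  and pi_iota: "pj (io u) = 0"
  and iota_central: "g : carrier G ==> g \<otimes> io u = io u \<otimes> g"
begin

lemma iota_0: "io 0 = \<one>" using iota_add[of 0 0] by (simp add: l_cancel_one')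

lemma pi_one: "pj \<one> = 0" using pi_iota[of 0] unfolding iota_0 .

lemma iota_minus: "io (- u) = inv (io u)"
 using iota_add[of "- u" u] iota_0 by (intro inv_equality[symmetric]) simp_all

lemma pi_inv: "g : carrier G ==> pj (inv g) = - pj g"
 using pi_mult[of "inv g" g] pi_one by (simp add: eq_neg_iff_add_eq_0 del: plus_fun_apply)

lemma iota_left: "g : carrier G ==> h : carrier G ==> g \<otimes> (io u \<otimes> h) = io u \<otimes> (g \<otimes> h)"
 by (simp add: m_assoc[symmetric] iota_central)

lemma iota_comb: "g : carrier G ==> io u \<otimes> (io v \<otimes> g) = io (u + v) \<otimes> g"
 by (simp add: m_assoc[symmetric] iota_add)

lemma same_pi:
 assumes "g : carrier G" "h : carrier G" "pj g = pj h"
 obtains u where "g = io u \<otimes> h"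
proof -
 have "pj (g \<otimes> inv h) = 0" using assms by (simp only: pi_mult inv_closed pi_inv) simp
 then obtain u where "g \<otimes> inv h = io u" using iota_range assms by blast
 hence "g = io u \<otimes> h" using assms by (metis inv_solve_right iota_carrier)
 thus ?thesis using that by blast
qed

text \<open>The commutator of g and h read in Z^2; it exists because \<open>pj\<close> does not see
  the order of the factors. It depends on \<open>pj g\<close> and \<open>pj h\<close> only and so
  descends to the form \<open>ph\<close>.\<close>

definition cm :: "'a => 'a => int * int" where
 "cm g h = (SOME u. g \<otimes> h = io u \<otimes> (h \<otimes> g))"

lemma cm_eq: "g : carrier G ==> h : carrier G ==> g \<otimes> h = io (cm g h) \<otimes> (h \<otimes> g)"
 unfolding cm_def by (rule someI_ex, rule same_pi[of "g \<otimes> h" "h \<otimes> g"]) (auto simp only: pi_mult m_closed add.commute)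

lemma cm_unique:
 assumes "g : carrier G" "h : carrier G" "g \<otimes> h = io u \<otimes> (h \<otimes> g)" shows "cm g h = u"
proof -
 have "io (cm g h) \<otimes> (h \<otimes> g) = io u \<otimes> (h \<otimes> g)" using cm_eq[OF assms(1,2)] assms(3) by simp
 hence "io (cm g h) = io u" using assms by simp
 thus ?thesis by (rule iota_inj)
qed

lemma cm_mult_left:
 assumes g: "g : carrier G" "g' : carrier G" "h : carrier G"
 shows "cm (g \<otimes> g') h = cm g h + cm g' h"
proof (rule cm_unique)
 have "g \<otimes> g' \<otimes> h = g \<otimes> (io (cm g' h) \<otimes> (h \<otimes> g'))" using cm_eq[of g' h] g by (simp add: m_assoc)
 also have "... = io (cm g' h) \<otimes> (g \<otimes> h \<otimes> g')" using g by (simp add: iota_left m_assoc)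
 also have "... = io (cm g' h) \<otimes> (io (cm g h) \<otimes> (h \<otimes> g) \<otimes> g')" using cm_eq[of g h] g by simp
 also have "... = io (cm g' h + cm g h) \<otimes> (h \<otimes> (g \<otimes> g'))" using g by (simp add: m_assoc iota_comb)
 finally show "g \<otimes> g' \<otimes> h = io (cm g h + cm g' h) \<otimes> (h \<otimes> (g \<otimes> g'))" by (simp only: add.commute)
qed (use g in auto)

lemma cm_swap: "g : carrier G ==> h : carrier G ==> cm h g = - cm g h"
 by (rule cm_unique) (simp_all add: cm_eq[of g h] iota_comb iota_0)

lemma cm_iota: "h : carrier G ==> cm (io u) h = 0" by (rule cm_unique) (simp_all add: iota_0 iota_central)

lemma cm_pi:
 assumes "g : carrier G" "g' : carrier G" "h : carrier G" "pj g = pj g'" shows "cm g h = cm g' h"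
proof -
 obtain u where "g = io u \<otimes> g'" by (rule same_pi[OF assms(1,2,4)])
 thus ?thesis using cm_mult_left[of "io u" g' h] cm_iota[OF assms(3), of u] assms by simp
qed

definition sec :: "(nat => int) => 'a" where "sec x = (SOME g. g : carrier G & pj g = x)"

lemma sec: assumes "x : Zd d" shows "sec x : carrier G" "pj (sec x) = x"
 using someI_ex[of "%g. g : carrier G & pj g = x"] pi_onto[OF assms] unfolding sec_def by blast+

definition ph :: "(nat => int) => (nat => int) => int * int" where "ph x y = cm (sec x) (sec y)"

lemma cm_ph:
 assumes "g : carrier G" "h : carrier G" shows "cm g h = ph (pj g) (pj h)"
proof -
 note s = sec[OF pi_Zd[OF assms(1)]] sec[OF pi_Zd[OF assms(2)]]
 have "cm g h = cm (sec (pj g)) h" by (rule cm_pi) (use assms s in auto)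
 also have "... = - cm h (sec (pj g))" using cm_swap assms s by blast
 also have "cm h (sec (pj g)) = cm (sec (pj h)) (sec (pj g))" by (rule cm_pi) (use assms s in auto)
 also have "- cm (sec (pj h)) (sec (pj g)) = ph (pj g) (pj h)" unfolding ph_def using cm_swap s by metis
 finally show ?thesis .
qed

lemma ph_add_left:
 assumes "x : Zd d" "x' : Zd d" "y : Zd d" shows "ph (x + x') y = ph x y + ph x' y"
proof -
 note s = sec[OF assms(1)] sec[OF assms(2)] sec[OF assms(3)]
 show ?thesis using cm_mult_left[of "sec x" "sec x'" "sec y"] s by (simp only: cm_ph m_closed pi_mult)
qed

lemma ph_swap: "x : Zd d ==> y : Zd d ==> ph y x = - ph x y" unfolding ph_def using cm_swap sec by metis

lemma ph_diff_left:
 assumes "x : Zd d" "x' : Zd d" "y : Zd d" shows "ph (x - x') y = ph x y - ph x' y"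
proof -
 have "x - x' : Zd d" by (rule addsub_diff[OF addsub_Zd assms(1,2)])
 from ph_add_left[OF this assms(2,3)] show ?thesis by simp
qed

text \<open>The values of the form ph(x, -) on the standard basis, flattened to a vector of Z^(2d).
  This makes X(M) the preimage of M^d under a homomorphism.\<close>

definition Ph :: "(nat => int) => nat => int" where
 "Ph x j = (if j < 2 * d then (if even j then fst (ph x (ev (j div 2))) else snd (ph x (ev (j div 2)))) else 0)"

lemma Ph_pair: "i < d ==> (Ph x (2 * i), Ph x (2 * i + 1)) = ph x (ev i)" by (simp add: Ph_def)

lemma Ph_Zd: "Ph x : Zd (2 * d)" by (simp add: Zd_def Ph_def)

lemma Ph_diff: "x : Zd d ==> x' : Zd d ==> Ph (x - x') = Ph x - Ph x'"
 by (rule ext) (simp add: Ph_def ph_diff_left[OF _ _ ev_Zd] del: minus_apply, simp add: Ph_def)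

definition Lat :: "(nat => int) set" where "Lat = Ph ` Zd d"

lemma addsub_Lat: "addsub Lat" "Lat <= Zd (2 * d)"
proof -
 have z: "0 : Zd d" by (rule addsub_zero[OF addsub_Zd])
 have "Ph 0 = 0" using Ph_diff[OF z z] by simp
 hence "0 : Lat" unfolding Lat_def using z by force
 moreover have "Ph x - Ph y : Lat" if "x : Zd d" "y : Zd d" for x y
  unfolding Lat_def Ph_diff[OF that, symmetric] using addsub_diff[OF addsub_Zd that] by blast
 ultimately show "addsub Lat" unfolding addsub_def Lat_def by blast
qed (use Ph_Zd in \<open>auto simp: Lat_def\<close>)

definition Xm :: "(int * int) set => (nat => int) set" where
 "Xm M = {x : Zd d. Ph x : Hm d M}"

lemma Xm_iff:
 assumes M: "addsub M" and x: "x : Zd d" shows "x : Xm M \<longleftrightarrow> (ALL y:Zd d. ph x y : M)"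
proof
 assume "x : Xm M"
 hence e: "ph x (ev i) : M" if "i < d" for i using that Ph_pair[OF that, of x] unfolding Xm_def Hm_def by (metis (lifting) CollectD)
 have "addsub {y : Zd d. ph y x : M}"
 proof -
  have "ph 0 x = 0" using ph_diff_left[OF x x x] by simp
  thus ?thesis
   using addsub_zero[OF addsub_Zd, of d] addsub_zero[OF M] addsub_diff[OF M] addsub_diff[OF addsub_Zd, of _ d]
   unfolding addsub_def by (simp add: ph_diff_left[OF _ _ x])
 qed
 moreover have "ev i : {y : Zd d. ph y x : M}" if "i < d" for i
  using e[OF that] ev_Zd[OF that] ph_swap[OF x ev_Zd[OF that]] addsub_minus[OF M] by simp
 ultimately have "Zd d <= {y : Zd d. ph y x : M}" by (rule Zd_generated)
 hence y: "ph y x : M" if "y : Zd d" for y using that by blast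
 have "ph x y : M" if "y : Zd d" for y using addsub_minus[OF M y[OF that]] ph_swap[OF that x] by simp
 thus "ALL y:Zd d. ph x y : M" by blast
next
 assume "ALL y:Zd d. ph x y : M"
 thus "x : Xm M" using x Ph_Zd Ph_pair ev_Zd by (simp add: Xm_def Hm_def)
qed

lemma addsub_Xm: assumes "addsub M" shows "addsub (Xm M)"
proof -
 have z: "0 : Zd d" by (rule addsub_zero[OF addsub_Zd])
 have "Ph 0 = 0" using Ph_diff[OF z z] by simp
 hence "0 : Xm M" using z addsub_zero[OF addsub_Hm[OF assms]] by (simp add: Xm_def)
 moreover have "x - y : Xm M" if "x : Xm M" "y : Xm M" for x y
  using that Ph_diff[of x y] addsub_diff[OF addsub_Zd, of x d y] addsub_diff[OF addsub_Hm[OF assms], of "Ph x" d "Ph y"]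
  by (simp only: Xm_def mem_Collect_eq)
 ultimately show ?thesis unfolding addsub_def by blast
qed

text \<open>The passage from the group to lattices: the index of X(M) depends only on the image
  lattice of \<open>Ph\<close>.\<close>

lemma idx_Xm: assumes "addsub M" shows "idx (Zd d) (Xm M) = idx Lat (Hm d M)"
 unfolding Xm_def by (rule idx_hom[OF addsub_Zd addsub_Lat(1) addsub_Hm[OF assms]]) (simp_all only: Lat_def Ph_diff)

definition Pm :: "(int * int) set => 'a set" where "Pm M = {g : carrier G. pj g : Xm M}"

lemma Pm_comm:
 assumes "addsub M" "g : Pm M" "h : carrier G"
 obtains m where "m : M" "g \<otimes> h = io m \<otimes> (h \<otimes> g)"
proof -
 have g: "g : carrier G" "pj g : Xm M" using assms(2) by (auto simp: Pm_def)
 have "ph (pj g) (pj h) : M" using Xm_iff[OF assms(1) pi_Zd[OF g(1)]] g(2) pi_Zd[OF assms(3)] by blast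
 thus ?thesis using that cm_eq[OF g(1) assms(3)] cm_ph[OF g(1) assms(3)] by metis
qed

lemma iota_collect:
 assumes "a : carrier G" "b : carrier G" "y : carrier G" "z : carrier G"
 shows "io m \<otimes> (a \<otimes> (io k \<otimes> (b \<otimes> y)) \<otimes> z) = io (m + k) \<otimes> (a \<otimes> b \<otimes> (y \<otimes> z))"
 using assms iota_left[of a "b \<otimes> y" k] by (simp add: m_assoc iota_comb)

primrec prods :: "(nat => 'a) => nat => (nat => int) => 'a" where
 "prods b 0 x = \<one>"
| "prods b (Suc n) x = prods b n x \<otimes> b n [^] x n"

lemma pi_int_pow:
 assumes "g : carrier G" shows "pj (g [^] (k :: int)) = zs k (pj g)"
proof -
 have n: "pj (g [^] (n :: nat)) = zs (int n) (pj g)" for n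
 proof (induction n)
  case 0 show ?case by (simp add: pi_one zs_simps)
 next
  case (Suc n)
  have "pj (g [^] Suc n) = zs (int n) (pj g) + zs 1 (pj g)"
   using Suc pi_mult[of "g [^] n" g] assms by (simp only: nat_pow_Suc nat_pow_closed zs_simps(7))
  also have "... = zs (int (Suc n)) (pj g)" by (simp only: zs_simps(1)[symmetric] of_nat_Suc add.commute[of 1])
  finally show ?case .
 qed
 show ?thesis
 proof (cases k rule: int_cases2)
  case (nonneg m)
  thus ?thesis using n[of m] by (simp only: int_pow_int)
 next
  case (nonpos m)
  show ?thesis unfolding nonpos int_pow_neg_int[OF assms] pi_inv[OF nat_pow_closed[OF assms]] n zs_simps(8) ..
 qed
qed

lemma prods_carrier: "(!!i. i < n ==> b i : carrier G) ==> prods b n x : carrier G" by (induction n) auto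

lemma pi_prods:
 "(!!i. i < n ==> b i : carrier G) ==> pj (prods b n x) = comb n (%i. pj (b i)) x"
proof (induction n)
 case 0 show ?case by (auto simp: pi_one comb_def)
next
 case (Suc n)
 have "pj (prods b (Suc n) x) = pj (prods b n x) + zs (x n) (pj (b n))"
  using Suc.prems prods_carrier[of n b x] by (simp only: prods.simps pi_mult int_pow_closed lessI less_SucI pi_int_pow)
 thus ?case using Suc by (simp add: comb_def zs_def fun_eq_iff)
qed

text \<open>Moving a factor that lies above X(M) past any other element costs only an element of M,
  so ordered products are additive in their exponents modulo M.\<close>

lemma prods_add:
 assumes M: "addsub M" and b: "!!i. i < n ==> b i : Pm M"
 shows "EX m:M. prods b n (x + y) = io m \<otimes> (prods b n x \<otimes> prods b n y)" using b
proof (induction n)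
 case 0
 show ?case by (rule bexI[OF _ addsub_zero[OF M]]) (simp add: iota_0)
next
 case (Suc n)
 have "EX m:M. prods b n (x + y) = io m \<otimes> (prods b n x \<otimes> prods b n y)"
  by (rule Suc.IH) (use Suc.prems in simp)
 then obtain m where m: "m : M" "prods b n (x + y) = io m \<otimes> (prods b n x \<otimes> prods b n y)" by blast
 have bc: "b i : carrier G" if "i < Suc n" for i using Suc.prems[OF that] by (simp add: Pm_def)
 have c: "prods b n z : carrier G" for z using bc by (intro prods_carrier) auto
 have bn: "b n : carrier G" by (rule bc) simp
 have "b n [^] x n : Pm M" using Suc.prems[of n] bn addsub_zs[OF addsub_Xm[OF M]] by (simp add: Pm_def pi_int_pow)
 from Pm_comm[OF M this c[of y]] obtain m' where m': "m' : M"
  "b n [^] x n \<otimes> prods b n y = io m' \<otimes> (prods b n y \<otimes> b n [^] x n)" by blast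
 hence s: "prods b n y \<otimes> b n [^] x n = io (- m') \<otimes> (b n [^] x n \<otimes> prods b n y)"
  using c bn by (simp add: iota_comb iota_0)
 have "prods b (Suc n) (x + y) = io m \<otimes> (prods b n x \<otimes> (prods b n y \<otimes> b n [^] x n) \<otimes> b n [^] y n)"
  unfolding prods.simps plus_fun_apply int_pow_mult[OF bn] m(2) using c bn by (simp add: m_assoc)
 also have "... = io (m + - m') \<otimes> (prods b (Suc n) x \<otimes> prods b (Suc n) y)"
  unfolding s prods.simps by (rule iota_collect) (use c bn in auto)
 finally show ?case using addsub_add[OF M m(1) addsub_minus[OF M m'(1)]] by blast
qed

end

section \<open>Normal subgroups of a central extension\<close>

context central_ext
begin

definition zpart :: "'a set => (int * int) set" where "zpart N = {u. io u : N}"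

text \<open>The candidate for the normal subgroup with central part M that contains the elements n
  0, ..., n (d-1); \<open>nspan_props\<close> shows that it is one when these lie above X(M) and are
  independent.\<close>

definition nspan :: "(int * int) set => (nat => 'a) => 'a set" where
 "nspan M n = {g. EX u:M. EX x:Zd d. g = io u \<otimes> prods n d x}"

lemma addsub_zpart: assumes "subgroup N G" shows "addsub (zpart N)"
proof -
 have "io (u - v) = io u \<otimes> inv (io v)" for u v using iota_add[of u "- v"] iota_minus[of v] by simp
 thus ?thesis unfolding addsub_def zpart_def
  using subgroup.one_closed[OF assms] subgroup.m_closed[OF assms] subgroup.m_inv_closed[OF assms] by (simp add: iota_0)
qed

lemma addsub_pi: assumes "subgroup N G" shows "addsub (pj ` N)"
proof -
 have c: "g : carrier G" if "g : N" for g using subgroup.mem_carrier[OF assms that] .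
 have "pj g - pj h : pj ` N" if g: "g : N" "h : N" for g h
 proof -
  have "pj (g \<otimes> inv h) = pj g - pj h" using g c by (simp only: pi_mult inv_closed pi_inv) simp
  moreover have "g \<otimes> inv h : N" using g subgroup.m_closed[OF assms] subgroup.m_inv_closed[OF assms] by blast
  ultimately show ?thesis by (metis imageI)
 qed
 moreover have "0 : pj ` N" using subgroup.one_closed[OF assms] pi_one by (metis imageI)
 ultimately show ?thesis unfolding addsub_def by blast
qed

text \<open>For g in a normal N and any h the commutator of g and h lies in N and is central, so it
  lies in M.\<close>

lemma normal_Pm:
 assumes N: "N \<lhd> G" shows "N <= Pm (zpart N)"
proof
 fix g assume g: "g : N"
 have sN: "subgroup N G" using N by (rule normal_imp_subgroup)
 have gc: "g : carrier G" using subgroup.mem_carrier[OF sN g] .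
 have "ph (pj g) y : zpart N" if "y : Zd d" for y
 proof -
  obtain h where h: "h : carrier G" "pj h = y" using pi_onto[OF `y : Zd d`] by blast
  have "g \<otimes> (h \<otimes> inv g \<otimes> inv h) : N"
   using g h N sN by (intro subgroup.m_closed[OF sN] normal.inv_op_closed2 subgroup.m_inv_closed)
  also have "g \<otimes> (h \<otimes> inv g \<otimes> inv h) = (g \<otimes> h) \<otimes> (inv g \<otimes> inv h)" using gc h by (simp add: m_assoc)
  also have "... = io (cm g h)" unfolding cm_eq[OF gc h(1)] using gc h(1) by (simp add: m_assoc inv_solve_right' flip: inv_mult_group)
  finally show ?thesis using cm_ph[OF gc h(1)] h(2) by (simp add: zpart_def)
 qed
 thus "g : Pm (zpart N)" using Xm_iff[OF addsub_zpart[OF sN] pi_Zd[OF gc]] gc by (simp add: Pm_def)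
qed

lemma prods_0: "prods n m 0 = \<one>" by (induction m) simp_all

lemma prods_ev: "(!!i. i < m ==> n i : carrier G) ==> prods n m (ev j) = (if j < m then n j else \<one>)"
proof (induction m)
 case (Suc m)
 have "prods n m (ev j) = (if j < m then n j else \<one>)" by (rule Suc.IH) (use Suc.prems in simp)
 thus ?case using Suc.prems[of m] Suc.prems[of j] by (auto simp: ev_def less_Suc_eq)
qed simp

lemma prods_subgroup:
 assumes "subgroup N G" "!!i. i < m ==> n i : N" shows "prods n m x : N" using assms(2)
proof (induction m)
 case (Suc m)
 thus ?case using subgroup.m_closed[OF assms(1)] subgroup_int_pow_closed[OF assms(1)] by simp
qed (simp add: subgroup.one_closed[OF assms(1)])

text \<open>\<open>prods_add\<close> makes the set closed under products and inverses, and
  \<open>Pm_comm\<close> makes it closed under conjugation. Independence of the projections keeps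
  the central part from growing beyond M.\<close>

lemma nspan_props:
 assumes M: "addsub M" and n: "!!i. i < d ==> n i : Pm M" and inj: "inj_on (comb d (%i. pj (n i))) (Zd d)"
 shows "nspan M n \<lhd> G" "zpart (nspan M n) = M" "pj ` nspan M n = comb d (%i. pj (n i)) ` Zd d" "!!i. i < d ==> n i : nspan M n"
proof -
 let ?c = "comb d (%i. pj (n i))"
 have nc: "n i : carrier G" if "i < d" for i using n[OF that] by (simp add: Pm_def)
 have pc: "prods n d x : carrier G" for x by (rule prods_carrier[OF nc])
 have pp: "pj (prods n d x) = ?c x" for x by (rule pi_prods[OF nc])
 have pa: "EX m:M. prods n d (x + y) = io m \<otimes> (prods n d x \<otimes> prods n d y)" for x y
  by (rule prods_add[OF M]) (rule n)
 have pX: "prods n d x : Pm M" for x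
 proof -
  have "?c x : Xm M" by (rule comb_in[OF addsub_Xm[OF M]]) (use n in \<open>simp add: Pm_def\<close>)
  thus ?thesis using pp pc by (simp add: Pm_def)
 qed
 have z: "0 : Zd d" by (rule addsub_zero[OF addsub_Zd])
 have I: "io u \<otimes> prods n d x : nspan M n" if "u : M" "x : Zd d" for u x using that by (auto simp: nspan_def)
 have sub: "nspan M n <= carrier G" using pc by (auto simp: nspan_def)
 have mul: "g \<otimes> h : nspan M n" if gh: "g : nspan M n" "h : nspan M n" for g h
 proof -
  obtain u x where g: "u : M" "x : Zd d" "g = io u \<otimes> prods n d x" using gh(1) by (auto simp: nspan_def)
  obtain v y where h: "v : M" "y : Zd d" "h = io v \<otimes> prods n d y" using gh(2) by (auto simp: nspan_def)
  obtain m where m: "m : M" "prods n d (x + y) = io m \<otimes> (prods n d x \<otimes> prods n d y)" using pa by blast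
  have "prods n d x \<otimes> prods n d y = io (- m) \<otimes> prods n d (x + y)" unfolding m(2) using pc by (simp add: iota_comb iota_0)
  moreover have "g \<otimes> h = io (u + v) \<otimes> (prods n d x \<otimes> prods n d y)"
   unfolding g h using iota_left[of "prods n d x" "prods n d y" v] pc by (simp add: m_assoc iota_comb)
  ultimately have "g \<otimes> h = io (u + v + - m) \<otimes> prods n d (x + y)" using pc by (simp only: iota_comb)
  thus ?thesis
   using I[OF addsub_add[OF M addsub_add[OF M g(1) h(1)] addsub_minus[OF M m(1)]] addsub_add[OF addsub_Zd g(2) h(2)]] by simp
 qed
 have inv: "inv g : nspan M n" if g: "g : nspan M n" for g
 proof -
  obtain u x where g: "u : M" "x : Zd d" "g = io u \<otimes> prods n d x" using g by (auto simp: nspan_def)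
  obtain m where m: "m : M" "prods n d (- x + x) = io m \<otimes> (prods n d (- x) \<otimes> prods n d x)" using pa by blast
  have "\<one> = io m \<otimes> (prods n d (- x) \<otimes> prods n d x)" using m(2) by (simp only: left_minus prods_0)
  hence "\<one> = io (m + - u) \<otimes> prods n d (- x) \<otimes> g"
   unfolding g using iota_left[of "prods n d (- x)" "prods n d x" u] pc by (simp add: m_assoc iota_comb)
  hence "inv g = io (m + - u) \<otimes> prods n d (- x)" using pc g(3) by (intro inv_equality) simp_all
  thus ?thesis using I[OF addsub_add[OF M m(1) addsub_minus[OF M g(1)]] addsub_minus[OF addsub_Zd g(2)]] by simp
 qed
 have "\<one> : nspan M n" using I[OF addsub_zero[OF M] z] by (simp add: iota_0 prods_0)
 hence sg: "subgroup (nspan M n) G" using sub mul inv by (intro subgroupI) auto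
 show N: "nspan M n \<lhd> G" unfolding normal_inv_iff
 proof (intro conjI sg ballI)
  fix h g assume h: "h : carrier G" and g: "g : nspan M n"
  obtain u x where gx: "u : M" "x : Zd d" "g = io u \<otimes> prods n d x" using g by (auto simp: nspan_def)
  obtain m where m: "m : M" "prods n d x \<otimes> h = io m \<otimes> (h \<otimes> prods n d x)" by (rule Pm_comm[OF M pX h])
  have gc: "g : carrier G" using g sub by blast
  have "g \<otimes> h = io m \<otimes> (h \<otimes> g)"
   unfolding gx using m(2) iota_left[OF h, of "prods n d x" u] pc h by (simp add: m_assoc iota_comb add.commute)
  hence "h \<otimes> g = io (- m) \<otimes> (g \<otimes> h)" using h gc by (simp add: iota_comb iota_0)
  hence "h \<otimes> g \<otimes> inv h = io (- m) \<otimes> g" using h gc by (simp add: m_assoc)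
  moreover have "io (- m) : nspan M n" using I[OF addsub_minus[OF M m(1)] z] by (simp add: prods_0)
  ultimately show "h \<otimes> g \<otimes> inv h : nspan M n" using mul g by simp
 qed
 show "pj ` nspan M n = ?c ` Zd d"
 proof -
  have e: "pj (io u \<otimes> prods n d x) = ?c x" for u x using pc by (simp only: pi_mult iota_carrier pi_iota pp) simp
  have "?c x : pj ` nspan M n" if "x : Zd d" for x using I[OF addsub_zero[OF M] that] e by (metis imageI)
  moreover have "pj g : ?c ` Zd d" if "g : nspan M n" for g using that e unfolding nspan_def by blast
  ultimately show ?thesis by blast
 qed
 show "n i : nspan M n" if "i < d" for i
 proof -
  have "prods n d (ev i) = (if i < d then n i else \<one>)" by (rule prods_ev) (rule nc)
  thus ?thesis using I[OF addsub_zero[OF M] ev_Zd[OF that]] nc[OF that] that by (simp add: iota_0)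
 qed
 show "zpart (nspan M n) = M"
 proof (rule equalityI; rule subsetI)
  fix w assume "w : zpart (nspan M n)"
  then obtain u x where ux: "u : M" "x : Zd d" "io w = io u \<otimes> prods n d x" by (auto simp: zpart_def nspan_def)
  have "0 = ?c x" using arg_cong[OF ux(3), of pj] pc by (simp only: pi_mult iota_carrier pi_iota pp) simp
  moreover have "?c 0 = 0" by (simp add: comb_def fun_eq_iff)
  ultimately have "x = 0" using inj_onD[OF inj _ ux(2) z] by simp
  hence "w = u" using ux(3) iota_inj by (simp add: prods_0)
  thus "w : M" using ux(1) by simp
 next
  fix u assume "u : M"
  thus "u : zpart (nspan M n)" using I[OF _ z] by (simp add: zpart_def prods_0)
 qed
qed

lemma nspan_unique:
 assumes N: "subgroup N G" "zpart N = M" "!!i. i < d ==> n i : N" "pj ` N = comb d (%i. pj (n i)) ` Zd d"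
 shows "N = nspan M n"
proof (rule equalityI; rule subsetI)
 have nc: "n i : carrier G" if "i < d" for i using subgroup.mem_carrier[OF N(1) N(3)[OF that]] .
 have pN: "prods n d x : N" for x by (rule prods_subgroup[OF N(1,3)])
 have pc: "prods n d x : carrier G" for x using subgroup.mem_carrier[OF N(1) pN] .
 fix g
 {
  assume g: "g : N"
  then obtain x where x: "x : Zd d" "pj g = comb d (%i. pj (n i)) x" using N(4) by blast
  have gc: "g : carrier G" using subgroup.mem_carrier[OF N(1) g] .
  have "pj g = pj (prods n d x)" unfolding x(2) by (rule pi_prods[OF nc, symmetric])
  then obtain u where u: "g = io u \<otimes> prods n d x" by (rule same_pi[OF gc pc])
  hence "io u = g \<otimes> inv (prods n d x)" using pc by (simp add: m_assoc)
  also have "... : N" by (intro subgroup.m_closed[OF N(1)] g subgroup.m_inv_closed[OF N(1)] pN)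
  finally have "u : M" using N(2) by (auto simp: zpart_def)
  thus "g : nspan M n" using u x(1) by (auto simp: nspan_def)
 next
  assume "g : nspan M n"
  then obtain u x where "u : M" "g = io u \<otimes> prods n d x" by (auto simp: nspan_def)
  thus "g : N" using N(2) subgroup.m_closed[OF N(1) _ pN] by (auto simp: zpart_def)
 }
qed

text \<open>With M and K fixed, N is determined by one lift of each of the d basis vectors of K.
  Each lift may be changed by an element of Z^2, and only its class modulo M matters.\<close>

lemma card_fibre:
 assumes M: "addsub M" and mp: "idx UNIV M > 0" and K: "!!K. K : KK ==> addsub K & K <= Xm M & idx (Zd d) K > 0" and fin: "finite KK"
 shows "finite {N. N \<lhd> G & zpart N = M & pj ` N : KK}"
  "card {N. N \<lhd> G & zpart N = M & pj ` N : KK} = card KK * idx UNIV M ^ d"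
proof -
 obtain R where R: "transv UNIV M R" "finite R" "card R = idx UNIV M"
  by (rule idx_pos_finite_transv[OF addsub_UNIV M mp])
 have XZ: "Xm M <= Zd d" by (auto simp: Xm_def)
 have "EX k. lat_basis K d k" if "K : KK" for K by (rule lat_basis_full[of K d]) (use K[OF that] XZ in auto)
 then obtain bas where bas: "!!K. K : KK ==> lat_basis K d (bas K)" by metis
 \<comment> \<open>The elements of N above a basis vector form one coset of M; v i names it by a
   representative in R.\<close>
 define n where "n K v i = io (v i) \<otimes> sec (bas K i)" for K and v :: "nat => int * int" and i
 have bK: "bas K i : K" if "K : KK" "i < d" for K i
  using lat_basisD(1)[OF bas[OF that(1)]] comb_ev[OF that(2), of "bas K"] ev_Zd[OF that(2)] by (metis imageI)
 have bZ: "bas K i : Zd d" if "K : KK" "i < d" for K i using bK[OF that] K[OF that(1)] XZ by blast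
 have nc: "n K v i : carrier G" and np: "pj (n K v i) = bas K i" if "K : KK" "i < d" for K v i
  using sec[OF bZ[OF that]] unfolding n_def by (simp_all only: m_closed pi_mult iota_carrier pi_iota) simp
 have nP: "n K v i : Pm M" if "K : KK" "i < d" for K v i
  using nc[OF that] np[OF that] bK[OF that] K[OF that(1)] by (auto simp: Pm_def)
 have cb: "comb d (%i. pj (n K v i)) = comb d (bas K)" if "K : KK" for K v
  by (rule ext) (simp add: comb_def np[OF that])
 have sp: "nspan M (n K v) \<lhd> G" "zpart (nspan M (n K v)) = M" "pj ` nspan M (n K v) = K" "!!i. i < d ==> n K v i : nspan M (n K v)"
  if "K : KK" for K v
  using nspan_props[OF M, of "n K v"] nP[OF that] lat_basisD[OF bas[OF that]] cb[OF that, of v] by simp_all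
 let ?D = "SIGMA K:KK. {..<d} \<rightarrow>\<^sub>E R" and ?F = "{N. N \<lhd> G & zpart N = M & pj ` N : KK}"
 have "bij_betw (%(K, v). nspan M (n K v)) ?D ?F" unfolding bij_betw_def
 proof (intro conjI inj_onI equalityI subsetI; clarify)
  fix K v K' v' assume h: "nspan M (n K v) = nspan M (n K' v')" "K : KK" "K' : KK" "v : {..<d} \<rightarrow>\<^sub>E R" "v' : {..<d} \<rightarrow>\<^sub>E R"
  have KK': "K = K'" using sp(3)[OF h(2), of v] sp(3)[OF h(3), of v'] h(1) by simp
  have "v i = v' i" if i: "i < d" for i
  proof -
   let ?S = "nspan M (n K v)"
   have sg: "subgroup ?S G" using sp(1)[OF h(2)] by (rule normal_imp_subgroup)
   have 1: "n K v i : ?S" "n K v' i : ?S" using sp(4)[OF h(2) i, of v] sp(4)[OF h(3) i, of v'] h(1) KK' by simp_all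
   have sc: "sec (bas K i) : carrier G" using sec(1)[OF bZ[OF h(2) i]] .
   have "n K v i \<otimes> inv (n K v' i) : ?S" by (intro subgroup.m_closed[OF sg] subgroup.m_inv_closed[OF sg] 1)
   moreover have "n K v i \<otimes> inv (n K v' i) = io (v i + - v' i)"
   proof -
    have "n K v i = io (v i + - v' i) \<otimes> n K v' i" unfolding n_def using sc by (simp add: iota_comb)
    thus ?thesis using nc[OF h(2) i] by (simp add: m_assoc)
   qed
   ultimately have "v i - v' i : M" using sp(2)[OF h(2), of v] by (auto simp: zpart_def)
   moreover have "v i - v i : M" using addsub_zero[OF M] by simp
   moreover have "v i : R" "v' i : R" using h(4,5) i by auto
   ultimately show ?thesis using R(1) unfolding transv_def by blast
  qed
  thus "K = K' & v = v'" using KK' PiE_ext[OF h(4,5)] by auto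
 next
  fix N assume N: "N \<lhd> G" "M = zpart N" "pj ` N : KK"
  let ?K = "pj ` N"
  have sg: "subgroup N G" using N(1) by (rule normal_imp_subgroup)
  have "EX r. r : R & io r \<otimes> sec (bas ?K i) : N" if i: "i < d" for i
  proof -
   obtain g where g: "g : N" "bas ?K i = pj g" using bK[OF N(3) i] by blast
   note s = sec[OF bZ[OF N(3) i]]
   obtain u where u: "g = io u \<otimes> sec (bas ?K i)"
    by (rule same_pi[OF subgroup.mem_carrier[OF sg g(1)] s(1)]) (simp only: s(2) g(2)[symmetric])
   have "EX! r. r : R & u - r : M" using R(1) unfolding transv_def by blast
   then obtain r where r: "r : R" "u - r : M" by blast
   have "io (r - u) : N" using addsub_minus[OF M r(2)] N(2) by (simp add: zpart_def)
   hence "io (r - u) \<otimes> g : N" using subgroup.m_closed[OF sg] g(1) by blast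
   moreover have "io (r - u) \<otimes> g = io r \<otimes> sec (bas ?K i)" unfolding u using s(1) by (simp add: iota_comb)
   ultimately show ?thesis using r(1) by metis
  qed
  then obtain v0 where v0: "!!i. i < d ==> v0 i : R & io (v0 i) \<otimes> sec (bas ?K i) : N" by metis
  let ?v = "restrict v0 {..<d}"
  have v: "?v : {..<d} \<rightarrow>\<^sub>E R" using v0 by auto
  have "N = nspan M (n ?K ?v)" by (rule nspan_unique[OF sg N(2)[symmetric]])
    (use v0 cb[OF N(3), of ?v] lat_basisD(1)[OF bas[OF N(3)]] in \<open>simp_all add: n_def\<close>)
  thus "N : (%(K, v). nspan (zpart N) (n K v)) ` ?D" using N(2,3) v by (intro image_eqI[of _ _ "(?K, ?v)"]) auto
 qed (use sp in auto)
 from bij_betw_same_card[OF this] bij_betw_finite[OF this]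
 show "finite ?F" "card ?F = card KK * idx UNIV M ^ d"
  using fin R(2,3) by (simp_all add: card_SigmaI card_PiE finite_PiE)
qed

end

text \<open>X is isomorphic to Z^d by its basis, so it has as many sublattices of each index as
  Z^d.\<close>

lemma subs_basis:
 assumes X: "addsub X" "lat_basis X d k"
 shows "bij_betw ((`) (comb d k)) (subs d p j) {K. addsub K & K <= X & idx X K = p ^ j}"
proof -
 note b = lat_basisD[OF X(2)]
 have ad: "addsub (comb d k ` K)" if "addsub K" for K unfolding addsub_def
 proof (intro conjI ballI)
  have "comb d k 0 = 0" by (simp add: comb_def fun_eq_iff)
  thus "0 : comb d k ` K" using addsub_zero[OF that] by (metis imageI)
  fix x y assume "x : comb d k ` K" "y : comb d k ` K"
  thus "x - y : comb d k ` K" using addsub_diff[OF that] by (auto simp: comb_diff[symmetric] simp del: minus_apply)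
 qed
 have ix: "idx X S = idx (Zd d) {x : Zd d. comb d k x : S}" if "addsub S" for S
  by (rule idx_hom[symmetric, OF addsub_Zd X(1) that comb_diff b(1)])
 have im: "{x : Zd d. comb d k x : comb d k ` K} = K" if "K <= Zd d" for K
  using inj_on_image_mem_iff[OF b(2) _ that] that by blast
 show ?thesis unfolding bij_betw_def
 proof (intro conjI)
  show "inj_on ((`) (comb d k)) (subs d p j)"
   by (rule inj_on_subset[OF inj_on_image_Pow[OF b(2)]]) (auto simp: subs_def)
  show "(`) (comb d k) ` subs d p j = {K. addsub K & K <= X & idx X K = p ^ j}"
  proof (rule equalityI; rule subsetI)
   fix K assume "K : (`) (comb d k) ` subs d p j"
   then obtain K' where K': "addsub K'" "K' <= Zd d" "idx (Zd d) K' = p ^ j" "K = comb d k ` K'" by (auto simp: subs_def)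
   thus "K : {K. addsub K & K <= X & idx X K = p ^ j}"
    using ad[OF K'(1)] ix[OF ad[OF K'(1)]] im[OF K'(2)] b(1) by auto
  next
   fix K assume "K : {K. addsub K & K <= X & idx X K = p ^ j}"
   hence K: "addsub K" "K <= X" "idx X K = p ^ j" by blast+
   let ?K = "{x : Zd d. comb d k x : K}"
   have "addsub ?K"
   proof -
    have "comb d k 0 = 0" by (simp add: comb_def fun_eq_iff)
    thus ?thesis
     unfolding addsub_def using addsub_zero[OF addsub_Zd, of d] addsub_zero[OF K(1)] addsub_diff[OF addsub_Zd, of _ d] addsub_diff[OF K(1)]
     by (simp add: comb_diff)
   qed
   hence "?K : subs d p j" using ix[OF K(1)] K(3) by (simp add: subs_def)
   moreover have "K = comb d k ` ?K" using K(2) b(1) by auto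
   ultimately show "K : (`) (comb d k) ` subs d p j" by blast
  qed
 qed
qed

context central_ext
begin

text \<open>The products of a representative of Z^2/M with a lift of a representative of Z^d/K
  represent the cosets of N.\<close>

lemma card_rcosets:
 assumes N: "N \<lhd> G"
 shows "card (rcosets N) = idx UNIV (zpart N) * idx (Zd d) (pj ` N)"
proof -
 have sg: "subgroup N G" using N by (rule normal_imp_subgroup)
 note aI = addsub_zpart[OF sg] and ap = addsub_pi[OF sg]
 obtain R where R: "transv UNIV (zpart N) R" by (rule transv_exists[OF addsub_UNIV aI])
 obtain S where S: "transv (Zd d) (pj ` N) S" by (rule transv_exists[OF addsub_Zd ap])
 have SZ: "S <= Zd d" using S by (simp add: transv_def)
 define a where "a = (%(r, s). io r \<otimes> sec s)"
 have ac: "a (r, s) : carrier G" and pa: "pj (a (r, s)) = s" if "s : S" for r s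
  using sec[of s] that SZ unfolding a_def case_prod_conv by (auto simp only: m_closed pi_mult iota_carrier pi_iota subset_iff add_0)
 have eqv: "N #> g = N #> h \<longleftrightarrow> g \<otimes> inv h : N" if gh: "g : carrier G" "h : carrier G" for g h
 proof
  assume "N #> g = N #> h"
  hence "g : N #> h" using rcos_self[OF gh(1) sg] by simp
  thus "g \<otimes> inv h : N" using subgroup.rcos_module[OF sg is_group gh(2,1)] by simp
 next
  assume "g \<otimes> inv h : N"
  hence "g : N #> h" using subgroup.rcos_module[OF sg is_group gh(2,1)] by simp
  thus "N #> g = N #> h" using repr_independence[OF _ gh(2) sg] by simp
 qed
 have "bij_betw (%x. N #> a x) (R \<times> S) (rcosets N)" unfolding bij_betw_def
 proof (intro conjI equalityI subsetI inj_onI; clarify?)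
  fix r s r' s' assume h: "r : R" "r' : R" "s : S" "s' : S" "N #> a (r, s) = N #> a (r', s')"
  hence q: "a (r, s) \<otimes> inv (a (r', s')) : N" using eqv ac by blast
  have "pj (a (r, s) \<otimes> inv (a (r', s'))) = s - s'"
   using ac[OF h(3)] ac[OF h(4)] pa[OF h(3)] pa[OF h(4)] by (simp only: pi_mult inv_closed pi_inv) simp
  hence "s - s' : pj ` N" using q by (metis imageI)
  moreover have "s - s : pj ` N" using addsub_zero[OF ap] by simp
  moreover have "s : Zd d" using h(3) SZ by blast
  ultimately have ss: "s = s'" using S h(3,4) unfolding transv_def by blast
  have "a (r, s) = io (r + - r') \<otimes> a (r', s')" using sec(1)[of s'] h(4) SZ unfolding a_def ss by (auto simp: iota_comb)
  hence "a (r, s) \<otimes> inv (a (r', s')) = io (r - r')" using ac[OF h(4)] by (simp add: m_assoc)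
  hence "r - r' : zpart N" using q by (simp add: zpart_def)
  moreover have "r - r : zpart N" using addsub_zero[OF aI] by simp
  ultimately have "r = r'" using R h(1,2) unfolding transv_def by blast
  thus "r = r' & s = s'" using ss by blast
 next
  fix r s assume "r : R" "s : S"
  thus "N #> a (r, s) : rcosets N" using ac unfolding RCOSETS_def by blast
 next
  fix C assume "C : rcosets N"
  then obtain g where g: "g : carrier G" "C = N #> g" unfolding RCOSETS_def by blast
  have "EX! s. s : S & pj g - s : pj ` N" using S pi_Zd[OF g(1)] unfolding transv_def by blast
  then obtain s h where s: "s : S" "h : N" "pj g - s = pj h" by blast
  have hc: "h : carrier G" using subgroup.mem_carrier[OF sg s(2)] .
  have sc: "sec s : carrier G" "pj (sec s) = s" using sec[of s] s(1) SZ by blast+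
  have "pj (inv h \<otimes> g) = - (pj g - s) + pj g" unfolding s(3) using hc g(1) by (simp only: pi_mult inv_closed pi_inv)
  also have "... = pj (sec s)" unfolding sc(2) by simp
  finally obtain u where u: "inv h \<otimes> g = io u \<otimes> sec s" using same_pi[of "inv h \<otimes> g" "sec s"] hc g(1) sc(1) by blast
  have "EX! r. r : R & u - r : zpart N" using R unfolding transv_def by blast
  then obtain r where r: "r : R" "io (u - r) : N" by (auto simp: zpart_def)
  have "g = h \<otimes> (inv h \<otimes> g)" using hc g(1) by (simp add: m_assoc[symmetric])
  also have "... = h \<otimes> (io (u + - r) \<otimes> a (r, s))" unfolding u a_def using sc(1) by (simp add: iota_comb)
  finally have "g \<otimes> inv (a (r, s)) = h \<otimes> io (u - r)" using hc ac[OF s(1), of r] by (simp add: m_assoc)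
  also have "... : N" by (rule subgroup.m_closed[OF sg s(2) r(2)])
  finally have "N #> g = N #> a (r, s)" using eqv[OF g(1) ac[OF s(1)]] by blast
  thus "C : (%x. N #> a x) ` (R \<times> S)" using g(2) r(1) s(1) by blast
 qed
 from bij_betw_same_card[OF this] show ?thesis
  using idx_transv[OF addsub_UNIV aI R] idx_transv[OF addsub_Zd ap S] by (simp add: card_cartesian_product)
qed

text \<open>Normal subgroups of index p^n are sorted by M and then by K inside X(M). The number of K
  depends only on the index in X(M), so the generating function factors into the sum over M and the
  zeta function of Z^d.\<close>

theorem normal_count_gf:
 assumes p: "prime p"
 shows "Abs_fps (%n. of_nat (normal_count G (p ^ n))) = Xi d Lat p * (PROD i<d. geo (of_nat p ^ i) 1)"
proof (rule fps_ext)
 fix n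
 have p0: "p > 0" using p by (rule prime_gt_0_nat)
 have p1: "p > 1" using p by (rule prime_gt_1_nat)
 define M where "M = (%(a, s, b, t). sc2 (int p ^ a) ` M0 p s b t)"
 \<comment> \<open>p^w is |Z^2:M| |Z^d:X(M)|, the least index that a normal subgroup with central
   part M can have; n - w is left for the index of K in X(M).\<close>
 define w where "w = (%(a, s, b, t). 2 * a + b + xw d Lat p (a, s, b, t))"
 define c where "c = (%(a :: nat, s :: bool, b :: nat, t :: int). p ^ (d * (2 * a + b)))"
 define KK where "KK x j = {K. addsub K & K <= Xm (M x) & idx (Xm (M x)) K = p ^ j}" for x j
 define F where "F x j = {N. N \<lhd> G & zpart N = M x & pj ` N : KK x j}" for x j
 define A where "A = {x : UNIV \<times> pts p. w x <= n}"
 have Ma: "addsub (M x)" for x unfolding M_def by (cases x) (simp add: addsub_sc2 addsub_M0)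
 have Mi: "idx UNIV (M x) ^ d = c x" "idx UNIV (M x) * idx (Zd d) (Xm (M x)) = p ^ w x" "idx UNIV (M x) > 0" "idx (Zd d) (Xm (M x)) > 0" for x
 proof -
  obtain a s b t where x: "x = (a, s, b, t)" by (cases x)
  have "satp (2 * d) p Lat a <= Zd (2 * d)" by (auto simp: satp_def)
  then obtain r l where "lat_basis (satp (2 * d) p Lat a) r l" by (rule lat_basis_exists[OF addsub_satp[OF addsub_Lat(1)]])
  from idx_xw(1)[OF p addsub_Lat this] have "idx (Zd d) (Xm (M x)) = p ^ xw d Lat p x"
   unfolding idx_Xm[OF Ma] unfolding M_def x by simp
  moreover have "idx UNIV (M x) = p ^ (2 * a + b)" unfolding M_def x using idx_sc2_M0[OF p0] by simp
  ultimately show "idx UNIV (M x) ^ d = c x" "idx UNIV (M x) * idx (Zd d) (Xm (M x)) = p ^ w x" "idx UNIV (M x) > 0" "idx (Zd d) (Xm (M x)) > 0"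
   using p0 by (simp_all add: c_def w_def x mult.commute flip: power_mult power_add)
 qed
 have XZ: "Xm (M x) <= Zd d" for x by (auto simp: Xm_def)
 have cK: "finite (KK x j)" "card (KK x j) = card (subs d p j)" for x j
 proof -
  obtain k where "lat_basis (Xm (M x)) d k" by (rule lat_basis_full[OF addsub_Xm[OF Ma] XZ Mi(4)])
  from subs_basis[OF addsub_Xm[OF Ma] this, of p j, folded KK_def] have b: "bij_betw ((`) (comb d k)) (subs d p j) (KK x j)" .
  have f: "finite (subs d p j)" using subs_gf[OF p, of d] by blast
  show "finite (KK x j)" using f bij_betw_finite[OF b] by blast
  show "card (KK x j) = card (subs d p j)" using bij_betw_same_card[OF b] ..
 qed
 have iK: "idx (Zd d) K = idx (Zd d) (Xm (M x)) * idx (Xm (M x)) K" if "addsub K" "K <= Xm (M x)" for K x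
  by (rule idx_mult[OF addsub_Zd addsub_Xm[OF Ma] that XZ])
 have KP: "addsub K & K <= Xm (M x) & idx (Zd d) K > 0" if "K : KK x j" for K x j
  using that iK[of K x] Mi(4)[of x] p0 by (simp add: KK_def)
 have cF: "finite (F x j)" "card (F x j) = card (subs d p j) * c x" for x j
 proof -
  have K: "addsub K & K <= Xm (M x) & idx (Zd d) K > 0" if "K : KK x j" for K by (rule KP[OF that])
  note r = card_fibre[OF Ma[of x] Mi(3)[of x] K cK(1)[of x j]]
  show "finite (F x j)" unfolding F_def by (rule r(1))
  show "card (F x j) = card (subs d p j) * c x" using r(2) unfolding F_def Mi(1) cK(2) .
 qed
 have finA: "finite {x : UNIV \<times> pts p. w x = i}" for i
  using locfin_apts[of w UNIV p] unfolding locfin_def by (auto simp: w_def)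
 have A_UN: "A = (UN i<=n. {x : UNIV \<times> pts p. w x = i})" by (auto simp: A_def)
 have fA: "finite A" unfolding A_UN by (intro finite_UN_I finA) simp
 have eq: "{N. N \<lhd> G & card (rcosets N) = p ^ n} = (UN x:A. F x (n - w x))"
 proof (rule equalityI; rule subsetI)
  fix N assume "N : {N. N \<lhd> G & card (rcosets N) = p ^ n}"
  hence N: "N \<lhd> G" "idx UNIV (zpart N) * idx (Zd d) (pj ` N) = p ^ n" using card_rcosets by auto
  have sg: "subgroup N G" using N(1) by (rule normal_imp_subgroup)
  have "idx UNIV (zpart N) dvd p ^ n" unfolding N(2)[symmetric] by (rule dvd_triv_left)
  then obtain i where "idx UNIV (zpart N) = p ^ i" unfolding divides_primepow_nat[OF p] by blast
  from M0_surj[OF p addsub_zpart[OF sg] this] obtain a s b t where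
   x: "(s, b, t) : pts p" "zpart N = sc2 (int p ^ a) ` M0 p s b t" by metis
  define x where "x = (a, s, b, t)"
  have Mx: "zpart N = M x" using x(2) by (simp add: M_def x_def)
  have pX: "pj ` N <= Xm (M x)" using normal_Pm[OF N(1)] unfolding Mx Pm_def by blast
  have e: "p ^ w x * idx (Xm (M x)) (pj ` N) = p ^ n"
   using N(2) unfolding Mx iK[OF addsub_pi[OF sg] pX] Mi(2)[symmetric] by (simp only: mult.assoc)
  have "idx (Xm (M x)) (pj ` N) dvd p ^ n" unfolding e[symmetric] by (rule dvd_triv_right)
  then obtain j where j: "idx (Xm (M x)) (pj ` N) = p ^ j" unfolding divides_primepow_nat[OF p] by blast
  have "p ^ (w x + j) = p ^ n" using e unfolding j power_add .
  hence wj: "w x + j = n" using power_inject_exp[OF p1] by blast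
  have "N : F x (n - w x)" using N(1) Mx addsub_pi[OF sg] pX j wj by (auto simp: F_def KK_def)
  moreover have "x : A" using wj x(1) by (simp add: A_def x_def)
  ultimately show "N : (UN x:A. F x (n - w x))" by blast
 next
  fix N assume "N : (UN x:A. F x (n - w x))"
  then obtain x where x: "w x <= n" "N \<lhd> G" "zpart N = M x" "pj ` N : KK x (n - w x)" by (auto simp: A_def F_def)
  hence "card (rcosets N) = p ^ w x * p ^ (n - w x)"
   unfolding card_rcosets[OF x(2)] Mi(2)[symmetric] using iK[of "pj ` N" x] by (simp add: KK_def)
  thus "N : {N. N \<lhd> G & card (rcosets N) = p ^ n}" using x by (simp flip: power_add)
 qed
 have disj: "F x i Int F y j = {}" if "x : A" "y : A" "x ~= y" for x y i j
 proof -
  obtain a s b t a' s' b' t' where xy: "x = (a, s, b, t)" "y = (a', s', b', t')" by (cases x, cases y)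
  have "(s, b, t) : pts p" "(s', b', t') : pts p" using that by (auto simp: A_def xy)
  hence "M x ~= M y" using M0_inj[OF p, of s b t s' b' t' a a'] that(3) by (auto simp: M_def xy)
  thus ?thesis by (auto simp: F_def)
 qed
 have "normal_count G (p ^ n) = (SUM x:A. card (F x (n - w x)))"
  unfolding normal_count_def eq by (rule card_UN_disjoint[OF fA]) (use cF(1) disj in blast)+
 also have "... = (SUM x:A. c x * card (subs d p (n - w x)))" unfolding cF(2) by (simp only: mult.commute)
 also have "... = (SUM i<=n. \<Sum>x | x : A & w x = i. c x * card (subs d p (n - w x)))"
  by (rule sum.group[symmetric, OF fA]) (auto simp: A_def)
 also have "... = (SUM i<=n. (\<Sum>x | x : UNIV \<times> pts p & w x = i. c x) * card (subs d p (n - i)))"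
  unfolding sum_distrib_right by (intro sum.cong) (auto simp: A_def)
 finally have nc: "normal_count G (p ^ n) = (SUM i<=n. (\<Sum>x | x : UNIV \<times> pts p & w x = i. c x) * card (subs d p (n - i)))" .
 have X: "fps_nth (Xi d Lat p) i = (\<Sum>x | x : UNIV \<times> pts p & w x = i. of_nat (c x))" for i
  unfolding Xi_def gf_nth w_def c_def by (rule sum.cong) (auto simp del: split_paired_All)
 show "fps_nth (Abs_fps (%n. of_nat (normal_count G (p ^ n)))) n = fps_nth (Xi d Lat p * (PROD i<d. geo (of_nat p ^ i) 1)) n"
  unfolding subs_gf[OF p, of d, THEN conjunct2, symmetric] fps_mult_nth X fps_nth_Abs_fps nc of_nat_sum of_nat_mult atLeast0AtMost ..
qed

end

section \<open>Hirsch length of abelian groups as rank\<close>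

text \<open>A lattice between m Z^h and Z^h has full rank; its coordinates with respect to a basis
  identify it with Z^h.\<close>

lemma lattice_coordinates:
 assumes Y: "addsub Y" "Y <= Zd h" and m: "m > 0" "zs (int m) ` Zd h <= Y"
 obtains ps where "ps ` Y = Zd h" "!!x y. x : Y ==> y : Y ==> ps (x + y) = ps x + ps y"
  "!!y. y : Y ==> ps y = 0 ==> y = 0"
proof -
 have "idx (Zd h) (zs (int m) ` Zd h) = idx (Zd h) Y * idx Y (zs (int m) ` Zd h)"
  by (rule idx_mult[OF addsub_Zd Y(1) addsub_mult[OF addsub_Zd] m(2) Y(2)])
 hence "idx (Zd h) Y > 0" using idx_Zd_mult[OF m(1), of h] m(1) by (metis gr0I mult_is_0 power_not_zero)
 from lat_basis_full[OF Y this] obtain b where "lat_basis Y h b" .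
 note b = lat_basisD[OF this]
 define ps where "ps = the_inv_into (Zd h) (comb h b)"
 have p: "ps (comb h b x) = x" if "x : Zd h" for x unfolding ps_def by (rule the_inv_into_f_f[OF b(2) that])
 have p2: "ps y : Zd h" "comb h b (ps y) = y" if y: "y : Y" for y
 proof -
  obtain x where "x : Zd h" "y = comb h b x" using y b(1) by blast
  thus "ps y : Zd h" "comb h b (ps y) = y" using p by simp_all
 qed
 show thesis
 proof
  show "ps ` Y = Zd h" using p p2(1) b(1) by (force simp: image_iff)
  fix x y assume xy: "x : Y" "y : Y"
  have "ps (comb h b (ps x + ps y)) = ps x + ps y" by (rule p[OF addsub_add[OF addsub_Zd p2(1)[OF xy(1)] p2(1)[OF xy(2)]]])
  thus "ps (x + y) = ps x + ps y" unfolding comb_add p2(2)[OF xy(1)] p2(2)[OF xy(2)] .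
 next
  fix y assume "y : Y" "ps y = 0"
  thus "y = 0" using p2(2)[of y] by (simp add: comb_def fun_eq_iff)
 qed
qed

text \<open>The group has rank h: it maps onto Z^h with a kernel of finite exponent. In this form
  the statement can be carried up a subnormal series without splitting off torsion.\<close>

definition free_quot :: "('a, 'b) monoid_scheme => 'a set => nat => ('a => nat => int) => nat => bool" where
 "free_quot A S h pj e \<longleftrightarrow> (ALL a:S. ALL b:S. pj (a \<otimes>\<^bsub>A\<^esub> b) = pj a + pj b) & pj ` S = Zd h
   & e > 0 & (ALL a:S. pj a = 0 --> a [^]\<^bsub>A\<^esub> e = \<one>\<^bsub>A\<^esub>)"

context comm_group
begin

text \<open>The map \<open>pj\<close> is extended from S to T by evaluating it at m-th powers. Its
  image is a lattice between m Z^h and Z^h, renormalized by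
  \<open>lattice_coordinates\<close>.\<close>

lemma free_quot_finite_step:
 assumes S: "subgroup S G" and T: "subgroup T G" "S <= T" and c: "!!a. a : T ==> a [^] (m :: nat) : S" and m: "m > 0"
  and q: "free_quot G S h pj e"
 shows "EX pj' e'. free_quot G T h pj' e'"
proof -
 note Tc = subgroup.mem_carrier[OF T(1)]
 have pm: "pj (a \<otimes> b) = pj a + pj b" if "a : S" "b : S" for a b using q that unfolding free_quot_def by blast
 have im: "pj ` S = Zd h" and e: "e > 0" and k: "!!a. a : S ==> pj a = 0 ==> a [^] e = \<one>"
  using q unfolding free_quot_def by blast+
 define f where "f a = pj (a [^] m)" for a
 have fm: "f (a \<otimes> b) = f a + f b" if "a : T" "b : T" for a b
  unfolding f_def using pm[OF c[OF that(1)] c[OF that(2)]] Tc that by (simp only: nat_pow_distrib)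
 have fS: "f b = zs (int m) (pj b)" if b: "b : S" for b
 proof -
  have "b [^] n : S & pj (b [^] n) = zs (int n) (pj b)" for n :: nat
  proof (induction n)
   case 0
   have "pj \<one> = pj \<one> + pj \<one>" using pm[of \<one> \<one>] subgroup.one_closed[OF S] by simp
   hence "pj \<one> = 0" by simp
   thus ?case using subgroup.one_closed[OF S] by (simp add: zs_simps)
  next
   case (Suc n)
   have "pj (b [^] Suc n) = zs (int n) (pj b) + zs 1 (pj b)" using Suc pm[of "b [^] n" b] b by (simp only: nat_pow_Suc zs_simps(7))
   thus ?case using Suc b subgroup.m_closed[OF S] by (simp only: zs_simps(1)[symmetric] of_nat_Suc add.commute[of 1] nat_pow_Suc)
  qed
  thus ?thesis unfolding f_def by blast
 qed
 let ?Y = "f ` T"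
 have f1: "f \<one> = 0" using fm[of \<one> \<one>] subgroup.one_closed[OF T(1)] by simp
 have Y: "addsub ?Y"
 proof -
  have "f x - f y : f ` T" if "x : T" "y : T" for x y
  proof -
   have iy: "inv y : T" using that subgroup.m_inv_closed[OF T(1)] by blast
   have "f (inv y) + f y = 0" using fm[OF iy that(2)] f1 Tc[OF that(2)] by simp
   hence "f (x \<otimes> inv y) = f x - f y" using fm[OF that(1) iy] by (simp add: eq_neg_iff_add_eq_0[symmetric] del: plus_fun_apply)
   thus ?thesis using subgroup.m_closed[OF T(1) that(1) iy] by (metis imageI)
  qed
  moreover have "0 : f ` T" by (rule image_eqI, rule f1[symmetric], rule subgroup.one_closed[OF T(1)])
  ultimately show ?thesis unfolding addsub_def by blast
 qed
 have YZ: "?Y <= Zd h" using c im by (auto simp: f_def)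
 have "zs (int m) ` Zd h <= ?Y" unfolding im[symmetric] using fS[symmetric] T(2) by auto
 from lattice_coordinates[OF Y YZ m this] obtain ps where psi: "ps ` ?Y = Zd h"
  "!!x y. x : ?Y ==> y : ?Y ==> ps (x + y) = ps x + ps y" "!!y. y : ?Y ==> ps y = 0 ==> y = 0" by blast
 have "free_quot G T h (%a. ps (f a)) (m * e)" unfolding free_quot_def
 proof (intro conjI ballI impI)
  show "ps (f (a \<otimes> b)) = ps (f a) + ps (f b)" if "a : T" "b : T" for a b
   using psi(2)[of "f a" "f b"] fm[OF that] that by simp
  show "(%a. ps (f a)) ` T = Zd h" using psi(1) by (simp add: image_image)
  show "m * e > 0" using m e by simp
  show "a [^] (m * e) = \<one>" if a: "a : T" "ps (f a) = 0" for a
   using psi(3)[of "f a"] a k[OF c[OF a(1)]] Tc[OF a(1)] by (simp add: f_def nat_pow_pow)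
 qed
 thus ?thesis by blast
qed

text \<open>No positive power of c lies in S, so T is the direct product of S and the group of c,
  and the exponent of c becomes the new coordinate.\<close>

lemma free_quot_infinite_step:
 assumes S: "subgroup S G" and T: "subgroup T G" "S <= T" and c: "c : T" "!!a. a : T ==> EX n::int. EX b:S. a = b \<otimes> c [^] n"
  and inf: "!!m::nat. m > 0 ==> c [^] m ~: S" and q: "free_quot G S h pj e"
 shows "EX pj'. free_quot G T (Suc h) pj' e"
proof -
 note Tc = subgroup.mem_carrier[OF T(1)] and Sc = subgroup.mem_carrier[OF S]
 have cc: "c : carrier G" using Tc c(1) .
 have pm: "pj (a \<otimes> b) = pj a + pj b" if "a : S" "b : S" for a b using q that unfolding free_quot_def by blast
 have im: "pj ` S = Zd h" and e: "e > 0" and k: "!!a. a : S ==> pj a = 0 ==> a [^] e = \<one>"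
  using q unfolding free_quot_def by blast+
 have z: "n = 0" if n: "c [^] (n :: int) : S" for n
 proof (cases n rule: int_cases2)
  case (nonneg m) thus ?thesis using inf[of m] n by (cases "m = 0") (simp_all add: int_pow_int)
 next
  case (nonpos m)
  hence "inv (c [^] m) : S" using n int_pow_neg_int[OF cc, of m] by simp
  hence "c [^] m : S" using subgroup.m_inv_closed[OF S] cc by fastforce
  thus ?thesis using inf[of m] nonpos by (cases "m = 0") simp_all
 qed
 obtain n b where nb: "!!a. a : T ==> b a : S & a = b a \<otimes> c [^] (n a :: int)" using c(2) by metis
 have uniq: "n' = n'' & b' = b''" if h: "b' : S" "b'' : S" "b' \<otimes> c [^] (n' :: int) = b'' \<otimes> c [^] n''" for n' n'' b' b''
 proof -
  have "b' \<otimes> c [^] n' \<otimes> inv (c [^] n') = b'' \<otimes> c [^] n'' \<otimes> inv (c [^] n')" using h(3) by simp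
  hence b: "b' = b'' \<otimes> c [^] (n'' - n')" using Sc[OF h(1)] Sc[OF h(2)] cc by (simp add: m_assoc int_pow_diff)
  hence "c [^] (n'' - n') = inv b'' \<otimes> b'" using Sc[OF h(2)] cc by (simp add: m_assoc[symmetric])
  hence "c [^] (n'' - n') : S" using h subgroup.m_closed[OF S] subgroup.m_inv_closed[OF S] by simp
  hence "n'' - n' = 0" by (rule z)
  thus ?thesis using b Sc[OF h(2)] by simp
 qed
 have mult: "n (x \<otimes> y) = n x + n y & b (x \<otimes> y) = b x \<otimes> b y" if xy: "x : T" "y : T" for x y
 proof (rule uniq)
  have bc: "b x : carrier G" "b y : carrier G" using nb[OF xy(1)] nb[OF xy(2)] Sc by blast+
  have "x \<otimes> y = (b x \<otimes> c [^] n x) \<otimes> (b y \<otimes> c [^] n y)" using nb[OF xy(1)] nb[OF xy(2)] by metis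
  also have "... = b x \<otimes> b y \<otimes> c [^] (n x + n y)" using bc cc by (simp add: m_ac int_pow_mult)
  finally show "b (x \<otimes> y) \<otimes> c [^] n (x \<otimes> y) = b x \<otimes> b y \<otimes> c [^] (n x + n y)"
   using nb[OF subgroup.m_closed[OF T(1) xy]] by simp
 qed (use nb xy subgroup.m_closed[OF T(1) xy] subgroup.m_closed[OF S] in blast)+
 define f where "f a = pj (b a) + zs (n a) (ev h)" for a
 have pZ: "pj (b a) : Zd h" if "a : T" for a using nb[OF that] im by blast
 have "free_quot G T (Suc h) f e" unfolding free_quot_def
 proof (intro conjI ballI impI e)
  show "f (x \<otimes> y) = f x + f y" if "x : T" "y : T" for x y
   using mult[OF that] pm nb[OF that(1)] nb[OF that(2)] by (simp only: f_def zs_simps(1) ac_simps)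
  show "f ` T = Zd (Suc h)"
  proof (rule equalityI; rule subsetI)
   fix y assume "y : f ` T"
   then obtain a where a: "a : T" "y = f a" by blast
   have "pj (b a) : Zd (Suc h)" using pZ[OF a(1)] Zd_mono[of h "Suc h"] by auto
   thus "y : Zd (Suc h)" unfolding a(2) f_def by (rule addsub_add[OF addsub_Zd _ zs_Zd[OF ev_Zd[OF lessI]]])
  next
   fix y assume y: "y : Zd (Suc h)"
   let ?y = "y - zs (y h) (ev h)"
   have "?y : Zd (Suc h)" by (rule addsub_diff[OF addsub_Zd y zs_Zd[OF ev_Zd[OF lessI]]])
   moreover have "?y h = 0" by (simp add: zs_def ev_def)
   ultimately have "?y : Zd h" by (rule Zd_Suc)
   then obtain s where s: "s : S" "pj s = ?y" using im by (metis imageE)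
   let ?a = "s \<otimes> c [^] y h"
   have "?a : T" using s(1) T subgroup_int_pow_closed[OF T(1) c(1)] subgroup.m_closed[OF T(1)] by blast
   moreover from nb[OF this] have "b ?a = s" "n ?a = y h" using uniq[of s "b ?a" "y h" "n ?a"] s(1) by metis+
   ultimately have "y = f ?a" "?a : T" unfolding f_def by (simp_all only: s(2) diff_add_cancel)
   thus "y : f ` T" by (rule image_eqI)
  qed
  show "a [^] e = \<one>" if a: "a : T" "f a = 0" for a
  proof -
   have "f a h = n a" using pZ[OF a(1)] by (simp add: f_def zs_def ev_def Zd_def)
   hence n0: "n a = 0" using a(2) by simp
   hence "pj (b a) = 0" using a(2) by (simp only: f_def zs_simps(6) add_0_right)
   moreover have "a = b a" using nb[OF a(1)] n0 Sc by (metis int_pow_0 r_one)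
   ultimately show ?thesis using k[of a] nb[OF a(1)] by metis
  qed
 qed
 thus ?thesis by blast
qed

end

text \<open>A generator of the quotient is lifted to T; the quotient is infinite exactly when no
  positive power of the lift falls into N.\<close>

lemma (in group) cyclic_quotient_generator:
 assumes T: "subgroup T G" and N: "N \<lhd> G(|carrier := T|)" and cyc: "cyclic_group (G(|carrier := T|) Mod N)"
 obtains c where "c : T" "!!a. a : T ==> EX n::int. EX b:N. a = b \<otimes> c [^] n"
  "infinite (carrier (G(|carrier := T|) Mod N)) \<longleftrightarrow> (ALL m::nat. m > 0 --> c [^] m ~: N)"
proof -
 let ?T = "G(|carrier := T|)" and ?Q = "G(|carrier := T|) Mod N"
 interpret N: normal N ?T by (rule N)
 have sN: "subgroup N G" using incl_subgroup[OF T normal_imp_subgroup[OF N]] .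
 note Tc = subgroup.mem_carrier[OF T]
 have gQ: "group ?Q" by (rule N.factorgroup_is_group)
 obtain X where X: "X : carrier ?Q" "carrier ?Q = range (%n::int. X [^]\<^bsub>?Q\<^esub> n)"
  using group.cyclic_group[OF gQ] cyc by blast
 obtain c where c: "c : T" "X = N #>\<^bsub>?T\<^esub> c" using X(1) by (auto simp: carrier_FactGroup)
 have rc: "N #>\<^bsub>?T\<^esub> a = N #> a" for a by (simp add: r_coset_def)
 have pw: "X [^]\<^bsub>?Q\<^esub> n = N #> c [^] (n :: int)" for n
  using N.FactGroup_int_pow[of c n] c int_pow_consistent[OF T c(1), of n] by (simp add: rc)
 have gen: "EX n::int. EX b:N. a = b \<otimes> c [^] n" if a: "a : T" for a
 proof -
  have "N #> a : carrier ?Q" using a by (auto simp: carrier_FactGroup rc)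
  then obtain n :: int where "N #> a = N #> c [^] n" unfolding X(2) pw by blast
  hence "a : N #> c [^] n" using rcos_self[OF Tc[OF a] sN] by simp
  thus ?thesis by (auto simp: r_coset_def)
 qed
 have car: "carrier ?Q = range (%n::int. N #> c [^] n)" unfolding X(2) pw ..
 have "infinite (carrier ?Q) \<longleftrightarrow> (ALL m::nat. m > 0 --> c [^] m ~: N)"
 proof (rule iffI; rule ccontr)
  assume "infinite (carrier ?Q)" "~ (ALL m::nat. m > 0 --> c [^] m ~: N)"
  then obtain m :: nat where m: "m > 0" "c [^] m : N" by blast
  have r: "N #> c [^] n = N #> c [^] (n mod int m)" for n :: int
  proof -
   have "c [^] n = c [^] (int m * (n div int m) + n mod int m)" by simp
   also have "... = c [^] (int m * (n div int m)) \<otimes> c [^] (n mod int m)" by (rule int_pow_mult[OF Tc[OF c(1)]])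
   also have "c [^] (int m * (n div int m)) = (c [^] int m) [^] (n div int m)" using int_pow_pow[OF Tc[OF c(1)]] by simp
   also have "c [^] int m = c [^] m" by (rule int_pow_int)
   finally have "c [^] n : N #> c [^] (n mod int m)"
    using subgroup_int_pow_closed[OF sN m(2), of "n div int m"] by (auto simp: r_coset_def)
   thus ?thesis using repr_independence[OF _ _ sN, of "c [^] n"] Tc[OF c(1)] by simp
  qed
  have "carrier ?Q <= (%n. N #> c [^] n) ` {0..<int m}"
  proof
   fix Y assume "Y : carrier ?Q"
   then obtain n :: int where "Y = N #> c [^] (n mod int m)" unfolding car using r by blast
   thus "Y : (%n. N #> c [^] n) ` {0..<int m}" using m(1) by (intro image_eqI[of _ _ "n mod int m"]) simp_all
  qed
  thus False using `infinite (carrier ?Q)` finite_surj by blast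
 next
  assume h: "ALL m::nat. m > 0 --> c [^] m ~: N" "~ infinite (carrier ?Q)"
  have "~ inj_on (%n::nat. N #> c [^] int n) UNIV"
  proof
   assume "inj_on (%n::nat. N #> c [^] int n) UNIV"
   moreover have "(%n::nat. N #> c [^] int n) ` UNIV <= carrier ?Q" unfolding car by blast
   moreover have "finite (carrier ?Q)" using h(2) by blast
   ultimately show False by (meson finite_imageD finite_subset infinite_UNIV_nat)
  qed
  then obtain i j :: nat where "i ~= j" "N #> c [^] int i = N #> c [^] int j" by (auto simp: inj_on_def)
  then obtain i j :: nat where ij: "i < j" "N #> c [^] int i = N #> c [^] int j" by (metis linorder_neqE_nat)
  have cc: "c : carrier G" using Tc[OF c(1)] .
  have "c [^] int j : N #> c [^] int i" unfolding ij(2) using rcos_self[OF _ sN] cc by simp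
  then obtain b where b: "b : N" "c [^] int j = b \<otimes> c [^] int i" by (auto simp: r_coset_def)
  have "c [^] (int j - int i) = b" unfolding int_pow_diff[OF cc] b(2) using cc subgroup.mem_carrier[OF sN b(1)] by (simp add: m_assoc)
  moreover have "int j - int i = int (j - i)" using ij(1) by simp
  ultimately have "c [^] (j - i) = b" by (simp only: int_pow_int)
  thus False using h(1) b(1) ij(1) by auto
 qed
 thus thesis using that c(1) gen by blast
qed

text \<open>Climbing the series, each infinite factor raises the rank by one and each finite factor
  preserves it while enlarging the exponent.\<close>

theorem (in comm_group) hirsch_free_quot:
 assumes "has_hirsch_length G h"
 shows "EX pj e. free_quot G (carrier G) h pj e"
proof -
 obtain H :: "nat => 'a set" and k where H: "H 0 = {\<one>}" "H k = carrier G"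
  "!!i. i < k ==> H i \<lhd> G(|carrier := H (Suc i)|) & cyclic_group (G(|carrier := H (Suc i)|) Mod H i)"
  "card {i. i < k & infinite (carrier (G(|carrier := H (Suc i)|) Mod H i))} = h"
  using assms unfolding has_hirsch_length_def by blast
 have sub: "subgroup (H i) G" if "i <= k" for i using that
 proof (induction rule: inc_induct)
  case base show ?case unfolding H(2) by (rule subgroup_self)
 next
  case (step i)
  thus ?case using incl_subgroup[OF step.IH normal_imp_subgroup] H(3)[of i] by blast
 qed
 define inf where "inf i \<longleftrightarrow> infinite (carrier (G(|carrier := H (Suc i)|) Mod H i))" for i
 have "EX pj e. free_quot G (H i) (card {j. j < i & inf j}) pj e" if "i <= k" for i using that
 proof (induction i)
  case 0
  have "Zd 0 = {0}" by (auto simp: Zd_def fun_eq_iff)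
  hence "free_quot G (H 0) (card {j. j < 0 & inf j}) (%_. 0) 1" by (simp add: free_quot_def H(1))
  thus ?case by blast
 next
  case (Suc i)
  then obtain pj e where q: "free_quot G (H i) (card {j. j < i & inf j}) pj e" by auto
  have i: "i < k" using Suc by simp
  have s: "subgroup (H i) G" "subgroup (H (Suc i)) G" using sub Suc.prems by auto
  have N: "H i \<lhd> G(|carrier := H (Suc i)|)" using H(3)[OF i] by blast
  have le: "H i <= H (Suc i)" using subgroup.subset[OF normal_imp_subgroup[OF N]] by simp
  obtain c where c: "c : H (Suc i)" "!!a. a : H (Suc i) ==> EX n::int. EX b:H i. a = b \<otimes> c [^] n"
   "inf i \<longleftrightarrow> (ALL m::nat. m > 0 --> c [^] m ~: H i)"
   using cyclic_quotient_generator[OF s(2) N, of thesis] H(3)[OF i] unfolding inf_def by blast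
  show ?case
  proof (cases "inf i")
   case True
   hence "{j. j < Suc i & inf j} = insert i {j. j < i & inf j}" by (auto simp: less_Suc_eq)
   hence "card {j. j < Suc i & inf j} = Suc (card {j. j < i & inf j})" by simp
   thus ?thesis using free_quot_infinite_step[OF s le c(1,2) _ q] c(3) True by auto
  next
   case False
   hence d: "{j. j < Suc i & inf j} = {j. j < i & inf j}" by (auto simp: less_Suc_eq)
   obtain m :: nat where m: "m > 0" "c [^] m : H i" using False c(3) by blast
   have cc: "c : carrier G" using subgroup.mem_carrier[OF s(2) c(1)] .
   have "a [^] m : H i" if a: "a : H (Suc i)" for a
   proof -
    obtain n :: int and b where b: "b : H i" "a = b \<otimes> c [^] n" using c(2)[OF a] by blast
    have bc: "b : carrier G" using subgroup.mem_carrier[OF s(1) b(1)] .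
    have "a [^] m = b [^] m \<otimes> (c [^] n) [^] int m" unfolding b(2) using bc cc by (simp add: nat_pow_distrib int_pow_int)
    also have "(c [^] n) [^] int m = (c [^] int m) [^] n" using cc by (simp only: int_pow_pow mult.commute)
    also have "b [^] m = b [^] int m" by (simp only: int_pow_int)
    also have "b [^] int m \<otimes> (c [^] int m) [^] n : H i"
     by (rule subgroup.m_closed[OF s(1) subgroup_int_pow_closed[OF s(1) b(1)] subgroup_int_pow_closed[OF s(1)]])
      (simp only: int_pow_int m(2))
    finally show ?thesis .
   qed
   thus ?thesis unfolding d using free_quot_finite_step[OF s le _ m(1) q] by blast
  qed
 qed
 from this[of k] show ?thesis unfolding H(2) inf_def H(4) by simp
qed

section \<open>The central extension attached to G\<close>

definition vec2 :: "int * int => nat => int" where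
 "vec2 u = (%j. if j = 0 then fst u else if j = 1 then snd u else 0)"

lemma vec2_add: "vec2 (u + v) = vec2 u + vec2 v" by (auto simp: vec2_def fun_eq_iff)

lemma vec2_inj: assumes "vec2 u = vec2 v" shows "u = v"
 using fun_cong[OF assms, of 0] fun_cong[OF assms, of 1] by (simp add: vec2_def prod_eq_iff)

lemma vec2_range: "vec2 u : Zd 2" "x : Zd 2 ==> EX u. x = vec2 u"
proof -
 show "vec2 u : Zd 2" by (auto simp: vec2_def Zd_def)
 assume "x : Zd 2"
 hence "x = vec2 (x 0, x 1)" by (auto simp: vec2_def Zd_def fun_eq_iff numeral_2_eq_2 not_less_eq_eq le_Suc_eq)
 thus "EX u. x = vec2 u" by blast
qed

text \<open>If the commutator c of g and h is central, the commutator of g^n and h is c^n.\<close>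

lemma (in group) central_pow_comm:
 assumes g: "g : carrier G" "h : carrier G" "c : carrier G" and gh: "g \<otimes> h = c \<otimes> (h \<otimes> g)"
  and c: "!!x. x : carrier G ==> c \<otimes> x = x \<otimes> c"
 shows "g [^] (n :: nat) \<otimes> h = c [^] n \<otimes> (h \<otimes> g [^] n)"
proof (induction n)
 case (Suc n)
 have "g [^] Suc n \<otimes> h = g [^] n \<otimes> (c \<otimes> (h \<otimes> g))" using g gh by (simp add: m_assoc)
 also have "... = g [^] n \<otimes> (c \<otimes> h) \<otimes> g" using g by (simp add: m_assoc)
 also have "... = g [^] n \<otimes> h \<otimes> c \<otimes> g" using g c[of h] by (simp add: m_assoc)
 also have "... = c [^] n \<otimes> (h \<otimes> (g [^] n \<otimes> c) \<otimes> g)" unfolding Suc.IH using g by (simp add: m_assoc)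
 also have "... = c [^] n \<otimes> (h \<otimes> c \<otimes> g [^] n \<otimes> g)" using g c[of "g [^] n"] by (simp add: m_assoc)
 also have "... = c [^] n \<otimes> (c \<otimes> h \<otimes> g [^] n \<otimes> g)" unfolding c[OF g(2)] ..
 also have "... = c [^] Suc n \<otimes> (h \<otimes> g [^] Suc n)" using g by (simp add: m_assoc)
 finally show ?case .
qed (use g in simp)

text \<open>G' itself will not do as the kernel, since G/G' may have torsion. The preimage I of that
  torsion is taken instead; it is still central and still free of rank 2.\<close>

theorem (in group) central_ext_exists:
 assumes T: "T_group G" and nil: "nilpotency_class G 2"
  and h2: "has_hirsch_length (G(|carrier := derived G (carrier G)|)) 2"
  and hd: "has_hirsch_length (G Mod derived G (carrier G)) d"
 shows "EX pj io. central_ext G pj io d"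
proof -
 let ?D = "derived G (carrier G)"
 have tf: "x = \<one>" if "x : carrier G" "0 < n" "x [^] n = \<one>" for x and n :: nat
  using T that unfolding T_group_def by blast
 have Dsub: "subgroup ?D G" by (rule derived_is_subgroup) simp
 have Dnorm: "?D \<lhd> G" by (rule derived_self_is_normal)
 have D1: "lower_central G (Suc 0) = ?D" by (simp add: derived_def)
 have com: "g \<otimes> h \<otimes> inv g \<otimes> inv h : ?D" if "g : carrier G" "h : carrier G" for g h
  unfolding derived_def by (rule generate.incl) (use that in blast)
 have cent: "x \<otimes> y = y \<otimes> x" if xy: "x : ?D" "y : carrier G" for x y
 proof -
  have xc: "x : carrier G" using subgroup.mem_carrier[OF Dsub xy(1)] .
  have "lower_central G (Suc (Suc 0)) = {\<one>}" using nil by (simp add: nilpotency_class_def numeral_2_eq_2)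
  moreover have "x \<otimes> y \<otimes> inv x \<otimes> inv y : lower_central G (Suc (Suc 0))"
   unfolding lower_central.simps(2)[of G "Suc 0"] D1 by (rule generate.incl) (use xy in blast)
  ultimately have "x \<otimes> y \<otimes> inv x \<otimes> inv y = \<one>" by blast
  hence "x \<otimes> y \<otimes> inv (y \<otimes> x) = \<one>" using xc xy(2) by (simp add: inv_mult_group m_assoc)
  thus ?thesis using xc xy(2) by (metis inv_equality inv_inv inv_closed m_closed)
 qed
 have "comm_group (G(|carrier := ?D|))"
  by (rule group.group_comm_groupI[OF subgroup_imp_group[OF Dsub]]) (use cent subgroup.mem_carrier[OF Dsub] in simp)
 from comm_group.hirsch_free_quot[OF this h2] obtain pj2 e2 where q2: "free_quot (G(|carrier := ?D|)) ?D 2 pj2 e2" by auto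
 from comm_group.hirsch_free_quot[OF derived_quot_is_comm_group hd] obtain pjQ e where
  qQ: "free_quot (G Mod ?D) (carrier (G Mod ?D)) d pjQ e" by blast
 define pj where "pj g = pjQ (?D #> g)" for g
 have cQ: "carrier (G Mod ?D) = (%g. ?D #> g) ` carrier G" by (rule carrier_FactGroup)
 have pim: "pj (g \<otimes> h) = pj g + pj h" if "g : carrier G" "h : carrier G" for g h
 proof -
  have "pjQ ((?D #> g) \<otimes>\<^bsub>G Mod ?D\<^esub> (?D #> h)) = pjQ (?D #> g) + pjQ (?D #> h)"
   using qQ that unfolding free_quot_def cQ by blast
  thus ?thesis using normal.rcos_sum[OF Dnorm that] by (simp only: pj_def mult_FactGroup)
 qed
 have piim: "pj ` carrier G = Zd d" using qQ unfolding free_quot_def cQ pj_def image_image by blast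
 have e: "e > 0" using qQ unfolding free_quot_def by blast
 \<comment> \<open>The kernel of G onto the torsion-free quotient of G/G'.\<close>
 define I where "I = {g : carrier G. pj g = 0}"
 have Ie: "g [^] e : ?D" if g: "g : I" for g
 proof -
  have gc: "g : carrier G" and "pjQ (?D #> g) = 0" using g by (auto simp: I_def pj_def)
  hence "(?D #> g) [^]\<^bsub>G Mod ?D\<^esub> e = \<one>\<^bsub>G Mod ?D\<^esub>" using qQ unfolding free_quot_def cQ by blast
  hence "?D #> g [^] e = ?D" using normal.FactGroup_pow[OF Dnorm gc] by simp
  thus ?thesis using rcos_self[OF nat_pow_closed[OF gc] Dsub, of e] by simp
 qed
 \<comment> \<open>g^e lies in G' and so is central. Hence the e-th power of the commutator c of g
   and h is trivial, and torsion-freeness gives c = 1.\<close>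
 have Icen: "g \<otimes> h = h \<otimes> g" if g: "g : I" "h : carrier G" for g h
 proof -
  define c where "c = g \<otimes> h \<otimes> inv g \<otimes> inv h"
  have gc: "g : carrier G" using g by (simp add: I_def)
  have cD: "c : ?D" unfolding c_def by (rule com[OF gc g(2)])
  have cc: "c : carrier G" using subgroup.mem_carrier[OF Dsub cD] .
  have gh: "g \<otimes> h = c \<otimes> (h \<otimes> g)"
  proof -
   have "inv h \<otimes> (h \<otimes> g) = g" using gc g(2) by (simp add: m_assoc[symmetric])
   thus ?thesis unfolding c_def using gc g(2) by (simp add: m_assoc)
  qed
  have "g [^] e \<otimes> h = c [^] e \<otimes> (h \<otimes> g [^] e)"
   by (rule central_pow_comm[OF gc g(2) cc gh]) (rule cent[OF cD])
  hence "h \<otimes> g [^] e = c [^] e \<otimes> (h \<otimes> g [^] e)" using cent[OF Ie[OF g(1)] g(2)] by simp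
  hence "c [^] e = \<one>" using gc g(2) cc by (metis m_closed nat_pow_closed r_cancel_one')
  hence "c = \<one>" by (rule tf[OF cc e])
  thus ?thesis using gh gc g(2) by simp
 qed
 have pi1: "pj \<one> = 0" using pim[of "\<one>" "\<one>"] by simp
 have piD: "pj g = 0" if "g : ?D" for g
 proof -
  have "?D #> g = ?D #> \<one>"
   using coset_join2[OF subgroup.mem_carrier[OF Dsub that] Dsub that] subgroup.subset[OF Dsub] by (simp add: coset_mult_one)
  thus ?thesis using pi1 by (simp add: pj_def)
 qed
 have Isub: "subgroup I G"
 proof (rule subgroupI)
  show "I <= carrier G" "I ~= {}" using pi1 by (auto simp: I_def)
  show "a \<otimes> b : I" if "a : I" "b : I" for a b using that pim[of a b] by (simp add: I_def)
  show "inv a : I" if "a : I" for a using that pim[of "inv a" a] pi1 by (simp add: I_def)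
 qed
 let ?I = "G(|carrier := I|)"
 have Icomm: "comm_group ?I"
  by (rule group.group_comm_groupI[OF subgroup_imp_group[OF Isub]]) (use Icen in \<open>simp add: I_def\<close>)
 have DI: "?D <= I" using piD subgroup.mem_carrier[OF Dsub] by (auto simp: I_def)
 have pw: "x [^]\<^bsub>G(|carrier := S|)\<^esub> n = x [^] n" for S x and n :: nat using nat_pow_consistent by metis
 \<comment> \<open>I inherits the rank 2 from G', because e-th powers of I lie in G'.
   Torsion-freeness then makes the map to Z^2 injective.\<close>
 have "EX pj' e'. free_quot ?I I 2 pj' e'"
 proof (rule comm_group.free_quot_finite_step[OF Icomm _ _ DI _ e])
  show "subgroup ?D ?I" by (rule subgroup_incl[OF Dsub Isub DI])
  show "subgroup I ?I" by (rule subgroup_incl[OF Isub Isub subset_refl])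
  show "a [^]\<^bsub>?I\<^esub> e : ?D" if "a : I" for a unfolding pw by (rule Ie[OF that])
  show "free_quot ?I ?D 2 pj2 e2" using q2 unfolding free_quot_def pw by simp
 qed
 then obtain ze e' where z: "free_quot ?I I 2 ze e'" by blast
 have zm: "ze (a \<otimes> b) = ze a + ze b" if "a : I" "b : I" for a b using z that unfolding free_quot_def by simp
 have zim: "ze ` I = Zd 2" using z unfolding free_quot_def by blast
 have z1: "ze \<one> = 0" using zm[of "\<one>" "\<one>"] subgroup.one_closed[OF Isub] by simp
 have zk: "a = \<one>" if "a : I" "ze a = 0" for a
  using z that tf[of a e'] unfolding free_quot_def pw by (simp add: I_def)
 have zinj: "a = b" if ab: "a : I" "b : I" "ze a = ze b" for a b
 proof -
  have ib: "inv b : I" using subgroup.m_inv_closed[OF Isub ab(2)] .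
  have bc: "a : carrier G" "b : carrier G" using ab by (auto simp: I_def)
  have "ze (a \<otimes> inv b) = ze (b \<otimes> inv b)" unfolding zm[OF ab(1) ib] zm[OF ab(2) ib] ab(3) ..
  hence "a \<otimes> inv b = \<one>" using zk[OF subgroup.m_closed[OF Isub ab(1) ib]] z1 bc by simp
  thus ?thesis using bc by (metis inv_equality inv_inv inv_closed)
 qed
 have "EX a. a : I & ze a = vec2 u" for u using zim vec2_range(1)[of u] by (metis imageE)
 then obtain io where iota: "!!u. io u : I & ze (io u) = vec2 u" by metis
 have "central_ext G pj io d"
 proof unfold_locales
  show "pj g : Zd d" if "g : carrier G" for g using piim that by blast
  show "pj (g \<otimes> h) = pj g + pj h" if "g : carrier G" "h : carrier G" for g h by (rule pim[OF that])
  show "EX g:carrier G. pj g = x" if "x : Zd d" for x using piim that by (metis imageE)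
  show "io u : carrier G" "pj (io u) = 0" for u using iota[of u] by (auto simp: I_def)
  show "io (u + v) = io u \<otimes> io v" for u v
  proof (rule zinj)
   show "ze (io (u + v)) = ze (io u \<otimes> io v)" using zm iota by (simp only: vec2_add)
  qed (use iota subgroup.m_closed[OF Isub] in blast)+
  show "u = v" if "io u = io v" for u v using iota[of u] iota[of v] that vec2_inj by metis
  show "EX u. g = io u" if g: "g : carrier G" "pj g = 0" for g
  proof -
   have gI: "g : I" using g by (simp add: I_def)
   then obtain u where "ze g = vec2 u" using zim vec2_range(2) by blast
   hence "g = io u" using zinj[OF gI, of "io u"] iota[of u] by simp
   thus ?thesis by blast
  qed
  show "g \<otimes> io u = io u \<otimes> g" if "g : carrier G" for g u using Icen[of "io u" g] iota[of u] that by simp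
 qed
 thus ?thesis by blast
qed

section \<open>Nondegeneracy of the commutator form\<close>

text \<open>Three vectors of Z^2 are dependent: the cross product of their two coordinate rows is a
  relation. If it vanishes, the first two vectors are already proportional.\<close>

lemma dependent_triple:
 fixes p q r s t w :: int
 obtains a b c :: int where "(a, b, c) ~= (0, 0, 0)" "a * p + b * r + c * t = 0" "a * q + b * s + c * w = 0"
proof (cases "(r * w - s * t, t * q - p * w, p * s - q * r) = (0, 0, 0)")
 case False
 show ?thesis by (rule that[OF False]) (simp_all add: algebra_simps)
next
 case True
 hence e: "p * s = q * r" by simp
 consider "p = 0 & q = 0" | "p ~= 0" | "q ~= 0" by blast
 thus ?thesis
 proof cases
  case 1 thus ?thesis using that[of 1 0 0] by simp
 next
  case 2 thus ?thesis using that[of r "- p" 0] e by (simp add: mult.commute)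
 next
  case 3 thus ?thesis using that[of s "- q" 0] e by (simp add: mult.commute)
 qed
qed

lemma additive_int:
 fixes f :: "int => nat => int"
 assumes "!!m n. f (m + n) = f m + f n" shows "f n = zs n (f 1)"
proof (induction n rule: int_induct[where k = 0])
 case base
 have "f 0 = 0" using assms[of 0 0] by simp
 thus ?case by (simp only: zs_simps(6))
next
 case (step1 n) thus ?case using assms[of n 1] by (simp only: zs_simps(1,7))
next
 case (step2 n)
 have "f n = f (n - 1) + f 1" using assms[of "n - 1" 1] by simp
 hence "f (n - 1) = f n - f 1" by simp
 thus ?case using step2 by (simp only: zs_simps(4,7))
qed

text \<open>If x is in the radical of the form, a lift g of x is central. The centre has rank 2 and
  already contains Z^2, so g is dependent on it, and projection to Z^d gives c x = 0.\<close>

theorem (in central_ext) Ph_injective: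
 assumes tf: "!!x n. x : carrier G ==> 0 < n ==> x [^] (n :: nat) = \<one> ==> x = \<one>"
  and hZ: "has_hirsch_length (G(|carrier := center G|)) 2" and x: "x : Zd d" "Ph x = 0"
 shows "x = 0"
proof -
 have Zc: "center G <= carrier G" by (auto simp: center_def)
 have Zsub: "subgroup (center G) G"
 proof (rule subgroupI)
  have "\<one> : center G" by (simp add: center_def)
  thus "center G ~= {}" by blast
  show "a \<otimes> b : center G" if ab: "a : center G" "b : center G" for a b
  proof -
   have c: "a : carrier G" "b : carrier G" using ab Zc by blast+
   have "a \<otimes> b \<otimes> y = y \<otimes> (a \<otimes> b)" if y: "y : carrier G" for y
   proof -
    have e: "b \<otimes> y = y \<otimes> b" "a \<otimes> y = y \<otimes> a" using ab y unfolding center_def by blast+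
    have "a \<otimes> b \<otimes> y = a \<otimes> (y \<otimes> b)" unfolding e(1)[symmetric] using c y by (simp add: m_assoc)
    also have "... = y \<otimes> a \<otimes> b" unfolding e(2)[symmetric] using c y by (simp add: m_assoc)
    finally show ?thesis using c y by (simp add: m_assoc)
   qed
   thus ?thesis using c by (simp add: center_def)
  qed
  show "inv a : center G" if a: "a : center G" for a
  proof -
   have ac: "a : carrier G" using a Zc by blast
   have "inv a \<otimes> y = y \<otimes> inv a" if y: "y : carrier G" for y
   proof -
    have "a \<otimes> y = y \<otimes> a" using a y unfolding center_def by blast
    hence "y \<otimes> a = a \<otimes> y" ..
    hence "inv a \<otimes> y \<otimes> a = inv a \<otimes> (a \<otimes> y)" using ac y by (simp add: m_assoc)
    also have "... = y" using ac y by (simp add: m_assoc[symmetric])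
    finally show ?thesis using inv_solve_right[of "inv a \<otimes> y" y a] ac y by simp
   qed
   thus ?thesis using ac by (simp add: center_def)
  qed
 qed (rule Zc)
 have ZZ: "a \<otimes> b = b \<otimes> a" if "a : center G" "b : center G" for a b using that Zc unfolding center_def by blast
 have "comm_group (G(|carrier := center G|))"
  by (rule group.group_comm_groupI[OF subgroup_imp_group[OF Zsub]]) (simp, rule ZZ)
 from comm_group.hirsch_free_quot[OF this hZ] obtain th e where q: "free_quot (G(|carrier := center G|)) (center G) 2 th e" by auto
 have tm: "th (a \<otimes> b) = th a + th b" if "a : center G" "b : center G" for a b using q that unfolding free_quot_def by simp
 have tZ: "th a : Zd 2" if "a : center G" for a using q that unfolding free_quot_def by blast
 have tk: "a = \<one>" if a: "a : center G" "th a = 0" for a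
 proof -
  have "a [^]\<^bsub>G(|carrier := center G|)\<^esub> e = \<one>" "e > 0" using q a unfolding free_quot_def by auto
  thus ?thesis using tf[of a e] nat_pow_consistent[of a e "center G"] a(1) Zc by auto
 qed
 define g where "g = sec x"
 note gs = sec[OF x(1), folded g_def]
 have "addsub {0 :: int * int}" by (auto simp: addsub_def)
 moreover have "x : Xm {0}" using x addsub_zero[OF addsub_Hm[OF calculation], of d] by (simp add: Xm_def)
 ultimately have px: "ALL y:Zd d. ph x y = 0" using Xm_iff[OF _ x(1)] by blast
 have gZ: "g : center G" unfolding center_def
 proof (intro CollectI conjI ballI gs)
  fix h assume h: "h : carrier G"
  have "cm g h = 0" unfolding cm_ph[OF gs(1) h] gs(2) using px pi_Zd[OF h] by blast
  thus "g \<otimes> h = h \<otimes> g" using cm_eq[OF gs(1) h] gs(1) h by (simp add: iota_0)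
 qed
 have iZ: "io u : center G" for u using iota_central[of _ u] by (simp add: center_def)
 define v1 v2 v3 where "v1 = th (io (1, 0))" and "v2 = th (io (0, 1))" and "v3 = th g"
 obtain a b c :: int where abc: "(a, b, c) ~= (0, 0, 0)" "a * v1 0 + b * v2 0 + c * v3 0 = 0" "a * v1 1 + b * v2 1 + c * v3 1 = 0"
  by (rule dependent_triple)
 have i1: "th (io (m, 0)) = zs m v1" for m
  unfolding v1_def by (rule additive_int[of "%m. th (io (m, 0))"]) (simp add: tm[OF iZ iZ, symmetric] iota_add[symmetric] del: plus_fun_apply)
 have i2: "th (io (0, m)) = zs m v2" for m
  unfolding v2_def by (rule additive_int[of "%m. th (io (0, m))"]) (simp add: tm[OF iZ iZ, symmetric] iota_add[symmetric] del: plus_fun_apply)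
 have gp: "g [^] (m :: int) : center G" for m by (rule subgroup_int_pow_closed[OF Zsub gZ])
 have i3: "th (g [^] m) = zs m v3" for m :: int
 proof -
  have "th (g [^] (m + n)) = th (g [^] m) + th (g [^] n)" for m n :: int
   using tm[OF gp gp] gs(1) by (simp only: int_pow_mult)
  from additive_int[of "%m. th (g [^] m)", OF this] show ?thesis using gs(1) by (simp add: v3_def)
 qed
 \<comment> \<open>The relation makes y a torsion element of the centre, so y = 1. If c were 0,
   injectivity of \<open>io\<close> would make the relation trivial.\<close>
 define y where "y = io (a, 0) \<otimes> io (0, b) \<otimes> g [^] c"
 have yZ: "y : center G" unfolding y_def by (intro subgroup.m_closed[OF Zsub] iZ gp)
 have "th y = zs a v1 + zs b v2 + zs c v3"
  unfolding y_def using tm[OF subgroup.m_closed[OF Zsub iZ iZ] gp] tm[OF iZ iZ] by (simp only: i1 i2 i3)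
 moreover have "(zs a v1 + zs b v2 + zs c v3) i = 0" for i
 proof -
  have "v1 i = 0" "v2 i = 0" "v3 i = 0" if "i >= 2"
   using tZ[OF iZ, of "(1, 0)"] tZ[OF iZ, of "(0, 1)"] tZ[OF gZ] that by (simp_all add: v1_def v2_def v3_def Zd_def)
  thus ?thesis using abc(2,3) by (cases "i >= 2") (auto simp: zs_def not_le less_2_cases_iff)
 qed
 ultimately have "th y = 0" by (simp only: fun_eq_iff zero_fun_apply) simp
 hence y1: "y = \<one>" by (rule tk[OF yZ])
 have "pj y = zs c x"
  unfolding y_def using gs by (simp only: pi_mult m_closed iota_carrier int_pow_closed pi_iota pi_int_pow add_0)
 hence zc: "zs c x = 0" unfolding y1 pi_one by simp
 show "x = 0"
 proof (rule ccontr)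
  assume "x ~= 0"
  then obtain i where "x i ~= 0" by (auto simp: fun_eq_iff)
  moreover have "c * x i = 0" using fun_cong[OF zc, of i] by (simp add: zs_def)
  ultimately have c0: "c = 0" by simp
  have "io (a, b) = y" unfolding y_def c0 by (simp add: iota_add[symmetric])
  hence "io (a, b) = io 0" unfolding y1 iota_0 .
  hence "(a, b) = 0" by (rule iota_inj)
  thus False using abc(1) c0 by (simp add: zero_prod_def)
 qed
qed

section \<open>Functional equations of the building blocks\<close>

definition gi :: "'a::field => 'a" where "gi r = inverse (1 - r)"

text \<open>\<open>Rm\<close>, \<open>Rinf\<close>, \<open>Sf\<close>, \<open>Kf\<close>,
  \<open>Uf\<close> and \<open>Pf\<close> are the series above with al = p^d, as expressions over
  any field in x = p and y = p^(-s). They are read both in the complex numbers and in the field of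
  rational functions.\<close>

definition Rm :: "nat => nat list => nat => 'a::field => 'a => 'a" where
 "Rm d ms t x y = x ^ (t - 1 + d * t) * y ^ (t + wk ms t)"

definition Rinf :: "nat => nat => 'a::field => 'a => 'a" where
 "Rinf d rh x y = x ^ (1 + d) * y ^ (1 + rh)"

definition Sf :: "nat => nat list => 'a::field => 'a => 'a" where
 "Sf d ms x y = (let K = Suc (sum_list ms); R = (%t. Rm d ms t x y) in
   (SUM t:{1..<K}. R t * (gi (R t) * gi (R (Suc t)))) + R K * (gi (R K) * gi (Rinf d (length ms) x y)))"

definition Kf :: "nat => nat list => 'a::field => 'a => 'a" where
 "Kf d ms x y = Sf d ms x y - inverse x * (Sf d ms x y + gi (Rinf d (length ms) x y) - gi (Rm d ms 1 x y))"

definition Uf :: "nat => nat => 'a::field => 'a => 'a" where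
 "Uf d rh x y = x ^ d * y ^ (1 + rh) * gi (Rinf d rh x y)"

definition Pf :: "nat => nat => 'a::field => 'a => 'a" where
 "Pf d r x y = (PROD i<d. gi (x ^ i * y)) * gi (x ^ (2 * d) * y ^ (2 + r))"

text \<open>No denominator vanishes. The range of exponents covers every monomial that occurs
  (\<open>exponent_bounds\<close>), the condition is symmetric under inversion, and it holds at x =
  p for 0 < |y| < p^(-d-1).\<close>

definition adm :: "nat => 'a::field => 'a => bool" where
 "adm d x y \<longleftrightarrow> x ~= 0 & y ~= 0 & (ALL i k. 1 <= k --> i <= (d + 1) * k --> x ^ i * y ^ k ~= 1)"

lemma adm_monom: "adm d x y ==> 1 <= k ==> i <= (d + 1) * k ==> x ^ i * y ^ k ~= 1" unfolding adm_def by blast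

lemma exponent_bounds:
 fixes d t k :: nat
 shows "t - 1 + d * t <= (d + 1) * (t + w)" "1 + d <= (d + 1) * (1 + rh)" "2 * d <= (d + 1) * (2 + r)" "i < d ==> i <= (d + 1) * 1"
 by (simp_all add: algebra_simps)

lemma adm_inverse: "adm d x y ==> adm d (inverse x) (inverse y)"
proof -
 have e: "inverse x ^ i * inverse y ^ k = inverse (x ^ i * y ^ k)" for i k by (simp add: power_inverse)
 show "adm d x y ==> adm d (inverse x) (inverse y)" unfolding adm_def e inverse_eq_1_iff by simp
qed

lemma gi_inverse: "r ~= 1 ==> r ~= 0 ==> gi (inverse r) = - r * gi r" by (simp add: gi_def field_simps)

lemma adm_R:
 assumes "adm d x y" shows "t >= 1 ==> Rm d ms t x y ~= 1" "Rm d ms t x y ~= 0" "Rinf d rh x y ~= 1" "Rinf d rh x y ~= 0"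
proof -
 have xy: "x ~= 0" "y ~= 0" using assms by (auto simp: adm_def)
 show "Rm d ms t x y ~= 1" if "t >= 1" unfolding Rm_def by (rule adm_monom[OF assms _ exponent_bounds(1)]) (use that in simp)
 show "Rinf d rh x y ~= 1" unfolding Rinf_def by (rule adm_monom[OF assms _ exponent_bounds(2)]) simp
 show "Rm d ms t x y ~= 0" "Rinf d rh x y ~= 0" using xy by (simp_all add: Rm_def Rinf_def)
qed

lemma R_inverse: "Rm d ms t (inverse x) (inverse y) = inverse (Rm d ms t x y)"
 "Rinf d rh (inverse x) (inverse y) = inverse (Rinf d rh x y)" by (simp_all add: Rm_def Rinf_def power_inverse)

lemma gi_diff:
 assumes "r ~= 1" "s ~= 1" shows "s * (gi r * gi s) = r * (gi r * gi s) + (gi s - gi r)"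
proof -
 have "(1 - r) * gi r = 1" "(1 - s) * gi s = 1" using assms by (simp_all add: gi_def)
 moreover have "s * (gi r * gi s) = r * (gi r * gi s) + ((1 - r) * gi r * gi s - gi r * ((1 - s) * gi s))"
  by (simp add: algebra_simps)
 ultimately show ?thesis by simp
qed

text \<open>Reciprocity for cones: inversion turns the half-open cone that contains its first ray
  into the one that contains its second ray. The two differ by the one-dimensional series of the
  rays, and these differences telescope from the ray (1,1) to the ray (1,0).\<close>

lemma Sf_inverse:
 assumes a: "adm d x y"
 shows "Sf d ms (inverse x) (inverse y) = Sf d ms x y + (gi (Rinf d (length ms) x y) - gi (Rm d ms 1 x y))"
proof -
 define R where "R t = Rm d ms t x y" for t
 define K where "K = Suc (sum_list ms)"
 define r where "r = Rinf d (length ms) x y"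
 have R: "t >= 1 ==> R t ~= 1" "R t ~= 0" "r ~= 1" "r ~= 0" for t using adm_R[OF a] by (auto simp: R_def r_def)
 have st: "inverse u * (gi (inverse u) * gi (inverse v)) = v * (gi u * gi v)" if "u ~= 1" "u ~= 0" "v ~= 1" "v ~= 0" for u v :: 'a
  unfolding gi_inverse[OF that(1,2)] gi_inverse[OF that(3,4)] using that(2) by simp
 have K1: "K >= 1" by (simp add: K_def)
 have "Sf d ms (inverse x) (inverse y) = (SUM t:{1..<K}. inverse (R t) * (gi (inverse (R t)) * gi (inverse (R (Suc t)))))
   + inverse (R K) * (gi (inverse (R K)) * gi (inverse r))" by (simp add: Sf_def R_inverse R_def r_def K_def Let_def)
 also have "... = (SUM t:{1..<K}. R t * (gi (R t) * gi (R (Suc t))) + (gi (R (Suc t)) - gi (R t))) + (R K * (gi (R K) * gi r) + (gi r - gi (R K)))"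
 proof (intro arg_cong2[where f = "(+)"] sum.cong refl)
  show "inverse (R t) * (gi (inverse (R t)) * gi (inverse (R (Suc t)))) = R t * (gi (R t) * gi (R (Suc t))) + (gi (R (Suc t)) - gi (R t))"
   if "t : {1..<K}" for t using that R by (simp add: st gi_diff)
  show "inverse (R K) * (gi (inverse (R K)) * gi (inverse r)) = R K * (gi (R K) * gi r) + (gi r - gi (R K))"
   using K1 R by (simp add: st gi_diff)
 qed
 also have "... = (SUM t:{1..<K}. R t * (gi (R t) * gi (R (Suc t)))) + (gi (R K) - gi (R 1)) + (R K * (gi (R K) * gi r) + (gi r - gi (R K)))"
  unfolding sum.distrib by (simp only: sum_Suc_diff'[OF K1, of "%t. gi (R t)"])
 also have "... = Sf d ms x y + (gi r - gi (R 1))" unfolding Sf_def Let_def by (fold R_def K_def r_def) simp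
 finally show ?thesis unfolding R_def r_def .
qed

text \<open>Let S' be the bracket in \<open>Kf\<close>, so that \<open>Kf\<close> = S - S'/x.
  Inversion interchanges S and S', which gives S' - x S.\<close>

lemma Kf_inverse:
 assumes a: "adm d x y"
 shows "Kf d ms (inverse x) (inverse y) = - x * Kf d ms x y"
proof -
 have x: "x ~= 0" using a by (simp add: adm_def)
 define S where "S = Sf d ms x y"
 define r where "r = Rinf d (length ms) x y"
 define R where "R = Rm d ms 1 x y"
 have R: "R ~= 1" "R ~= 0" "r ~= 1" "r ~= 0" using adm_R[OF a] by (auto simp: R_def r_def)
 have g: "gi (inverse u) = 1 - gi u" if "u ~= 1" "u ~= 0" for u :: 'a using that by (simp add: gi_def field_simps)
 show ?thesis unfolding Kf_def Sf_inverse[OF a] R_inverse inverse_inverse_eq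
  unfolding S_def[symmetric] r_def[symmetric] R_def[symmetric] g[OF R(1,2)] g[OF R(3,4)] using x by (simp add: field_simps)
qed

text \<open>With r the monomial of the ray (1,0), x U = 1/(1-r) - 1, and inversion takes U to
  -x/(1-r).\<close>

lemma Uf_inverse:
 assumes a: "adm d x y"
 shows "1 + (inverse x + 1) * Uf d rh (inverse x) (inverse y) = - x * (1 + (x + 1) * Uf d rh x y)"
proof -
 have x: "x ~= 0" "y ~= 0" using a by (auto simp: adm_def)
 define r where "r = Rinf d rh x y"
 have r: "r ~= 1" "r ~= 0" using adm_R[OF a] by (auto simp: r_def)
 have u: "Uf d rh u v = Rinf d rh u v * inverse u * gi (Rinf d rh u v)" if "u ~= 0" for u v :: 'a
  using that by (simp add: Uf_def Rinf_def)
 have "inverse r * inverse (inverse x) * gi (inverse r) = - x * gi r" unfolding gi_inverse[OF r] using r(2) by simp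
 moreover have "x * (r * inverse x * gi r) = gi r - 1"
 proof -
  have "r * gi r = gi r - 1" using r(1) by (simp add: gi_def field_simps)
  moreover have "x * (r * inverse x * gi r) = x * inverse x * (r * gi r)" by (simp only: ac_simps)
  ultimately show ?thesis using x(1) by simp
 qed
 ultimately have w: "x * Uf d rh x y = gi r - 1" "Uf d rh (inverse x) (inverse y) = - x * gi r"
  using u[OF x(1), of y] u[of "inverse x" "inverse y"] x(1) unfolding R_inverse r_def[symmetric] by (simp_all add: mult.assoc)
 have "1 + (inverse x + 1) * (- x * gi r) = 1 - x * inverse x * gi r - x * gi r" by (simp add: algebra_simps)
 also have "... = - x - (x + 1) * (gi r - 1)" using x(1) by (simp add: algebra_simps)
 also have "... = - x - (x + 1) * (x * Uf d rh x y)" unfolding w(1) ..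
 also have "... = - x * (1 + (x + 1) * Uf d rh x y)" by (simp add: algebra_simps)
 finally show ?thesis unfolding w(2) .
qed

text \<open>Each of the d + 1 geometric factors contributes minus its monomial.\<close>

lemma Pf_inverse:
 assumes a: "adm d x y"
 shows "Pf d d (inverse x) (inverse y) = - ((- 1) ^ d) * x ^ (2 * d + d * (d - 1) div 2) * y ^ (2 * d + 2) * Pf d d x y"
proof -
 have x: "x ~= 0" "y ~= 0" using a by (auto simp: adm_def)
 have "gi (inverse x ^ i * inverse y) = - (x ^ i * y) * gi (x ^ i * y)" if "i < d" for i
  using gi_inverse[of "x ^ i * y"] adm_monom[OF a _ exponent_bounds(4)[OF that]] x by (simp add: power_inverse)
 hence "(PROD i<d. gi (inverse x ^ i * inverse y)) = (PROD i<d. - (x ^ i * y) * gi (x ^ i * y))" by (intro prod.cong) auto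
 also have "... = (PROD i<d. - 1 * (x ^ i * y)) * (PROD i<d. gi (x ^ i * y))" by (simp only: prod.distrib[symmetric] mult_minus1)
 also have "(PROD i<d. - 1 * (x ^ i * y)) = (- 1) ^ d * (x ^ (SUM i<d. i) * y ^ d)"
  by (simp only: prod.distrib power_sum prod_constant card_lessThan)
 also have "(SUM i<d. i) = d * (d - 1) div 2" by (simp add: lessThan_atLeast0 Sum_Ico_nat)
 finally have 1: "(PROD i<d. gi (inverse x ^ i * inverse y)) = (- 1) ^ d * (x ^ (d * (d - 1) div 2) * y ^ d) * (PROD i<d. gi (x ^ i * y))" .
 have 2: "gi (inverse x ^ (2 * d) * inverse y ^ (2 + d)) = - (x ^ (2 * d) * y ^ (2 + d)) * gi (x ^ (2 * d) * y ^ (2 + d))"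
  using gi_inverse[of "x ^ (2 * d) * y ^ (2 + d)"] adm_monom[OF a _ exponent_bounds(3), of d] x by (simp add: power_inverse)
 have "2 * d + 2 = d + (2 + d)" by simp
 hence y: "y ^ (2 * d + 2) = y ^ d * y ^ (2 + d)" by (simp only: power_add)
 show ?thesis unfolding Pf_def 1 2 y power_add[of x] by (simp only: mult_minus_left mult_minus_right ac_simps)
qed

section \<open>Evaluation of rational functions\<close>

lemma map_poly_ring_hom:
 fixes h :: "'a::comm_ring_1 => 'b::comm_ring_1"
 assumes h: "h 0 = 0" "!!a b. h (a + b) = h a + h b" "!!a b. h (a * b) = h a * h b"
 shows "map_poly h (p + q) = map_poly h p + map_poly h q" "map_poly h (p * q) = map_poly h p * map_poly h q"
proof -
 show "map_poly h (p + q) = map_poly h p + map_poly h q" by (rule poly_eqI) (simp add: coeff_map_poly h)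
 show "map_poly h (p * q) = map_poly h p * map_poly h q"
 proof (rule poly_eqI)
  fix n
  have "h (SUM i<=n. coeff p i * coeff q (n - i)) = (SUM i<=n. h (coeff p i * coeff q (n - i)))"
   using sum_comp_morphism[of h "%i. coeff p i * coeff q (n - i)", OF h(1,2)] by (simp add: o_def)
  thus "coeff (map_poly h (p * q)) n = coeff (map_poly h p * map_poly h q) n"
   by (simp add: coeff_map_poly coeff_mult h)
 qed
qed

lemma poly2_eval_add: "poly2_eval (p + q) x y = poly2_eval p x y + poly2_eval q x y"
 and poly2_eval_mult: "poly2_eval (p * q) x y = poly2_eval p x y * poly2_eval q x y"
proof -
 have r: "map_poly of_rat (a + b) = (map_poly of_rat a + map_poly of_rat b :: complex poly)"
  "map_poly of_rat (a * b) = (map_poly of_rat a * map_poly of_rat b :: complex poly)" for a b :: "rat poly"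
  by (rule map_poly_ring_hom; simp add: of_rat_add of_rat_mult)+
 let ?h = "%c. poly (map_poly of_rat c) x"
 have "map_poly ?h (p + q) = map_poly ?h p + map_poly ?h q" "map_poly ?h (p * q) = map_poly ?h p * map_poly ?h q"
  by (rule map_poly_ring_hom; simp add: r)+
 thus "poly2_eval (p + q) x y = poly2_eval p x y + poly2_eval q x y"
  "poly2_eval (p * q) x y = poly2_eval p x y * poly2_eval q x y" unfolding poly2_eval_def by simp_all
qed

lemma poly2_eval_pCons: "poly2_eval (pCons c q) x y = poly (map_poly of_rat c) x + y * poly2_eval q x y"
 unfolding poly2_eval_def by (simp add: map_poly_pCons)

lemma poly2_eval_0: "poly2_eval 0 x y = 0" by (simp add: poly2_eval_def)

text \<open>Some fraction representing W has a denominator not vanishing at the point. Unlike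
  evaluation in lowest terms this is visibly compatible with sums, products and inverses, and
  \<open>rf_valD\<close> passes to lowest terms.\<close>

definition rf_val :: "rat_fun2 => complex => complex => complex => bool" where
 "rf_val W x y v \<longleftrightarrow> (EX a b. W = Fract a b & poly2_eval b x y ~= 0 & v = poly2_eval a x y / poly2_eval b x y)"

lemma rf_valD:
 assumes "rf_val W x y v" shows "rf_regular W x y" "rf_eval W x y = v"
proof -
 obtain a b where ab: "W = Fract a b" "poly2_eval b x y ~= 0" "v = poly2_eval a x y / poly2_eval b x y"
  using assms unfolding rf_val_def by blast
 define u w where "u = fst (quot_of_fract W)" and "w = snd (quot_of_fract W)"
 have b: "b ~= 0" using ab(2) by (auto simp: poly2_eval_0)
 have w: "w ~= 0" by (simp add: w_def)
 have "Fract u w = Fract a b" unfolding u_def w_def ab(1)[symmetric] by simp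
 hence e: "u * b = a * w" using b w by (simp add: eq_fract)
 have "coprime u w" unfolding u_def w_def by (metis coprime_quot_of_fract)
 moreover have "w dvd u * b" unfolding e by simp
 ultimately have "w dvd b" by (metis coprime_commute coprime_dvd_mult_right_iff)
 then obtain k where "b = w * k" by (rule dvdE)
 hence we: "poly2_eval w x y ~= 0" using ab(2) by (auto simp: poly2_eval_mult)
 show "rf_regular W x y" unfolding rf_regular_def w_def[symmetric] by (rule we)
 have "poly2_eval u x y * poly2_eval b x y = poly2_eval a x y * poly2_eval w x y"
  unfolding poly2_eval_mult[symmetric] e ..
 thus "rf_eval W x y = v" unfolding rf_eval_def u_def[symmetric] w_def[symmetric] ab(3) using we ab(2) by (simp add: field_simps)
qed

lemma rf_val_Fract: "poly2_eval b x y ~= 0 ==> rf_val (Fract a b) x y (poly2_eval a x y / poly2_eval b x y)"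
 unfolding rf_val_def by blast

lemma poly2_eval_1: "poly2_eval 1 x y = 1" by (simp add: poly2_eval_def)

lemma rf_val_0: "rf_val 0 x y 0" and rf_val_1: "rf_val 1 x y 1"
 using rf_val_Fract[of 1 x y 0] rf_val_Fract[of 1 x y 1] by (simp_all add: poly2_eval_1 poly2_eval_0 Zero_fract_def One_fract_def)

lemma rf_val_add:
 assumes "rf_val V x y v" "rf_val W x y w" shows "rf_val (V + W) x y (v + w)"
proof -
 obtain a b a' b' where e: "V = Fract a b" "poly2_eval b x y ~= 0" "v = poly2_eval a x y / poly2_eval b x y"
  "W = Fract a' b'" "poly2_eval b' x y ~= 0" "w = poly2_eval a' x y / poly2_eval b' x y" using assms unfolding rf_val_def by blast
 have "b ~= 0" "b' ~= 0" using e by (auto simp: poly2_eval_0)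
 hence "V + W = Fract (a * b' + a' * b) (b * b')" using e by simp
 moreover have "v + w = poly2_eval (a * b' + a' * b) x y / poly2_eval (b * b') x y"
  unfolding e(3,6) poly2_eval_add poly2_eval_mult by (rule add_frac_eq[OF e(2,5)])
 moreover have "poly2_eval (b * b') x y ~= 0" using e by (simp add: poly2_eval_mult)
 ultimately show ?thesis unfolding rf_val_def by blast
qed

lemma rf_val_mult:
 assumes "rf_val V x y v" "rf_val W x y w" shows "rf_val (V * W) x y (v * w)"
proof -
 obtain a b a' b' where e: "V = Fract a b" "poly2_eval b x y ~= 0" "v = poly2_eval a x y / poly2_eval b x y"
  "W = Fract a' b'" "poly2_eval b' x y ~= 0" "w = poly2_eval a' x y / poly2_eval b' x y" using assms unfolding rf_val_def by blast
 have "V * W = Fract (a * a') (b * b')" using e by simp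
 moreover have "v * w = poly2_eval (a * a') x y / poly2_eval (b * b') x y" using e by (simp add: poly2_eval_mult)
 moreover have "poly2_eval (b * b') x y ~= 0" using e by (simp add: poly2_eval_mult)
 ultimately show ?thesis unfolding rf_val_def by blast
qed

lemma rf_val_uminus: assumes "rf_val W x y w" shows "rf_val (- W) x y (- w)"
proof -
 have m: "rf_val (- 1) x y (- 1)"
 proof -
  have "poly2_eval (- 1) x y = - 1" using poly2_eval_add[of "- 1" 1 x y] by (simp add: poly2_eval_0 poly2_eval_1 eq_neg_iff_add_eq_0)
  thus ?thesis using rf_val_Fract[of 1 x y "- 1"] by (simp add: poly2_eval_1 One_fract_def)
 qed
 show ?thesis using rf_val_mult[OF m assms] by simp
qed

lemma rf_val_diff: "rf_val V x y v ==> rf_val W x y w ==> rf_val (V - W) x y (v - w)"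
 using rf_val_add[OF _ rf_val_uminus, of V x y v W w] by simp

lemma rf_val_inverse: assumes "rf_val W x y w" "w ~= 0" shows "rf_val (inverse W) x y (inverse w)"
proof -
 obtain a b where e: "W = Fract a b" "poly2_eval b x y ~= 0" "w = poly2_eval a x y / poly2_eval b x y"
  using assms unfolding rf_val_def by blast
 have "inverse W = Fract b a" "poly2_eval a x y ~= 0" using e assms(2) by simp_all
 moreover have "inverse w = poly2_eval b x y / poly2_eval a x y" unfolding e(3) by simp
 ultimately show ?thesis unfolding rf_val_def by blast
qed

lemma rf_val_power: "rf_val W x y w ==> rf_val (W ^ n) x y (w ^ n)"
 by (induction n) (auto intro: rf_val_1 rf_val_mult)

lemma rf_val_sum: "(!!i. i : A ==> rf_val (f i) x y (g i)) ==> rf_val (sum f A) x y (sum g A)"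
 by (induction A rule: infinite_finite_induct) (auto intro: rf_val_0 rf_val_add)

lemma rf_val_prod: "(!!i. i : A ==> rf_val (f i) x y (g i)) ==> rf_val (prod f A) x y (prod g A)"
 by (induction A rule: infinite_finite_induct) (auto intro: rf_val_1 rf_val_mult)

lemma rf_val_of_nat: "rf_val (of_nat n) x y (of_nat n)" by (induction n) (auto intro: rf_val_0 rf_val_1 rf_val_add)

definition RX :: rat_fun2 where "RX = Fract [:[:0, 1:]:] 1"
definition RY :: rat_fun2 where "RY = Fract [:0, 1:] 1"

lemma rf_val_X: "rf_val RX x y x" and rf_val_Y: "rf_val RY x y y"
 using rf_val_Fract[of 1 x y "[:[:0, 1:]:]"] rf_val_Fract[of 1 x y "[:0, 1:]"]
 by (simp_all add: RX_def RY_def poly2_eval_1 poly2_eval_0 poly2_eval_pCons map_poly_pCons)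

lemma rf_val_gi: "rf_val W x y w ==> w ~= 1 ==> rf_val (gi W) x y (gi w)"
 unfolding gi_def by (intro rf_val_inverse rf_val_diff rf_val_1) auto

lemma rf_val_Kf:
 assumes a: "adm d x y"
 shows "rf_val (Kf d ms RX RY) x y (Kf d ms x y)" "rf_val (Uf d rh RX RY) x y (Uf d rh x y)" "rf_val (Pf d r RX RY) x y (Pf d r x y)"
proof -
 note R = adm_R[OF a]
 have m: "rf_val (RX ^ i * RY ^ k) x y (x ^ i * y ^ k)" for i k by (intro rf_val_mult rf_val_power rf_val_X rf_val_Y)
 have Rm: "rf_val (Rm d ms t RX RY) x y (Rm d ms t x y)" for t unfolding Rm_def by (rule m)
 have Ri: "rf_val (Rinf d rh RX RY) x y (Rinf d rh x y)" for rh unfolding Rinf_def by (rule m)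
 have x: "x ~= 0" using a by (simp add: adm_def)
 have S: "rf_val (Sf d ms RX RY) x y (Sf d ms x y)"
  unfolding Sf_def Let_def by (intro rf_val_add rf_val_sum rf_val_mult rf_val_gi Rm Ri R) auto
 show "rf_val (Kf d ms RX RY) x y (Kf d ms x y)"
  unfolding Kf_def by (intro rf_val_add rf_val_diff rf_val_mult rf_val_inverse rf_val_X rf_val_gi Rm Ri R S x) auto
 show "rf_val (Uf d rh RX RY) x y (Uf d rh x y)" unfolding Uf_def by (intro rf_val_mult rf_val_gi Ri R m)
 show "rf_val (Pf d r RX RY) x y (Pf d r x y)" unfolding Pf_def
 proof (rule rf_val_mult, rule rf_val_prod, rule rf_val_gi)
  show "rf_val (RX ^ i * RY) x y (x ^ i * y)" "x ^ i * y ~= 1" if "i : {..<d}" for i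
   using m[of i 1] adm_monom[OF a _ exponent_bounds(4), of i] that by simp_all
  show "rf_val (gi (RX ^ (2 * d) * RY ^ (2 + r))) x y (gi (x ^ (2 * d) * y ^ (2 + r)))"
   by (rule rf_val_gi[OF m adm_monom[OF a _ exponent_bounds(3)]]) simp
 qed
qed

section \<open>Convergence and values of power series\<close>

text \<open>Absolute convergence is part of the notion so that Cauchy products are covered.\<close>

definition fe :: "rat fps => complex => complex => bool" where
 "fe F y v \<longleftrightarrow> summable (%n. norm (of_rat (fps_nth F n) * y ^ n)) & (%n. of_rat (fps_nth F n) * y ^ n) sums v"

lemma fe_add: assumes "fe F y v" "fe G y w" shows "fe (F + G) y (v + w)"
proof -
 have e: "of_rat (fps_nth (F + G) n) * y ^ n = of_rat (fps_nth F n) * y ^ n + of_rat (fps_nth G n) * y ^ n" for n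
  by (simp add: of_rat_add distrib_right)
 have "summable (%n. norm (of_rat (fps_nth F n) * y ^ n) + norm (of_rat (fps_nth G n) * y ^ n))"
  using assms unfolding fe_def by (intro summable_add) auto
 hence "summable (%n. norm (of_rat (fps_nth (F + G) n) * y ^ n))"
  by (rule summable_comparison_test'[of _ 0]) (simp only: e real_norm_def abs_norm_cancel norm_triangle_ineq)
 thus ?thesis using assms unfolding fe_def e by (auto intro: sums_add)
qed

lemma fe_mult: assumes F: "fe F y v" and G: "fe G y w" shows "fe (F * G) y (v * w)"
proof -
 let ?a = "%n. of_rat (fps_nth F n) * y ^ n" and ?b = "%n. of_rat (fps_nth G n) * y ^ n"
 have s: "summable (%n. norm (?a n))" "summable (%n. norm (?b n))" "suminf ?a = v" "suminf ?b = w"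
  using assms by (auto simp: fe_def sums_iff)
 have e: "of_rat (fps_nth (F * G) n) * y ^ n = (SUM i<=n. ?a i * ?b (n - i))" for n
  unfolding fps_mult_nth of_rat_sum of_rat_mult sum_distrib_right atLeast0AtMost
  by (rule sum.cong) (simp_all add: power_add[symmetric] mult.assoc mult.left_commute[of "y ^ _"])
 have "summable (%n. SUM i<=n. norm (?a i) * norm (?b (n - i)))"
  using Cauchy_product_sums[of "%n. norm (?a n)" "%n. norm (?b n)"] s by (simp add: sums_iff)
 hence "summable (%n. norm (of_rat (fps_nth (F * G) n) * y ^ n))"
  by (rule summable_comparison_test'[of _ 0]) (simp only: e real_norm_def abs_norm_cancel, rule order_trans[OF norm_sum], simp add: norm_mult)
 moreover have "(%n. of_rat (fps_nth (F * G) n) * y ^ n) sums (v * w)"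
  unfolding e using Cauchy_product_sums[OF s(1,2)] s(3,4) by simp
 ultimately show ?thesis by (simp add: fe_def)
qed

lemma fe_single: assumes "!!n. n ~= k ==> fps_nth F n = 0" shows "fe F y (of_rat (fps_nth F k) * y ^ k)"
proof -
 have "(%n. of_rat (fps_nth F n) * y ^ n) sums (SUM n:{k}. of_rat (fps_nth F n) * y ^ n)"
  by (rule sums_finite) (use assms in auto)
 moreover have "(%n. norm (of_rat (fps_nth F n) * y ^ n)) sums (SUM n:{k}. norm (of_rat (fps_nth F n) * y ^ n))"
  by (rule sums_finite) (use assms in auto)
 ultimately show ?thesis by (auto simp: fe_def sums_iff)
qed

lemma fe_const: "fe (fps_const c) y (of_rat c)" using fe_single[of 0 "fps_const c" y] by simp

lemma fe_X: "fe (fps_X ^ k) y (y ^ k)" using fe_single[of k "fps_X ^ k" y] by (simp add: fps_X_power_nth)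

lemma fe_1: "fe 1 y 1" using fe_const[of 1 y] by simp

lemma fe_sum: "(!!i. i : A ==> fe (f i) y (g i)) ==> fe (sum f A) y (sum g A)"
 using fe_const[of 0 y] by (induction A rule: infinite_finite_induct) (auto intro: fe_add)

lemma fe_prod: "(!!i. i : A ==> fe (f i) y (g i)) ==> fe (prod f A) y (prod g A)"
 by (induction A rule: infinite_finite_induct) (auto intro: fe_1 fe_mult)

lemma fe_diff: assumes "fe F y v" "fe G y w" shows "fe (F - G) y (v - w)"
proof -
 have "F - G = F + fps_const (- 1) * G" by (simp flip: fps_const_neg)
 moreover have "v - w = v + of_rat (- 1) * w" by (simp add: of_rat_minus)
 ultimately show ?thesis using fe_add[OF assms(1) fe_mult[OF fe_const assms(2), of "- 1"]] by (simp only:)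
qed

lemma fe_geo:
 assumes "k >= 1" "norm (of_rat q * y ^ k) < 1"
 shows "fe (geo q k) y (gi (of_rat q * y ^ k))"
proof -
 let ?f = "%n. of_rat (fps_nth (geo q k) n) * y ^ n"
 have c: "fps_nth (geo q k) (k * m) = q ^ m" for m
 proof -
  have "{s. s : UNIV & k * s = k * m} = {m}" using assms(1) by auto
  thus ?thesis unfolding gf_geo[OF assms(1), symmetric] gf_nth by simp
 qed
 have z: "?f n = 0" if "n ~: range (%m. k * m)" for n
 proof -
  have "{s. s : UNIV & k * s = n} = {}" using that by auto
  thus ?thesis unfolding gf_geo[OF assms(1), symmetric] gf_nth by simp
 qed
 have sm: "strict_mono (%m. k * m)" using assms(1) by (auto simp: strict_mono_def)
 have e: "?f (k * m) = (of_rat q * y ^ k) ^ m" for m by (simp add: c of_rat_power power_mult_distrib power_mult)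
 have "(%m. (of_rat q * y ^ k) ^ m) sums (1 / (1 - of_rat q * y ^ k))" by (rule geometric_sums[OF assms(2)])
 moreover have "(%m. ?f (k * m)) sums c \<longleftrightarrow> ?f sums c" for c by (rule sums_mono_reindex[OF sm]) (rule z)
 ultimately have "?f sums (gi (of_rat q * y ^ k))" unfolding e by (simp add: gi_def inverse_eq_divide)
 moreover have "summable (%m. norm ((of_rat q * y ^ k) ^ m))"
  using summable_geometric[of "norm (of_rat q * y ^ k)"] assms(2) by (simp add: norm_power norm_mult)
 moreover have "summable (%m. norm (?f (k * m))) \<longleftrightarrow> summable (%n. norm (?f n))"
  by (rule summable_mono_reindex[OF sm, of "%n. norm (?f n)"]) (unfold norm_eq_zero, rule z)
 ultimately show ?thesis unfolding e fe_def by blast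
qed

text \<open>Makes every geometric series in the formula converge in one region |y| < p^(-d-1), that
  is Re s > d + 1, a half-plane independent of p.\<close>

lemma monom_small:
 fixes y :: complex
 assumes p: "p >= 1" and y: "norm y < 1 / real p ^ (d + 1)" and k: "k >= 1" "i <= (d + 1) * k"
 shows "norm (of_nat p ^ i * y ^ k) < 1"
proof -
 have p0: "real p > 0" using p by simp
 have "real p ^ i <= real p ^ ((d + 1) * k)" using p k(2) by (intro power_increasing) auto
 hence "norm (of_nat p ^ i * y ^ k) <= real p ^ ((d + 1) * k) * norm y ^ k"
  by (simp add: norm_mult norm_power mult_right_mono)
 also have "... = (real p ^ (d + 1) * norm y) ^ k" by (simp only: power_mult power_mult_distrib)
 also have "... < 1"
 proof -
  have "real p ^ (d + 1) * norm y < 1" using y p0 by (simp add: field_simps)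
  moreover have "real p ^ (d + 1) * norm y >= 0" using p0 by simp
  ultimately show ?thesis using k(1) by (simp add: power_less_one_iff)
 qed
 finally show ?thesis .
qed

lemma adm_prime:
 assumes "p >= 1" "norm y < 1 / real p ^ (d + 1)" "y ~= 0" shows "adm d (of_nat p) (y :: complex)"
 unfolding adm_def using assms monom_small[OF assms(1,2)] by fastforce

lemma fe_geo_monom:
 assumes p: "p >= 1" and y: "norm y < 1 / real p ^ (d + 1)" and k: "k >= 1" "i <= (d + 1) * k"
 shows "fe (geo (of_nat p ^ i) k) y (gi (of_nat p ^ i * y ^ k))"
 using fe_geo[OF k(1), of "of_nat p ^ i" y] monom_small[OF assms] by (simp add: of_rat_power)

text \<open>The formal series and the field expressions have the same shape, so values are matched
  term by term; only the geometric series need convergence.\<close>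

lemma fe_Kg:
 assumes p: "p >= 1" and y: "norm y < 1 / real p ^ (d + 1)"
 shows "fe (Kg p (of_nat p ^ d) ms) y (Kf d ms (of_nat p) y)" "fe (Ug p (of_nat p ^ d) rh) y (Uf d rh (of_nat p) y)"
  "fe (geo (of_nat p ^ (2 * d)) (2 + r) * (PROD i<d. geo (of_nat p ^ i) 1)) y (Pf d r (of_nat p) y)"
proof -
 note G = fe_geo_monom[OF p y]
 let ?R = "Rc p (of_nat p ^ d)" and ?e = "%t. t + wk ms t"
 have pc: "fe (fps_const (of_nat p ^ i)) y (of_nat p ^ i)" for i using fe_const[of "of_nat p ^ i" y] by (simp add: of_rat_power)
 have R: "?R t = of_nat p ^ (t - 1 + d * t)" for t by (simp add: Rc_def power_add power_mult)
 have gR: "fe (geo (?R t) (?e t)) y (gi (Rm d ms t (of_nat p) y))" if "t >= 1" for t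
  unfolding R Rm_def by (rule G[OF _ exponent_bounds(1)]) (use that in simp)
 have mR: "fe (fps_const (?R t) * fps_X ^ ?e t) y (Rm d ms t (of_nat p) y)" for t
  unfolding R Rm_def by (intro fe_mult pc fe_X)
 have "of_nat p * of_nat p ^ d = (of_nat p ^ (1 + d) :: rat)" by simp
 hence gI: "fe (geo (of_nat p * of_nat p ^ d) (1 + rh)) y (gi (Rinf d rh (of_nat p) y))" for rh
  unfolding Rinf_def by (simp only:) (rule G[OF _ exponent_bounds(2)], simp)
 have S: "fe (Sg p (of_nat p ^ d) ms) y (Sf d ms (of_nat p) y)"
  unfolding Sg_def Sf_def Let_def by (intro fe_add fe_sum fe_mult[OF mR] fe_mult gR gI) auto
 have ip: "fe (fps_const (1 / of_nat p)) y (inverse (of_nat p))"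
  using fe_const[of "1 / of_nat p" y] by (simp add: of_rat_divide inverse_eq_divide)
 show "fe (Kg p (of_nat p ^ d) ms) y (Kf d ms (of_nat p) y)"
  unfolding Kg_def Kf_def by (intro fe_diff fe_mult fe_add ip S gI gR[of 1, simplified One_nat_def[symmetric]]) simp
 show "fe (Ug p (of_nat p ^ d) rh) y (Uf d rh (of_nat p) y)" unfolding Ug_def Uf_def by (intro fe_mult pc fe_X gI)
 have "fe (PROD i<d. geo (of_nat p ^ i) 1) y (PROD i<d. gi (of_nat p ^ i * y))"
 proof (rule fe_prod)
  fix i assume "i : {..<d}"
  thus "fe (geo (of_nat p ^ i) 1) y (gi (of_nat p ^ i * y))" using G[of 1 i] by simp
 qed
 moreover have "fe (geo (of_nat p ^ (2 * d)) (2 + r)) y (gi (of_nat p ^ (2 * d) * y ^ (2 + r)))"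
  by (rule G[OF _ exponent_bounds(3)]) simp
 ultimately show "fe (geo (of_nat p ^ (2 * d)) (2 + r) * (PROD i<d. geo (of_nat p ^ i) 1)) y (Pf d r (of_nat p) y)"
  unfolding Pf_def by (subst mult.commute) (rule fe_mult)
qed

section \<open>Points of the projective line over F_p\<close>

lemma inverse_mod_prime:
 assumes "prime p" "~ int p dvd x"
 obtains l where "l : {1..<int p}" "l * x mod int p = 1" "ALL y. l * (x * y mod int p) mod int p = y mod int p"
proof -
 have p1: "int p > 1" using prime_gt_1_nat[OF assms(1)] by simp
 have "prime (int p)" using assms(1) by simp
 from prime_imp_coprime[OF this assms(2)] have "coprime x (int p)" by (simp add: coprime_commute)
 then obtain u v where "u * x + v * int p = 1" using bezout_int by (metis coprime_imp_gcd_eq_1)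
 hence "(u * x + v * int p) mod int p = 1" using p1 by simp
 hence u: "u * x mod int p = 1" by simp
 let ?l = "u mod int p"
 have lx: "?l * x mod int p = 1" using u by (simp add: mod_mult_left_eq)
 have "?l ~= 0" using lx by auto
 moreover have "?l >= 0" "?l < int p" using p1 by simp_all
 ultimately have "?l : {1..<int p}" by simp
 moreover have "?l * (x * y mod int p) mod int p = y mod int p" for y
 proof -
  have "?l * (x * y mod int p) mod int p = (?l * x mod int p) * y mod int p"
   by (simp only: mod_mult_left_eq mod_mult_right_eq mult.assoc)
  thus ?thesis unfolding lx by simp
 qed
 ultimately show ?thesis using that lx by blast
qed

lemma equiv_proj_rel:
 assumes p: "prime p" shows "equiv (proj_reps p) (proj_rel p)"
proof (rule equivI)
 have p1: "int p > 1" using prime_gt_1_nat[OF p] by simp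
 have pp: "prime (int p)" using p by simp
 show "proj_rel p <= proj_reps p \<times> proj_reps p" by (auto simp: proj_rel_def)
 show "refl_on (proj_reps p) (proj_rel p)" unfolding refl_on_def
 proof (intro ballI; clarify)
  fix x y assume h: "(x, y) : proj_reps p"
  hence "x = 1 * x mod int p" "y = 1 * y mod int p" by (simp_all add: proj_reps_def)
  thus "((x, y), (x, y)) : proj_rel p" unfolding proj_rel_def using h p1 by (auto intro!: bexI[of _ 1])
 qed
 show "sym (proj_rel p)"
 proof (rule symI; clarify)
  fix x y x' y' assume h: "((x, y), (x', y')) : proj_rel p"
  then obtain l where l: "l : {1..<int p}" "x' = l * x mod int p" "y' = l * y mod int p" and
   r: "(x, y) : proj_reps p" "(x', y') : proj_reps p" by (auto simp: proj_rel_def)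
  have "~ int p dvd l" using l(1) by (auto dest: zdvd_imp_le)
  then obtain k where k: "k : {1..<int p}" "k * l mod int p = 1" "ALL z. k * (l * z mod int p) mod int p = z mod int p" using inverse_mod_prime[OF p] by blast
  have "x = k * x' mod int p" "y = k * y' mod int p" unfolding l(2,3) k(3)[rule_format] using r(1) by (auto simp: proj_reps_def)
  thus "((x', y'), (x, y)) : proj_rel p" unfolding proj_rel_def using r k(1) by auto
 qed
 show "trans (proj_rel p)"
 proof (rule transI; clarify)
  fix x y x' y' x'' y'' assume h: "((x, y), (x', y')) : proj_rel p" "((x', y'), (x'', y'')) : proj_rel p"
  then obtain l where l: "l : {1..<int p}" "x' = l * x mod int p" "y' = l * y mod int p" and
   r: "(x, y) : proj_reps p" by (auto simp: proj_rel_def)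
  from h obtain k where k: "k : {1..<int p}" "x'' = k * x' mod int p" "y'' = k * y' mod int p" and
   r': "(x'', y'') : proj_reps p" by (auto simp: proj_rel_def)
  have "~ int p dvd l" "~ int p dvd k" using l(1) k(1) by (auto dest: zdvd_imp_le)
  hence "~ int p dvd k * l" using pp by (simp add: prime_dvd_mult_iff)
  hence "k * l mod int p ~= 0" by (simp add: dvd_eq_mod_eq_0)
  moreover have "k * l mod int p >= 0" "k * l mod int p < int p" using p1 by simp_all
  ultimately have kl: "k * l mod int p : {1..<int p}" by simp
  have "x'' = (k * l mod int p) * x mod int p" "y'' = (k * l mod int p) * y mod int p"
   unfolding k l by (simp_all only: mod_mult_left_eq mod_mult_right_eq mult.assoc)
  thus "((x, y), (x'', y'')) : proj_rel p" unfolding proj_rel_def using r r' kl by auto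
 qed
qed

definition proj_pt :: "nat => int * int => (int * int) set" where "proj_pt p r = proj_rel p `` {r}"

text \<open>The usual representatives: (1,0), the point at infinity, and (t,1).\<close>

lemma bij_proj_line:
 assumes p: "prime p"
 shows "bij_betw (proj_pt p) (insert (1, 0) ((%t. (int t, 1)) ` {..<p})) (proj_line p)"
  "insert (1, 0) ((%t. (int t, 1)) ` {..<p}) <= proj_reps p"
proof -
 let ?Q = "insert (1 :: int, 0 :: int) ((%t. (int t, 1)) ` {..<p})"
 have p1: "int p > 1" using prime_gt_1_nat[OF p] by simp
 show Q: "?Q <= proj_reps p" using p1 by (auto simp: proj_reps_def)
 note E = equiv_proj_rel[OF p]
 show "bij_betw (proj_pt p) ?Q (proj_line p)" unfolding bij_betw_def
 proof (intro conjI inj_onI)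
  fix a b assume ab: "a : ?Q" "b : ?Q" "proj_pt p a = proj_pt p b"
  hence "(a, b) : proj_rel p" using eq_equiv_class[OF _ E, of a b] Q unfolding proj_pt_def by blast
  then obtain l where l: "l : {1..<int p}" "fst b = l * fst a mod int p" "snd b = l * snd a mod int p"
   by (auto simp: proj_rel_def)
  show "a = b"
  proof (cases "a = (1, 0)")
   case True
   hence "snd b = 0" using l(3) by simp
   thus ?thesis using ab(2) True by auto
  next
   case False
   then obtain t where t: "a = (int t, 1)" "t < p" using ab(1) by auto
   hence "snd b = l" using l(1,3) by simp
   hence "l = 1" "b ~= (1, 0)" using ab(2) l(1) by auto
   thus ?thesis using t l(2) ab(2) by auto
  qed
 next
  show "proj_pt p ` ?Q = proj_line p"
  proof (rule equalityI; rule subsetI)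
   fix P assume "P : proj_pt p ` ?Q"
   thus "P : proj_line p" using Q unfolding proj_line_def quotient_def proj_pt_def by blast
  next
   fix P assume "P : proj_line p"
   then obtain x y where xy: "(x, y) : proj_reps p" "P = proj_pt p (x, y)"
    unfolding proj_line_def quotient_def proj_pt_def by auto
   have "EX q:?Q. ((x, y), q) : proj_rel p"
   proof (cases "y = 0")
    case True
    hence "~ int p dvd x" using xy(1) by (auto simp: proj_reps_def dest: zdvd_imp_le)
    then obtain l where "l : {1..<int p}" "l * x mod int p = 1" using inverse_mod_prime[OF p] by blast
    hence "((x, y), (1, 0)) : proj_rel p" using xy(1) Q True unfolding proj_rel_def by force
    thus ?thesis by blast
   next
    case False
    hence "~ int p dvd y" using xy(1) by (auto simp: proj_reps_def dest: zdvd_imp_le)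
    then obtain l where l: "l : {1..<int p}" "l * y mod int p = 1" using inverse_mod_prime[OF p] by blast
    let ?t = "nat (l * x mod int p)"
    have t: "int ?t = l * x mod int p" "?t < p" using p1 by (simp_all add: nat_less_iff)
    have q: "(int ?t, 1) : ?Q" using t(2) by blast
    hence "(int ?t, 1) : proj_reps p" using Q by blast
    hence "((x, y), (int ?t, 1)) : proj_rel p" using xy(1) l t(1) unfolding proj_rel_def by force
    thus ?thesis using q by blast
   qed
   then obtain q where q: "q : ?Q" "((x, y), q) : proj_rel p" by blast
   have "P = proj_pt p q" unfolding xy(2) proj_pt_def by (rule equiv_class_eq[OF E q(2)])
   thus "P : proj_pt p ` ?Q" using q(1) by blast
  qed
 qed
qed

definition hom_form :: "int poly => int => int => int" where
 "hom_form f x y = (SUM k<=degree f. coeff f k * x ^ k * y ^ (degree f - k))"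

lemma hom_form_scale: "hom_form f (l * x) (l * y) = l ^ degree f * hom_form f x y"
 unfolding hom_form_def sum_distrib_left
proof (rule sum.cong[OF refl])
 fix k assume "k : {..degree f}"
 hence "l ^ degree f = l ^ k * l ^ (degree f - k)" by (simp flip: power_add)
 thus "coeff f k * (l * x) ^ k * (l * y) ^ (degree f - k) = l ^ degree f * (coeff f k * x ^ k * y ^ (degree f - k))"
  by (simp add: power_mult_distrib)
qed

lemma hom_form_mod: "hom_form f (x mod m) (y mod m) mod m = hom_form f x y mod m"
proof -
 have "coeff f k * (x mod m) ^ k * (y mod m) ^ j mod m = coeff f k * x ^ k * y ^ j mod m" for k j
  by (metis (no_types, opaque_lifting) mod_mult_eq power_mod)
 hence "(SUM k<=degree f. coeff f k * (x mod m) ^ k * (y mod m) ^ (degree f - k) mod m) mod m =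
   (SUM k<=degree f. coeff f k * x ^ k * y ^ (degree f - k) mod m) mod m" by simp
 thus ?thesis unfolding hom_form_def mod_sum_eq .
qed

text \<open>The homogenized form scales by a power of l along a point, so its vanishing can be
  tested at one representative.\<close>

lemma vanishes_at_pt:
 assumes p: "prime p" and r: "(a, b) : proj_reps p"
 shows "vanishes_mod p (rp f) (proj_pt p (a, b)) \<longleftrightarrow> int p dvd hom_form f a b"
proof -
 have p1: "int p > 1" using prime_gt_1_nat[OF p] by simp
 have "modular_inverse (int p) 1 = 1" using p1 by (intro modular_inverse_int_eqI) (simp_all add: cong_def)
 hence rm: "rat_mod p (of_int c) = c mod int p" for c by (simp add: rat_mod_def)
 have v: "(SUM k<=degree (rp f). rat_mod p (coeff (rp f) k) * x ^ k * y ^ (degree (rp f) - k)) mod int p = 0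
   \<longleftrightarrow> int p dvd hom_form f x y" for x y
 proof -
  have dg: "degree (rp f) = degree f" by (rule degree_map_poly) simp
  have "(SUM k<=degree f. (coeff f k mod int p) * x ^ k * y ^ (degree f - k)) mod int p =
   (SUM k<=degree f. (coeff f k mod int p) * x ^ k * y ^ (degree f - k) mod int p) mod int p" by (rule mod_sum_eq[symmetric])
  also have "... = (SUM k<=degree f. coeff f k * x ^ k * y ^ (degree f - k) mod int p) mod int p"
   by (simp only: mult.assoc mod_mult_left_eq)
  also have "... = hom_form f x y mod int p" unfolding hom_form_def by (rule mod_sum_eq)
  finally show ?thesis unfolding dg by (simp add: coeff_map_poly rm dvd_eq_mod_eq_0)
 qed
 have "(a, b) : proj_pt p (a, b)" unfolding proj_pt_def by (rule equiv_class_self[OF equiv_proj_rel[OF p] r])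
 moreover have "int p dvd hom_form f x y" if h: "(x, y) : proj_pt p (a, b)" "int p dvd hom_form f a b" for x y
 proof -
  obtain l where l: "x = l * a mod int p" "y = l * b mod int p" using h(1) by (auto simp: proj_pt_def proj_rel_def)
  have "hom_form f x y mod int p = l ^ degree f * hom_form f a b mod int p" unfolding l hom_form_mod hom_form_scale ..
  moreover have "int p dvd l ^ degree f * hom_form f a b" using h(2) by (rule dvd_mult)
  ultimately show ?thesis by (simp only: dvd_eq_mod_eq_0)
 qed
 ultimately show ?thesis unfolding vanishes_mod_def v by blast
qed

lemma hom_form_1: "hom_form f t 1 = poly f t" by (simp add: hom_form_def poly_altdef)

lemma hom_form_infinity: "hom_form f 1 0 = lead_coeff f"
proof -
 have "hom_form f 1 0 = (SUM k<=degree f. if k = degree f then lead_coeff f else 0)"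
  unfolding hom_form_def by (rule sum.cong) (auto simp: power_0_left)
 thus ?thesis by simp
qed

text \<open>The point counts group the points by the set of polynomials vanishing there. The
  isolated term g {} is the point at infinity, where the homogenized form takes the value of the
  leading coefficient, a unit modulo p.\<close>

theorem point_count_sum:
 fixes g :: "nat set => complex"
 assumes p: "prime p" and f: "!!i. i : {1..m} ==> f i = rp (F i)" "!!i. i : {1..m} ==> ~ int p dvd lead_coeff (F i)"
 shows "(SUM I:Pow {1..m}. of_nat (point_count p m f I) * g I) =
  g {} + (SUM t<p. g {i : {1..m}. int p dvd poly (F i) (int t)})"
proof -
 let ?Q = "insert (1 :: int, 0 :: int) ((%t. (int t, 1)) ` {..<p})"
 define J where "J P = {i : {1..m}. vanishes_mod p (f i) P}" for P
 note b = bij_proj_line[OF p]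
 have fin: "finite (proj_line p)" using bij_betw_finite[OF b(1)] by simp
 have pc: "of_nat (point_count p m f I) * g I = (\<Sum>P | P : proj_line p & J P = I. g (J P))" if "I : Pow {1..m}" for I
 proof -
  have "{P : proj_line p. ALL i:{1..m}. vanishes_mod p (f i) P \<longleftrightarrow> i : I} = {P. P : proj_line p & J P = I}"
   using that by (auto simp: J_def)
  thus ?thesis unfolding point_count_def by simp
 qed
 have "(SUM I:Pow {1..m}. of_nat (point_count p m f I) * g I) = (SUM I:Pow {1..m}. \<Sum>P | P : proj_line p & J P = I. g (J P))"
  by (rule sum.cong[OF refl pc])
 also have "... = (SUM P:proj_line p. g (J P))" by (rule sum.group[OF fin]) (auto simp: J_def)
 also have "... = (SUM q:?Q. g (J (proj_pt p q)))" by (rule sum.reindex_bij_betw[OF b(1), symmetric])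
 also have "... = g (J (proj_pt p (1, 0))) + (SUM q:(%t. (int t, 1)) ` {..<p}. g (J (proj_pt p q)))"
  by (rule sum.insert) auto
 also have "(SUM q:(%t. (int t, 1)) ` {..<p}. g (J (proj_pt p q))) = (SUM t<p. g (J (proj_pt p (int t, 1))))"
  by (subst sum.reindex) (auto simp: inj_on_def)
 also have "J (proj_pt p (1, 0)) = {}"
  using vanishes_at_pt[OF p, of 1 0] b(2) f by (auto simp: J_def hom_form_infinity)
 also have "(SUM t<p. g (J (proj_pt p (int t, 1)))) = (SUM t<p. g {i : {1..m}. int p dvd poly (F i) (int t)})"
 proof (rule sum.cong[OF refl])
  fix t assume "t : {..<p}"
  hence "(int t, 1) : proj_reps p" using b(2) by blast
  hence "J (proj_pt p (int t, 1)) = {i : {1..m}. int p dvd poly (F i) (int t)}"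
   using vanishes_at_pt[OF p, of "int t" 1] f(1) by (auto simp: J_def hom_form_1)
  thus "g (J (proj_pt p (int t, 1))) = g {i : {1..m}. int p dvd poly (F i) (int t)}" by simp
 qed
 finally show ?thesis .
qed

section \<open>Finite uniformity\<close>

lemma root_count_le_degree:
 assumes p: "prime p" and f: "~ int p dvd lead_coeff f"
 shows "root_count p f <= degree f" using f
proof (induction "degree f" arbitrary: f)
 case 0
 then obtain c where "f = [:c:]" by (metis degree_eq_zeroE)
 thus ?case using 0 by (simp add: root_count_def)
next
 case (Suc n)
 show ?case
 proof (cases "EX a<p. int p dvd poly f (int a)")
  case False
  hence "{z : {..<p}. int p dvd poly f (int z)} = {}" by blast
  thus ?thesis unfolding root_count_def by (simp only: card.empty)
 next
  case True
  then obtain a where a: "a < p" "int p dvd poly f (int a)" by blast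
  define q where "q = synthetic_div f (int a)"
  have fq: "f = [:- int a, 1:] * q + [:poly f (int a):]" unfolding q_def by (rule synthetic_div_correct'[symmetric])
  have dq: "n = degree q" using Suc(2) by (simp add: q_def degree_synthetic_div)
  have "coeff f (Suc n) = coeff ([:- int a, 1:] * q + [:poly f (int a):]) (Suc n)" by (rule arg_cong[OF fq])
  also have "... = coeff q n" using dq by (simp add: coeff_eq_0)
  finally have "~ int p dvd lead_coeff q" using Suc(2,3) dq by simp
  from Suc(1)[OF dq this] have le: "root_count p q <= n" using dq by simp
  have "{z : {..<p}. int p dvd poly f (int z)} <= insert a {z : {..<p}. int p dvd poly q (int z)}"
  proof
   fix z assume z: "z : {z : {..<p}. int p dvd poly f (int z)}"
   have "poly f (int z) = (int z - int a) * poly q (int z) + poly f (int a)" by (subst fq) (simp add: algebra_simps)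
   hence "int p dvd (int z - int a) * poly q (int z)" using z a(2) by (metis (no_types, lifting) dvd_add_left_iff mem_Collect_eq)
   hence "int p dvd int z - int a | int p dvd poly q (int z)" using p by (simp add: prime_dvd_mult_iff)
   moreover have "z = a" if "int p dvd int z - int a"
   proof -
    have "int z mod int p = int a mod int p" using that by (simp add: mod_eq_dvd_iff)
    thus ?thesis using z a(1) by simp
   qed
   ultimately show "z : insert a {z : {..<p}. int p dvd poly q (int z)}" using z by blast
  qed
  hence "root_count p f <= card (insert a {z : {..<p}. int p dvd poly q (int z)})"
   unfolding root_count_def by (intro card_mono) auto
  also have "... <= Suc (root_count p q)" unfolding root_count_def by (rule card_insert_le_m1) auto
  finally show ?thesis using Suc(2) le by simp
 qed
qed

text \<open>The expansion of 1/Q has positive radius of convergence; inside it the power series and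
  the rational function agree. V involves only the outer variable, so x is arbitrary.\<close>

lemma ratl_fe:
 assumes "ratl F"
 shows "EX V R. R > 0 & (ALL x y. norm y < R --> (EX v. fe F y v & rf_val V x y v))"
proof -
 obtain P Q where PQ: "coeff Q 0 ~= 0" "F * fps_of_poly Q = fps_of_poly P" using assms unfolding ratl_def by blast
 define c where "c A = (map_poly of_rat A :: complex poly)" for A :: "rat poly"
 define k where "k A = map_poly (%c. [:c:]) A" for A :: "rat poly"
 have kc: "poly2_eval (k A) x y = poly (c A) y" for A x y
  unfolding poly2_eval_def k_def c_def by (subst map_poly_map_poly) (simp_all add: o_def map_poly_pCons)
 define C where "C = Abs_fps (%n. complex_of_rat (fps_nth F n))"
 have CQ: "C * fps_of_poly (c Q) = fps_of_poly (c P)"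
 proof (rule fps_ext)
  fix n
  have "fps_nth (F * fps_of_poly Q) n = coeff P n" unfolding PQ(2) by simp
  hence "complex_of_rat (\<Sum>i=0..n. fps_nth F i * coeff Q (n - i)) = of_rat (coeff P n)" by (simp add: fps_mult_nth)
  thus "fps_nth (C * fps_of_poly (c Q)) n = fps_nth (fps_of_poly (c P)) n"
   by (simp add: fps_mult_nth C_def c_def coeff_map_poly of_rat_sum of_rat_mult)
 qed
 have Q0: "fps_nth (fps_of_poly (c Q)) 0 ~= 0" using PQ(1) by (simp add: c_def coeff_map_poly)
 define I where "I = inverse (fps_of_poly (c Q))"
 have IQ: "I * fps_of_poly (c Q) = 1" unfolding I_def by (rule inverse_mult_eq_1[OF Q0])
 have CI: "C = fps_of_poly (c P) * I"
  unfolding CQ[symmetric] mult.assoc mult.commute[of "fps_of_poly (c Q)"] IQ by simp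
 have rI: "fps_conv_radius I > 0" unfolding I_def by (rule fps_conv_radius_inverse_pos[OF Q0]) simp
 have rC: "fps_conv_radius C >= fps_conv_radius I" unfolding CI using fps_conv_radius_mult[of "fps_of_poly (c P)" I] by simp
 obtain R where R: "ereal 0 < ereal R" "ereal R < fps_conv_radius I" using ereal_dense2[of 0 "fps_conv_radius I"] rI by (auto simp: zero_ereal_def)
 have "EX v. fe F y v & rf_val (Fract (k P) (k Q)) x y v" if y: "norm y < R" for x y
 proof -
  have yI: "ereal (norm y) < fps_conv_radius I" using y R(2) by (meson ereal_less(2) less_ereal.simps(1) less_trans)
  hence yC: "ereal (norm y) < fps_conv_radius C" using rC by (rule less_le_trans)
  have "eval_fps I y * poly (c Q) y = eval_fps (I * fps_of_poly (c Q)) y" using yI by (simp add: eval_fps_mult)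
  hence q: "poly (c Q) y ~= 0" unfolding IQ by auto
  have "eval_fps C y * poly (c Q) y = eval_fps (C * fps_of_poly (c Q)) y" using yC by (simp add: eval_fps_mult)
  hence "eval_fps C y = poly (c P) y / poly (c Q) y" unfolding CQ using q by (simp add: field_simps)
  moreover have "fe F y (eval_fps C y)"
   using norm_summable_fps[OF yC] sums_eval_fps[OF yC] by (simp add: fe_def C_def)
  moreover have "rf_val (Fract (k P) (k Q)) x y (poly (c P) y / poly (c Q) y)"
   using rf_val_Fract[of "k Q" x y "k P"] q by (simp add: kc)
  ultimately show ?thesis by metis
 qed
 hence "ALL x y. norm y < R --> (EX v. fe F y v & rf_val (Fract (k P) (k Q)) x y v)" by blast
 moreover have "R > 0" using R(1) by simp
 ultimately show ?thesis by blast
qed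

lemma ratl_prod: "(!!i. i : A ==> ratl (f i)) ==> ratl (prod f A)"
 by (induction A rule: infinite_finite_induct) (auto intro: ratl_mult)

lemma powr_power: "p > 0 ==> of_nat p powr (- (of_nat n * s)) = (of_nat p powr (- s)) ^ n" for s :: complex
 by (simp add: powr_def mult.assoc flip: exp_of_nat_mult)

lemma norm_prime_powr: "p > 0 ==> norm (of_nat p powr (- s)) = real p powr (- Re s)" for s :: complex
 by (subst norm_powr_real_powr) simp_all

lemma local_zeta_fe:
 assumes p: "p > 0" and fe: "fe (Abs_fps (%n. of_nat (normal_count G (p ^ n)))) (of_nat p powr (- s)) v"
 shows "summable (local_normal_zeta_term G p s)" "local_normal_zeta G p s = v"
proof -
 have "local_normal_zeta_term G p s = (%n. of_rat (of_nat (normal_count G (p ^ n))) * (of_nat p powr (- s)) ^ n)"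
  by (rule ext) (simp add: local_normal_zeta_term_def powr_power[OF p])
 hence "local_normal_zeta_term G p s sums v" using fe by (simp add: fe_def)
 thus "summable (local_normal_zeta_term G p s)" "local_normal_zeta G p s = v"
  unfolding local_normal_zeta_def by (simp_all add: sums_iff)
qed

text \<open>Enumerates a finite set of candidate functions and passes from power series to the
  Dirichlet series in p^(-s).\<close>

lemma finitely_uniformI:
 assumes fin: "finite VV" and VV: "!!p. prime p ==> EX V:VV. ALL s. Re s > sm --> (EX v.
  fe (Abs_fps (%n. of_nat (normal_count G (p ^ n)))) (of_nat p powr (- s)) v & rf_val V (of_nat p) (of_nat p powr (- s)) v)"
 shows "finitely_uniform G"
proof -
 obtain h where h: "bij_betw h {1..card VV} VV" using ex_bij_betw_nat_finite_1[OF fin] by blast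
 have "EX k:{1..card VV}. ALL s. Re s > sm --> summable (local_normal_zeta_term G p s) & rf_regular (h k) (of_nat p) (of_nat p powr (- s))
  & local_normal_zeta G p s = rf_eval (h k) (of_nat p) (of_nat p powr (- s))" if p: "prime p" for p
 proof -
  obtain V where V: "V : VV" "!!s. Re s > sm ==> EX v. fe (Abs_fps (%n. of_nat (normal_count G (p ^ n)))) (of_nat p powr (- s)) v
    & rf_val V (of_nat p) (of_nat p powr (- s)) v" using VV[OF p] by blast
  obtain k where k: "k : {1..card VV}" "V = h k" using V(1) h unfolding bij_betw_def by blast
  have "summable (local_normal_zeta_term G p s) & rf_regular (h k) (of_nat p) (of_nat p powr (- s))
   & local_normal_zeta G p s = rf_eval (h k) (of_nat p) (of_nat p powr (- s))" if s: "Re s > sm" for s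
  proof -
   obtain v where v: "fe (Abs_fps (%n. of_nat (normal_count G (p ^ n)))) (of_nat p powr (- s)) v"
     "rf_val (h k) (of_nat p) (of_nat p powr (- s)) v" using V(2)[OF s] k(2) by blast
   show ?thesis using local_zeta_fe[OF prime_gt_0_nat[OF p] v(1)] rf_valD[OF v(2)] by simp
  qed
  thus ?thesis using k(1) by blast
 qed
 thus ?thesis unfolding finitely_uniform_def by blast
qed

section \<open>Assembly\<close>

lemma (in central_ext) Lat_basis:
 obtains r l where "lat_basis Lat r l" "(ALL x:Zd d. Ph x = 0 --> x = 0) --> r = d"
proof (cases "ALL x:Zd d. Ph x = 0 --> x = 0")
 case True
 let ?b = "%i. Ph (ev i)"
 have z: "0 : Zd d" by (rule addsub_zero[OF addsub_Zd])
 have "comb d ?b 0 = Ph 0" using comb_diff[of d ?b 0 0] Ph_diff[OF z z] by (simp only: diff_self)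
 hence "addsub {x : Zd d. comb d ?b x = Ph x}"
  using addsub_diff[OF addsub_Zd] z by (simp add: addsub_def comb_diff Ph_diff)
 hence "Zd d <= {x : Zd d. comb d ?b x = Ph x}" by (rule Zd_generated) (simp add: ev_Zd comb_ev)
 hence c: "comb d ?b x = Ph x" if "x : Zd d" for x using that by blast
 have "inj_on Ph (Zd d)"
 proof (rule inj_onI)
  fix x y assume xy: "x : Zd d" "y : Zd d" "Ph x = Ph y"
  hence "Ph (x - y) = 0" using Ph_diff[of x y] by simp
  hence "x - y = 0" using True addsub_diff[OF addsub_Zd xy(1,2)] by blast
  thus "x = y" by simp
 qed
 hence "bij_betw Ph (Zd d) Lat" unfolding bij_betw_def Lat_def by blast
 hence "lat_basis Lat d (%i. Ph (ev i))" unfolding lat_basis_def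
  using bij_betw_cong[where A = "Zd d" and A' = Lat and f = "comb d (%i. Ph (ev i))" and g = Ph, OF c] by blast
 thus ?thesis using that by blast
next
 case False
 obtain r l where "lat_basis Lat r l" by (rule lat_basis_exists[OF addsub_Lat])
 thus ?thesis using that False by blast
qed

text \<open>A weight that is constant plus additive over the vanishing polynomials sees only the
  number p + 1 of points and the root counts.\<close>

lemma sum_over_points:
 fixes w :: complex
 assumes p: "prime p" and f: "!!i. i : {1..m} ==> f i = rp (F i)" "!!i. i : {1..m} ==> ~ int p dvd lead_coeff (F i)"
 shows "(SUM I:Pow {1..m}. of_nat (point_count p m f I) * (w + (SUM i:I. k i))) =
  (of_nat p + 1) * w + (SUM i:{1..m}. of_nat (root_count p (F i)) * k i)"
proof -
 have "(SUM t<p. SUM i:{i : {1..m}. int p dvd poly (F i) (int t)}. k i) = (SUM t<p. SUM i:{1..m}. if int p dvd poly (F i) (int t) then k i else 0)"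
  by (intro sum.cong refl sum.inter_filter) simp
 also have "... = (SUM i:{1..m}. SUM t<p. if int p dvd poly (F i) (int t) then k i else 0)" by (rule sum.swap)
 also have "... = (SUM i:{1..m}. of_nat (root_count p (F i)) * k i)"
 proof (rule sum.cong[OF refl])
  fix i
  have "(SUM t<p. if int p dvd poly (F i) (int t) then k i else 0) = (SUM t:{t : {..<p}. int p dvd poly (F i) (int t)}. k i)"
   by (rule sum.inter_filter[symmetric]) simp
  thus "(SUM t<p. if int p dvd poly (F i) (int t) then k i else 0) = of_nat (root_count p (F i)) * k i"
   by (simp add: root_count_def)
 qed
 finally have t: "(SUM t<p. SUM i:{i : {1..m}. int p dvd poly (F i) (int t)}. k i) = (SUM i:{1..m}. of_nat (root_count p (F i)) * k i)" .
 have "(SUM I:Pow {1..m}. of_nat (point_count p m f I) * (w + (SUM i:I. k i))) =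
   (w + (SUM i:{}. k i)) + (SUM t<p. w + (SUM i:{i : {1..m}. int p dvd poly (F i) (int t)}. k i))"
  by (rule point_count_sum[OF p]) (use f in auto)
 thus ?thesis unfolding sum.distrib t by (simp add: algebra_simps)
qed

lemma choose_two_shift: "(d + 2) choose 2 = 2 * d + d * (d - 1) div 2 + 1"
proof -
 have "(d + 2) * (d + 2 - 1) = d * (d - 1) + 2 * (2 * d + 1)" by (cases d) (simp_all add: algebra_simps)
 thus ?thesis by (simp add: choose_two)
qed

text \<open>The bracket of \<open>Xg\<close>, with the root counts n left as parameters.\<close>

definition Ef :: "nat => nat => nat list => int poly set => (int poly => nat list) => (int poly => nat) => 'a::field => 'a => 'a" where
 "Ef d rh msI Fs ms n x y = 1 + (x + 1) * Uf d rh x y + Kf d msI x y + (SUM f:Fs. of_nat (n f) * Kf d (ms f) x y)"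

text \<open>The share of a point at which no f vanishes. Division by x + 1 distributes the terms of
  level 0 and of the point at infinity evenly over the p + 1 points.\<close>

definition Wf :: "nat => nat => nat => nat list => 'a::field => 'a => 'a" where
 "Wf d r rh msI x y = Pf d r x y * ((1 + Kf d msI x y) * inverse (x + 1) + Uf d rh x y)"

definition kf :: "nat => nat => nat list => 'a::field => 'a => 'a" where
 "kf d r ms x y = Pf d r x y * Kf d ms x y"

theorem theorem2:
  fixes G :: "('a, 'b) monoid_scheme" and d :: nat
  assumes "T_group G"
    and "nilpotency_class G 2"
    and "has_hirsch_length (G\<lparr>carrier := derived G (carrier G)\<rparr>) 2"
    and "has_hirsch_length (G Mod derived G (carrier G)) d"
  shows "(\<exists>(m::nat) (f :: nat \<Rightarrow> rat poly) (W :: nat set \<Rightarrow> rat_fun2) (\<sigma>::real).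
            (\<forall>i \<in> {1..m}. irreducible (f i))
          \<and> (\<forall>\<^sub>\<infinity>p::nat. prime p \<longrightarrow> (\<forall>s::complex. Re s > \<sigma> \<longrightarrow>
                summable (local_normal_zeta_term G p s)
              \<and> (\<forall>I \<in> Pow {1..m}. rf_regular (W I) (of_nat p) (of_nat p powr (- s)))
              \<and> local_normal_zeta G p s = uniform_sum m f W p s))
          \<and> (has_hirsch_length (G\<lparr>carrier := center G\<rparr>) 2 \<longrightarrow>
              (\<forall>\<^sub>\<infinity>p::nat. prime p \<longrightarrow> (\<forall>s::complex. Re s > \<sigma> \<longrightarrow>
                (\<forall>I \<in> Pow {1..m}. rf_regular (W I) (inverse (of_nat p)) (of_nat p powr s))
              \<and> uniform_sum_inverted m f W p s =
                  (- 1) ^ (d + 2)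
                  * of_nat p powr (of_nat ((d + 2) choose 2) - of_nat (2 * d + 2) * s)
                  * local_normal_zeta G p s))))
       \<and> finitely_uniform G"
proof -
 have "group G" using assms(1) by (simp add: T_group_def)
 then obtain pj io where "central_ext G pj io d" using group.central_ext_exists[OF _ assms] by blast
 then interpret central_ext G pj io d .
 have tf: "x = \<one>\<^bsub>G\<^esub>" if "x : carrier G" "0 < n" "x [^]\<^bsub>G\<^esub> n = \<one>\<^bsub>G\<^esub>" for x and n :: nat
  using assms(1) that unfolding T_group_def by blast
 define NF where "NF p = Abs_fps (%n. rat_of_nat (normal_count G (p ^ n)))" for p
 have NF: "NF p = Xi d Lat p * (PROD i<d. geo (of_nat p ^ i) 1)" if "prime p" for p
  unfolding NF_def by (rule normal_count_gf[OF that])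
 obtain r l where l: "lat_basis Lat r l" and rd: "(ALL x:Zd d. Ph x = 0 --> x = 0) --> r = d" by (rule Lat_basis)
 obtain Fs N rh msI ms where Fs: "finite Fs" "ALL f:Fs. irreducible (rp f)"
  and lc0: "ALL p. prime p --> p > N --> (ALL f:Fs. ~ int p dvd lead_coeff f)"
  and Xi0: "ALL p. prime p --> p > N --> Xi d Lat p = Xg d r rh msI Fs ms p" by (rule Xi_good[OF addsub_Lat l])
 have lc: "~ int p dvd lead_coeff f" if "prime p" "p > N" "f : Fs" for p f using lc0 that by blast
 note Xi = Xi0[rule_format]
 have good: "fe (NF p) y (Pf d r (of_nat p) y * Ef d rh msI Fs ms (root_count p) (of_nat p) y)"
  if p: "prime p" "p > N" and y: "norm y < 1 / real p ^ (d + 1)" for p y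
 proof -
  have p1: "p >= 1" using prime_gt_0_nat[OF p(1)] by simp
  note K = fe_Kg[OF p1 y]
  have c: "fe (fps_const (of_nat k)) y (of_nat k)" for k using fe_const[of "of_nat k" y] by simp
  have "of_nat p + 1 = (of_nat (p + 1) :: rat)" "of_nat p + 1 = (of_nat (p + 1) :: complex)" by simp_all
  hence c1: "fe (fps_const (of_nat p + 1)) y (of_nat p + 1)" using c[of "p + 1"] by (simp only:)
  have "fe (1 + fps_const (of_nat p + 1) * Ug p (of_nat p ^ d) rh + Kg p (of_nat p ^ d) msI
     + (SUM f:Fs. fps_const (of_nat (root_count p f)) * Kg p (of_nat p ^ d) (ms f))) y (Ef d rh msI Fs ms (root_count p) (of_nat p) y)"
   unfolding Ef_def by (intro fe_add fe_sum fe_mult fe_1 c c1 K)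
  from fe_mult[OF K(3)[of r] this] show ?thesis unfolding NF[OF p(1)] Xi[OF p] Xg_def by (simp only: ac_simps)
 qed
 have pt: "norm (of_nat p powr (- s)) < 1 / real p ^ (d + 1)" "of_nat p powr (- s) ~= 0" "adm d (of_nat p) (of_nat p powr (- s))"
  if p: "prime p" and s: "Re s > real (d + 1)" for p and s :: complex
 proof -
  have p1: "real p > 1" "p > 0" "p >= 1" using prime_gt_1_nat[OF p] by simp_all
  have "real p powr (- Re s) < real p powr (- real (d + 1))" using s p1(1) by (intro powr_less_mono) auto
  also have "... = 1 / real p ^ (d + 1)" using p1(2) by (simp only: powr_minus powr_realpow of_nat_0_less_iff inverse_eq_divide)
  finally show 1: "norm (of_nat p powr (- s)) < 1 / real p ^ (d + 1)" unfolding norm_prime_powr[OF p1(2)] .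
  show 2: "of_nat p powr (- s) ~= 0" using p1(2) by simp
  show "adm d (of_nat p) (of_nat p powr (- s))" by (rule adm_prime[OF p1(3) 1 2])
 qed
 define m where "m = card Fs"
 obtain fi where phi: "bij_betw fi {1..m} Fs" using ex_bij_betw_nat_finite_1[OF Fs(1)] unfolding m_def by blast
 have phiF: "fi i : Fs" if "i : {1..m}" for i using phi that unfolding bij_betw_def by blast
 define f where "f i = rp (fi i)" for i
 \<comment> \<open>Additive in I, so that \<open>sum_over_points\<close> turns the sum over subsets
   into root counts.\<close>
 define W where "W I = Wf d r rh msI RX RY + (SUM i:I. kf d r (ms (fi i)) RX RY)" for I
 have kval: "rf_val (kf d r (ms (fi i)) RX RY) x y (kf d r (ms (fi i)) x y)" if "adm d x y" for i x y
  unfolding kf_def by (intro rf_val_mult rf_val_Kf that)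
 have Wval: "rf_val (W I) x y (Wf d r rh msI x y + (SUM i:I. kf d r (ms (fi i)) x y))" if "adm d x y" "x + 1 ~= 0" for I x y
  unfolding W_def Wf_def by (intro rf_val_add rf_val_sum rf_val_mult rf_val_Kf rf_val_1 rf_val_X rf_val_inverse kval that)
 \<comment> \<open>The common part \<open>Wf\<close>, with its denominator x + 1, cancels in the
   difference.\<close>
 have Wdiff: "rf_val (W I - W {}) x y (SUM i:I. kf d r (ms (fi i)) x y)" if "adm d x y" for I x y
  unfolding W_def using rf_val_sum[of I "%i. kf d r (ms (fi i)) RX RY", OF kval[OF that]] by simp
 have wE: "(x + 1) * Wf d r rh msI x y + (SUM i:{1..m}. of_nat (n (fi i)) * kf d r (ms (fi i)) x y) = Pf d r x y * Ef d rh msI Fs ms n x y"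
  if "x + 1 ~= 0" for n and x y :: complex
 proof -
  have "(SUM g:Fs. of_nat (n g) * Kf d (ms g) x y) = (SUM i:{1..m}. of_nat (n (fi i)) * Kf d (ms (fi i)) x y)"
   by (rule sum.reindex_bij_betw[OF phi, symmetric])
  hence "Pf d r x y * (SUM g:Fs. of_nat (n g) * Kf d (ms g) x y) = (SUM i:{1..m}. of_nat (n (fi i)) * kf d r (ms (fi i)) x y)"
   by (simp add: sum_distrib_left kf_def mult.left_commute)
  moreover have "(x + 1) * Wf d r rh msI x y = Pf d r x y * (1 + (x + 1) * Uf d rh x y + Kf d msI x y)"
  proof -
   have "(x + 1) * Wf d r rh msI x y = Pf d r x y * ((1 + Kf d msI x y) * ((x + 1) * inverse (x + 1)) + (x + 1) * Uf d rh x y)"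
    unfolding Wf_def by (simp only: distrib_left distrib_right ac_simps)
   thus ?thesis using that by (simp add: ac_simps)
  qed
  ultimately show ?thesis unfolding Ef_def by (simp add: distrib_left)
 qed
 have x1: "of_nat p + 1 ~= (0 :: complex)" "inverse (of_nat p) + 1 ~= (0 :: complex)" if "prime p" for p
 proof -
  have e: "of_nat p + 1 = complex_of_real (real p + 1)" "inverse (of_nat p) + 1 = complex_of_real (inverse (real p) + 1)" by simp_all
  show "of_nat p + 1 ~= (0 :: complex)" "inverse (of_nat p) + 1 ~= (0 :: complex)"
   unfolding e of_real_eq_0_iff by (simp_all add: add_nonneg_eq_0_iff)
 qed
 have zeta: "summable (local_normal_zeta_term G p s)" "local_normal_zeta G p s = Pf d r (of_nat p) (of_nat p powr (- s)) * Ef d rh msI Fs ms (root_count p) (of_nat p) (of_nat p powr (- s))"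
  if "prime p" "p > N" "Re s > real (d + 1)" for p s
  using local_zeta_fe[OF prime_gt_0_nat[OF that(1)] good[OF that(1,2) pt(1)[OF that(1,3)], unfolded NF_def]] by blast+
 have fs: "f i = rp (fi i)" for i by (rule f_def)
 have main: "summable (local_normal_zeta_term G p s) & (ALL I:Pow {1..m}. rf_regular (W I) (of_nat p) (of_nat p powr (- s)))
   & local_normal_zeta G p s = uniform_sum m f W p s" if p: "prime p" "p > N" and s: "Re s > real (d + 1)" for p s
 proof -
  let ?x = "of_nat p :: complex" and ?y = "of_nat p powr (- s) :: complex"
  note v = Wval[OF pt(3)[OF p(1) s] x1(1)[OF p(1)]]
  have "uniform_sum m f W p s = (SUM I:Pow {1..m}. of_nat (point_count p m f I) * (Wf d r rh msI ?x ?y + (SUM i:I. kf d r (ms (fi i)) ?x ?y)))"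
   unfolding uniform_sum_def rf_valD(2)[OF v] ..
  also have "... = (?x + 1) * Wf d r rh msI ?x ?y + (SUM i:{1..m}. of_nat (root_count p (fi i)) * kf d r (ms (fi i)) ?x ?y)"
   by (rule sum_over_points[OF p(1) fs lc[OF p phiF]])
  also have "... = local_normal_zeta G p s" unfolding zeta(2)[OF p s] by (rule wE[OF x1(1)[OF p(1)]])
  finally show ?thesis using zeta(1)[OF p s] rf_valD(1)[OF v] by simp
 qed
 have inverted: "(ALL I:Pow {1..m}. rf_regular (W I) (inverse (of_nat p)) (of_nat p powr s))
   & uniform_sum_inverted m f W p s = (- 1) ^ (d + 2) * of_nat p powr (of_nat ((d + 2) choose 2) - of_nat (2 * d + 2) * s) * local_normal_zeta G p s"
  if hZ: "has_hirsch_length (G(|carrier := center G|)) 2" and p: "prime p" "p > N" and s: "Re s > real (d + 1)" for p s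
 proof -
  \<comment> \<open>A centre of Hirsch length 2 makes \<open>Ph\<close> injective, so
    \<open>Lat\<close> has rank d; with r = d the factor \<open>Pf\<close> produces the exponent 2 d
    + 2 of p^(-s).\<close>
  have "x = 0" if "x : Zd d" "Ph x = 0" for x by (rule Ph_injective[OF _ hZ that]) (rule tf)
  hence r: "r = d" using rd by blast
  let ?x = "of_nat p :: complex" and ?y = "of_nat p powr (- s) :: complex"
  have p0: "?x ~= 0" using prime_gt_0_nat[OF p(1)] by simp
  have ys: "of_nat p powr s = inverse ?y" by (simp add: powr_minus)
  note a = pt(3)[OF p(1) s]
  note a' = adm_inverse[OF a]
  note v = Wval[OF a' x1(2)[OF p(1)]]
  have "uniform_sum_inverted m f W p s = (inverse ?x + 1) * Wf d r rh msI (inverse ?x) (inverse ?y)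
    + (SUM I:Pow {1..m} - {{}}. of_nat (point_count p m f I) * (SUM i:I. kf d r (ms (fi i)) (inverse ?x) (inverse ?y)))"
   unfolding uniform_sum_inverted_def ys rf_valD(2)[OF Wdiff[OF a']] using rf_valD(2)[OF v, of "{}"] by simp
  also have "(SUM I:Pow {1..m} - {{}}. of_nat (point_count p m f I) * (SUM i:I. kf d r (ms (fi i)) (inverse ?x) (inverse ?y))) =
    (SUM I:Pow {1..m}. of_nat (point_count p m f I) * (0 + (SUM i:I. kf d r (ms (fi i)) (inverse ?x) (inverse ?y))))"
   \<comment> \<open>The empty set contributes an empty sum. Including it allows
     \<open>sum_over_points\<close> with constant part 0, so the root counts stay uninverted and
     only the factor x + 1 of \<open>Wf\<close> is inverted.\<close>
   by (rule sum.mono_neutral_cong_left) auto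
  also have "... = (?x + 1) * 0 + (SUM i:{1..m}. of_nat (root_count p (fi i)) * kf d r (ms (fi i)) (inverse ?x) (inverse ?y))"
   by (rule sum_over_points[OF p(1) fs lc[OF p phiF]])
  also have "(inverse ?x + 1) * Wf d r rh msI (inverse ?x) (inverse ?y) + ... =
    Pf d d (inverse ?x) (inverse ?y) * Ef d rh msI Fs ms (root_count p) (inverse ?x) (inverse ?y)"
   using wE[OF x1(2)[OF p(1)], of "inverse ?y" "root_count p"] unfolding r by simp
  also have "Ef d rh msI Fs ms (root_count p) (inverse ?x) (inverse ?y) = - ?x * Ef d rh msI Fs ms (root_count p) ?x ?y"
  proof -
   have "(SUM g:Fs. of_nat (root_count p g) * (- ?x * Kf d (ms g) ?x ?y)) = - ?x * (SUM g:Fs. of_nat (root_count p g) * Kf d (ms g) ?x ?y)"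
    by (simp only: sum_distrib_left mult.left_commute)
   thus ?thesis unfolding Ef_def Uf_inverse[OF a] Kf_inverse[OF a] by (simp only: distrib_left)
  qed
  also have "Pf d d (inverse ?x) (inverse ?y) * (- ?x * Ef d rh msI Fs ms (root_count p) ?x ?y) =
    (- 1) ^ (d + 2) * (?x ^ ((d + 2) choose 2) * ?y ^ (2 * d + 2)) * (Pf d d ?x ?y * Ef d rh msI Fs ms (root_count p) ?x ?y)"
  proof -
   have "(- 1) ^ (d + 2) = ((- 1) ^ d :: complex)" by simp
   moreover have "?x ^ ((d + 2) choose 2) = ?x ^ (2 * d + d * (d - 1) div 2) * ?x" unfolding choose_two_shift by simp
   ultimately show ?thesis unfolding Pf_inverse[OF a] by (simp only: mult_minus_left mult_minus_right minus_minus ac_simps)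
  qed
  also have "?x ^ ((d + 2) choose 2) * ?y ^ (2 * d + 2) = of_nat p powr (of_nat ((d + 2) choose 2) - of_nat (2 * d + 2) * s)"
   using powr_power[OF prime_gt_0_nat[OF p(1)], of "2 * d + 2" s] p0
   by (simp only: diff_conv_add_uminus powr_add powr_nat if_False)
  also have "Pf d d ?x ?y * Ef d rh msI Fs ms (root_count p) ?x ?y = local_normal_zeta G p s" unfolding zeta(2)[OF p s] r ..
  finally show ?thesis using rf_valD(1)[OF v] unfolding ys by simp
 qed
 have 3: "ALL i:{1..m}. irreducible (f i)" using Fs(2) phiF unfolding f_def by blast
 have fu: "finitely_uniform G"
 proof -
  \<comment> \<open>With the root counts as a parameter n, the same rational function serves all
    large primes with these counts.\<close>
  define V where "V n = Pf d r RX RY * Ef d rh msI Fs ms n RX RY" for n :: "int poly => nat"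
  have Vval: "rf_val (V n) x y (Pf d r x y * Ef d rh msI Fs ms n x y)" if "adm d x y" for n x y
   unfolding V_def Ef_def by (intro rf_val_mult rf_val_add rf_val_sum rf_val_Kf rf_val_1 rf_val_X rf_val_of_nat that)
  \<comment> \<open>Any single prime has its own rational function and half-plane, from
    \<open>Xi_ratl\<close>; this will be used for the finitely many p up to N.\<close>
  have "EX z. ALL s. Re s > snd z --> (EX v. fe (NF p) (of_nat p powr (- s)) v & rf_val (fst z) (of_nat p) (of_nat p powr (- s)) v)"
   if p: "prime p" for p
  proof -
   have "ratl (NF p)" unfolding NF[OF p] by (intro ratl_mult ratl_prod ratl_geo Xi_ratl[OF p addsub_Lat]) simp
   then obtain V R where R: "R > 0" "!!x y. norm y < R ==> EX v. fe (NF p) y v & rf_val V x y v" using ratl_fe by blast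
   have p1: "real p > 1" "p > 0" using prime_gt_1_nat[OF p] by simp_all
   have "norm (of_nat p powr (- s)) < R" if s: "Re s > - log p R" for s :: complex
   proof -
    have "real p powr (- Re s) < real p powr (log p R)" using s p1(1) by (intro powr_less_mono) auto
    thus ?thesis unfolding norm_prime_powr[OF p1(2)] using p1 R(1) by simp
   qed
   thus ?thesis using R(2) by (intro exI[of _ "(V, - log p R)"]) simp
  qed
  then obtain z where z: "!!p s. prime p ==> Re s > snd (z p) ==> EX v. fe (NF p) (of_nat p powr (- s)) v & rf_val (fst (z p)) (of_nat p) (of_nat p powr (- s)) v"
   by metis
  define sm where "sm = Max (insert (real (d + 1)) ((%p. snd (z p)) ` {..N}))"
  have sig: "real (d + 1) <= sm" "p <= N ==> snd (z p) <= sm" for p unfolding sm_def by (rule Max_ge; simp)+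
  \<comment> \<open>Root counts are bounded by the degrees, so only finitely many n occur; one
    further function is added for each p up to N.\<close>
  let ?VV = "V ` (Fs \<rightarrow>\<^sub>E {.. Max (insert 0 (degree ` Fs))}) Un (%p. fst (z p)) ` {..N}"
  show ?thesis
  proof (rule finitely_uniformI[of ?VV sm])
   show "finite ?VV" using Fs(1) by (simp add: finite_PiE)
   fix p :: nat assume p: "prime p"
   show "EX U:?VV. ALL s. Re s > sm --> (EX v. fe (Abs_fps (%n. of_nat (normal_count G (p ^ n)))) (of_nat p powr (- s)) v
     & rf_val U (of_nat p) (of_nat p powr (- s)) v)" unfolding NF_def[symmetric]
   proof (cases "p <= N")
    case True
    have "ALL s. Re s > sm --> (EX v. fe (NF p) (of_nat p powr (- s)) v & rf_val (fst (z p)) (of_nat p) (of_nat p powr (- s)) v)"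
     using z[OF p] sig(2)[OF True] by (meson le_less_trans)
    thus "EX U:?VV. ALL s. Re s > sm --> (EX v. fe (NF p) (of_nat p powr (- s)) v & rf_val U (of_nat p) (of_nat p powr (- s)) v)"
     using True by blast
   next
    case False
    \<comment> \<open>Restriction to Fs places the root counts in the finite function space indexing
      \<open>?VV\<close>; \<open>Ef\<close> looks at values on Fs only.\<close>
    define n where "n = restrict (root_count p) Fs"
    have "root_count p g <= Max (insert 0 (degree ` Fs))" if "g : Fs" for g
     using root_count_le_degree[OF p lc[OF p _ that]] False Fs(1) that by (meson Max_ge finite_imageI finite_insert image_eqI insertI2 le_trans not_le_imp_less)
    hence n: "n : Fs \<rightarrow>\<^sub>E {.. Max (insert 0 (degree ` Fs))}" unfolding n_def by auto
    have En: "Ef d rh msI Fs ms n x y = Ef d rh msI Fs ms (root_count p) x y" for x y :: complex unfolding Ef_def n_def by simp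
    have "EX v. fe (NF p) (of_nat p powr (- s)) v & rf_val (V n) (of_nat p) (of_nat p powr (- s)) v" if "Re s > sm" for s
    proof -
     have s: "Re s > real (d + 1)" using that sig(1) by linarith
     show ?thesis using good[OF p _ pt(1)[OF p s]] Vval[OF pt(3)[OF p s], of n] False unfolding En by auto
    qed
    thus "EX U:?VV. ALL s. Re s > sm --> (EX v. fe (NF p) (of_nat p powr (- s)) v & rf_val U (of_nat p) (of_nat p powr (- s)) v)"
     using n by blast
   qed
  qed
 qed
 have gt: "\<forall>\<^sub>\<infinity>p::nat. p > N" unfolding MOST_nat by blast
 show ?thesis
 proof (intro conjI exI[of _ m] exI[of _ f] exI[of _ W] exI[of _ "real (d + 1)"] impI, goal_cases)
  case 1 show ?case by (rule 3)
 next
  case 2 show ?case by (rule MOST_mono[OF gt]) (use main in blast)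
 next
  case 3 show ?case by (rule MOST_mono[OF gt]) (use inverted[OF 3] in blast)
 next
  case 4 show ?case by (rule fu)
 qed
qed

end
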